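(* Let $1\le q<\infty$ and $r>0$. The set-valued mapping $G^{P_r}:X\times\mathbb{R}\rightrightarrows\mathcal{L}(X\times\mathbb{R},L^q(a,b))$ defined by $$G^{P_r}(u,z_0)=G^{\Delta_n}(u,z_0)\quad\text{if }(u,z_0)\in\overline{V}_n\setminus\overline{V}_{n-1}$$ is a Newton derivative of the play operator $\mathcal{P}_r:X\times\mathbb{R}\to L^q(a,b)$, with the following remainder estimate: for every $(u,z_0)\in X\times\mathbb{R}$ there is a function $\rho_{(u,z_0)}$ with $\rho_{(u,z_0)}(\delta)\downarrow 0$ as $\delta\downarrow 0$ such that for all $(h,y)\in X\times\mathbb{R}$ $$\sup_{L^{P_r}\in G^{P_r}(u+h,z_0+y)}\big\|\mathcal{P}_r[u+h;z_0+y]-\mathcal{P}_r[u;z_0]-L^{P_r}(h,y)\big\|_{L^q(a,b)}\le\rho_{(u,z_0)}(\|h\|_\infty+|y|)\,\|(h,y)\|_{X\times\mathbb{R}}.$$ For all $(u,z_0)\in X\times\mathbb{R}$, the elements $L^{P_r}$ of $G^{P_r}(u,z_0)$ satisfy $$\|L^{P_r}(h,y)\|_{\infty,t}\le\|h\|_{\infty,t}+|y|\qquad\text{for all }h\in X,\ y\in\mathbb{R},\ t\in[a,b].$$ They have the form $$L^{P_r}(h,y)(t)=\langle\mu^{P_r}(u,z_0,t),(h,y)\rangle,\quad t\in(a,b),$$ where $$\mu^{P_r}(u,z_0,t)=\mu^{\Delta_n}(u,z_0,t)\quad\text{if }(u,z_0)\in\overline{V}_n\setminus\overline{V}_{n-1},\qquad\mu^{\Delta_n}\in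 S^{\Delta_n}\ (n\ge1).$$ The functions $\mu^{P_r}:C[a,b]\times\mathbb{R}\times[a,b]\to(C[a,b]\times\mathbb{R})^*$ are measurable.
   Context: Fix $a<b$, $r>0$. Spaces. $X$ is either $C^{0,\alpha}[a,b]$ with $0<\alpha\le1$ and norm $|u(a)|+\sup_{s\ne t}|u(t)-u(s)|/|t-s|^\alpha$, or $W^{1,\gamma}(a,b)$ with $1<\gamma\le\infty$ and norm $|u(a)|+\|u'\|_{L^\gamma}$. $X\times\mathbb{R}$ carries a product norm, e.g. $\|h\|_X+|y|$. $\|\cdot\|_\infty$ is the sup norm and $\|v\|_{\infty,t}=\sup_{s\le t}|v(s)|$. $\mathcal{L}(A,B)$ is the space of continuous linear maps. $f:A\rightrightarrows B$ denotes a set-valued map with nonempty values. $\operatorname{osc}_I(u)=\sup_{s,t\in I}|u(t)-u(s)|$. "Measurable" means Borel measurable; duals such as $C(I)^*$ and $(C[a,b]\times\mathbb{R})^*$ carry the weak-star topology. Newton derivative. For normed spaces $A,B$, $U\subset A$ open and $F:U\to B$, a map $G:U\rightrightarrows\mathcal{L}(A,B)$ is a Newton derivative of $F$ in $U$ if $\lim_{h\to0}\sup_{L\in G(u+h)}\|F(u+h)-F(u)-Lh\|/\|h\|=0$ for every $u\in U$. Play operator. Let $\pi_r(z)=\max\{-r,\min\{r,z\}\}$. For continuous piecewise monotone $u:[a,b]\to\mathbb{R}$ (monotone on each interval of a partition $a=s_0<\dots<s_m=b$) and $z_0\in\mathbb{R}$, $w=\mathcal{P}_r[u;z_0]$ is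 defined by $w(a)=u(a)-\pi_r(z_0)$ and successively $w(t)=\max\{u(t)-r,\min\{u(t)+r,w(s_i)\}\}$ for $s_i<t\le s_{i+1}$. $\mathcal{P}_r$ is Lipschitz for the maximum norm and is extended uniquely by continuity to $\mathcal{P}_r:C[a,b]\times\mathbb{R}\to C[a,b]$. Interval objects. For a compact interval $I=[t_*,t^*]\subset[a,b]$ and $u\in C(I)$, $t\in I$: $(F^Iu)(t)=\max_{s\in I,s\le t}u(s)$; $M^I(u,t)=\{s\in I:s\le t,\ u(s)=(F^Iu)(t)\}$; $\Phi^I(u,t)=\{\nu\in C(I)^*:\operatorname{supp}\nu\subset M^I(u,t),\ \nu\ge0,\ \|\nu\|=1\}$. $S_\Phi^I$ is the set of all measurable selectors $\mu:C(I)\times I\to C(I)^*$ of $\Phi^I$, i.e. $\mu$ measurable with $\mu(u,t)\in\Phi^I(u,t)$. $S_H$ is the set of functions $\lambda_H:\mathbb{R}\to[0,1]$ with $\lambda_H(x)=0$ for $x<0$, $\lambda_H(x)=1$ for $x>0$, $\lambda_H(0)\in\mathbb{Q}\cap[0,1]$. Let $Z^I=\{(u,p)\in C(I)\times\mathbb{R}:\operatorname{osc}_I u<r\}$; with $w_+=\max\{p,F^I(u-r)\}$ and $w_-=\min\{p,-F^I(-u-r)\}$ (pointwise in $t$) let $Z^I_+=\{(u,p)\in Z^I:u-w_+>-r\text{ on }I\}$, $Z^I_-=\{(u,p)\in Z^I:u-w_-<r\text{ on }I\}$. One has $Z^I=Z^I_+\cup Z^I_-$, and $w_+=w_-=p$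 on $Z_+^I\cap Z_-^I$; set $P^I(u,p)=w_\pm$ if $(u,p)\in Z^I_\pm$. $S^I$ is the set of all $\nu:Z^I\times I\to(C(I)\times\mathbb{R})^*$ of the form $\langle\nu(u,p,t),(h,\eta)\rangle=\eta+\lambda^+(F^I(u-p-r)(t))\,\langle\mu^+(u,t),h-\eta\rangle$ if $(u,p)\in Z^I_+$, and $\langle\nu(u,p,t),(h,\eta)\rangle=\eta+\lambda^-(F^I(-u+p-r)(t))\,\langle\mu^-(-u,t),h-\eta\rangle$ if $(u,p)\in Z^I_-$, with $\lambda^\pm\in S_H$, $\mu^\pm\in S^I_\Phi$ (both expressions equal $\eta$ on $Z^I_+\cap Z^I_-$; real numbers are identified with constant functions). Partition objects. For a partition $\Delta=\{t_k\}$, $a=t_0<\dots<t_N=b$, let $I_k=[t_{k-1},t_k]$, $|\Delta|=\max_k(t_k-t_{k-1})$ and $Z^\Delta=\{(u,z_0)\in C[a,b]\times\mathbb{R}:\operatorname{osc}_{I_k}(u)<r\text{ for all }k\}$. On $Z^\Delta$ set $w_0^\Delta(u,z_0)=u(a)-\pi_r(z_0)$ and $w_k^\Delta(u,z_0)=P^{I_k}(u|_{I_k},w_{k-1}^\Delta(u,z_0))(t_k)$. $S_R$ is the set of functions $\lambda_0:\mathbb{R}\to[0,1]$ with $\lambda_0(x)=0$ for $|x|>r$, $\lambda_0(x)=1$ for $|x|<r$, $\lambda_0(\pm r)\in\mathbb{Q}\cap[0,1]$. $S_0^\Delta$ is the set of maps $\mu_0^\Delta$ with $\langle\mu_0^\Delta(u,z_0,t_0),(h,y)\rangle=h(a)-\lambda_0(z_0)y$,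 $\lambda_0\in S_R$. For $k\ge1$, $S_k^\Delta$ is the set of maps $\mu_k^\Delta:Z^\Delta\times I_k\to(C[a,b]\times\mathbb{R})^*$ of the form $\langle\mu_k^\Delta(u,z_0,t),(h,y)\rangle=\big\langle\nu(u|_{I_k},w_{k-1}^\Delta(u,z_0),t),\,(h|_{I_k},\langle\mu_{k-1}^\Delta(u,z_0,t_{k-1}),(h,y)\rangle)\big\rangle$ with $\nu\in S^{I_k}$, $\mu_{k-1}^\Delta\in S_{k-1}^\Delta$. $S^\Delta$ is the set of maps $\mu^\Delta:Z^\Delta\times[a,b]\to(C[a,b]\times\mathbb{R})^*$ with $\mu^\Delta=\mu_1^\Delta$ on $Z^\Delta\times[t_0,t_1]$ and $\mu^\Delta=\mu_k^\Delta$ on $Z^\Delta\times(t_{k-1},t_k]$ for $k>1$, for some $\mu_k^\Delta\in S_k^\Delta$ ($1\le k\le N$). For $(u,z_0)\in Z^\Delta$, $G^\Delta(u,z_0)$ is the set of all operators $L^\Delta$, $L^\Delta(h,y)(t)=\langle\mu^\Delta(u,z_0,t),(h,y)\rangle$ on $[a,b]$, with $\mu^\Delta\in S^\Delta$. Gluing. $\{\Delta_n\}_{n\ge1}$ is a sequence of partitions with $\Delta_1=\{a,b\}$, $\Delta_{n+1}$ obtained from $\Delta_n$ by adding a single new point, and $|\Delta_n|\to0$. $0<r_1<r_2<\dots$ is a sequence with $r_n<r$. With $I_{n,k}$ the partition intervals of $\Delta_n$, $V_n=\{(u,z_0):u\in C[a,b],\ z_0\in\mathbb{R},\ \operatorname{osc}_{I_{n,k}}u<r_n\text{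 for all }k\}$, so that $\overline V_n$ is given by $\operatorname{osc}_{I_{n,k}}u\le r_n$ for all $k$; $\overline V_0=\emptyset$. *)

theory Defs
  imports
    "HOL-Analysis.Analysis"
    "HOL-Library.Function_Algebras"
    "HOL-Probability.Essential_Supremum"
begin

section \<open>Spaces of continuous functions and their duals\<close>

text \<open>
  \<open>C[c,d]\<close> is realised as the closed subspace of bounded continuous functions on the real
  line that are constant to the left of \<open>c\<close> and to the right of \<open>d\<close>; the norm of the ambient type
  is then the maximum norm on \<open>[c,d]\<close>, and \<open>restr c d\<close> is the restriction map \<open>u \<mapsto> u|[c,d]\<close>.
\<close>

type_synonym cfun = "real \<Rightarrow>\<^sub>C real"

definition restr :: "real \<Rightarrow> real \<Rightarrow> cfun \<Rightarrow> cfun" where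
  "restr c d u = Bcontfun (\<lambda>t. u (max c (min d t)))"

lemma restr_apply [simp]: "restr c d u t = u (max c (min d t))"
proof -
  have "continuous_on UNIV (\<lambda>t. u (max c (min d t)))"
    by (rule continuous_on_compose2[of UNIV u]) (auto intro!: continuous_on_max continuous_on_min)
  moreover have "bounded (range (\<lambda>t. u (max c (min d t))))"
    by (rule bounded_subset[OF bounded_apply_bcontfun[of u]]) auto
  ultimately show ?thesis
    unfolding restr_def by (subst Bcontfun_inverse) (auto simp: bcontfun_def)
qed

definition C_on :: "real \<Rightarrow> real \<Rightarrow> cfun set" where
  "C_on c d = {u. restr c d u = u}"

text \<open>
  A continuous functional on \<open>C[c,d]\<close> is represented by its composition with the (norm one)
  restriction map, so that the operator norm is unchanged and, on these sets, the library's
  \<^const>\<open>strong_operator_topology\<close>, i.e. pointwise convergence, is the weak-star topology.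
\<close>

definition dual_C :: "real \<Rightarrow> real \<Rightarrow> (cfun \<Rightarrow>\<^sub>L real) set" where
  "dual_C c d = {\<phi> :: cfun \<Rightarrow>\<^sub>L real. \<forall>h. \<phi> h = \<phi> (restr c d h)}"

definition dual_CR :: "real \<Rightarrow> real \<Rightarrow> ((cfun \<times> real) \<Rightarrow>\<^sub>L real) set" where
  "dual_CR c d = {\<phi> :: (cfun \<times> real) \<Rightarrow>\<^sub>L real. \<forall>h y. \<phi> (h, y) = \<phi> (restr c d h, y)}"

definition borel_of :: "'a topology \<Rightarrow> 'a measure" where
  "borel_of T = sigma (topspace T) {U. openin T U}"

definition weak_star_borel :: "('a::real_normed_vector \<Rightarrow>\<^sub>L real) set \<Rightarrow> ('a \<Rightarrow>\<^sub>L real) measure" where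
  "weak_star_borel D = borel_of (subtopology strong_operator_topology D)"

text \<open>Support of the measure represented by \<open>\<nu>\<close>: complement of the largest open null set.\<close>

definition supp :: "real \<Rightarrow> real \<Rightarrow> (cfun \<Rightarrow>\<^sub>L real) \<Rightarrow> real set" where
  "supp c d \<nu> = {s \<in> {c..d}. \<forall>U. open U \<and> s \<in> U \<longrightarrow>
     (\<exists>h :: cfun. h \<in> C_on c d \<and> (\<forall>t \<in> {c..d} - U. h t = 0) \<and> \<nu> h \<noteq> 0)}"

definition sup_norm_upto :: "real \<Rightarrow> real \<Rightarrow> (real \<Rightarrow> real) \<Rightarrow> ennreal" where
  "sup_norm_upto a t v = (SUP s\<in>{a..t}. ennreal \<bar>v s\<bar>)"

definition osc :: "real \<Rightarrow> real \<Rightarrow> (real \<Rightarrow> real) \<Rightarrow> real" where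
  "osc c d u = (SUP (s, t) \<in> {c..d} \<times> {c..d}. \<bar>u t - u s\<bar>)"


section \<open>Lebesgue, Hoelder and Sobolev spaces\<close>

definition Lp_norm :: "'a measure \<Rightarrow> ennreal \<Rightarrow> ('a \<Rightarrow> real) \<Rightarrow> ennreal" where
  "Lp_norm M p f =
    (if p = \<infinity> then esssup M (\<lambda>x. ennreal \<bar>f x\<bar>)
     else let I = (\<integral>\<^sup>+ x. ennreal (\<bar>f x\<bar> powr enn2real p) \<partial>M) in
       if I = \<infinity> then \<infinity> else ennreal (enn2real I powr (1 / enn2real p)))"

definition Lp_space :: "'a measure \<Rightarrow> ennreal \<Rightarrow> ('a \<Rightarrow> real) set" where
  "Lp_space M p = {f \<in> borel_measurable M. Lp_norm M p f < \<infinity>}"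

definition holder_quotients :: "real \<Rightarrow> real \<Rightarrow> real \<Rightarrow> cfun \<Rightarrow> real set" where
  "holder_quotients a b \<alpha> u =
     {\<bar>u t - u s\<bar> / \<bar>t - s\<bar> powr \<alpha> | s t. s \<in> {a..b} \<and> t \<in> {a..b} \<and> s \<noteq> t}"

definition holder_space :: "real \<Rightarrow> real \<Rightarrow> real \<Rightarrow> cfun set" where
  "holder_space a b \<alpha> = {u \<in> C_on a b. bdd_above (holder_quotients a b \<alpha> u)}"

definition holder_norm :: "real \<Rightarrow> real \<Rightarrow> real \<Rightarrow> cfun \<Rightarrow> real" where
  "holder_norm a b \<alpha> u = \<bar>u a\<bar> + Sup (holder_quotients a b \<alpha> u)"

definition test_functions :: "real \<Rightarrow> real \<Rightarrow> (real \<Rightarrow> real) set" where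
  "test_functions a b = {\<phi>. (\<forall>k t. (deriv ^^ k) \<phi> field_differentiable (at t)) \<and>
     (\<exists>c d. a < c \<and> d < b \<and> (\<forall>t. t \<notin> {c..d} \<longrightarrow> \<phi> t = 0))}"

definition weak_deriv :: "real \<Rightarrow> real \<Rightarrow> (real \<Rightarrow> real) \<Rightarrow> (real \<Rightarrow> real) \<Rightarrow> bool" where
  "weak_deriv a b u v \<longleftrightarrow> (\<forall>\<phi> \<in> test_functions a b.
     (LINT t|lebesgue_on {a<..<b}. u t * deriv \<phi> t) = - (LINT t|lebesgue_on {a<..<b}. v t * \<phi> t))"

text \<open>Elements of \<open>W\<^sup>1\<^sup>,\<^sup>\<gamma>(a,b)\<close> are identified with their continuous representatives on \<open>[a,b]\<close>.\<close>

definition sobolev_space :: "real \<Rightarrow> real \<Rightarrow> ennreal \<Rightarrow> cfun set" where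
  "sobolev_space a b \<gamma> = {u :: cfun. u \<in> C_on a b \<and> (\<exists>v \<in> Lp_space (lebesgue_on {a<..<b}) \<gamma>. weak_deriv a b u v)}"

text \<open>The weak derivative is unique up to null sets, so the choice below is immaterial.\<close>

definition sobolev_norm :: "real \<Rightarrow> real \<Rightarrow> ennreal \<Rightarrow> cfun \<Rightarrow> real" where
  "sobolev_norm a b \<gamma> u = \<bar>u a\<bar> + enn2real (Lp_norm (lebesgue_on {a<..<b}) \<gamma>
     (SOME v. v \<in> Lp_space (lebesgue_on {a<..<b}) \<gamma> \<and> weak_deriv a b u v))"


section \<open>Newton derivatives\<close>

instantiation "fun" :: (type, real_vector) real_vector
begin

definition scaleR_fun :: "real \<Rightarrow> ('a \<Rightarrow> 'b) \<Rightarrow> 'a \<Rightarrow> 'b" where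
  "scaleR_fun c f = (\<lambda>x. c *\<^sub>R f x)"

instance
  by standard (simp_all add: scaleR_fun_def fun_eq_iff scaleR_add_left scaleR_add_right)

end

text \<open>
  Normed spaces are given by a carrier (a linear subspace) and a norm on it. The target space is given by an
  extended-real-valued seminorm that is finite on its carrier, and its elements are identified if
  their difference has seminorm zero. This covers \<open>L\<^sup>q\<close>, whose elements are functions modulo null sets.
\<close>

definition linear_ops ::
  "'a::real_vector set \<Rightarrow> ('a \<Rightarrow> real) \<Rightarrow> 'b::real_vector set \<Rightarrow> ('b \<Rightarrow> ennreal) \<Rightarrow> ('a \<Rightarrow> 'b) set" where
  "linear_ops A nA B nB = {L.
     (\<forall>x\<in>A. L x \<in> B) \<and>
     (\<forall>x\<in>A. \<forall>y\<in>A. nB (L (x + y) - (L x + L y)) = 0) \<and>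
     (\<forall>c. \<forall>x\<in>A. nB (L (c *\<^sub>R x) - c *\<^sub>R L x) = 0) \<and>
     (\<exists>K. \<forall>x\<in>A. nB (L x) \<le> ennreal (K * nA x))}"

definition newton_derivative ::
  "'a::real_vector set \<Rightarrow> ('a \<Rightarrow> real) \<Rightarrow> 'b::real_vector set \<Rightarrow> ('b \<Rightarrow> ennreal) \<Rightarrow>
   'a set \<Rightarrow> ('a \<Rightarrow> 'b) \<Rightarrow> ('a \<Rightarrow> ('a \<Rightarrow> 'b) set) \<Rightarrow> bool" where
  "newton_derivative A nA B nB U F G \<longleftrightarrow>
     U \<subseteq> A \<and> (\<forall>u\<in>U. \<exists>e>0. \<forall>h\<in>A. nA h < e \<longrightarrow> u + h \<in> U) \<and>
     (\<forall>u\<in>U. F u \<in> B) \<and>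
     (\<forall>u\<in>U. G u \<noteq> {} \<and> G u \<subseteq> linear_ops A nA B nB) \<and>
     (\<forall>u\<in>U. ((\<lambda>h. (SUP L\<in>G (u + h). nB (F (u + h) - F u - L h)) / ennreal (nA h)) \<longlongrightarrow> 0)
        (inf (filtercomap nA (at_right 0)) (principal A)))"


section \<open>Partitions\<close>

text \<open>A partition of \<open>[a,b]\<close> is the finite set of its points; \<open>pt \<Delta> 0 < \<dots> < pt \<Delta> (npt \<Delta>)\<close> enumerates it.\<close>

definition is_partition :: "real \<Rightarrow> real \<Rightarrow> real set \<Rightarrow> bool" where
  "is_partition a b \<Delta> \<longleftrightarrow> finite \<Delta> \<and> {a, b} \<subseteq> \<Delta> \<and> \<Delta> \<subseteq> {a..b}"

definition pt :: "real set \<Rightarrow> nat \<Rightarrow> real" where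
  "pt \<Delta> k = sorted_list_of_set \<Delta> ! k"

definition npt :: "real set \<Rightarrow> nat" where
  "npt \<Delta> = card \<Delta> - 1"

definition mesh :: "real set \<Rightarrow> real" where
  "mesh \<Delta> = Max ((\<lambda>k. pt \<Delta> k - pt \<Delta> (k - 1)) ` {1..npt \<Delta>})"


section \<open>The play operator\<close>

definition clip :: "real \<Rightarrow> real \<Rightarrow> real" where
  "clip r z = max (- r) (min r z)"

definition monotone_pieces :: "real set \<Rightarrow> (real \<Rightarrow> real) \<Rightarrow> bool" where
  "monotone_pieces \<Delta> u \<longleftrightarrow> (\<forall>i < npt \<Delta>.
     mono_on {pt \<Delta> i..pt \<Delta> (Suc i)} u \<or> antimono_on {pt \<Delta> i..pt \<Delta> (Suc i)} u)"

definition play_recursion ::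
  "real \<Rightarrow> real \<Rightarrow> real set \<Rightarrow> (real \<Rightarrow> real) \<Rightarrow> real \<Rightarrow> (real \<Rightarrow> real) \<Rightarrow> bool" where
  "play_recursion r a \<Delta> u z0 w \<longleftrightarrow>
     w a = u a - clip r z0 \<and>
     (\<forall>i < npt \<Delta>. \<forall>t \<in> {pt \<Delta> i<..pt \<Delta> (Suc i)}.
        w t = max (u t - r) (min (u t + r) (w (pt \<Delta> i))))"

text \<open>
  The continuous extension of the recursion from piecewise monotone functions to \<open>C[a,b] \<times> \<real>\<close>.
  The recursion gives the same result for every partition on whose intervals \<open>u\<close> is monotone.
\<close>

definition play :: "real \<Rightarrow> real \<Rightarrow> real \<Rightarrow> cfun \<times> real \<Rightarrow> cfun" where
  "play r a b = (THE P.
     P \<in> extensional (C_on a b \<times> UNIV) \<and>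
     (\<forall>x \<in> C_on a b \<times> UNIV. P x \<in> C_on a b) \<and>
     continuous_on (C_on a b \<times> UNIV) P \<and>
     (\<forall>(u :: cfun) z0 \<Delta>. u \<in> C_on a b \<and> is_partition a b \<Delta> \<and> monotone_pieces \<Delta> u \<longrightarrow>
        play_recursion r a \<Delta> u z0 (P (u, z0) :: cfun)))"


section \<open>Objects on a single interval \<open>I = [c,d]\<close>\<close>

definition F_int :: "real \<Rightarrow> real \<Rightarrow> (real \<Rightarrow> real) \<Rightarrow> real \<Rightarrow> real" where
  "F_int c d u t = (SUP s \<in> {s \<in> {c..d}. s \<le> t}. u s)"

definition M_int :: "real \<Rightarrow> real \<Rightarrow> (real \<Rightarrow> real) \<Rightarrow> real \<Rightarrow> real set" where
  "M_int c d u t = {s \<in> {c..d}. s \<le> t \<and> u s = F_int c d u t}"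

definition \<Phi>_int :: "real \<Rightarrow> real \<Rightarrow> cfun \<Rightarrow> real \<Rightarrow> (cfun \<Rightarrow>\<^sub>L real) set" where
  "\<Phi>_int c d u t = {\<nu> :: cfun \<Rightarrow>\<^sub>L real. \<nu> \<in> dual_C c d \<and>
     supp c d \<nu> \<subseteq> M_int c d u t \<and>
     (\<forall>h :: cfun. h \<in> C_on c d \<and> (\<forall>s \<in> {c..d}. 0 \<le> h s) \<longrightarrow> 0 \<le> \<nu> h) \<and>
     norm \<nu> = 1}"

definition S\<Phi>_int :: "real \<Rightarrow> real \<Rightarrow> (cfun \<times> real \<Rightarrow> (cfun \<Rightarrow>\<^sub>L real)) set" where
  "S\<Phi>_int c d = {\<mu>.
     \<mu> \<in> restrict_space borel (C_on c d \<times> {c..d}) \<rightarrow>\<^sub>M weak_star_borel (dual_C c d) \<and>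
     (\<forall>u \<in> C_on c d. \<forall>t \<in> {c..d}. \<mu> (u, t) \<in> \<Phi>_int c d u t)}"

definition S_H :: "(real \<Rightarrow> real) set" where
  "S_H = {l. (\<forall>x. l x \<in> {0..1}) \<and> (\<forall>x<0. l x = 0) \<and> (\<forall>x>0. l x = 1) \<and> l 0 \<in> \<rat>}"

definition Z_int :: "real \<Rightarrow> real \<Rightarrow> real \<Rightarrow> (cfun \<times> real) set" where
  "Z_int r c d = {(u :: cfun, p). u \<in> C_on c d \<and> osc c d u < r}"

definition w_plus :: "real \<Rightarrow> real \<Rightarrow> real \<Rightarrow> cfun \<Rightarrow> real \<Rightarrow> real \<Rightarrow> real" where
  "w_plus r c d u p t = max p (F_int c d (\<lambda>s. u s - r) t)"

definition w_minus :: "real \<Rightarrow> real \<Rightarrow> real \<Rightarrow> cfun \<Rightarrow> real \<Rightarrow> real \<Rightarrow> real" where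
  "w_minus r c d u p t = min p (- F_int c d (\<lambda>s. - u s - r) t)"

definition Z_plus :: "real \<Rightarrow> real \<Rightarrow> real \<Rightarrow> (cfun \<times> real) set" where
  "Z_plus r c d = {(u :: cfun, p). (u, p) \<in> Z_int r c d \<and> (\<forall>t \<in> {c..d}. u t - w_plus r c d u p t > - r)}"

definition Z_minus :: "real \<Rightarrow> real \<Rightarrow> real \<Rightarrow> (cfun \<times> real) set" where
  "Z_minus r c d = {(u :: cfun, p). (u, p) \<in> Z_int r c d \<and> (\<forall>t \<in> {c..d}. u t - w_minus r c d u p t < r)}"

text \<open>On \<open>Z_plus \<inter> Z_minus\<close> both branches are equal to \<open>p\<close>.\<close>

definition P_int :: "real \<Rightarrow> real \<Rightarrow> real \<Rightarrow> cfun \<Rightarrow> real \<Rightarrow> real \<Rightarrow> real" where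
  "P_int r c d u p = (if (u, p) \<in> Z_plus r c d then w_plus r c d u p else w_minus r c d u p)"

definition S_int :: "real \<Rightarrow> real \<Rightarrow> real \<Rightarrow> (cfun \<times> real \<times> real \<Rightarrow> ((cfun \<times> real) \<Rightarrow>\<^sub>L real)) set" where
  "S_int r c d = {\<nu> :: cfun \<times> real \<times> real \<Rightarrow> ((cfun \<times> real) \<Rightarrow>\<^sub>L real). \<exists>lp \<in> S_H. \<exists>lm \<in> S_H. \<exists>\<mu>p \<in> S\<Phi>_int c d. \<exists>\<mu>m \<in> S\<Phi>_int c d.
     \<forall>(u :: cfun, p) \<in> Z_int r c d. \<forall>t \<in> {c..d}.
       \<nu> (u, p, t) \<in> dual_CR c d \<and>
       (\<forall>h \<in> C_on c d. \<forall>\<eta>.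
         ((u, p) \<in> Z_plus r c d \<longrightarrow>
            \<nu> (u, p, t) (h, \<eta>) =
              \<eta> + lp (F_int c d (\<lambda>s. u s - p - r) t) * \<mu>p (u, t) (h - const_bcontfun \<eta>)) \<and>
         ((u, p) \<in> Z_minus r c d \<longrightarrow>
            \<nu> (u, p, t) (h, \<eta>) =
              \<eta> + lm (F_int c d (\<lambda>s. - u s + p - r) t) * \<mu>m (- u, t) (h - const_bcontfun \<eta>)))}"


section \<open>Objects associated with a partition\<close>

definition Z_part :: "real \<Rightarrow> real \<Rightarrow> real \<Rightarrow> real set \<Rightarrow> (cfun \<times> real) set" where
  "Z_part r a b \<Delta> = {(u :: cfun, z0). u \<in> C_on a b \<and> (\<forall>k \<in> {1..npt \<Delta>}. osc (pt \<Delta> (k - 1)) (pt \<Delta> k) u < r)}"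

primrec w_part :: "real \<Rightarrow> real set \<Rightarrow> nat \<Rightarrow> cfun \<Rightarrow> real \<Rightarrow> real" where
  "w_part r \<Delta> 0 u z0 = u (pt \<Delta> 0) - clip r z0"
| "w_part r \<Delta> (Suc k) u z0 =
     P_int r (pt \<Delta> k) (pt \<Delta> (Suc k)) (restr (pt \<Delta> k) (pt \<Delta> (Suc k)) u) (w_part r \<Delta> k u z0) (pt \<Delta> (Suc k))"

definition S_R :: "real \<Rightarrow> (real \<Rightarrow> real) set" where
  "S_R r = {l. (\<forall>x. l x \<in> {0..1}) \<and> (\<forall>x. \<bar>x\<bar> > r \<longrightarrow> l x = 0) \<and> (\<forall>x. \<bar>x\<bar> < r \<longrightarrow> l x = 1) \<and>
     l r \<in> \<rat> \<and> l (- r) \<in> \<rat>}"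

type_synonym functional_map = "cfun \<times> real \<times> real \<Rightarrow> ((cfun \<times> real) \<Rightarrow>\<^sub>L real)"

primrec Sk_part :: "real \<Rightarrow> real \<Rightarrow> real \<Rightarrow> real set \<Rightarrow> nat \<Rightarrow> functional_map set" where
  "Sk_part r a b \<Delta> 0 = {\<mu> :: functional_map. \<exists>l0 \<in> S_R r. \<forall>(u :: cfun, z0) \<in> Z_part r a b \<Delta>.
     \<mu> (u, z0, pt \<Delta> 0) \<in> dual_CR a b \<and>
     (\<forall>h \<in> C_on a b. \<forall>y. \<mu> (u, z0, pt \<Delta> 0) (h, y) = h a - l0 z0 * y)}"
| "Sk_part r a b \<Delta> (Suc k) = {\<mu> :: functional_map. \<exists>\<nu> \<in> S_int r (pt \<Delta> k) (pt \<Delta> (Suc k)). \<exists>\<mu>' \<in> Sk_part r a b \<Delta> k.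
     \<forall>(u :: cfun, z0) \<in> Z_part r a b \<Delta>. \<forall>t \<in> {pt \<Delta> k..pt \<Delta> (Suc k)}.
       \<mu> (u, z0, t) \<in> dual_CR a b \<and>
       (\<forall>h \<in> C_on a b. \<forall>y. \<mu> (u, z0, t) (h, y) =
          \<nu> (restr (pt \<Delta> k) (pt \<Delta> (Suc k)) u, w_part r \<Delta> k u z0, t)
            (restr (pt \<Delta> k) (pt \<Delta> (Suc k)) h, \<mu>' (u, z0, pt \<Delta> k) (h, y)))}"

definition S_part :: "real \<Rightarrow> real \<Rightarrow> real \<Rightarrow> real set \<Rightarrow> functional_map set" where
  "S_part r a b \<Delta> = {\<mu> :: functional_map. \<exists>\<mu>k. (\<forall>k \<in> {1..npt \<Delta>}. \<mu>k k \<in> Sk_part r a b \<Delta> k) \<and>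
     (\<forall>(u :: cfun, z0) \<in> Z_part r a b \<Delta>.
        (\<forall>t \<in> {pt \<Delta> 0..pt \<Delta> 1}. \<mu> (u, z0, t) = \<mu>k 1 (u, z0, t)) \<and>
        (\<forall>k \<in> {2..npt \<Delta>}. \<forall>t \<in> {pt \<Delta> (k - 1)<..pt \<Delta> k}. \<mu> (u, z0, t) = \<mu>k k (u, z0, t)))}"

text \<open>Values of the operators outside \<open>[a,b]\<close> are arbitrary and never used.\<close>

definition G_part :: "real \<Rightarrow> real \<Rightarrow> real \<Rightarrow> real set \<Rightarrow> cfun \<times> real \<Rightarrow> (cfun \<times> real \<Rightarrow> real \<Rightarrow> real) set" where
  "G_part r a b \<Delta> = (\<lambda>(u, z0). {L. \<exists>\<mu> \<in> S_part r a b \<Delta>. L = (\<lambda>(h, y) t. \<mu> (u, z0, t) (h, y))})"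


section \<open>Gluing along a sequence of partitions\<close>

definition V_set :: "real \<Rightarrow> real \<Rightarrow> (nat \<Rightarrow> real set) \<Rightarrow> (nat \<Rightarrow> real) \<Rightarrow> nat \<Rightarrow> (cfun \<times> real) set" where
  "V_set a b D \<rho> n = {(u :: cfun, z0). u \<in> C_on a b \<and>
     (\<forall>k \<in> {1..npt (D n)}. osc (pt (D n) (k - 1)) (pt (D n) k) u < \<rho> n)}"

definition V_bar :: "real \<Rightarrow> real \<Rightarrow> (nat \<Rightarrow> real set) \<Rightarrow> (nat \<Rightarrow> real) \<Rightarrow> nat \<Rightarrow> (cfun \<times> real) set" where
  "V_bar a b D \<rho> n = (if n = 0 then {} else closure (V_set a b D \<rho> n))"

definition G_play :: "real \<Rightarrow> real \<Rightarrow> real \<Rightarrow> (nat \<Rightarrow> real set) \<Rightarrow> (nat \<Rightarrow> real) \<Rightarrow>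
    cfun \<times> real \<Rightarrow> (cfun \<times> real \<Rightarrow> real \<Rightarrow> real) set" where
  "G_play r a b D \<rho> x =
     {L. \<exists>n\<ge>1. x \<in> V_bar a b D \<rho> n - V_bar a b D \<rho> (n - 1) \<and> L \<in> G_part r a b (D n) x}"

text \<open>The maps \<open>\<mu>\<close> glued together from some \<open>\<mu>\<^sub>n \<in> S_part r a b (D n)\<close>.\<close>

definition S_play :: "real \<Rightarrow> real \<Rightarrow> real \<Rightarrow> (nat \<Rightarrow> real set) \<Rightarrow> (nat \<Rightarrow> real) \<Rightarrow> functional_map set" where
  "S_play r a b D \<rho> = {\<mu> :: functional_map. \<exists>\<mu>n. (\<forall>n\<ge>1. \<mu>n n \<in> S_part r a b (D n)) \<and>
     (\<forall>n\<ge>1. \<forall>(u :: cfun, z0) \<in> V_bar a b D \<rho> n - V_bar a b D \<rho> (n - 1). \<forall>t \<in> {a..b}.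
        \<mu> (u, z0, t) = \<mu>n n (u, z0, t))}"

end

theory Submission
  imports Defs
begin

text \<open>
  On an interval on which \<open>u\<close> oscillates by less than \<open>r\<close>, the play is the projection of its initial
  value onto \<open>[max u - r, min u + r]\<close>, with running extrema, and only one of the two bounds can be
  active. The running maximum has the argmax-supported probability measures as a Newton derivative:
  \<open>max (u + h) - max u - \<langle>\<mu>, h\<rangle>\<close> is controlled by the oscillation of \<open>h\<close> over the distance from the
  argmax of \<open>u + h\<close> to that of \<open>u\<close>, and this distance tends to zero by compactness. Hence the
  remainder is \<open>o(\<parallel>h\<parallel>\<^sub>X)\<close> at every single time, uniformly over all selectors, as soon as the unit
  ball of \<open>X\<close> is equicontinuous; the chain rule propagates this along a partition. Since the remainder
  is also bounded by a multiple of the norm, dominated convergence along a sequence of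
  counterexamples turns the pointwise statement into the estimate in \<open>L\<^sup>q\<close>.
  Near a given point only finitely many levels of the gluing occur.
  On bounded sets the weak-star topology is generated by evaluations on a countable
  dense set, so that measurability of the functionals reduces to that of their evaluations.
\<close>

section \<open>Continuous functions on an interval\<close>

text \<open>The derivative is evaluated at the perturbed point, whose argmax is only known to lie
  near that of the base point, and the radius for which this holds is obtained separately for each
  time t. Hence every estimate is first made at one fixed time, with a radius chosen before the
  selectors. Two features keep the chain rule harmless. On each interval the remainder is a convex
  combination of the error carried in and the error of the running maximum, so errors add up along
  the partition and are never amplified. And the kinks of the positive part and of the clipping cost
  nothing: near a fixed argument both functions are linearised exactly, whatever admissible value is
  chosen at the kink. In the gluing, the perturbed point may belong to another level than the base
  point, so the partition of that other level has to be expanded at the base point. The strict gap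
  between \<open>\<rho> n\<close> and r permits this: a perturbed point at level n has oscillation
  at most \<open>\<rho> n\<close>, so the base point still has oscillation below r on the same
  intervals.\<close>

lemma clamp_id: "t \<in> {c..d} \<Longrightarrow> max c (min d t) = (t::real)"
  by auto

lemma clamp_in: "c \<le> d \<Longrightarrow> max c (min d t) \<in> {c..d::real}"
  by auto

lemma clamp_clamp: "c \<le> d \<Longrightarrow> max c (min d (max c (min d t))) = max c (min d (t::real))"
  by (rule clamp_id[OF clamp_in])

lemma C_onI: "(\<And>t. (u :: cfun) (max c (min d t)) = u t) \<Longrightarrow> u \<in> C_on c d"
  unfolding C_on_def by (auto intro!: bcontfun_eqI)

lemma C_on_clamp: "(u :: cfun) \<in> C_on c d \<Longrightarrow> u (max c (min d t)) = u t"
  unfolding C_on_def by (metis (mono_tags) mem_Collect_eq restr_apply)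

lemma restr_in_C_on: "c \<le> d \<Longrightarrow> restr c d u \<in> C_on c d"
  by (rule C_onI) (simp add: max_def min_def)

lemma C_on_eqI:
  fixes u v :: cfun
  assumes "u \<in> C_on c d" "v \<in> C_on c d" "c \<le> d" "\<And>t. t \<in> {c..d} \<Longrightarrow> u t = v t"
  shows "u = v"
proof (rule bcontfun_eqI)
  fix t show "u t = v t"
    using assms C_on_clamp[of u c d t] C_on_clamp[of v c d t] clamp_in[of c d t] by metis
qed

lemma C_on_add: "u \<in> C_on c d \<Longrightarrow> v \<in> C_on c d \<Longrightarrow> u + v \<in> C_on c d"
  by (rule C_onI) (simp add: C_on_clamp)

lemma C_on_diff: "u \<in> C_on c d \<Longrightarrow> v \<in> C_on c d \<Longrightarrow> u - v \<in> C_on c d"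
  by (rule C_onI) (simp add: C_on_clamp)

lemma C_on_uminus: "u \<in> C_on c d \<Longrightarrow> - u \<in> C_on c d"
  by (rule C_onI) (simp add: C_on_clamp)

lemma C_on_scaleR: "u \<in> C_on c d \<Longrightarrow> k *\<^sub>R u \<in> C_on c d"
  by (rule C_onI) (simp add: C_on_clamp)

lemma C_on_const: "const_bcontfun k \<in> C_on c d"
  by (rule C_onI) simp

lemma abs_apply_le_norm: "\<bar>(u :: cfun) t\<bar> \<le> norm u"
  using norm_bounded[of u t] by simp

lemma norm_C_on_le:
  fixes u :: cfun
  assumes "u \<in> C_on c d" "c \<le> d" "\<And>t. t \<in> {c..d} \<Longrightarrow> \<bar>u t\<bar> \<le> B"
  shows "norm u \<le> B"
proof (rule norm_bound)
  fix t show "norm (u t) \<le> B"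
    using assms C_on_clamp[OF assms(1), of t] clamp_in[of c d t] by (metis real_norm_def)
qed

lemma C_on_extend:
  assumes "c \<le> d" "continuous_on {c..d} f"
  shows "\<exists>u. u \<in> C_on c d \<and> (\<forall>t\<in>{c..d}. u t = f t)"
proof -
  let ?g = "\<lambda>t. f (max c (min d t))"
  have "continuous_on UNIV ?g"
    by (rule continuous_on_compose2[OF assms(2)]) (use assms(1) in \<open>auto intro!: continuous_intros\<close>)
  moreover have "bounded (range ?g)"
    by (rule bounded_subset[of "f ` {c..d}"])
      (use assms in \<open>auto intro!: compact_imp_bounded compact_continuous_image\<close>)
  ultimately have eq: "apply_bcontfun (Bcontfun ?g) = ?g"
    by (subst Bcontfun_inverse) (auto simp: bcontfun_def)
  show ?thesis
  proof (intro exI conjI ballI)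
    show "Bcontfun ?g \<in> C_on c d"
      by (rule C_onI) (simp only: eq clamp_clamp[OF assms(1)])
    show "apply_bcontfun (Bcontfun ?g) t = f t" if "t \<in> {c..d}" for t
      unfolding eq using clamp_id[OF that] by simp
  qed
qed

lemma eval_diff_bound: "\<bar>(u :: cfun) s - u t\<bar> \<le> norm u * 2"
  using abs_apply_le_norm[of u s] abs_apply_le_norm[of u t] by linarith

lemma closed_pointwise_eq: "closed {u :: cfun. u s = u t}"
proof -
  have "closed {u :: cfun. u s - u t \<in> {0}}"
  proof (rule closed_vimage[unfolded vimage_def])
    show "continuous_on UNIV (\<lambda>u :: cfun. u s - u t)"
      by (rule bounded_linear.continuous_on[where f="\<lambda>u :: cfun. u s - u t"])
         (auto intro!: bounded_linear_intro[where K=2] eval_diff_bound simp: algebra_simps)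
  qed simp
  then show ?thesis by simp
qed

lemma closed_C_on: "closed (C_on c d)"
proof -
  have "C_on c d = (\<Inter>t. {u :: cfun. u (max c (min d t)) = u t})"
    by (auto intro: C_onI simp: C_on_clamp)
  then show ?thesis by (auto intro!: closed_INT closed_pointwise_eq)
qed

lemma dist_apply_le: "dist ((u :: cfun) t) ((v :: cfun) t) \<le> dist u v"
  by (rule dist_bounded)

section \<open>The running maximum\<close>

text \<open>By compactness the supremum is a maximum. Later proofs pick a maximiser here and then
  compare values pointwise.\<close>

lemma F_int_attained:
  assumes "continuous_on {c..d} u" "t \<in> {c..d}"
  shows "\<exists>s\<in>{c..t}. u s = F_int c d u t \<and> (\<forall>s'\<in>{c..t}. u s' \<le> F_int c d u t)"
proof -
  have eq: "{s \<in> {c..d}. s \<le> t} = {c..t}" using assms(2) by auto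
  have "continuous_on {c..t} u" by (rule continuous_on_subset[OF assms(1)]) (use assms(2) in auto)
  then obtain s where s: "s \<in> {c..t}" "\<And>s'. s' \<in> {c..t} \<Longrightarrow> u s' \<le> u s"
    using continuous_attains_sup[of "{c..t}" u] assms(2) by auto
  have "F_int c d u t = u s"
    unfolding F_int_def eq by (rule cSup_eq_maximum) (use s in auto)
  then show ?thesis using s by auto
qed

lemma F_int_ge:
  assumes "continuous_on {c..d} u" "t \<in> {c..d}" "s \<in> {c..t}"
  shows "u s \<le> F_int c d u t"
  using F_int_attained[OF assms(1,2)] assms(3) by blast

lemma F_int_less_iff:
  assumes "continuous_on {c..d} u" "t \<in> {c..d}"
  shows "x < F_int c d u t \<longleftrightarrow> (\<exists>s\<in>{c..t}. x < u s)"
  using F_int_attained[OF assms] by force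

lemma F_int_eqI:
  assumes "continuous_on {c..d} u" "t \<in> {c..d}" "s \<in> {c..t}" "\<And>s'. s' \<in> {c..t} \<Longrightarrow> u s' \<le> u s"
  shows "F_int c d u t = u s"
  using F_int_attained[OF assms(1,2)] assms(3,4) by (force intro: order_antisym)

lemma F_int_add_const:
  assumes "continuous_on {c..d} u" "t \<in> {c..d}"
  shows "F_int c d (\<lambda>s. u s + k) t = F_int c d u t + k"
proof -
  obtain s where s: "s \<in> {c..t}" "u s = F_int c d u t" "\<And>s'. s' \<in> {c..t} \<Longrightarrow> u s' \<le> F_int c d u t"
    using F_int_attained[OF assms] by blast
  have "F_int c d (\<lambda>s. u s + k) t = u s + k"
    by (rule F_int_eqI) (use s assms in \<open>auto intro!: continuous_intros\<close>)
  then show ?thesis using s by simp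
qed

lemma F_int_Lipschitz:
  assumes "continuous_on {c..d} u" "continuous_on {c..d} v" "t \<in> {c..d}"
    and "\<And>s. s \<in> {c..t} \<Longrightarrow> \<bar>u s - v s\<bar> \<le> e"
  shows "\<bar>F_int c d u t - F_int c d v t\<bar> \<le> e"
proof -
  obtain s where s: "s \<in> {c..t}" "u s = F_int c d u t" "\<And>s'. s' \<in> {c..t} \<Longrightarrow> u s' \<le> F_int c d u t"
    using F_int_attained[OF assms(1,3)] by blast
  obtain s' where s': "s' \<in> {c..t}" "v s' = F_int c d v t" "\<And>s. s \<in> {c..t} \<Longrightarrow> v s \<le> F_int c d v t"
    using F_int_attained[OF assms(2,3)] by blast
  show ?thesis using assms(4)[OF s(1)] assms(4)[OF s'(1)] s(2) s'(2) s(3)[OF s'(1)] s'(3)[OF s(1)] by linarith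
qed

section \<open>The play operator\<close>

text \<open>
  The play is the composition of the projections onto \<open>[u(s) - r, u(s) + r]\<close> in the order of time.
  Distributing the minima over the maxima describes its strict superlevel sets.
\<close>

definition play_above :: "real \<Rightarrow> real \<Rightarrow> (real \<Rightarrow> real) \<Rightarrow> real \<Rightarrow> real \<Rightarrow> real \<Rightarrow> bool" where
  "play_above r a u p t x \<longleftrightarrow> (x < p \<and> (\<forall>s\<in>{a..t}. x < u s + r)) \<or>
     (\<exists>s\<in>{a..t}. x < u s - r \<and> (\<forall>s'\<in>{s..t}. x < u s' + r))"

text \<open>The parameter p is the state before the first projection; if it lies within r of u a, it
  is the initial value, see \<open>play_val_initial\<close>.\<close>

definition play_val :: "real \<Rightarrow> real \<Rightarrow> (real \<Rightarrow> real) \<Rightarrow> real \<Rightarrow> real \<Rightarrow> real" where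
  "play_val r a u p t = Sup {x. play_above r a u p t x}"

lemma play_above_mono: "play_above r a u p t y \<Longrightarrow> x \<le> y \<Longrightarrow> play_above r a u p t x"
  unfolding play_above_def by (meson order_le_less_trans)

text \<open>By compactness a strict bound leaves room for a larger one. This keeps the superlevel
  sets of the play free of a largest element, and it keeps points near (u, p) in the same branch in
  \<open>P_int_newton\<close>.\<close>

lemma less_on_interval_room:
  fixes f :: "real \<Rightarrow> real"
  assumes "continuous_on {s..t} f" "\<forall>\<sigma>\<in>{s..t}. x < f \<sigma>"
  shows "\<exists>y>x. \<forall>\<sigma>\<in>{s..t}. y < f \<sigma>"
proof (cases "s \<le> t")
  case True
  then obtain \<tau> where \<tau>: "\<tau> \<in> {s..t}" "\<And>\<sigma>. \<sigma> \<in> {s..t} \<Longrightarrow> f \<tau> \<le> f \<sigma>"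
    using continuous_attains_inf[of "{s..t}" f] assms(1) by auto
  obtain y where "x < y" "y < f \<tau>" using dense bspec[OF assms(2) \<tau>(1)] by blast
  then show ?thesis using \<tau>(2) by force
next
  case False then show ?thesis by (intro exI[of _ "x + 1"]) auto
qed

text \<open>The set of all x with \<open>play_above\<close> is closed downwards, nonempty, bounded
  by u t + r and without a largest element. Such a set consists exactly of the numbers strictly
  below its supremum.\<close>

lemma less_play_val_iff:
  assumes "a \<le> t" "continuous_on {a..t} u"
  shows "x < play_val r a u p t \<longleftrightarrow> play_above r a u p t x"
proof -
  let ?S = "{x. play_above r a u p t x}"
  have bdd: "bdd_above ?S"
    by (rule bdd_aboveI[of _ "u t + r"]) (use assms(1) in \<open>force simp: play_above_def\<close>)
  have cont: "continuous_on {s..t} (\<lambda>\<sigma>. u \<sigma> + r)" if "s \<in> {a..t}" for s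
    by (intro continuous_intros continuous_on_subset[OF assms(2)]) (use that in auto)
  have room: "\<exists>y>x. play_above r a u p t y" if "play_above r a u p t x" for x
    using that unfolding play_above_def
  proof (elim disjE bexE conjE)
    assume 1: "x < p" "\<forall>s\<in>{a..t}. x < u s + r"
    then obtain y where y: "x < y" "\<And>\<sigma>. \<sigma> \<in> {a..t} \<Longrightarrow> y < u \<sigma> + r"
      using less_on_interval_room[OF cont[of a], of x] assms(1) by auto
    obtain z where "x < z" "z < min p y" using dense[of x "min p y"] 1 y(1) by auto
    then show "\<exists>y>x. (y < p \<and> (\<forall>s\<in>{a..t}. y < u s + r)) \<or>
       (\<exists>s\<in>{a..t}. y < u s - r \<and> (\<forall>s'\<in>{s..t}. y < u s' + r))"
      using y(2) by (intro exI[of _ z]) force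
  next
    fix s assume 1: "s \<in> {a..t}" "x < u s - r" "\<forall>s'\<in>{s..t}. x < u s' + r"
    then obtain y where y: "x < y" "\<And>\<sigma>. \<sigma> \<in> {s..t} \<Longrightarrow> y < u \<sigma> + r"
      using less_on_interval_room[OF cont 1(3)] by blast
    obtain z where "x < z" "z < min (u s - r) y" using dense[of x "min (u s - r) y"] 1 y(1) by auto
    then show "\<exists>y>x. (y < p \<and> (\<forall>s\<in>{a..t}. y < u s + r)) \<or>
       (\<exists>s\<in>{a..t}. y < u s - r \<and> (\<forall>s'\<in>{s..t}. y < u s' + r))"
      using y(2) 1(1) by (intro exI[of _ z]) force
  qed
  have "\<exists>m. \<forall>\<sigma>\<in>{a..t}. m < u \<sigma> + r"
  proof -
    have "compact ((\<lambda>\<sigma>. u \<sigma> + r) ` {a..t})"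
      by (rule compact_continuous_image) (use cont[of a] assms(1) in auto)
    from bounded_imp_bdd_below[OF compact_imp_bounded[OF this]] show ?thesis
      unfolding bdd_below_def by (metis image_eqI less_le_trans lt_ex)
  qed
  then obtain m where m: "\<forall>\<sigma>\<in>{a..t}. m < u \<sigma> + r" ..
  have "play_above r a u p t (min m (p - 1))"
    unfolding play_above_def using m by force
  then have ne: "?S \<noteq> {}" by blast
  show ?thesis
  proof
    assume "x < play_val r a u p t"
    then show "play_above r a u p t x"
      unfolding play_val_def using less_cSup_iff[OF ne bdd] play_above_mono by (metis less_imp_le mem_Collect_eq)
  next
    assume "play_above r a u p t x"
    then show "x < play_val r a u p t"
      unfolding play_val_def using less_cSup_iff[OF ne bdd] room by blast
  qed
qed

lemma eq_if_same_below: "(\<And>x. x < A \<longleftrightarrow> x < B) \<Longrightarrow> A = (B :: 'a :: linorder)"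
  by (metis less_irrefl linorder_neqE)

text \<open>The play can be restarted at s from its own value. Both sides have the same strict
  superlevel sets, because the quantifiers over [a, t] split at s.\<close>

lemma play_val_flow:
  assumes "a \<le> s" "s \<le> t" "continuous_on {a..t} u"
  shows "play_val r a u p t = play_val r s u (play_val r a u p s) t"
proof (rule eq_if_same_below)
  fix x
  have c1: "continuous_on {a..s} u" "continuous_on {s..t} u"
    by (rule continuous_on_subset[OF assms(3)], use assms in auto)+
  have split: "{a..t} = {a..s} \<union> {s..t}" using assms by auto
  have split': "{\<sigma>..t} = {\<sigma>..s} \<union> {s..t}" if "\<sigma> \<in> {a..s}" for \<sigma> using that assms by auto
  \<comment> \<open>The time of the lower barrier lies before or after s. If before, the condition
    on the upper barrier up to t splits into the one up to s and the one from s on.\<close>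
  have *: "(\<exists>\<sigma>\<in>{a..t}. x < u \<sigma> - r \<and> (\<forall>s'\<in>{\<sigma>..t}. x < u s' + r)) \<longleftrightarrow>
     (\<exists>\<sigma>\<in>{a..s}. x < u \<sigma> - r \<and> (\<forall>s'\<in>{\<sigma>..s}. x < u s' + r) \<and> (\<forall>s'\<in>{s..t}. x < u s' + r)) \<or>
     (\<exists>\<sigma>\<in>{s..t}. x < u \<sigma> - r \<and> (\<forall>s'\<in>{\<sigma>..t}. x < u s' + r))" (is "?L \<longleftrightarrow> ?R")
  proof -
    have "?L \<longleftrightarrow> (\<exists>\<sigma>\<in>{a..s}. x < u \<sigma> - r \<and> (\<forall>s'\<in>{\<sigma>..t}. x < u s' + r)) \<or>
     (\<exists>\<sigma>\<in>{s..t}. x < u \<sigma> - r \<and> (\<forall>s'\<in>{\<sigma>..t}. x < u s' + r))"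
      unfolding split bex_Un by simp
    also have "\<dots> \<longleftrightarrow> ?R" by (simp only: split' ball_Un cong: bex_cong)
    finally show ?thesis .
  qed
  have "x < play_val r a u p t \<longleftrightarrow> (x < p \<and> (\<forall>\<sigma>\<in>{a..s}. x < u \<sigma> + r) \<and> (\<forall>\<sigma>\<in>{s..t}. x < u \<sigma> + r)) \<or>
     (\<exists>\<sigma>\<in>{a..s}. x < u \<sigma> - r \<and> (\<forall>s'\<in>{\<sigma>..s}. x < u s' + r) \<and> (\<forall>s'\<in>{s..t}. x < u s' + r)) \<or>
     (\<exists>\<sigma>\<in>{s..t}. x < u \<sigma> - r \<and> (\<forall>s'\<in>{\<sigma>..t}. x < u s' + r))"
    using less_play_val_iff[of a t u x r p] assms unfolding play_above_def *
    unfolding split ball_Un by auto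
  also have "\<dots> \<longleftrightarrow> x < play_val r s u (play_val r a u p s) t"
    using less_play_val_iff[of s t u x r "play_val r a u p s"] less_play_val_iff[of a s u x r p] c1 assms
    unfolding play_above_def by auto
  finally show "x < play_val r a u p t \<longleftrightarrow> x < play_val r s u (play_val r a u p s) t" .
qed

text \<open>Raising v and q by e dominates u and p, so any x below the play of u gives x - e below
  the play of v. This one-sided comparison is used in both directions.\<close>

lemma play_val_Lipschitz:
  assumes "a \<le> t" "continuous_on {a..t} u" "continuous_on {a..t} v"
    and "\<And>s. s \<in> {a..t} \<Longrightarrow> \<bar>u s - v s\<bar> \<le> e" "\<bar>p - q\<bar> \<le> e"
  shows "\<bar>play_val r a u p t - play_val r a v q t\<bar> \<le> e"
proof -
  have *: "play_val r a u p t \<le> play_val r a v q t + e"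
    if "continuous_on {a..t} u" "continuous_on {a..t} v"
      "\<And>s. s \<in> {a..t} \<Longrightarrow> u s \<le> v s + e" "p \<le> q + e" for u v p q
  proof (rule dense_le)
    fix x assume "x < play_val r a u p t"
    then have "play_above r a u p t x" using less_play_val_iff assms(1) that by blast
    then have "play_above r a v q t (x - e)"
      unfolding play_above_def
    proof (elim disjE bexE conjE)
      assume "x < p" "\<forall>s\<in>{a..t}. x < u s + r"
      then have "x - e < q \<and> (\<forall>s\<in>{a..t}. x - e < v s + r)" using that(3,4) by force
      then show "(x - e < q \<and> (\<forall>s\<in>{a..t}. x - e < v s + r)) \<or>
        (\<exists>s\<in>{a..t}. x - e < v s - r \<and> (\<forall>s'\<in>{s..t}. x - e < v s' + r))" ..
    next
      fix s assume s: "s \<in> {a..t}" "x < u s - r" "\<forall>s'\<in>{s..t}. x < u s' + r"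
      have "x - e < v s' + r" if "s' \<in> {s..t}" for s'
      proof -
        have "x < u s' + r" "u s' \<le> v s' + e" using that s \<open>\<And>s. s \<in> {a..t} \<Longrightarrow> u s \<le> v s + e\<close> by auto
        then show ?thesis by linarith
      qed
      moreover have "x - e < v s - r" using s(2) that(3)[OF s(1)] by linarith
      ultimately have "x - e < v s - r \<and> (\<forall>s'\<in>{s..t}. x - e < v s' + r)" by blast
      then show "(x - e < q \<and> (\<forall>s\<in>{a..t}. x - e < v s + r)) \<or>
        (\<exists>s\<in>{a..t}. x - e < v s - r \<and> (\<forall>s'\<in>{s..t}. x - e < v s' + r))" using s(1) by blast
    qed
    then have "x - e < play_val r a v q t" using less_play_val_iff assms(1) that by blast
    then show "x \<le> play_val r a v q t + e" by simp
  qed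
  have "play_val r a u p t \<le> play_val r a v q t + e"
    by (rule *) (use assms in \<open>force simp: abs_le_iff\<close>)+
  moreover have "play_val r a v q t \<le> play_val r a u p t + e"
    by (rule *) (use assms in \<open>force simp: abs_le_iff\<close>)+
  ultimately show ?thesis by linarith
qed

text \<open>The last projection is onto [u t - r, u t + r]; in \<open>play_above\<close> it
  corresponds to the time t itself.\<close>

lemma play_val_near:
  assumes "a \<le> t" "continuous_on {a..t} u" "0 < r"
  shows "\<bar>play_val r a u p t - u t\<bar> \<le> r"
proof -
  have "\<not> u t + r < play_val r a u p t"
    unfolding less_play_val_iff[OF assms(1,2)] play_above_def using assms(1) by force
  moreover have "play_val r a u p t \<ge> u t - r"
  proof (rule dense_ge)
    show "u t - r \<le> x" if "play_val r a u p t < x" for x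
    proof (rule ccontr)
      assume "\<not> ?thesis"
      then have "play_above r a u p t x"
        unfolding play_above_def using assms by (intro disjI2 bexI[of _ t]) auto
      then have "x < play_val r a u p t" using less_play_val_iff[OF assms(1,2)] by simp
      then show False using that by simp
    qed
  qed
  ultimately show ?thesis by linarith
qed

lemma play_val_initial:
  assumes "\<bar>p - u a\<bar> \<le> r"
  shows "play_val r a u p a = p"
proof (rule eq_if_same_below)
  fix x
  show "x < play_val r a u p a \<longleftrightarrow> x < p"
    using assms by (auto simp: less_play_val_iff play_above_def abs_le_iff)
qed

text \<open>With oscillation below 2 * r every lower barrier u s - r stays below every upper barrier
  u s' + r. The two kinds of conditions in \<open>play_above\<close> then decouple into one on the
  running maximum and one on the running minimum.\<close>

lemma play_val_small_osc:
  assumes "c \<le> t" "continuous_on {c..d} u" "t \<in> {c..d}"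
    and "\<And>\<sigma> \<tau>. \<sigma> \<in> {c..t} \<Longrightarrow> \<tau> \<in> {c..t} \<Longrightarrow> u \<sigma> - u \<tau> < 2 * r"
  shows "play_val r c u p t = max (F_int c d u t - r) (min p (r - F_int c d (\<lambda>s. - u s) t))"
proof (rule eq_if_same_below)
  fix x
  have c: "continuous_on {c..t} u" by (rule continuous_on_subset[OF assms(2)]) (use assms in auto)
  have "x < F_int c d u t - r \<longleftrightarrow> (\<exists>s\<in>{c..t}. x < u s - r)"
    using F_int_less_iff[OF assms(2,3), of "x + r"] by (simp add: algebra_simps)
  moreover have "x < r - F_int c d (\<lambda>s. - u s) t \<longleftrightarrow> (\<forall>s\<in>{c..t}. x < u s + r)"
  proof -
    have m: "continuous_on {c..d} (\<lambda>s. - u s)" using assms(2) by (intro continuous_intros)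
    obtain s where "s \<in> {c..t}" "- u s = F_int c d (\<lambda>s. - u s) t" "\<And>s'. s' \<in> {c..t} \<Longrightarrow> - u s' \<le> F_int c d (\<lambda>s. - u s) t"
      using F_int_attained[OF m assms(3)] by blast
    then show ?thesis by force
  qed
  moreover have "\<forall>s'\<in>{s..t}. x < u s' + r" if "s \<in> {c..t}" "x < u s - r" for s
  proof
    fix s' assume "s' \<in> {s..t}"
    then show "x < u s' + r" using assms(4)[of s s'] that by auto
  qed
  ultimately show "x < play_val r c u p t \<longleftrightarrow> x < max (F_int c d u t - r) (min p (r - F_int c d (\<lambda>s. - u s) t))"
    using less_play_val_iff[OF assms(1) c, of x r p] unfolding play_above_def by auto
qed

text \<open>The link to the defining recursion. For increasing u the lower barrier at t is the
  highest one, and no upper barrier acts because the play starts at or below u s + r. For decreasing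
  u the upper barrier at t is the lowest one, and no lower barrier exceeds the starting
  value.\<close>

lemma play_val_monotone_step:
  assumes "a \<le> s" "s \<le> t" "continuous_on {a..t} u" "0 < r"
    and mono: "mono_on {s..t} u \<or> antimono_on {s..t} u"
  shows "play_val r a u p t = max (u t - r) (min (u t + r) (play_val r a u p s))" (is "_ = ?R")
proof (rule eq_if_same_below)
  fix x
  let ?w = "play_val r a u p s"
  have c1: "continuous_on {a..s} u" "continuous_on {s..t} u"
    by (rule continuous_on_subset[OF assms(3)], use assms in auto)+
  have near: "\<bar>?w - u s\<bar> \<le> r" by (rule play_val_near) (use assms c1 in auto)
  have "x < play_val r a u p t \<longleftrightarrow> play_above r s u ?w t x"
    using play_val_flow[OF assms(1-3)] less_play_val_iff[OF assms(2) c1(2)] by simp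
  also have "\<dots> \<longleftrightarrow> x < ?R"
    using mono
  proof
    assume m: "mono_on {s..t} u"
    have 1: "u s \<le> u \<sigma>" "u \<sigma> \<le> u t" if "\<sigma> \<in> {s..t}" for \<sigma>
      using m that assms(2) by (auto simp: mono_on_def)
    show ?thesis
    proof
      assume "play_above r s u ?w t x"
      then show "x < ?R" using assms(2,4) 1 unfolding play_above_def by force
    next
      assume "x < ?R"
      then consider "x < u t - r" | "x < u t + r" "x < ?w" by fastforce
      then show "play_above r s u ?w t x"
      proof cases
        case 1 then show ?thesis unfolding play_above_def
          using assms by (intro disjI2 bexI[of _ t]) auto
      next
        case 2
        have "x < u \<sigma> + r" if "\<sigma> \<in> {s..t}" for \<sigma> using 2 near 1[OF that] by linarith
        then show ?thesis unfolding play_above_def using 2 by blast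
      qed
    qed
  next
    assume m: "antimono_on {s..t} u"
    have 1: "u \<sigma> \<le> u s" "u t \<le> u \<sigma>" if "\<sigma> \<in> {s..t}" for \<sigma>
      using m that assms(2) by (auto simp: monotone_on_def)
    show ?thesis
    proof
      assume "play_above r s u ?w t x"
      then show "x < ?R"
        unfolding play_above_def
      proof (elim disjE bexE conjE)
        assume *: "x < ?w" "\<forall>s\<in>{s..t}. x < u s + r"
        have "x < u t + r" by (rule *(2)[rule_format]) (use assms(2) in auto)
        then show ?thesis using *(1) by simp
      next
        fix \<sigma> assume \<sigma>: "\<sigma> \<in> {s..t}" "x < u \<sigma> - r" "\<forall>s'\<in>{\<sigma>..t}. x < u s' + r"
        then have "x < u t + r" by auto
        moreover have "x < ?w" using 1[OF \<sigma>(1)] \<sigma>(2) near by linarith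
        ultimately show ?thesis by auto
      qed
    next
      assume "x < ?R"
      then consider "x < u t - r" | "x < u t + r" "x < ?w" by fastforce
      then show "play_above r s u ?w t x"
      proof cases
        case 1 then show ?thesis unfolding play_above_def
          using assms by (intro disjI2 bexI[of _ t]) auto
      next
        case 2
        have "x < u \<sigma> + r" if "\<sigma> \<in> {s..t}" for \<sigma> using 2 1[OF that] by linarith
        then show ?thesis unfolding play_above_def using 2 by blast
      qed
    qed
  qed
  finally show "x < play_val r a u p t \<longleftrightarrow> x < ?R" .
qed

text \<open>The play starts at s within r of u s and the barriers move by at most e, so the
  projection displaces it by at most e. The assumption e \<le> r gives the oscillation below 2 * r
  on which the closed formula rests.\<close>

lemma play_val_increment:
  assumes "a \<le> s" "s \<le> t" "continuous_on {a..t} u" "0 < r" "e \<le> r"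
    and "\<And>\<sigma> \<tau>. \<sigma> \<in> {s..t} \<Longrightarrow> \<tau> \<in> {s..t} \<Longrightarrow> \<bar>u \<sigma> - u \<tau>\<bar> \<le> e"
  shows "\<bar>play_val r a u p t - play_val r a u p s\<bar> \<le> e"
proof -
  let ?w = "play_val r a u p s"
  have c1: "continuous_on {a..s} u" "continuous_on {s..t} u"
    by (rule continuous_on_subset[OF assms(3)], use assms in auto)+
  have near: "\<bar>?w - u s\<bar> \<le> r" by (rule play_val_near) (use assms c1 in auto)
  have "play_val r a u p t = play_val r s u ?w t" by (rule play_val_flow[OF assms(1-3)])
  also have "\<dots> = max (F_int s t u t - r) (min ?w (r - F_int s t (\<lambda>s. - u s) t))"
    by (rule play_val_small_osc) (use assms c1 in \<open>force simp: abs_le_iff\<close>)+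
  finally have eq: "play_val r a u p t = max (F_int s t u t - r) (min ?w (r - F_int s t (\<lambda>s. - u s) t))" .
  obtain \<sigma> where \<sigma>: "\<sigma> \<in> {s..t}" "u \<sigma> = F_int s t u t" using F_int_attained[OF c1(2), of t] assms(2) by auto
  obtain \<tau> where \<tau>: "\<tau> \<in> {s..t}" "- u \<tau> = F_int s t (\<lambda>s. - u s) t"
    using F_int_attained[OF continuous_on_minus[OF c1(2)], of t] assms(2) by auto
  show ?thesis
    using assms(6)[OF \<sigma>(1), of s] assms(6)[OF \<tau>(1), of s] assms(2) near unfolding eq \<sigma>(2)[symmetric] \<tau>(2)[symmetric]
    by (auto simp: max_def min_def abs_le_iff)
qed

lemma continuous_on_play_val:
  assumes "continuous_on {a..b} u" "0 < r"
  shows "continuous_on {a..b} (play_val r a u p)"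
  unfolding continuous_on_iff
proof (intro ballI allI impI)
  fix t and e :: real assume t: "t \<in> {a..b}" and e: "0 < e"
  have "uniformly_continuous_on {a..b} u" by (rule compact_uniformly_continuous[OF assms(1)]) simp
  \<comment> \<open>\<open>play_val_increment\<close> asks for a bound of at most r; halving e turns
    its weak inequality into the strict one wanted.\<close>
  then obtain \<delta> where \<delta>: "\<delta> > 0" "\<And>s t. s \<in> {a..b} \<Longrightarrow> t \<in> {a..b} \<Longrightarrow> dist t s < \<delta> \<Longrightarrow> dist (u t) (u s) < min (e / 2) r"
    unfolding uniformly_continuous_on_def using e assms(2) by (metis half_gt_zero min_less_iff_conj)
  have *: "\<bar>play_val r a u p t - play_val r a u p s\<bar> < e" if "s \<in> {a..b}" "t \<in> {a..b}" "s \<le> t" "t - s < \<delta>" for s t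
  proof -
    have "\<bar>play_val r a u p t - play_val r a u p s\<bar> \<le> min (e / 2) r"
    proof (rule play_val_increment)
      show "continuous_on {a..t} u" by (rule continuous_on_subset[OF assms(1)]) (use that in auto)
      show "\<bar>u \<sigma> - u \<tau>\<bar> \<le> min (e / 2) r" if "\<sigma> \<in> {s..t}" "\<tau> \<in> {s..t}" for \<sigma> \<tau>
        using \<delta>(2)[of \<tau> \<sigma>] that \<open>s \<in> {a..b}\<close> \<open>t \<in> {a..b}\<close> \<open>t - s < \<delta>\<close> by (force simp: dist_real_def)
    qed (use that assms(2) in auto)
    then show ?thesis using e by linarith
  qed
  show "\<exists>d>0. \<forall>x'\<in>{a..b}. dist x' t < d \<longrightarrow> dist (play_val r a u p x') (play_val r a u p t) < e"
  proof (intro exI[of _ \<delta>] conjI ballI impI \<delta>(1))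
    fix s assume s: "s \<in> {a..b}" "dist s t < \<delta>"
    show "dist (play_val r a u p s) (play_val r a u p t) < e"
      using *[of s t] *[of t s] s t by (cases "s \<le> t") (auto simp: dist_real_def abs_minus_commute)
  qed
qed

section \<open>Partitions: enumeration, covering and refinement\<close>

lemma partition_basic:
  assumes "is_partition a b \<Delta>" "a < b"
  shows "npt \<Delta> \<ge> 1" "card \<Delta> = Suc (npt \<Delta>)" "bij_betw (pt \<Delta>) {..npt \<Delta>} \<Delta>"
    and "pt \<Delta> 0 = a" "pt \<Delta> (npt \<Delta>) = b"
proof -
  have fin: "finite \<Delta>" and ab: "a \<in> \<Delta>" "b \<in> \<Delta>" and sub: "\<Delta> \<subseteq> {a..b}"
    using assms unfolding is_partition_def by auto
  have "card {a, b} \<le> card \<Delta>" using fin ab by (intro card_mono) auto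
  then have 2: "card \<Delta> \<ge> 2" using assms(2) by simp
  then show n: "npt \<Delta> \<ge> 1" and c: "card \<Delta> = Suc (npt \<Delta>)" unfolding npt_def by auto
  have len: "length (sorted_list_of_set \<Delta>) = Suc (npt \<Delta>)" using c by simp
  have "bij_betw (\<lambda>i. sorted_list_of_set \<Delta> ! i) {..<Suc (npt \<Delta>)} (set (sorted_list_of_set \<Delta>))"
    using bij_betw_nth[of "sorted_list_of_set \<Delta>"] len by (auto simp: fin)
  then show bij: "bij_betw (pt \<Delta>) {..npt \<Delta>} \<Delta>"
    using fin by (simp add: pt_def[abs_def] lessThan_Suc_atMost)
  have le: "pt \<Delta> i \<le> pt \<Delta> j" if "i \<le> j" "j \<le> npt \<Delta>" for i j
    unfolding pt_def using that len by (intro sorted_nth_mono) auto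
  have mem: "pt \<Delta> i \<in> \<Delta>" if "i \<le> npt \<Delta>" for i using bij that by (auto dest: bij_betwE)
  obtain i j where ij: "i \<le> npt \<Delta>" "pt \<Delta> i = a" "j \<le> npt \<Delta>" "pt \<Delta> j = b"
    using bij ab unfolding bij_betw_def by (metis atMost_iff imageE)
  show "pt \<Delta> 0 = a" using le[of 0 i] mem[of 0] ij sub by fastforce
  show "pt \<Delta> (npt \<Delta>) = b" using le[of j "npt \<Delta>"] mem[of "npt \<Delta>"] ij sub by fastforce
qed

lemma pt_mem:
  assumes "is_partition a b \<Delta>" "a < b" "i \<le> npt \<Delta>"
  shows "pt \<Delta> i \<in> \<Delta>" "pt \<Delta> i \<in> {a..b}"
proof -
  show "pt \<Delta> i \<in> \<Delta>" using partition_basic(3)[OF assms(1,2)] assms(3) by (auto dest: bij_betwE)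
  then show "pt \<Delta> i \<in> {a..b}" using assms(1) unfolding is_partition_def by auto
qed

lemma pt_less:
  assumes "is_partition a b \<Delta>" "a < b" "i < j" "j \<le> npt \<Delta>"
  shows "pt \<Delta> i < pt \<Delta> j"
proof -
  have "sorted_wrt (<) (sorted_list_of_set \<Delta>)" by simp
  moreover have "j < length (sorted_list_of_set \<Delta>)"
    using partition_basic(2)[OF assms(1,2)] assms(4) by simp
  ultimately show ?thesis unfolding pt_def using assms(3) by (simp add: sorted_wrt_iff_nth_less)
qed

lemma pt_Suc_less:
  assumes "is_partition a b \<Delta>" "a < b" "k < npt \<Delta>"
  shows "pt \<Delta> k < pt \<Delta> (Suc k)" "a \<le> pt \<Delta> k" "pt \<Delta> (Suc k) \<le> b"
  using pt_less[OF assms(1,2), of k "Suc k"] pt_mem[OF assms(1,2), of k] pt_mem[OF assms(1,2), of "Suc k"] assms(3)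
  by auto

lemma partition_gap:
  assumes "is_partition a b \<Delta>" "a < b" "k < npt \<Delta>" "x \<in> \<Delta>"
  shows "x \<le> pt \<Delta> k \<or> pt \<Delta> (Suc k) \<le> x"
proof -
  obtain i where i: "i \<le> npt \<Delta>" "x = pt \<Delta> i"
    using partition_basic(3)[OF assms(1,2)] assms(4) unfolding bij_betw_def by blast
  show ?thesis
  proof (cases "i \<le> k")
    case True
    then show ?thesis using pt_less[OF assms(1,2), of i k] assms(3) i(2) by (cases "i = k") auto
  next
    case False
    then show ?thesis using pt_less[OF assms(1,2), of "Suc k" i] i by (cases "i = Suc k") auto
  qed
qed

lemma partition_cover:
  assumes "is_partition a b \<Delta>" "a < b" "t \<in> {a<..b}"
  obtains k where "k < npt \<Delta>" "t \<in> {pt \<Delta> k<..pt \<Delta> (Suc k)}"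
proof -
  have "\<exists>k. t \<le> pt \<Delta> k" using partition_basic(5)[OF assms(1,2)] assms(3) by auto
  then obtain k where k: "t \<le> pt \<Delta> k" "\<And>j. j < k \<Longrightarrow> \<not> t \<le> pt \<Delta> j"
    using exists_least_iff[of "\<lambda>k. t \<le> pt \<Delta> k"] by blast
  have "k \<le> npt \<Delta>" using k(2)[of "npt \<Delta>"] partition_basic(5)[OF assms(1,2)] assms(3) by force
  moreover have "k \<noteq> 0" using k(1) partition_basic(4)[OF assms(1,2)] assms(3) by (metis greaterThanAtMost_iff not_less)
  ultimately show thesis using that[of "k - 1"] k(1) k(2)[of "k - 1"] by auto
qed

text \<open>Take the coarse interval that covers the right end of the fine one. Its left end is also
  a fine node, so it cannot lie inside the fine interval.\<close>

lemma partition_refine: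
  assumes "is_partition a b \<Delta>" "is_partition a b \<Delta>'" "a < b" "\<Delta> \<subseteq> \<Delta>'" "k < npt \<Delta>'"
  obtains j where "j < npt \<Delta>" "{pt \<Delta>' k..pt \<Delta>' (Suc k)} \<subseteq> {pt \<Delta> j..pt \<Delta> (Suc j)}"
proof -
  have s: "pt \<Delta>' k < pt \<Delta>' (Suc k)" "a \<le> pt \<Delta>' k" "pt \<Delta>' (Suc k) \<le> b"
    by (rule pt_Suc_less[OF assms(2,3,5)])+
  then obtain j where j: "j < npt \<Delta>" "pt \<Delta>' (Suc k) \<in> {pt \<Delta> j<..pt \<Delta> (Suc j)}"
    using partition_cover[OF assms(1,3), of "pt \<Delta>' (Suc k)"] by auto
  have "pt \<Delta> j \<in> \<Delta>'" using pt_mem(1)[OF assms(1,3), of j] j(1) assms(4) by auto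
  from partition_gap[OF assms(2,3,5) this] have "pt \<Delta> j \<le> pt \<Delta>' k" using j(2) by auto
  then show thesis using that[OF j(1)] j(2) by auto
qed

lemma partition_insert:
  assumes "is_partition a b \<Delta>" "x \<in> {a..b}"
  shows "is_partition a b (insert x \<Delta>)"
  using assms unfolding is_partition_def by auto

section \<open>Polynomials: density with rational coefficients, and piecewise monotonicity\<close>

lemma rational_polynomial_dense:
  fixes f :: "real \<Rightarrow> real"
  assumes "continuous_on {a..b} f" "0 < e"
  shows "\<exists>(n :: nat) (l :: rat list). \<forall>t\<in>{a..b}. \<bar>f t - poly (\<Sum>i\<le>n. monom (of_rat (l ! i)) i) t\<bar> < e"
proof -
  obtain g where g: "real_polynomial_function g" "\<And>t. t \<in> {a..b} \<Longrightarrow> \<bar>f t - g t\<bar> < e / 2"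
    using Stone_Weierstrass_real_polynomial_function[of "{a..b}" f "e / 2"] assms by auto
  obtain c n where c: "g = (\<lambda>x. \<Sum>i\<le>n. c i * x ^ i)"
    using real_polynomial_function_imp_sum[OF g(1)] by blast
  define B where "B = max 1 (max \<bar>a\<bar> \<bar>b\<bar>)"
  \<comment> \<open>There are n + 1 coefficient errors, each multiplied by a power of t of size at
    most B^n; together they amount to e / 2.\<close>
  define \<delta> where "\<delta> = e / (2 * (real n + 1) * B ^ n)"
  have B: "B \<ge> 1" "\<And>t. t \<in> {a..b} \<Longrightarrow> \<bar>t\<bar> \<le> B" unfolding B_def by auto
  have \<delta>: "\<delta> > 0" unfolding \<delta>_def using assms(2) B(1) by simp
  have "\<exists>q. \<bar>c i - of_rat q\<bar> < \<delta>" for i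
  proof -
    obtain q where "c i < of_rat q" "of_rat q < c i + \<delta>" using of_rat_dense[of "c i" "c i + \<delta>"] \<delta> by auto
    then show ?thesis by (intro exI[of _ q]) auto
  qed
  then obtain q where q: "\<And>i. \<bar>c i - of_rat (q i)\<bar> < \<delta>" by metis
  define l where "l = map q [0..<Suc n]"
  have "\<bar>f t - poly (\<Sum>i\<le>n. monom (of_rat (l ! i)) i) t\<bar> < e" if t: "t \<in> {a..b}" for t
  proof -
    have "poly (\<Sum>i\<le>n. monom (of_rat (l ! i)) i) t = (\<Sum>i\<le>n. of_rat (q i) * t ^ i)"
      unfolding poly_sum poly_monom
      by (rule sum.cong) (auto simp: l_def simp del: upt_Suc)
    then have "\<bar>g t - poly (\<Sum>i\<le>n. monom (of_rat (l ! i)) i) t\<bar> = \<bar>\<Sum>i\<le>n. (c i - of_rat (q i)) * t ^ i\<bar>"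
      unfolding c by (simp add: sum_subtractf left_diff_distrib)
    also have "\<dots> \<le> (\<Sum>i\<le>n. \<bar>(c i - of_rat (q i)) * t ^ i\<bar>)" by (rule sum_abs)
    also have "\<dots> \<le> (\<Sum>i\<le>n. \<delta> * B ^ n)"
    proof (rule sum_mono)
      fix i assume "i \<in> {..n}"
      have "\<bar>t\<bar> ^ i \<le> B ^ i" by (rule power_mono[OF B(2)[OF t]]) simp
      also have "\<dots> \<le> B ^ n" by (rule power_increasing) (use B(1) \<open>i \<in> {..n}\<close> in auto)
      finally show "\<bar>(c i - of_rat (q i)) * t ^ i\<bar> \<le> \<delta> * B ^ n"
        unfolding abs_mult power_abs using q[of i] \<delta> by (intro mult_mono) auto
    qed
    also have "\<dots> = (real n + 1) * (e / (2 * (real n + 1) * B ^ n) * B ^ n)" unfolding \<delta>_def by simp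
    also have "\<dots> = e / 2"
    proof -
      have "N * (e / (2 * N * K) * K) = e / 2" if "N \<noteq> 0" "K \<noteq> 0" for N K :: real
        using that by simp
      moreover have "B ^ n \<noteq> 0" "real n + 1 \<noteq> 0" using B(1) by auto
      ultimately show ?thesis by blast
    qed
    finally show ?thesis using g(2)[OF t] by linarith
  qed
  then show ?thesis by blast
qed

text \<open>By the intermediate value theorem a derivative without zeros keeps one sign on the open
  interval; continuity extends monotonicity to the end points.\<close>

lemma poly_monotone_between_critical_points:
  fixes p :: "real poly"
  assumes "\<And>x. s < x \<Longrightarrow> x < t \<Longrightarrow> poly (pderiv p) x \<noteq> 0"
  shows "mono_on {s..t} (poly p) \<or> antimono_on {s..t} (poly p)"
proof -
  have sgn: "(\<forall>x. s < x \<and> x < t \<longrightarrow> poly (pderiv p) x > 0) \<or> (\<forall>x. s < x \<and> x < t \<longrightarrow> poly (pderiv p) x < 0)"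
  proof (rule ccontr)
    assume "\<not> ?thesis"
    then obtain x y where xy: "s < x" "x < t" "s < y" "y < t" "poly (pderiv p) x < 0" "poly (pderiv p) y > 0"
      using assms by (metis linorder_neqE_linordered_idom)
    have "x \<noteq> y" using xy by auto
    then consider "x < y" | "y < x" by linarith
    then show False
    proof cases
      case 1 show False using poly_IVT_pos[OF 1 xy(5,6)] assms xy by force
    next
      case 2 show False using poly_IVT_neg[OF 2 xy(6,5)] assms xy by force
    qed
  qed
  have c: "continuous_on {x..y} (poly p)" for x y by (intro continuous_intros)
  from sgn show ?thesis
  proof
    assume *: "\<forall>x. s < x \<and> x < t \<longrightarrow> poly (pderiv p) x > 0"
    have "poly p x \<le> poly p y" if "s \<le> x" "x \<le> y" "y \<le> t" for x y
    proof (cases "x = y")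
      case False
      then have "poly p x < poly p y"
        by (intro DERIV_pos_imp_increasing_open[OF _ _ c]) (use that * poly_DERIV in fastforce)+
      then show ?thesis by simp
    qed simp
    then show ?thesis by (auto simp: mono_on_def)
  next
    assume *: "\<forall>x. s < x \<and> x < t \<longrightarrow> poly (pderiv p) x < 0"
    have "poly p y \<le> poly p x" if "s \<le> x" "x \<le> y" "y \<le> t" for x y
    proof (cases "x = y")
      case False
      then have "poly p y < poly p x"
        by (intro DERIV_neg_imp_decreasing_open[OF _ _ c]) (use that * poly_DERIV in fastforce)+
      then show ?thesis by simp
    qed simp
    then show ?thesis by (auto simp: monotone_on_def)
  qed
qed

lemma poly_monotone_pieces:
  assumes "a < b"
  obtains \<Delta> where "is_partition a b \<Delta>" "\<And>v. (\<And>t. t \<in> {a..b} \<Longrightarrow> v t = poly p t) \<Longrightarrow> monotone_pieces \<Delta> v"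
proof -
  \<comment> \<open>The nodes are the critical points. For constant p every point is critical, so
    the zero set would be infinite and is left out.\<close>
  define \<Delta> where "\<Delta> = {a, b} \<union> (if pderiv p = 0 then {} else {x \<in> {a..b}. poly (pderiv p) x = 0})"
  have part: "is_partition a b \<Delta>"
    unfolding is_partition_def \<Delta>_def using assms poly_roots_finite[of "pderiv p"] by auto
  have "mono_on {pt \<Delta> i..pt \<Delta> (Suc i)} (poly p) \<or> antimono_on {pt \<Delta> i..pt \<Delta> (Suc i)} (poly p)"
    if i: "i < npt \<Delta>" for i
  proof (cases "pderiv p = 0")
    case True
    then obtain c where "p = [:c:]" by (metis pderiv_iszero)
    then show ?thesis by (simp add: mono_on_def)
  next
    case False
    have s: "a \<le> pt \<Delta> i" "pt \<Delta> (Suc i) \<le> b" using pt_Suc_less[OF part assms i] by auto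
    show ?thesis
    proof (rule poly_monotone_between_critical_points)
      fix x assume x: "pt \<Delta> i < x" "x < pt \<Delta> (Suc i)"
      then have "x \<notin> \<Delta>" using partition_gap[OF part assms i, of x] by auto
      then show "poly (pderiv p) x \<noteq> 0" unfolding \<Delta>_def using x s False by auto
    qed
  qed
  moreover have "monotone_pieces \<Delta> v"
    if *: "\<And>i. i < npt \<Delta> \<Longrightarrow> mono_on {pt \<Delta> i..pt \<Delta> (Suc i)} (poly p) \<or> antimono_on {pt \<Delta> i..pt \<Delta> (Suc i)} (poly p)"
      and v: "\<And>t. t \<in> {a..b} \<Longrightarrow> v t = poly p t" for v
    unfolding monotone_pieces_def
  proof (intro allI impI)
    fix i assume i: "i < npt \<Delta>"
    have "{pt \<Delta> i..pt \<Delta> (Suc i)} \<subseteq> {a..b}" using pt_Suc_less[OF part assms i] by auto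
    then have "v t = poly p t" if "t \<in> {pt \<Delta> i..pt \<Delta> (Suc i)}" for t using that v by blast
    then show "mono_on {pt \<Delta> i..pt \<Delta> (Suc i)} v \<or> antimono_on {pt \<Delta> i..pt \<Delta> (Suc i)} v"
      using *[OF i] by (simp add: monotone_on_def)
  qed
  ultimately show thesis using that[OF part] by blast
qed

lemma piecewise_monotone_dense:
  assumes "a < b" "u \<in> C_on a b" "0 < e"
  shows "\<exists>v. v \<in> C_on a b \<and> (\<exists>\<Delta>. is_partition a b \<Delta> \<and> monotone_pieces \<Delta> v) \<and> norm (u - v) \<le> e"
proof -
  obtain p :: "real poly" where p: "\<And>t. t \<in> {a..b} \<Longrightarrow> \<bar>u t - poly p t\<bar> < e"
    using rational_polynomial_dense[OF _ assms(3), of a b u] by fastforce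
  have cont: "continuous_on {a..b} (poly p)" by (intro continuous_intros)
  have "a \<le> b" using assms(1) by simp
  from C_on_extend[OF this cont] obtain v where
    v: "v \<in> C_on a b" "\<And>t. t \<in> {a..b} \<Longrightarrow> apply_bcontfun v t = poly p t" by blast
  obtain \<Delta> where "is_partition a b \<Delta>" "monotone_pieces \<Delta> v"
    using poly_monotone_pieces[OF assms(1), of p] v(2) by blast
  moreover have "norm (u - v) \<le> e"
  proof (rule norm_C_on_le)
    show "u - v \<in> C_on a b" using assms(2) v(1) by (rule C_on_diff)
    show "\<bar>(u - v) t\<bar> \<le> e" if "t \<in> {a..b}" for t
      using p[OF that] v(2)[OF that] by simp
  qed (use assms in simp)
  ultimately show ?thesis using v(1) by blast
qed

section \<open>Existence and uniqueness of the continuous extension\<close>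

lemma play_recursion_unique:
  assumes "is_partition a b \<Delta>" "a < b" "play_recursion r a \<Delta> u z0 w" "play_recursion r a \<Delta> u z0 w'" "t \<in> {a..b}"
  shows "w t = w' t"
proof -
  have 1: "w (pt \<Delta> i) = w' (pt \<Delta> i)" if "i \<le> npt \<Delta>" for i
    using that
  proof (induction i)
    case 0 show ?case using assms(3,4) partition_basic(4)[OF assms(1,2)] by (simp add: play_recursion_def)
  next
    case (Suc i)
    then have "pt \<Delta> (Suc i) \<in> {pt \<Delta> i<..pt \<Delta> (Suc i)}" using pt_Suc_less[OF assms(1,2), of i] by auto
    then show ?case using assms(3,4) Suc unfolding play_recursion_def by (metis Suc_leD Suc_le_lessD)
  qed
  show ?thesis
  proof (cases "t = a")
    case True then show ?thesis using assms(3,4) by (simp add: play_recursion_def)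
  next
    case False
    then obtain k where "k < npt \<Delta>" "t \<in> {pt \<Delta> k<..pt \<Delta> (Suc k)}"
      using partition_cover[OF assms(1,2), of t] assms(5) by auto
    then show ?thesis using 1[of k] assms(3,4) by (simp add: play_recursion_def)
  qed
qed

lemma clip_bounded: "0 < r \<Longrightarrow> \<bar>clip r z\<bar> \<le> r"
  unfolding clip_def by auto

lemma clip_Lipschitz: "\<bar>clip r z - clip r z'\<bar> \<le> \<bar>z - z'\<bar>"
  unfolding clip_def by (auto simp: max_def min_def)

lemma play_recursion_play_val:
  assumes "is_partition a b \<Delta>" "a < b" "0 < r" "continuous_on {a..b} u" "monotone_pieces \<Delta> u"
    and w: "\<And>t. t \<in> {a..b} \<Longrightarrow> w t = play_val r a u (u a - clip r z0) t"
  shows "play_recursion r a \<Delta> u z0 w"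
  unfolding play_recursion_def
proof (intro conjI allI impI ballI)
  show "w a = u a - clip r z0"
    using w[of a] play_val_initial[of "u a - clip r z0" u a r] clip_bounded[OF assms(3), of z0] assms(2) by simp
next
  fix i t assume i: "i < npt \<Delta>" and t: "t \<in> {pt \<Delta> i<..pt \<Delta> (Suc i)}"
  note s = pt_Suc_less[OF assms(1,2) i]
  have "play_val r a u (u a - clip r z0) t = max (u t - r) (min (u t + r) (play_val r a u (u a - clip r z0) (pt \<Delta> i)))"
  proof (rule play_val_monotone_step)
    show "continuous_on {a..t} u" by (rule continuous_on_subset[OF assms(4)]) (use s t in auto)
    have "{pt \<Delta> i..t} \<subseteq> {pt \<Delta> i..pt \<Delta> (Suc i)}" using t by auto
    then show "mono_on {pt \<Delta> i..t} u \<or> antimono_on {pt \<Delta> i..t} u"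
      using assms(5) i unfolding monotone_pieces_def by (meson monotone_on_subset)
  qed (use s t assms(3) in auto)
  then show "w t = max (u t - r) (min (u t + r) (w (pt \<Delta> i)))" using w s t by auto
qed

text \<open>\<open>play\<close> is a definite description, so nothing is known about it before
  existence and uniqueness are settled. Existence is supplied by \<open>play_val\<close>. For
  uniqueness, two candidates agree on piecewise monotone functions by the recursion; these are dense
  and both candidates are continuous.\<close>

theorem play_eq_play_val:
  assumes "a < b" "0 < r" "u \<in> C_on a b"
  shows "play r a b (u, z0) \<in> C_on a b"
    and "t \<in> {a..b} \<Longrightarrow> play r a b (u, z0) t = play_val r a u (u a - clip r z0) t"
proof -
  let ?D = "C_on a b \<times> (UNIV :: real set)"
  let ?w = "\<lambda>(u :: cfun) z0. play_val r a u (u a - clip r z0)"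
  have "\<exists>v. v \<in> C_on a b \<and> (\<forall>t\<in>{a..b}. v t = ?w u z0 t)" for u :: cfun and z0
    by (rule C_on_extend[OF less_imp_le[OF assms(1)] continuous_on_play_val[OF _ assms(2)]]) simp
  then obtain Q where Q: "\<And>u z0. Q u z0 \<in> C_on a b" "\<And>u z0 t. t \<in> {a..b} \<Longrightarrow> Q u z0 t = ?w u z0 t" by metis
  \<comment> \<open>Functions are total, so the description also fixes the values off the domain
    through \<open>extensional\<close>; \<open>restrict\<close> assigns the matching
    default.\<close>
  define P where "P = restrict (\<lambda>(u, z0). Q u z0) ?D"
  define spec where "spec = (\<lambda>P :: cfun \<times> real \<Rightarrow> cfun. P \<in> extensional ?D \<and> (\<forall>x \<in> ?D. P x \<in> C_on a b) \<and>
     continuous_on ?D P \<and>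
     (\<forall>(u :: cfun) z0 \<Delta>. u \<in> C_on a b \<and> is_partition a b \<Delta> \<and> monotone_pieces \<Delta> u \<longrightarrow>
        play_recursion r a \<Delta> u z0 (P (u, z0) :: cfun)))"
  have "continuous_on ?D P"
    unfolding continuous_on_iff
  proof (intro ballI allI impI)
    fix x and e :: real assume x: "x \<in> ?D" and e: "0 < e"
    obtain u z where [simp]: "x = (u, z)" by (cases x)
    show "\<exists>d>0. \<forall>x'\<in>?D. dist x' x < d \<longrightarrow> dist (P x') (P x) < e"
    \<comment> \<open>The initial value changes by less than e / 4 through u a and by less than e /
      4 through the clipping; together this stays within e / 2 < e.\<close>
    proof (intro exI[of _ "e / 4"] conjI ballI impI)
      fix x' assume x': "x' \<in> ?D" "dist x' x < e / 4"
      obtain u' z' where [simp]: "x' = (u', z')" by (cases x')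
      have d: "norm (u' - u) < e / 4" "\<bar>z' - z\<bar> < e / 4"
        using dist_fst_le[of x' x] dist_snd_le[of x' x] x'(2) by (auto simp: dist_norm dist_real_def)
      have ut: "\<bar>u' t - u t\<bar> < e / 4" for t
        using abs_apply_le_norm[of "u' - u" t] d(1) by simp
      have "norm (P x' - P x) \<le> e / 2"
      proof (rule norm_C_on_le[of _ a b])
        show "P x' - P x \<in> C_on a b" using Q(1) x x' by (auto simp: P_def intro!: C_on_diff)
        fix t assume t: "t \<in> {a..b}"
        have "\<bar>?w u' z' t - ?w u z t\<bar> \<le> e / 2"
        proof (rule play_val_Lipschitz)
          show "\<bar>u' s - u s\<bar> \<le> e / 2" for s using ut[of s] e by linarith
          show "\<bar>u' a - clip r z' - (u a - clip r z)\<bar> \<le> e / 2"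
            using ut[of a] clip_Lipschitz[of r z' z] d(2) by linarith
        qed (use t in auto)
        then show "\<bar>(P x' - P x) t\<bar> \<le> e / 2" using Q(2)[OF t] x x' by (simp add: P_def)
      qed (use assms in auto)
      then show "dist (P x') (P x) < e" unfolding dist_norm using e by linarith
    qed (use e in simp)
  qed
  then have spec: "spec P"
    unfolding spec_def
  proof (intro conjI)
    show "\<forall>(u :: cfun) z0 \<Delta>. u \<in> C_on a b \<and> is_partition a b \<Delta> \<and> monotone_pieces \<Delta> u \<longrightarrow>
        play_recursion r a \<Delta> u z0 (P (u, z0) :: cfun)"
      by (intro allI impI play_recursion_play_val) (use assms Q in \<open>auto simp: P_def\<close>)
  qed (use Q in \<open>auto simp: P_def\<close>)
  have specD: "P' \<in> extensional ?D" "\<And>u z. u \<in> C_on a b \<Longrightarrow> P' (u, z) \<in> C_on a b" "continuous_on ?D P'"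
    "\<And>u z \<Delta>. u \<in> C_on a b \<Longrightarrow> is_partition a b \<Delta> \<Longrightarrow> monotone_pieces \<Delta> u \<Longrightarrow>
        play_recursion r a \<Delta> u z (P' (u, z) :: cfun)" if "spec P'" for P'
    using that unfolding spec_def by auto
  have unique: "P' = P" if "spec P'" for P'
  proof
    fix x
    show "P' x = P x"
    proof (cases "x \<in> ?D")
      case False
      show ?thesis
        using extensional_arb[OF specD(1)[OF spec] False] extensional_arb[OF specD(1)[OF that] False] by simp
    next
      case True
      obtain u z where x [simp]: "x = (u, z)" by (cases x)
      have "u \<in> C_on a b" using True by simp
      have "\<forall>n. \<exists>v. v \<in> C_on a b \<and> (\<exists>\<Delta>. is_partition a b \<Delta> \<and> monotone_pieces \<Delta> v) \<and> norm (u - v) \<le> inverse (real (Suc n))"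
        using piecewise_monotone_dense[OF assms(1) \<open>u \<in> C_on a b\<close>] by simp
      from choice[OF this] obtain v where v: "\<And>n. v n \<in> C_on a b"
        "\<And>n. \<exists>\<Delta>. is_partition a b \<Delta> \<and> monotone_pieces \<Delta> (v n)" "\<And>n. norm (u - v n) \<le> inverse (real (Suc n))"
        by auto
      have "(\<lambda>n. norm (u - v n)) \<longlonglongrightarrow> 0"
        by (rule tendsto_sandwich[OF _ _ tendsto_const LIMSEQ_inverse_real_of_nat]) (use v(3) in \<open>auto simp del: of_nat_Suc\<close>)
      then have "(\<lambda>n. dist (v n) u) \<longlonglongrightarrow> 0" unfolding dist_norm norm_minus_commute[of _ u] .
      then have "v \<longlonglongrightarrow> u" by (simp only: tendsto_dist_iff[symmetric])
      then have lim: "(\<lambda>n. (v n, z)) \<longlonglongrightarrow> x" unfolding x by (rule tendsto_Pair[OF _ tendsto_const])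
      have "P' (v n, z) = P (v n, z)" for n
      proof (rule C_on_eqI)
        show "P' (v n, z) \<in> C_on a b" "P (v n, z) \<in> C_on a b"
          by (rule specD(2)[OF \<open>spec P'\<close> v(1)], rule specD(2)[OF spec v(1)])
        show "a \<le> b" using assms(1) by simp
        fix t assume t: "t \<in> {a..b}"
        obtain \<Delta> where \<Delta>: "is_partition a b \<Delta>" "monotone_pieces \<Delta> (v n)" using v(2) by blast
        show "P' (v n, z) t = P (v n, z) t"
          by (rule play_recursion_unique[OF \<Delta>(1) assms(1) specD(4)[OF \<open>spec P'\<close> v(1) \<Delta>] specD(4)[OF spec v(1) \<Delta>] t])
      qed
      note eq = this
      have lim_R: "(\<lambda>n. R (v n, z)) \<longlonglongrightarrow> R x" if "spec R" for R
      proof (rule continuous_on_tendsto_compose[OF specD(3)[OF that] lim True])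
        show "\<forall>\<^sub>F n in sequentially. (v n, z) \<in> ?D" using v(1) by simp
      qed
      have "(\<lambda>n. P (v n, z)) \<longlonglongrightarrow> P' x" using lim_R[OF \<open>spec P'\<close>] unfolding eq .
      then show ?thesis by (rule LIMSEQ_unique[OF _ lim_R[OF spec]])
    qed
  qed
  have "play r a b = (THE P. spec P)" unfolding play_def spec_def ..
  also have "\<dots> = P" using spec unique by (rule the_equality)
  finally have "play r a b = P" .
  then show "play r a b (u, z0) \<in> C_on a b"
    and "t \<in> {a..b} \<Longrightarrow> play r a b (u, z0) t = play_val r a u (u a - clip r z0) t"
    using Q assms(3) by (auto simp: P_def)
qed

section \<open>Oscillation on an interval\<close>

lemma osc_attained:
  fixes u :: cfun
  assumes "c \<le> d"
  shows "\<exists>s\<in>{c..d}. \<exists>t\<in>{c..d}. osc c d u = \<bar>u t - u s\<bar> \<and>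
    (\<forall>s'\<in>{c..d}. \<forall>t'\<in>{c..d}. \<bar>u t' - u s'\<bar> \<le> osc c d u)"
proof -
  let ?f = "\<lambda>(s, t). \<bar>u t - u s\<bar>"
  have "continuous_on ({c..d} \<times> {c..d}) ?f"
    unfolding case_prod_beta
    by (intro continuous_intros continuous_on_compose2[OF continuous_on_apply_bcontfun[of UNIV u]]) auto
  then obtain x where x: "x \<in> {c..d} \<times> {c..d}" "\<And>y. y \<in> {c..d} \<times> {c..d} \<Longrightarrow> ?f y \<le> ?f x"
    using continuous_attains_sup[of "{c..d} \<times> {c..d}" ?f] assms by (auto simp: compact_Times)
  have eq: "osc c d u = ?f x" unfolding osc_def by (rule cSup_eq_maximum) (use x in auto)
  show ?thesis
    unfolding eq by (rule bexI[of _ "fst x"], rule bexI[of _ "snd x"]) (use x in \<open>auto simp: case_prod_beta\<close>)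
qed

lemma osc_less_iff:
  fixes u :: cfun
  assumes "c \<le> d"
  shows "osc c d u < x \<longleftrightarrow> (\<forall>s\<in>{c..d}. \<forall>t\<in>{c..d}. \<bar>u t - u s\<bar> < x)"
  using osc_attained[OF assms, of u] by fastforce

lemma osc_le_iff:
  fixes u :: cfun
  assumes "c \<le> d"
  shows "osc c d u \<le> x \<longleftrightarrow> (\<forall>s\<in>{c..d}. \<forall>t\<in>{c..d}. \<bar>u t - u s\<bar> \<le> x)"
  using osc_attained[OF assms, of u] by fastforce

lemma osc_perturb:
  fixes u v :: cfun
  assumes "c \<le> d"
  shows "osc c d v \<le> osc c d u + 2 * norm (v - u)"
  unfolding osc_le_iff[OF assms]
proof (intro ballI)
  fix s t assume "s \<in> {c..d}" "t \<in> {c..d}"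
  then have "\<bar>u t - u s\<bar> \<le> osc c d u" using osc_le_iff[OF assms, of u "osc c d u"] by auto
  then show "\<bar>v t - v s\<bar> \<le> osc c d u + 2 * norm (v - u)"
    using abs_apply_le_norm[of "v - u" s] abs_apply_le_norm[of "v - u" t] by simp
qed

section \<open>Positive functionals supported on the argmax\<close>

lemma const_bcontfun_eq_scaleR: "const_bcontfun k = k *\<^sub>R (const_bcontfun 1 :: cfun)"
  by (rule bcontfun_eqI) simp

lemma norm_const_bcontfun_one: "norm (const_bcontfun 1 :: cfun) \<le> 1"
  by (rule norm_bound) simp

lemma \<Phi>_int_mono:
  assumes "\<nu> \<in> \<Phi>_int c d u t" "h \<in> C_on c d" "k \<in> C_on c d" "\<And>s. s \<in> {c..d} \<Longrightarrow> h s \<le> k s"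
  shows "\<nu> h \<le> \<nu> k"
proof -
  have "0 \<le> \<nu> (k - h)" using assms C_on_diff[OF assms(3,2)] unfolding \<Phi>_int_def by auto
  then show ?thesis by (simp add: blinfun.diff_right)
qed

text \<open>A positive functional satisfies \<nu> h \<le> norm h * \<nu> 1, so its norm is its value
  at the constant 1. Norm one therefore means total mass one.\<close>

lemma \<Phi>_int_one:
  assumes "\<nu> \<in> \<Phi>_int c d u t" "c \<le> d"
  shows "\<nu> (const_bcontfun 1) = 1"
proof -
  let ?one = "const_bcontfun 1 :: cfun"
  have n1: "norm \<nu> = 1" and rs: "\<And>h. \<nu> h = \<nu> (restr c d h)"
    using assms(1) unfolding \<Phi>_int_def dual_C_def by auto
  have "\<nu> ?one \<le> norm \<nu> * norm ?one" using norm_blinfun[of \<nu> ?one] by simp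
  then have le: "\<nu> ?one \<le> 1" using n1 norm_const_bcontfun_one by simp
  have *: "\<nu> h \<le> norm h * \<nu> ?one" for h
  proof -
    have "\<nu> (restr c d h) \<le> \<nu> (norm h *\<^sub>R ?one)"
      by (rule \<Phi>_int_mono[OF assms(1) restr_in_C_on[OF assms(2)] C_on_scaleR[OF C_on_const]])
        (use abs_apply_le_norm[of h] in \<open>force simp: abs_le_iff\<close>)
    then show ?thesis using rs by (simp add: blinfun.scaleR_right)
  qed
  have "norm \<nu> \<le> \<nu> ?one"
  proof (rule norm_blinfun_bound)
    have "\<nu> 0 \<le> \<nu> ?one" by (rule \<Phi>_int_mono[OF assms(1) _ C_on_const]) (auto intro: C_onI)
    then show "0 \<le> \<nu> ?one" by simp
    show "norm (\<nu> h) \<le> \<nu> ?one * norm h" for h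
      using *[of h] *[of "- h"] by (auto simp: blinfun.minus_right mult.commute abs_le_iff)
  qed
  then show ?thesis using le n1 by simp
qed

lemma \<Phi>_int_const:
  assumes "\<nu> \<in> \<Phi>_int c d u t" "c \<le> d"
  shows "\<nu> (const_bcontfun k) = k"
  using \<Phi>_int_one[OF assms] by (subst const_bcontfun_eq_scaleR) (simp add: blinfun.scaleR_right)

text \<open>
  A compact set disjoint from the support is covered by finitely many tents that the functional
  annihilates, so by positivity it annihilates every function supported in that set.
\<close>

lemma \<Phi>_int_le:
  assumes \<nu>: "\<nu> \<in> \<Phi>_int c d u t" and "c \<le> d" and h: "h \<in> C_on c d"
    and bound: "\<And>s. s \<in> M_int c d u t \<Longrightarrow> h s \<le> m"
  shows "\<nu> h \<le> m"
proof (rule field_le_epsilon)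
  fix e :: real assume e: "0 < e"
  define K where "K = {s \<in> {c..d}. m + e \<le> h s}"
  have "K = {c..d} \<inter> {s. m + e \<le> h s}" unfolding K_def by auto
  moreover have "closed {s. m + e \<le> h s}" by (rule closed_Collect_le) auto
  ultimately have K: "compact K" by (simp add: compact_Int_closed)
  have "\<exists>r>0. \<forall>k. k \<in> C_on c d \<and> (\<forall>x\<in>{c..d} - ball s r. k x = 0) \<longrightarrow> \<nu> k = 0" if "s \<in> K" for s
  proof -
    have "s \<notin> M_int c d u t" using bound[of s] that e unfolding K_def by auto
    then have "s \<notin> supp c d \<nu>" using \<nu> unfolding \<Phi>_int_def by auto
    then have "\<not> (\<forall>U. open U \<and> s \<in> U \<longrightarrow>
        (\<exists>k :: cfun. k \<in> C_on c d \<and> (\<forall>x\<in>{c..d} - U. k x = 0) \<and> \<nu> k \<noteq> 0))"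
      using that unfolding supp_def K_def by simp
    then obtain U where U: "open U" "s \<in> U"
      "\<not> (\<exists>k :: cfun. k \<in> C_on c d \<and> (\<forall>x\<in>{c..d} - U. k x = 0) \<and> \<nu> k \<noteq> 0)" by auto
    obtain r where r: "r > 0" "ball s r \<subseteq> U" using U(1,2) by (meson open_contains_ball)
    show ?thesis
    proof (intro exI[of _ r] conjI allI impI r(1))
      fix k assume k: "k \<in> C_on c d \<and> (\<forall>x\<in>{c..d} - ball s r. k x = 0)"
      then have "\<forall>x\<in>{c..d} - U. k x = 0" using r(2) by auto
      then show "\<nu> k = 0" using U(3) k by auto
    qed
  qed
  then have "\<forall>s\<in>K. \<exists>r. r > 0 \<and> (\<forall>k. k \<in> C_on c d \<and> (\<forall>x\<in>{c..d} - ball s r. k x = 0) \<longrightarrow> \<nu> k = 0)" by simp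
  from bchoice[OF this] obtain r where
    r: "\<forall>s\<in>K. r s > 0 \<and> (\<forall>k. k \<in> C_on c d \<and> (\<forall>x\<in>{c..d} - ball s (r s). k x = 0) \<longrightarrow> \<nu> k = 0)" ..
  obtain T where T: "T \<subseteq> K" "finite T" "K \<subseteq> (\<Union>s\<in>T. ball s (r s))"
  proof (rule compactE_image[OF K, of K "\<lambda>s. ball s (r s)"])
    show "K \<subseteq> (\<Union>s\<in>K. ball s (r s))" using r by auto
  qed auto
  have "\<exists>\<phi>. \<phi> \<in> C_on c d \<and> (\<forall>x\<in>{c..d}. \<phi> x = max 0 (r s - \<bar>x - s\<bar>))" for s
  proof -
    have "continuous_on {c..d} (\<lambda>x. max 0 (r s - \<bar>x - s\<bar>))" by (intro continuous_intros)
    from C_on_extend[OF assms(2) this] show ?thesis .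
  qed
  then have "\<forall>s. \<exists>\<phi>. \<phi> \<in> C_on c d \<and> (\<forall>x\<in>{c..d}. \<phi> x = max 0 (r s - \<bar>x - s\<bar>))" by blast
  from choice[OF this] obtain \<phi> where
    "\<forall>s. \<phi> s \<in> C_on c d \<and> (\<forall>x\<in>{c..d}. \<phi> s x = max 0 (r s - \<bar>x - s\<bar>))" ..
  then have \<phi>: "\<And>s. \<phi> s \<in> C_on c d" "\<And>s x. x \<in> {c..d} \<Longrightarrow> \<phi> s x = max 0 (r s - \<bar>x - s\<bar>)"
    by auto
  have \<nu>\<phi>: "\<nu> (\<phi> s) = 0" if "s \<in> K" for s
  proof -
    have "\<forall>x\<in>{c..d} - ball s (r s). \<phi> s x = 0" by (auto simp: \<phi>(2) dist_real_def)
    then show ?thesis using r that \<phi>(1) by auto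
  qed
  define \<Psi> where "\<Psi> = (\<Sum>s\<in>T. \<phi> s)"
  have \<Psi>_app: "\<Psi> x = (\<Sum>s\<in>T. \<phi> s x)" for x
    unfolding \<Psi>_def using T(2) by (induction T rule: finite_induct) auto
  have \<Psi>_C: "\<Psi> \<in> C_on c d"
    by (rule C_onI) (auto simp: \<Psi>_app C_on_clamp[OF \<phi>(1)])
  have \<Psi>_nonneg: "0 \<le> \<Psi> x" if "x \<in> {c..d}" for x
    unfolding \<Psi>_app using that by (auto intro!: sum_nonneg simp: \<phi>(2))
  have \<Psi>_pos: "0 < \<Psi> x" if xK: "x \<in> K" for x
  proof -
    obtain s where s: "s \<in> T" "x \<in> ball s (r s)" using T(3) xK by blast
    have "x \<in> {c..d}" using that unfolding K_def by auto
    then have "0 < \<phi> s x" using s(2) by (auto simp: \<phi>(2) dist_real_def)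
    also have "\<dots> \<le> \<Psi> x" unfolding \<Psi>_app
      by (rule member_le_sum[OF s(1) _ T(2)]) (use \<open>x \<in> {c..d}\<close> in \<open>auto simp: \<phi>(2)\<close>)
    finally show ?thesis .
  qed
  have \<nu>\<Psi>: "\<nu> \<Psi> = 0" unfolding \<Psi>_def blinfun.sum_right using \<nu>\<phi> T(1) by (intro sum.neutral) auto
  obtain \<kappa> where \<kappa>: "\<kappa> > 0" "\<And>x. x \<in> K \<Longrightarrow> \<kappa> \<le> \<Psi> x"
  proof (cases "K = {}")
    case False
    then obtain x0 where "x0 \<in> K" "\<And>x. x \<in> K \<Longrightarrow> \<Psi> x0 \<le> \<Psi> x"
      using continuous_attains_inf[OF K, of \<Psi>] by auto
    then show thesis using that[of "\<Psi> x0"] \<Psi>_pos by auto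
  qed (use that[of 1] in auto)
  \<comment> \<open>On K the function A * \<Psi> is at least A * \<kappa> = norm h + |m|, which
    dominates h - m; off K the constant m + e already dominates h.\<close>
  define A where "A = (norm h + \<bar>m\<bar>) / \<kappa>"
  have "\<nu> h \<le> \<nu> (A *\<^sub>R \<Psi> + const_bcontfun (m + e))"
  proof (rule \<Phi>_int_mono[OF \<nu> h C_on_add[OF C_on_scaleR[OF \<Psi>_C] C_on_const]])
    fix x assume x: "x \<in> {c..d}"
    show "h x \<le> (A *\<^sub>R \<Psi> + const_bcontfun (m + e)) x"
    proof (cases "x \<in> K")
      case True
      have "h x - m \<le> norm h + \<bar>m\<bar>" using abs_apply_le_norm[of h x] by linarith
      also have "\<dots> = A * \<kappa>" unfolding A_def using \<kappa>(1) by simp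
      also have "\<dots> \<le> A * \<Psi> x" by (rule mult_left_mono[OF \<kappa>(2)[OF True]]) (use \<kappa>(1) in \<open>simp add: A_def\<close>)
      finally show ?thesis using e by simp
    next
      case False
      then have "h x < m + e" using x unfolding K_def by auto
      moreover have "0 \<le> A * \<Psi> x" using \<kappa>(1) \<Psi>_nonneg[OF x] by (simp add: A_def)
      ultimately show ?thesis by simp
    qed
  qed
  then show "\<nu> h \<le> m + e"
    using \<nu>\<Psi> \<Phi>_int_const[OF \<nu> assms(2), of "m + e"] by (simp add: blinfun.add_right blinfun.scaleR_right)
qed

lemma \<Phi>_int_ge:
  assumes "\<nu> \<in> \<Phi>_int c d u t" "c \<le> d" "h \<in> C_on c d"
    and "\<And>s. s \<in> M_int c d u t \<Longrightarrow> m \<le> h s"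
  shows "m \<le> \<nu> h"
proof -
  have "\<nu> (- h) \<le> - m" by (rule \<Phi>_int_le[OF assms(1,2) C_on_uminus[OF assms(3)]]) (use assms(4) in auto)
  then show ?thesis by (simp add: blinfun.minus_right)
qed

lemma \<Phi>_int_abs_le:
  assumes "\<nu> \<in> \<Phi>_int c d u t" "c \<le> d" "h \<in> C_on c d" "\<And>s. s \<in> {c..t} \<Longrightarrow> \<bar>h s\<bar> \<le> B"
  shows "\<bar>\<nu> h\<bar> \<le> B"
proof -
  have "\<nu> h \<le> B" by (rule \<Phi>_int_le[OF assms(1-3)]) (use assms(4) in \<open>force simp: M_int_def abs_le_iff\<close>)
  moreover have "- B \<le> \<nu> h" by (rule \<Phi>_int_ge[OF assms(1-3)]) (use assms(4) in \<open>force simp: M_int_def abs_le_iff\<close>)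
  ultimately show ?thesis by simp
qed

section \<open>Newton differentiability of the running maximum\<close>

text \<open>Away from the e-neighbourhood of the argmax, compactness keeps u more than 2 * \<delta>
  below its maximum. A perturbation smaller than \<delta> cannot create a maximiser there.\<close>

lemma M_int_upper_semicontinuous:
  fixes u :: cfun
  assumes t: "t \<in> {c..d}" and e: "0 < e"
  shows "\<exists>\<delta>>0. \<forall>u' :: cfun. norm (u' - u) < \<delta> \<longrightarrow>
    (\<forall>s\<in>M_int c d u' t. \<exists>\<tau>\<in>M_int c d u t. \<bar>s - \<tau>\<bar> < e)"
proof -
  define K where "K = {c..t} \<inter> (\<Inter>\<tau>\<in>M_int c d u t. {s. e \<le> \<bar>s - \<tau>\<bar>})"
  have "compact K" unfolding K_def
    by (intro compact_Int_closed closed_INT ballI closed_Collect_le continuous_intros) auto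
  obtain \<tau>0 where \<tau>0: "\<tau>0 \<in> {c..t}" "u \<tau>0 = F_int c d u t"
    using F_int_attained[of c d u t] t by auto
  have "\<exists>\<delta>>0. \<forall>s\<in>K. u s + 2 * \<delta> < F_int c d u t"
  proof (cases "K = {}")
    case False
    then obtain k where k: "k \<in> K" "\<And>s. s \<in> K \<Longrightarrow> u s \<le> u k"
      using continuous_attains_sup[OF \<open>compact K\<close>, of u] by auto
    have "k \<in> {c..t}" using k(1) unfolding K_def by auto
    then have "u k \<le> F_int c d u t" using F_int_ge[of c d u t k] t by auto
    moreover have "u k \<noteq> F_int c d u t"
    proof
      assume "u k = F_int c d u t"
      then have "k \<in> M_int c d u t" using \<open>k \<in> {c..t}\<close> t unfolding M_int_def by auto
      then have "e \<le> \<bar>k - k\<bar>" using k(1) unfolding K_def by blast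
      then show False using e by simp
    qed
    \<comment> \<open>A third of the gap is taken so that 2 * \<delta> stays strictly below
      it.\<close>
    ultimately show ?thesis using k(2)
      by (intro exI[of _ "(F_int c d u t - u k) / 3"]) (force simp: field_simps)
  qed (auto intro: exI[of _ 1])
  then obtain \<delta> where \<delta>: "\<delta> > 0" "\<And>s. s \<in> K \<Longrightarrow> u s + 2 * \<delta> < F_int c d u t" by blast
  show ?thesis
  proof (intro exI[of _ \<delta>] conjI allI impI ballI \<delta>(1), rule ccontr)
    fix u' :: cfun and s
    assume u': "norm (u' - u) < \<delta>" and s: "s \<in> M_int c d u' t"
      and no: "\<not> (\<exists>\<tau>\<in>M_int c d u t. \<bar>s - \<tau>\<bar> < e)"
    have near: "\<bar>u' x - u x\<bar> < \<delta>" for x using abs_apply_le_norm[of "u' - u" x] u' by simp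
    have "s \<in> K" using no s unfolding K_def M_int_def by force
    moreover have "u' \<tau>0 \<le> u' s" using s F_int_ge[of c d u' t \<tau>0] t \<tau>0(1) unfolding M_int_def by auto
    ultimately show False using \<delta>(2)[of s] near[of s] near[of \<tau>0] \<tau>0(2) by linarith
  qed
qed

text \<open>Let D be the change of the maximum. A maximiser s of u' satisfies D \<le> (u' - u) s,
  since u s is at most the maximum of u; a maximiser \<tau> of u satisfies (u' - u) \<tau> \<le> D.
  Passing from s to a nearby \<tau> costs B, and averaging over \<nu>, which is carried by the
  maximisers of u', preserves both bounds.\<close>

lemma F_int_newton:
  fixes u u' :: cfun
  assumes "t \<in> {c..d}" "\<nu> \<in> \<Phi>_int c d u' t" "u' - u \<in> C_on c d"
    and near: "\<And>s. s \<in> M_int c d u' t \<Longrightarrow> \<exists>\<tau>\<in>M_int c d u t. \<bar>(u' - u) s - (u' - u) \<tau>\<bar> \<le> B"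
  shows "\<bar>F_int c d u' t - F_int c d u t - \<nu> (u' - u)\<bar> \<le> B"
proof -
  let ?D = "F_int c d u' t - F_int c d u t"
  have "c \<le> d" using assms(1) by auto
  have up: "u s \<le> F_int c d u t" "u' s \<le> F_int c d u' t" if "s \<in> {c..t}" for s
    using that F_int_ge[of c d u t s] F_int_ge[of c d u' t s] assms(1) by auto
  have "\<nu> (u' - u) \<le> ?D + B"
  proof (rule \<Phi>_int_le[OF assms(2) \<open>c \<le> d\<close> assms(3)])
    fix s assume "s \<in> M_int c d u' t"
    then obtain \<tau> where "\<tau> \<in> M_int c d u t" "\<bar>(u' - u) s - (u' - u) \<tau>\<bar> \<le> B" using near by blast
    then show "(u' - u) s \<le> ?D + B" using up(2)[of \<tau>] unfolding M_int_def by auto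
  qed
  moreover have "?D \<le> \<nu> (u' - u)"
  proof (rule \<Phi>_int_ge[OF assms(2) \<open>c \<le> d\<close> assms(3)])
    fix s assume "s \<in> M_int c d u' t"
    then show "?D \<le> (u' - u) s" using up(1)[of s] unfolding M_int_def by auto
  qed
  moreover have "\<exists>s. s \<in> M_int c d u' t"
    using F_int_attained[of c d u' t] assms(1) unfolding M_int_def by fastforce
  then obtain s where "s \<in> M_int c d u' t" ..
  then have "0 \<le> B" using near by fastforce
  ultimately show ?thesis by linarith
qed

text \<open>The linearisation is exact because the positive part is piecewise linear. At the kink
  the free value l 0 is multiplied by the increment 0; away from it a small perturbation does not
  reach the kink.\<close>

lemma positive_part_newton:
  "\<exists>\<delta>>0. \<forall>x'. \<bar>x' - x\<bar> < \<delta> \<longrightarrow> (\<forall>l\<in>S_H. max 0 x' - max 0 x = l x' * (x' - x))" for x :: real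
proof (cases x "0 :: real" rule: linorder_cases)
  case less
  then show ?thesis by (intro exI[of _ "- x"]) (auto simp: S_H_def)
next
  case equal
  show ?thesis
  proof (intro exI[of _ 1] conjI allI impI ballI)
    fix x' l assume "l \<in> S_H"
    then show "max 0 x' - max 0 x = l x' * (x' - x)"
      using equal by (cases x' "0 :: real" rule: linorder_cases) (auto simp: S_H_def)
  qed simp
next
  case greater
  then show ?thesis by (intro exI[of _ x]) (auto simp: S_H_def)
qed

lemma S_H_range: "l \<in> S_H \<Longrightarrow> 0 \<le> l x \<and> l x \<le> 1"
  unfolding S_H_def by auto

lemma convex_abs_le:
  fixes l :: real
  assumes "0 \<le> l" "l \<le> 1" "\<bar>x\<bar> \<le> A" "\<bar>y\<bar> \<le> B"
  shows "\<bar>(1 - l) * x + l * y\<bar> \<le> (1 - l) * A + l * B"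
proof -
  have "\<bar>(1 - l) * x + l * y\<bar> \<le> (1 - l) * \<bar>x\<bar> + l * \<bar>y\<bar>"
    using abs_triangle_ineq[of "(1 - l) * x" "l * y"] assms(1,2) by (simp add: abs_mult)
  also have "\<dots> \<le> (1 - l) * A + l * B"
    using assms by (intro add_mono mult_left_mono) auto
  finally show ?thesis .
qed

text \<open>The bound B is a free parameter and not computed from h: for h in X it becomes a small
  multiple of the norm of h, once e is taken from equicontinuity.\<close>

abbreviation modulus_le :: "real \<Rightarrow> real \<Rightarrow> real \<Rightarrow> cfun \<Rightarrow> real \<Rightarrow> bool" where
  "modulus_le c d e h B \<equiv> \<forall>s\<in>{c..d}. \<forall>s'\<in>{c..d}. \<bar>s - s'\<bar> < e \<longrightarrow> \<bar>h s - h s'\<bar> \<le> B"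

text \<open>Write max p (F - r) as p + max 0 (F - p - r) and linearise the positive part exactly.
  The remainder is then the combination, with weights 1 - l and l, of the incoming error p' - p -
  \<eta> and the error of the running maximum. Here \<eta> is the linearised change of p, still
  unspecified.\<close>

lemma branch_newton:
  fixes u :: cfun
  assumes t: "t \<in> {c..d}" and e: "0 < e"
  shows "\<exists>\<delta>>0. \<forall>(u' :: cfun) p' \<eta> B l \<nu>. u' - u \<in> C_on c d \<longrightarrow> norm (u' - u) < \<delta> \<longrightarrow> \<bar>p' - p\<bar> < \<delta> \<longrightarrow>
     l \<in> S_H \<longrightarrow> \<nu> \<in> \<Phi>_int c d u' t \<longrightarrow>
     modulus_le c d e (u' - u) B \<longrightarrow>
     \<bar>max p' (F_int c d u' t - r) - max p (F_int c d u t - r)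
       - (\<eta> + l (F_int c d u' t - p' - r) * (\<nu> (u' - u) - \<eta>))\<bar> \<le> \<bar>p' - p - \<eta>\<bar> + B"
proof -
  let ?x = "F_int c d u t - p - r"
  obtain \<delta>1 where \<delta>1: "\<delta>1 > 0" "\<And>u' :: cfun. norm (u' - u) < \<delta>1 \<Longrightarrow>
    (\<forall>s\<in>M_int c d u' t. \<exists>\<tau>\<in>M_int c d u t. \<bar>s - \<tau>\<bar> < e)"
    using M_int_upper_semicontinuous[OF t e] by blast
  obtain \<delta>2 where \<delta>2: "\<delta>2 > 0" "\<And>x' l. \<bar>x' - ?x\<bar> < \<delta>2 \<Longrightarrow> l \<in> S_H \<Longrightarrow> max 0 x' - max 0 ?x = l x' * (x' - ?x)"
    using positive_part_newton[of ?x] by blast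
  show ?thesis
  \<comment> \<open>The argument of the positive part moves with u and with p; each may use half of
    \<delta>2.\<close>
  proof (intro exI[of _ "min \<delta>1 (\<delta>2 / 2)"] conjI allI impI)
    show "0 < min \<delta>1 (\<delta>2 / 2)" using \<delta>1(1) \<delta>2(1) by simp
    fix u' :: cfun and p' \<eta> B l \<nu>
    assume C: "u' - u \<in> C_on c d" and n: "norm (u' - u) < min \<delta>1 (\<delta>2 / 2)" and p: "\<bar>p' - p\<bar> < min \<delta>1 (\<delta>2 / 2)"
      and l: "l \<in> S_H" and \<nu>: "\<nu> \<in> \<Phi>_int c d u' t"
      and B: "modulus_le c d e (u' - u) B"
    let ?x' = "F_int c d u' t - p' - r"
    let ?D = "F_int c d u' t - F_int c d u t"
    have D: "\<bar>?D - \<nu> (u' - u)\<bar> \<le> B"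
    proof (rule F_int_newton[OF t \<nu> C])
      fix s assume s: "s \<in> M_int c d u' t"
      then obtain \<tau> where \<tau>: "\<tau> \<in> M_int c d u t" "\<bar>s - \<tau>\<bar> < e" using \<delta>1(2)[of u'] n by auto
      have "s \<in> {c..d}" "\<tau> \<in> {c..d}" using s \<tau>(1) unfolding M_int_def by auto
      then have "\<bar>(u' - u) s - (u' - u) \<tau>\<bar> \<le> B" using B \<tau>(2) by blast
      then show "\<exists>\<tau>\<in>M_int c d u t. \<bar>(u' - u) s - (u' - u) \<tau>\<bar> \<le> B" using \<tau>(1) by blast
    qed
    have "\<bar>?D\<bar> \<le> norm (u' - u)"
      by (rule F_int_Lipschitz) (use t abs_apply_le_norm[of "u' - u"] in auto)
    then have "\<bar>?x' - ?x\<bar> < \<delta>2" using n p by linarith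
    from \<delta>2(2)[OF this l] have eq: "max 0 ?x' - max 0 ?x = l ?x' * (?x' - ?x)" .
    have "max p' (F_int c d u' t - r) - max p (F_int c d u t - r)
       - (\<eta> + l ?x' * (\<nu> (u' - u) - \<eta>)) = (p' - p - \<eta>) + (max 0 ?x' - max 0 ?x) - l ?x' * (\<nu> (u' - u) - \<eta>)"
      by (simp add: max_def)
    also have "\<dots> = (1 - l ?x') * (p' - p - \<eta>) + l ?x' * (?D - \<nu> (u' - u))"
      unfolding eq by (simp add: algebra_simps)
    finally have "\<bar>max p' (F_int c d u' t - r) - max p (F_int c d u t - r)
       - (\<eta> + l ?x' * (\<nu> (u' - u) - \<eta>))\<bar> = \<bar>(1 - l ?x') * (p' - p - \<eta>) + l ?x' * (?D - \<nu> (u' - u))\<bar>" by simp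
    also have "\<dots> \<le> (1 - l ?x') * \<bar>p' - p - \<eta>\<bar> + l ?x' * B"
      by (rule convex_abs_le) (use D S_H_range[OF l] in auto)
    also have "\<dots> \<le> \<bar>p' - p - \<eta>\<bar> + B"
    proof -
      have "l ?x' * B \<le> 1 * B" "(1 - l ?x') * \<bar>p' - p - \<eta>\<bar> \<le> 1 * \<bar>p' - p - \<eta>\<bar>"
        using S_H_range[OF l, of ?x'] D by (intro mult_right_mono; force)+
      then show ?thesis by simp
    qed
    finally show "\<bar>max p' (F_int c d u' t - r) - max p (F_int c d u t - r)
       - (\<eta> + l ?x' * (\<nu> (u' - u) - \<eta>))\<bar> \<le> \<bar>p' - p - \<eta>\<bar> + B" .
  qed
qed

section \<open>The play on a short interval\<close>

lemma Z_int_iff: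
  fixes u :: cfun
  assumes "c \<le> d"
  shows "(u, p) \<in> Z_int r c d \<longleftrightarrow> u \<in> C_on c d \<and> (\<forall>s\<in>{c..d}. \<forall>t\<in>{c..d}. \<bar>u t - u s\<bar> < r)"
  unfolding Z_int_def using osc_less_iff[OF assms] by auto

lemma F_int_shift:
  fixes u :: cfun
  assumes "t \<in> {c..d}"
  shows "F_int c d (\<lambda>s. u s - r) t = F_int c d u t - r"
    and "F_int c d (\<lambda>s. - u s - r) t = F_int c d (- u) t - r"
    and "F_int c d (\<lambda>s. u s - p - r) t = F_int c d u t - p - r"
    and "F_int c d (\<lambda>s. - u s + p - r) t = F_int c d (- u) t + p - r"
proof -
  have c: "continuous_on {c..d} u" "continuous_on {c..d} (- u)" by (rule continuous_on_apply_bcontfun)+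
  show "F_int c d (\<lambda>s. u s - r) t = F_int c d u t - r"
    using F_int_add_const[OF c(1) assms, of "- r"] by simp
  show "F_int c d (\<lambda>s. - u s - r) t = F_int c d (- u) t - r"
    using F_int_add_const[OF c(2) assms, of "- r"] by simp
  show "F_int c d (\<lambda>s. u s - p - r) t = F_int c d u t - p - r"
    using F_int_add_const[OF c(1) assms, of "- p - r"] by (simp add: add_diff_eq)
  show "F_int c d (\<lambda>s. - u s + p - r) t = F_int c d (- u) t + p - r"
    using F_int_add_const[OF c(2) assms, of "p - r"] by (simp add: add_diff_eq)
qed

lemma F_int_attained_cfun:
  fixes u :: cfun
  assumes "t \<in> {c..d}"
  shows "\<exists>s\<in>{c..t}. u s = F_int c d u t"
  using F_int_attained[of c d u t] assms by auto

text \<open>Oscillation below r already keeps the running maximum minus r below u + r. Only p can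
  violate the condition, so \<open>Z_plus\<close> says that p lies below every upper barrier of the
  interval.\<close>

lemma Z_plus_iff:
  fixes u :: cfun
  assumes "c \<le> d"
  shows "(u, p) \<in> Z_plus r c d \<longleftrightarrow> (u, p) \<in> Z_int r c d \<and> (\<forall>t\<in>{c..d}. p < u t + r)"
proof -
  have "u t - w_plus r c d u p t > - r \<longleftrightarrow> p < u t + r" if Z: "(u, p) \<in> Z_int r c d" and t: "t \<in> {c..d}" for t
  proof -
    obtain s where s: "s \<in> {c..t}" "u s = F_int c d u t" using F_int_attained_cfun[OF t] by blast
    have "\<bar>u s - u t\<bar> < r" using Z s(1) t unfolding Z_int_iff[OF assms] by auto
    then show ?thesis unfolding w_plus_def F_int_shift[OF t] s(2)[symmetric] by auto
  qed
  then show ?thesis unfolding Z_plus_def by auto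
qed

lemma Z_minus_iff:
  fixes u :: cfun
  assumes "c \<le> d"
  shows "(u, p) \<in> Z_minus r c d \<longleftrightarrow> (u, p) \<in> Z_int r c d \<and> (\<forall>t\<in>{c..d}. u t - r < p)"
proof -
  have "u t - w_minus r c d u p t < r \<longleftrightarrow> u t - r < p" if Z: "(u, p) \<in> Z_int r c d" and t: "t \<in> {c..d}" for t
  proof -
    obtain s where s: "s \<in> {c..t}" "(- u) s = F_int c d (- u) t" using F_int_attained_cfun[OF t] by blast
    have "\<bar>u s - u t\<bar> < r" using Z s(1) t unfolding Z_int_iff[OF assms] by auto
    then show ?thesis unfolding w_minus_def F_int_shift[OF t] s(2)[symmetric] by auto
  qed
  then show ?thesis unfolding Z_minus_def by auto
qed

text \<open>Failing both conditions puts p at or above some u s + r and at or below some u t - r, so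
  u would vary by at least 2 * r.\<close>

lemma Z_int_cases:
  assumes "c \<le> d" "(u, p) \<in> Z_int r c d"
  shows "(u, p) \<in> Z_plus r c d \<or> (u, p) \<in> Z_minus r c d"
proof (rule ccontr)
  assume "\<not> ?thesis"
  then obtain s t where "s \<in> {c..d}" "t \<in> {c..d}" "u s + r \<le> p" "p \<le> u t - r"
    using assms unfolding Z_plus_iff[OF assms(1)] Z_minus_iff[OF assms(1)] by force
  moreover from this have "\<bar>u t - u s\<bar> < r" using assms(2) unfolding Z_int_iff[OF assms(1)] by auto
  ultimately show False by linarith
qed

text \<open>On the overlap p is not touched by any barrier. The last two conclusions concern the
  arguments of the step functions in \<open>S_int\<close>: being negative, they reduce both formulas
  there to \<eta>.\<close>

lemma w_plus_minus_agree:
  assumes "c \<le> d" "(u, p) \<in> Z_plus r c d" "(u, p) \<in> Z_minus r c d" "t \<in> {c..d}"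
  shows "w_plus r c d u p t = p" "w_minus r c d u p t = p"
    and "F_int c d u t - p - r < 0" "F_int c d (- u) t + p - r < 0"
proof -
  obtain s where s: "s \<in> {c..t}" "u s = F_int c d u t" using F_int_attained_cfun[OF assms(4)] by blast
  obtain s' where s': "s' \<in> {c..t}" "(- u) s' = F_int c d (- u) t" using F_int_attained_cfun[OF assms(4)] by blast
  have "p < u s' + r" "u s - r < p"
    using assms(2,3) s(1) s'(1) assms(4) unfolding Z_plus_iff[OF assms(1)] Z_minus_iff[OF assms(1)] by auto
  then show "w_plus r c d u p t = p" "w_minus r c d u p t = p"
    and "F_int c d u t - p - r < 0" "F_int c d (- u) t + p - r < 0"
    unfolding w_plus_def w_minus_def F_int_shift[OF assms(4)] s(2)[symmetric] s'(2)[symmetric] by auto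
qed

lemma P_int_plus: "(u, p) \<in> Z_plus r c d \<Longrightarrow> t \<in> {c..d} \<Longrightarrow> P_int r c d u p t = max p (F_int c d u t - r)"
  unfolding P_int_def w_plus_def by (simp add: F_int_shift)

lemma P_int_minus:
  assumes "c \<le> d" "(u, p) \<in> Z_minus r c d" "t \<in> {c..d}"
  shows "P_int r c d u p t = min p (r - F_int c d (- u) t)"
proof -
  have "P_int r c d u p t = w_minus r c d u p t"
    unfolding P_int_def using w_plus_minus_agree[OF assms(1) _ assms(2,3)] by auto
  then show ?thesis unfolding w_minus_def by (simp add: F_int_shift[OF assms(3)])
qed

text \<open>One formula for both branches, in the shape delivered by
  \<open>play_val_small_osc\<close>: in each branch the bound that its own formula omits is
  inactive.\<close>

lemma P_int_clip:
  fixes u :: cfun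
  assumes "c \<le> d" "(u, p) \<in> Z_int r c d" "t \<in> {c..d}"
  shows "P_int r c d u p t = max (F_int c d u t - r) (min p (r - F_int c d (- u) t))"
proof -
  obtain s where s: "s \<in> {c..t}" "u s = F_int c d u t" using F_int_attained_cfun[OF assms(3)] by blast
  obtain s' where s': "s' \<in> {c..t}" "(- u) s' = F_int c d (- u) t" using F_int_attained_cfun[OF assms(3)] by blast
  have m: "s \<in> {c..d}" "s' \<in> {c..d}" using s s' assms(3) by auto
  then have "\<bar>u s - u s'\<bar> < r" using assms(2) unfolding Z_int_iff[OF assms(1)] by auto
  moreover from Z_int_cases[OF assms(1,2)] show ?thesis
  proof
    assume *: "(u, p) \<in> Z_plus r c d"
    then have "p < u s' + r" using m unfolding Z_plus_iff[OF assms(1)] by auto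
    then show ?thesis unfolding P_int_plus[OF * assms(3)] s'(2)[symmetric] by auto
  next
    assume *: "(u, p) \<in> Z_minus r c d"
    then have "u s - r < p" using m unfolding Z_minus_iff[OF assms(1)] by auto
    then show ?thesis using \<open>\<bar>u s - u s'\<bar> < r\<close>
      unfolding P_int_minus[OF assms(1) * assms(3)] s'(2)[symmetric] s(2)[symmetric] by auto
  qed
qed

text \<open>The constant function \<eta> inside the functional may be pulled out as the number
  \<eta> because the functionals have total mass one. Measurability is dropped here; only pointwise
  membership in \<open>\<Phi>_int\<close> matters for the estimates.\<close>

lemma S_int_plus:
  assumes "\<nu> \<in> S_int r c d" "c \<le> d" "t \<in> {c..d}"
  shows "\<exists>l\<in>S_H. \<forall>u p. (u, p) \<in> Z_plus r c d \<longrightarrow> (\<exists>\<mu>\<in>\<Phi>_int c d u t. \<forall>h\<in>C_on c d. \<forall>\<eta>.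
      \<nu> (u, p, t) (h, \<eta>) = \<eta> + l (F_int c d u t - p - r) * (\<mu> h - \<eta>))"
proof -
  obtain lp \<mu>p where lp: "lp \<in> S_H" "\<mu>p \<in> S\<Phi>_int c d" and eq: "\<And>u p h \<eta>. (u, p) \<in> Z_plus r c d \<Longrightarrow> (u, p) \<in> Z_int r c d \<Longrightarrow>
     h \<in> C_on c d \<Longrightarrow> \<nu> (u, p, t) (h, \<eta>) = \<eta> + lp (F_int c d (\<lambda>s. u s - p - r) t) * \<mu>p (u, t) (h - const_bcontfun \<eta>)"
    using assms(1,3) unfolding S_int_def by blast
  show ?thesis
  proof (intro bexI[OF _ lp(1)] allI impI)
    fix u p assume Z: "(u, p) \<in> Z_plus r c d"
    then have Z': "(u, p) \<in> Z_int r c d" and u: "u \<in> C_on c d" unfolding Z_plus_def Z_int_def by auto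
    have \<mu>: "\<mu>p (u, t) \<in> \<Phi>_int c d u t" using lp(2) u assms(3) unfolding S\<Phi>_int_def by auto
    show "\<exists>\<mu>\<in>\<Phi>_int c d u t. \<forall>h\<in>C_on c d. \<forall>\<eta>. \<nu> (u, p, t) (h, \<eta>) = \<eta> + lp (F_int c d u t - p - r) * (\<mu> h - \<eta>)"
    proof (intro bexI[OF _ \<mu>] ballI allI)
      fix h \<eta> assume h: "h \<in> C_on c d"
      show "\<nu> (u, p, t) (h, \<eta>) = \<eta> + lp (F_int c d u t - p - r) * (\<mu>p (u, t) h - \<eta>)"
        unfolding eq[OF Z Z' h] F_int_shift[OF assms(3)] blinfun.diff_right \<Phi>_int_const[OF \<mu> assms(2)] ..
    qed
  qed
qed

lemma S_int_minus:
  assumes "\<nu> \<in> S_int r c d" "c \<le> d" "t \<in> {c..d}"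
  shows "\<exists>l\<in>S_H. \<forall>u p. (u, p) \<in> Z_minus r c d \<longrightarrow> (\<exists>\<mu>\<in>\<Phi>_int c d (- u) t. \<forall>h\<in>C_on c d. \<forall>\<eta>.
      \<nu> (u, p, t) (h, \<eta>) = \<eta> + l (F_int c d (- u) t + p - r) * (\<mu> h - \<eta>))"
proof -
  obtain lp \<mu>p where lp: "lp \<in> S_H" "\<mu>p \<in> S\<Phi>_int c d" and eq: "\<And>u p h \<eta>. (u, p) \<in> Z_minus r c d \<Longrightarrow> (u, p) \<in> Z_int r c d \<Longrightarrow>
     h \<in> C_on c d \<Longrightarrow> \<nu> (u, p, t) (h, \<eta>) = \<eta> + lp (F_int c d (\<lambda>s. - u s + p - r) t) * \<mu>p (- u, t) (h - const_bcontfun \<eta>)"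
    using assms(1,3) unfolding S_int_def by blast
  show ?thesis
  proof (intro bexI[OF _ lp(1)] allI impI)
    fix u p assume Z: "(u, p) \<in> Z_minus r c d"
    then have Z': "(u, p) \<in> Z_int r c d" and u: "u \<in> C_on c d" unfolding Z_minus_def Z_int_def by auto
    have \<mu>: "\<mu>p (- u, t) \<in> \<Phi>_int c d (- u) t" using lp(2) C_on_uminus[OF u] assms(3) unfolding S\<Phi>_int_def by auto
    show "\<exists>\<mu>\<in>\<Phi>_int c d (- u) t. \<forall>h\<in>C_on c d. \<forall>\<eta>. \<nu> (u, p, t) (h, \<eta>) = \<eta> + lp (F_int c d (- u) t + p - r) * (\<mu> h - \<eta>)"
    proof (intro bexI[OF _ \<mu>] ballI allI)
      fix h \<eta> assume h: "h \<in> C_on c d"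
      show "\<nu> (u, p, t) (h, \<eta>) = \<eta> + lp (F_int c d (- u) t + p - r) * (\<mu>p (- u, t) h - \<eta>)"
        unfolding eq[OF Z Z' h] F_int_shift[OF assms(3)] blinfun.diff_right \<Phi>_int_const[OF \<mu> assms(2)] ..
    qed
  qed
qed

text \<open>In either branch the value is a convex combination of \<eta> and an average of h over
  times not later than t.\<close>

lemma S_int_bound:
  assumes "\<nu> \<in> S_int r c d" "c \<le> d" "t \<in> {c..d}" "(u, p) \<in> Z_int r c d" "h \<in> C_on c d"
    and "\<And>s. s \<in> {c..t} \<Longrightarrow> \<bar>h s\<bar> \<le> B" "\<bar>\<eta>\<bar> \<le> B"
  shows "\<bar>\<nu> (u, p, t) (h, \<eta>)\<bar> \<le> B"
proof -
  have "\<exists>l \<mu> v. 0 \<le> l \<and> l \<le> 1 \<and> \<mu> \<in> \<Phi>_int c d v t \<and> \<nu> (u, p, t) (h, \<eta>) = \<eta> + l * (\<mu> h - \<eta>)"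
    using Z_int_cases[OF assms(2,4)]
  proof
    assume "(u, p) \<in> Z_plus r c d"
    then show ?thesis using S_int_plus[OF assms(1-3)] assms(5) S_H_range by fast
  next
    assume "(u, p) \<in> Z_minus r c d"
    then show ?thesis using S_int_minus[OF assms(1-3)] assms(5) S_H_range by fast
  qed
  then obtain l \<mu> v where l: "0 \<le> l" "l \<le> 1" and \<mu>: "\<mu> \<in> \<Phi>_int c d v t"
    and eq: "\<nu> (u, p, t) (h, \<eta>) = \<eta> + l * (\<mu> h - \<eta>)" by blast
  have "\<bar>\<mu> h\<bar> \<le> B" by (rule \<Phi>_int_abs_le[OF \<mu> assms(2,5,6)])
  from convex_abs_le[OF l assms(7) this] show ?thesis unfolding eq by (simp add: algebra_simps)
qed

text \<open>Both branch conditions are open, so near (u, p) a branch containing it may be used and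
  \<open>branch_newton\<close> applies. The minus branch is the plus branch for -u, -p and
  -\<eta>.\<close>

theorem P_int_newton:
  fixes u :: cfun
  assumes "c \<le> d" "(u, p) \<in> Z_int r c d" "t \<in> {c..d}" "0 < e"
  shows "\<exists>\<delta>>0. \<forall>u' p' \<eta> B \<nu>. u' \<in> C_on c d \<longrightarrow> norm (u' - u) < \<delta> \<longrightarrow> \<bar>p' - p\<bar> < \<delta> \<longrightarrow> \<nu> \<in> S_int r c d \<longrightarrow>
     modulus_le c d e (u' - u) B \<longrightarrow>
     \<bar>P_int r c d u' p' t - P_int r c d u p t - \<nu> (u', p', t) (u' - u, \<eta>)\<bar> \<le> \<bar>p' - p - \<eta>\<bar> + B"
proof -
  have u: "u \<in> C_on c d" and osc: "osc c d u < r" using assms(2) unfolding Z_int_def by auto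
  have Z': "(u', p') \<in> Z_int r c d" if "u' \<in> C_on c d" "norm (u' - u) < (r - osc c d u) / 2" for u' p'
    using that osc_perturb[OF assms(1), of u' u] unfolding Z_int_def by auto
  from Z_int_cases[OF assms(1,2)] show ?thesis
  proof
    assume Z: "(u, p) \<in> Z_plus r c d"
    have "\<exists>y>p. \<forall>s\<in>{c..d}. y < u s + r"
      by (rule less_on_interval_room) (use Z in \<open>auto simp: Z_plus_iff[OF assms(1)] intro!: continuous_intros\<close>)
    then obtain y where y: "p < y" "\<And>s. s \<in> {c..d} \<Longrightarrow> y < u s + r" by blast
    obtain \<delta> where \<delta>: "\<delta> > 0" "\<forall>(u' :: cfun) p' \<eta> B l \<nu>. u' - u \<in> C_on c d \<longrightarrow> norm (u' - u) < \<delta> \<longrightarrow> \<bar>p' - p\<bar> < \<delta> \<longrightarrow>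
     l \<in> S_H \<longrightarrow> \<nu> \<in> \<Phi>_int c d u' t \<longrightarrow>
     modulus_le c d e (u' - u) B \<longrightarrow>
     \<bar>max p' (F_int c d u' t - r) - max p (F_int c d u t - r)
       - (\<eta> + l (F_int c d u' t - p' - r) * (\<nu> (u' - u) - \<eta>))\<bar> \<le> \<bar>p' - p - \<eta>\<bar> + B"
      using branch_newton[OF assms(3,4)] by blast
    show ?thesis
    \<comment> \<open>By \<open>osc_perturb\<close>, half of r - osc keeps the oscillation below r.
      Half of y - p for u and for p each keeps p' below u' + r, since y separates p from all upper
      barriers.\<close>
    proof (intro exI[of _ "min \<delta> (min ((r - osc c d u) / 2) ((y - p) / 2))"] conjI allI impI)
      show "0 < min \<delta> (min ((r - osc c d u) / 2) ((y - p) / 2))" using \<delta>(1) osc y(1) by simp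
      fix u' p' \<eta> B \<nu>
      assume u': "u' \<in> C_on c d" and n: "norm (u' - u) < min \<delta> (min ((r - osc c d u) / 2) ((y - p) / 2))"
        and p': "\<bar>p' - p\<bar> < min \<delta> (min ((r - osc c d u) / 2) ((y - p) / 2))" and \<nu>: "\<nu> \<in> S_int r c d"
        and B: "modulus_le c d e (u' - u) B"
      have "p' < u' s + r" if "s \<in> {c..d}" for s
      proof -
        have "\<bar>u' s - u s\<bar> < (y - p) / 2" "\<bar>p' - p\<bar> < (y - p) / 2"
          using p' n abs_apply_le_norm[of "u' - u" s] by auto
        then show ?thesis using y(2)[OF that] unfolding abs_less_iff by (simp add: field_simps)
      qed
      then have Z1: "(u', p') \<in> Z_plus r c d"
        unfolding Z_plus_iff[OF assms(1)] using Z'[OF u', of p'] n by simp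
      have C: "u' - u \<in> C_on c d" by (rule C_on_diff[OF u' u])
      obtain l \<mu> where l: "l \<in> S_H" "\<mu> \<in> \<Phi>_int c d u' t" and eq:
        "\<nu> (u', p', t) (u' - u, \<eta>) = \<eta> + l (F_int c d u' t - p' - r) * (\<mu> (u' - u) - \<eta>)"
        using S_int_plus[OF \<nu> assms(1,3)] Z1 C by fast
      have "\<bar>max p' (F_int c d u' t - r) - max p (F_int c d u t - r)
       - (\<eta> + l (F_int c d u' t - p' - r) * (\<mu> (u' - u) - \<eta>))\<bar> \<le> \<bar>p' - p - \<eta>\<bar> + B"
        by (rule \<delta>(2)[rule_format, OF C _ _ l]) (use n p' B in auto)
      then show "\<bar>P_int r c d u' p' t - P_int r c d u p t - \<nu> (u', p', t) (u' - u, \<eta>)\<bar> \<le> \<bar>p' - p - \<eta>\<bar> + B"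
        unfolding P_int_plus[OF Z assms(3)] P_int_plus[OF Z1 assms(3)] eq .
    qed
  next
    assume Z: "(u, p) \<in> Z_minus r c d"
    have "\<exists>y>-p. \<forall>s\<in>{c..d}. y < - u s + r"
      by (rule less_on_interval_room) (use Z in \<open>force simp: Z_minus_iff[OF assms(1)] intro!: continuous_intros\<close>)+
    then obtain y where y: "- p < y" "\<And>s. s \<in> {c..d} \<Longrightarrow> y < - u s + r" by blast
    obtain \<delta> where \<delta>: "\<delta> > 0" "\<forall>(u' :: cfun) p' \<eta> B l \<nu>. u' - (- u) \<in> C_on c d \<longrightarrow> norm (u' - (- u)) < \<delta> \<longrightarrow> \<bar>p' - (- p)\<bar> < \<delta> \<longrightarrow>
     l \<in> S_H \<longrightarrow> \<nu> \<in> \<Phi>_int c d u' t \<longrightarrow>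
     modulus_le c d e (u' - (- u)) B \<longrightarrow>
     \<bar>max p' (F_int c d u' t - r) - max (- p) (F_int c d (- u) t - r)
       - (\<eta> + l (F_int c d u' t - p' - r) * (\<nu> (u' - (- u)) - \<eta>))\<bar> \<le> \<bar>p' - (- p) - \<eta>\<bar> + B"
      using branch_newton[OF assms(3,4), of "- u" "- p"] by blast
    show ?thesis
    proof (intro exI[of _ "min \<delta> (min ((r - osc c d u) / 2) ((y + p) / 2))"] conjI allI impI)
      show "0 < min \<delta> (min ((r - osc c d u) / 2) ((y + p) / 2))" using \<delta>(1) osc y(1) by simp
      fix u' p' \<eta> B \<nu>
      assume u': "u' \<in> C_on c d" and n: "norm (u' - u) < min \<delta> (min ((r - osc c d u) / 2) ((y + p) / 2))"
        and p': "\<bar>p' - p\<bar> < min \<delta> (min ((r - osc c d u) / 2) ((y + p) / 2))" and \<nu>: "\<nu> \<in> S_int r c d"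
        and B: "modulus_le c d e (u' - u) B"
      have "u' s - r < p'" if "s \<in> {c..d}" for s
      proof -
        have "\<bar>u' s - u s\<bar> < (y + p) / 2" "\<bar>p' - p\<bar> < (y + p) / 2"
          using p' n abs_apply_le_norm[of "u' - u" s] by auto
        then show ?thesis using y(2)[OF that] unfolding abs_less_iff by (simp add: field_simps)
      qed
      then have Z1: "(u', p') \<in> Z_minus r c d"
        unfolding Z_minus_iff[OF assms(1)] using Z'[OF u', of p'] n by simp
      have C: "u' - u \<in> C_on c d" by (rule C_on_diff[OF u' u])
      have neg: "- u' - (- u) = - (u' - u)" by simp
      obtain l \<mu> where l: "l \<in> S_H" "\<mu> \<in> \<Phi>_int c d (- u') t" and eq:
        "\<nu> (u', p', t) (u' - u, \<eta>) = \<eta> + l (F_int c d (- u') t + p' - r) * (\<mu> (u' - u) - \<eta>)"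
        using S_int_minus[OF \<nu> assms(1,3)] Z1 C by fast
      have "\<bar>max (- p') (F_int c d (- u') t - r) - max (- p) (F_int c d (- u) t - r)
       - (- \<eta> + l (F_int c d (- u') t - (- p') - r) * (\<mu> (- u' - (- u)) - (- \<eta>)))\<bar> \<le> \<bar>- p' - (- p) - (- \<eta>)\<bar> + B"
      proof (rule \<delta>(2)[rule_format, OF _ _ _ l])
        show "- u' - (- u) \<in> C_on c d" unfolding neg by (rule C_on_uminus[OF C])
        show "norm (- u' - (- u)) < \<delta>" unfolding neg norm_minus_cancel using n by simp
        show "\<bar>(- u' - - u) s - (- u' - - u) s'\<bar> \<le> B" if "s \<in> {c..d}" "s' \<in> {c..d}" "\<bar>s - s'\<bar> < e" for s s'
          using B[rule_format, OF that] by (simp add: abs_minus_commute algebra_simps)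
      qed (use p' in auto)
      moreover have "\<mu> (- u' - (- u)) = - \<mu> (u' - u)" unfolding neg by (rule blinfun.minus_right)
      moreover have "max (- x) (y - r) = - min x (r - y)" for x y by auto
      ultimately have "\<bar>- min p' (r - F_int c d (- u') t) - - min p (r - F_int c d (- u) t)
        - - (\<eta> + l (F_int c d (- u') t + p' - r) * (\<mu> (u' - u) - \<eta>))\<bar> \<le> \<bar>- (p' - p - \<eta>)\<bar> + B"
        by (simp add: algebra_simps)
      then show "\<bar>P_int r c d u' p' t - P_int r c d u p t - \<nu> (u', p', t) (u' - u, \<eta>)\<bar> \<le> \<bar>p' - p - \<eta>\<bar> + B"
        unfolding P_int_minus[OF assms(1) Z assms(3)] P_int_minus[OF assms(1) Z1 assms(3)] eq by linarith
    qed
  qed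
qed

section \<open>The play along a partition\<close>

lemma Z_part_iff:
  "(u :: cfun, z0) \<in> Z_part r a b \<Delta> \<longleftrightarrow> u \<in> C_on a b \<and> (\<forall>k<npt \<Delta>. osc (pt \<Delta> k) (pt \<Delta> (Suc k)) u < r)"
proof -
  have *: "(\<forall>k\<in>{1..n}. Q (k - 1) k) \<longleftrightarrow> (\<forall>k<n. Q k (Suc k))" for Q and n :: nat
  proof (intro iffI ballI allI impI)
    fix k assume "\<forall>k\<in>{1..n}. Q (k - 1) k" "k < n"
    then show "Q k (Suc k)" using bspec[of "{1..n}" "\<lambda>k. Q (k - 1) k" "Suc k"] by simp
  next
    fix k assume *: "\<forall>k<n. Q k (Suc k)" and k: "k \<in> {1..n}"
    have "k - 1 < n" using k by auto
    then have "Q (k - 1) (Suc (k - 1))" using * by blast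
    then show "Q (k - 1) k" using k by simp
  qed
  show ?thesis unfolding Z_part_def using *[of "npt \<Delta>" "\<lambda>i j. osc (pt \<Delta> i) (pt \<Delta> j) u < r"] by simp
qed

lemma restr_diff: "restr c d (u - v) = restr c d u - restr c d v"
  by (rule bcontfun_eqI) simp

lemma restr_add: "restr c d (u + v) = restr c d u + restr c d v"
  by (rule bcontfun_eqI) simp

lemma restr_scaleR: "restr c d (k *\<^sub>R u) = k *\<^sub>R restr c d u"
  by (rule bcontfun_eqI) simp

lemma norm_restr_le: "norm (restr c d u) \<le> norm u"
  by (rule norm_bound) (simp add: abs_apply_le_norm)

lemma restr_apply_id: "t \<in> {c..d} \<Longrightarrow> restr c d u t = apply_bcontfun u t"
  by (simp add: clamp_id)

lemma restr_Z_int: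
  fixes u :: cfun
  assumes "c \<le> d" "osc c d u < r"
  shows "(restr c d u, p) \<in> Z_int r c d"
  using assms(2) restr_in_C_on[OF assms(1)]
  unfolding Z_int_iff[OF assms(1)] osc_less_iff[OF assms(1)] by (simp add: clamp_id)

lemma F_int_cong: "t \<in> {c..d} \<Longrightarrow> (\<And>s. s \<in> {c..d} \<Longrightarrow> u s = v s) \<Longrightarrow> F_int c d u t = F_int c d v t"
  unfolding F_int_def by (intro SUP_cong) auto

lemma Z_part_interval:
  assumes "is_partition a b \<Delta>" "a < b" "(u, z0) \<in> Z_part r a b \<Delta>" "k < npt \<Delta>"
  shows "(restr (pt \<Delta> k) (pt \<Delta> (Suc k)) u, p) \<in> Z_int r (pt \<Delta> k) (pt \<Delta> (Suc k))"
  using assms restr_Z_int pt_Suc_less(1)[OF assms(1,2,4)] unfolding Z_part_iff by auto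

text \<open>Restart the play at the left node by the flow property and apply the closed formula for
  small oscillation on the single interval.\<close>

lemma play_val_P_int:
  fixes u :: cfun
  assumes part: "is_partition a b \<Delta>" "a < b" and r: "0 < r" and Z: "(u, z0) \<in> Z_part r a b \<Delta>"
    and k: "k < npt \<Delta>" and t: "t \<in> {pt \<Delta> k..pt \<Delta> (Suc k)}"
  shows "play_val r a u p t =
    P_int r (pt \<Delta> k) (pt \<Delta> (Suc k)) (restr (pt \<Delta> k) (pt \<Delta> (Suc k)) u) (play_val r a u p (pt \<Delta> k)) t"
proof -
  let ?c = "pt \<Delta> k" and ?d = "pt \<Delta> (Suc k)"
  let ?w = "play_val r a u p ?c"
  note s = pt_Suc_less[OF part k]
  have "?c \<le> ?d" using s by simp
  have osc: "\<bar>u \<sigma> - u \<tau>\<bar> < r" if "\<sigma> \<in> {?c..?d}" "\<tau> \<in> {?c..?d}" for \<sigma> \<tau>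
  proof -
    have "osc ?c ?d u < r" using Z k unfolding Z_part_iff by simp
    then show ?thesis using that unfolding osc_less_iff[OF \<open>?c \<le> ?d\<close>] by blast
  qed
  have "play_val r a u p t = play_val r ?c u ?w t"
    by (rule play_val_flow) (use s t in auto)
  also have "\<dots> = max (F_int ?c ?d u t - r) (min ?w (r - F_int ?c ?d (\<lambda>s. - u s) t))"
  proof (rule play_val_small_osc)
    show "u \<sigma> - u \<tau> < 2 * r" if "\<sigma> \<in> {?c..t}" "\<tau> \<in> {?c..t}" for \<sigma> \<tau>
      using osc[of \<sigma> \<tau>] that t r by auto
  qed (use s t in auto)
  also have "F_int ?c ?d u t = F_int ?c ?d (restr ?c ?d u) t"
    by (rule F_int_cong[OF t]) (simp add: clamp_id)
  also have "F_int ?c ?d (\<lambda>s. - u s) t = F_int ?c ?d (- restr ?c ?d u) t"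
    by (rule F_int_cong[OF t]) (simp add: clamp_id)
  also have "max (F_int ?c ?d (restr ?c ?d u) t - r) (min ?w (r - F_int ?c ?d (- restr ?c ?d u) t)) =
      P_int r ?c ?d (restr ?c ?d u) ?w t"
    by (rule P_int_clip[symmetric, OF \<open>?c \<le> ?d\<close> Z_part_interval[OF part Z k] t])
  finally show ?thesis .
qed

lemma w_part_eq:
  fixes u :: cfun
  assumes part: "is_partition a b \<Delta>" "a < b" and r: "0 < r" and Z: "(u, z0) \<in> Z_part r a b \<Delta>"
    and k: "k \<le> npt \<Delta>"
  shows "w_part r \<Delta> k u z0 = play_val r a u (u a - clip r z0) (pt \<Delta> k)"
  using k
proof (induction k)
  case 0
  have "\<bar>u a - clip r z0 - u a\<bar> \<le> r" using clip_bounded[OF r, of z0] by simp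
  then show ?case using play_val_initial[of "u a - clip r z0" u a r] partition_basic(4)[OF part] by simp
next
  case (Suc k)
  then have k: "k < npt \<Delta>" by simp
  have "pt \<Delta> (Suc k) \<in> {pt \<Delta> k..pt \<Delta> (Suc k)}" using pt_Suc_less[OF part k] by simp
  from play_val_P_int[OF part r Z k this] show ?case using Suc by simp
qed

lemma play_P_int:
  assumes part: "is_partition a b \<Delta>" "a < b" and r: "0 < r" and Z: "(u, z0) \<in> Z_part r a b \<Delta>"
    and k: "k < npt \<Delta>" and t: "t \<in> {pt \<Delta> k..pt \<Delta> (Suc k)}"
  shows "play r a b (u, z0) t =
    P_int r (pt \<Delta> k) (pt \<Delta> (Suc k)) (restr (pt \<Delta> k) (pt \<Delta> (Suc k)) u) (w_part r \<Delta> k u z0) t"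
proof -
  have u: "u \<in> C_on a b" using Z unfolding Z_part_iff by simp
  have "t \<in> {a..b}" using t pt_Suc_less[OF part k] by auto
  from play_eq_play_val(2)[OF part(2) r u this]
  show ?thesis
    unfolding play_val_P_int[OF part r Z k t] w_part_eq[OF part r Z less_imp_le[OF k]] .
qed

lemma play_Lipschitz:
  assumes "a < b" "0 < r" "u \<in> C_on a b" "v \<in> C_on a b" "t \<in> {a..b}"
  shows "\<bar>play r a b (u, y) t - play r a b (v, z) t\<bar> \<le> norm (u - v) + \<bar>y - z\<bar>"
  unfolding play_eq_play_val(2)[OF assms(1,2,3,5)] play_eq_play_val(2)[OF assms(1,2,4,5)]
proof (rule play_val_Lipschitz)
  show "\<bar>u s - v s\<bar> \<le> norm (u - v) + \<bar>y - z\<bar>" for s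
    using abs_apply_le_norm[of "u - v" s] by simp
  show "\<bar>u a - clip r y - (v a - clip r z)\<bar> \<le> norm (u - v) + \<bar>y - z\<bar>"
    using abs_apply_le_norm[of "u - v" a] clip_Lipschitz[of r y z] by simp
qed (use assms in auto)

lemma w_part_eq_play:
  assumes "is_partition a b \<Delta>" "a < b" "0 < r" "(u, z0) \<in> Z_part r a b \<Delta>" "k \<le> npt \<Delta>"
  shows "w_part r \<Delta> k u z0 = play r a b (u, z0) (pt \<Delta> k)"
proof -
  have "u \<in> C_on a b" using assms(4) unfolding Z_part_iff by simp
  then show ?thesis
    using w_part_eq[OF assms] play_eq_play_val(2)[OF assms(2,3) _ pt_mem(2)[OF assms(1,2,5)]] by simp
qed

lemma w_part_Lipschitz:
  assumes "is_partition a b \<Delta>" "a < b" "0 < r" "(u, y) \<in> Z_part r a b \<Delta>" "(v, z) \<in> Z_part r a b \<Delta>" "k \<le> npt \<Delta>"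
  shows "\<bar>w_part r \<Delta> k u y - w_part r \<Delta> k v z\<bar> \<le> norm (u - v) + \<bar>y - z\<bar>"
proof -
  have "u \<in> C_on a b" "v \<in> C_on a b" using assms(4,5) unfolding Z_part_iff by auto
  then show ?thesis
    unfolding w_part_eq_play[OF assms(1-4,6)] w_part_eq_play[OF assms(1-3,5,6)]
    by (rule play_Lipschitz[OF assms(2,3) _ _ pt_mem(2)[OF assms(1,2,6)]])
qed

lemma Z_part_perturb:
  fixes u :: cfun
  assumes part: "is_partition a b \<Delta>" "a < b" and Z: "(u, z0) \<in> Z_part r a b \<Delta>"
  shows "\<exists>\<delta>>0. \<forall>u' z'. u' \<in> C_on a b \<longrightarrow> norm (u' - u) < \<delta> \<longrightarrow> (u', z') \<in> Z_part r a b \<Delta>"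
proof -
  define m where "m = Max ((\<lambda>k. osc (pt \<Delta> k) (pt \<Delta> (Suc k)) u) ` {..<npt \<Delta>})"
  have "0 \<in> {..<npt \<Delta>}" using partition_basic(1)[OF part] by simp
  then have ne: "{..<npt \<Delta>} \<noteq> {}" by blast
  then have "m < r" unfolding m_def using Z unfolding Z_part_iff by (subst Max_less_iff) auto
  have le: "osc (pt \<Delta> k) (pt \<Delta> (Suc k)) u \<le> m" if "k < npt \<Delta>" for k
    unfolding m_def using that by (intro Max_ge) auto
  show ?thesis
  proof (intro exI[of _ "(r - m) / 2"] conjI allI impI)
    show "0 < (r - m) / 2" using \<open>m < r\<close> by simp
    fix u' z' assume u': "u' \<in> C_on a b" "norm (u' - u) < (r - m) / 2"
    show "(u', z') \<in> Z_part r a b \<Delta>"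
      unfolding Z_part_iff
    proof (intro conjI u'(1) allI impI)
      fix k assume k: "k < npt \<Delta>"
      have "pt \<Delta> k \<le> pt \<Delta> (Suc k)" using pt_Suc_less[OF part k] by simp
      from osc_perturb[OF this, of u' u] show "osc (pt \<Delta> k) (pt \<Delta> (Suc k)) u' < r"
        using le[OF k] u'(2) by simp
    qed
  qed
qed

text \<open>As for the positive part there is no remainder: the clipping is piecewise linear, and at
  a corner the free value of l meets the increment 0. The radius r in the corner cases keeps z' away
  from the opposite corner.\<close>

lemma clip_newton:
  assumes "0 < r"
  shows "\<exists>\<delta>>0. \<forall>z'. \<bar>z' - z\<bar> < \<delta> \<longrightarrow> (\<forall>l\<in>S_R r. clip r z' - clip r z = l z' * (z' - z))"
proof -
  have l: "l x = 0" if "l \<in> S_R r" "r < \<bar>x\<bar>" for l x using that unfolding S_R_def by auto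
  have l': "l x = 1" if "l \<in> S_R r" "\<bar>x\<bar> < r" for l x using that unfolding S_R_def by auto
  have "r < z \<or> z < - r \<or> \<bar>z\<bar> < r \<or> z = r \<or> z = - r" by linarith
  then consider "r < z" | "z < - r" | "\<bar>z\<bar> < r" | "z = r" | "z = - r" by blast
  then show ?thesis
  proof cases
    case 1 then show ?thesis using assms by (intro exI[of _ "z - r"]) (auto simp: l clip_def)
  next
    case 2 then show ?thesis using assms by (intro exI[of _ "- r - z"]) (auto simp: l clip_def)
  next
    case 3 
    show ?thesis
    proof (intro exI[of _ "r - \<bar>z\<bar>"] conjI allI impI ballI)
      fix z' k assume z': "\<bar>z' - z\<bar> < r - \<bar>z\<bar>" and k: "k \<in> S_R r"
      then have "\<bar>z'\<bar> < r" by linarith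
      then show "clip r z' - clip r z = k z' * (z' - z)" using l'[OF k, of z'] 3 by (simp add: clip_def abs_less_iff)
    qed (use 3 in simp)
  next
    case 4
    show ?thesis
    proof (intro exI[of _ r] conjI allI impI ballI)
      fix z' k assume z': "\<bar>z' - z\<bar> < r" and k: "k \<in> S_R r"
      consider "z' = r" | "r < \<bar>z'\<bar>" "r < z'" | "\<bar>z'\<bar> < r" using z' 4 by linarith
      then show "clip r z' - clip r z = k z' * (z' - z)"
        by cases (use 4 l[OF k] l'[OF k] assms in \<open>auto simp: clip_def abs_less_iff\<close>)
    qed (use assms in simp)
  next
    case 5
    show ?thesis
    proof (intro exI[of _ r] conjI allI impI ballI)
      fix z' k assume z': "\<bar>z' - z\<bar> < r" and k: "k \<in> S_R r"
      consider "z' = - r" | "r < \<bar>z'\<bar>" "z' < - r" | "\<bar>z'\<bar> < r" using z' 5 by linarith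
      then show "clip r z' - clip r z = k z' * (z' - z)"
        by cases (use 5 l[OF k] l'[OF k] assms in \<open>auto simp: clip_def abs_less_iff\<close>)
    qed (use assms in simp)
  qed
qed

lemma Sk_part_SucD:
  assumes "\<mu> \<in> Sk_part r a b \<Delta> (Suc k)"
  shows "\<exists>\<nu>\<in>S_int r (pt \<Delta> k) (pt \<Delta> (Suc k)). \<exists>\<mu>'\<in>Sk_part r a b \<Delta> k.
     \<forall>u z0 t h y. (u, z0) \<in> Z_part r a b \<Delta> \<longrightarrow> t \<in> {pt \<Delta> k..pt \<Delta> (Suc k)} \<longrightarrow> h \<in> C_on a b \<longrightarrow>
       \<mu> (u, z0, t) (h, y) = \<nu> (restr (pt \<Delta> k) (pt \<Delta> (Suc k)) u, w_part r \<Delta> k u z0, t)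
            (restr (pt \<Delta> k) (pt \<Delta> (Suc k)) h, \<mu>' (u, z0, pt \<Delta> k) (h, y))"
proof -
  obtain \<nu> \<mu>' where *: "\<nu> \<in> S_int r (pt \<Delta> k) (pt \<Delta> (Suc k))" "\<mu>' \<in> Sk_part r a b \<Delta> k"
    "\<forall>(u :: cfun, z0) \<in> Z_part r a b \<Delta>. \<forall>t \<in> {pt \<Delta> k..pt \<Delta> (Suc k)}.
       \<mu> (u, z0, t) \<in> dual_CR a b \<and>
       (\<forall>h \<in> C_on a b. \<forall>y. \<mu> (u, z0, t) (h, y) =
          \<nu> (restr (pt \<Delta> k) (pt \<Delta> (Suc k)) u, w_part r \<Delta> k u z0, t)
            (restr (pt \<Delta> k) (pt \<Delta> (Suc k)) h, \<mu>' (u, z0, pt \<Delta> k) (h, y)))"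
    using assms unfolding Sk_part.simps by blast
  show ?thesis by (intro bexI[OF _ *(1)] bexI[OF _ *(2)] allI impI) (use *(3) in auto)
qed

text \<open>Each interval contributes a convex combination of the node value and an average of h
  over the past, so the bound of the first node is never exceeded. For k = 0 truncated subtraction
  makes the time interval the single point \<open>pt \<Delta> 0\<close>.\<close>

lemma Sk_part_bound:
  fixes u h :: cfun
  assumes part: "is_partition a b \<Delta>" "a < b" and Z: "(u, z0) \<in> Z_part r a b \<Delta>" and h: "h \<in> C_on a b"
    and "k \<le> npt \<Delta>" "\<mu> \<in> Sk_part r a b \<Delta> k" "t \<in> {pt \<Delta> (k - 1)..pt \<Delta> k}"
    and "\<And>s. s \<in> {a..t} \<Longrightarrow> \<bar>h s\<bar> \<le> B"
  shows "\<bar>\<mu> (u, z0, t) (h, y)\<bar> \<le> B + \<bar>y\<bar>"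
  using assms(5-8)
proof (induction k arbitrary: \<mu> t)
  case 0
  then have t: "t = pt \<Delta> 0" by simp
  obtain l where l: "l \<in> S_R r" "\<mu> (u, z0, pt \<Delta> 0) (h, y) = h a - l z0 * y"
    using 0(2) Z h by auto
  have "\<bar>l z0\<bar> \<le> 1" using l(1) unfolding S_R_def by auto
  then have "\<bar>l z0 * y\<bar> \<le> \<bar>y\<bar>" unfolding abs_mult by (rule mult_left_le_one_le[rotated 2]) auto
  moreover have "\<bar>h a\<bar> \<le> B" using 0(4)[of a] t partition_basic(4)[OF part] by simp
  ultimately show ?case unfolding t l(2) by linarith
next
  case (Suc k)
  then have k: "k < npt \<Delta>" and t: "t \<in> {pt \<Delta> k..pt \<Delta> (Suc k)}" by auto
  note s = pt_Suc_less[OF part k]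
  obtain \<nu> \<mu>' where \<nu>: "\<nu> \<in> S_int r (pt \<Delta> k) (pt \<Delta> (Suc k))" and \<mu>': "\<mu>' \<in> Sk_part r a b \<Delta> k"
    and eq: "\<mu> (u, z0, t) (h, y) = \<nu> (restr (pt \<Delta> k) (pt \<Delta> (Suc k)) u, w_part r \<Delta> k u z0, t)
            (restr (pt \<Delta> k) (pt \<Delta> (Suc k)) h, \<mu>' (u, z0, pt \<Delta> k) (h, y))"
    using Sk_part_SucD[OF Suc.prems(2)] Z t h by fast
  have "pt \<Delta> (k - 1) \<le> pt \<Delta> k" using pt_less[OF part, of "k - 1" k] k by (cases k) auto
  then have "\<bar>\<mu>' (u, z0, pt \<Delta> k) (h, y)\<bar> \<le> B + \<bar>y\<bar>"
    by (intro Suc.IH[OF _ \<mu>'] Suc.prems(4)) (use k t in auto)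
  moreover have "\<bar>restr (pt \<Delta> k) (pt \<Delta> (Suc k)) h \<sigma>\<bar> \<le> B + \<bar>y\<bar>" if "\<sigma> \<in> {pt \<Delta> k..t}" for \<sigma>
  proof -
    have "\<bar>h \<sigma>\<bar> \<le> B" using Suc.prems(4)[of \<sigma>] that s by auto
    then show ?thesis using that t restr_apply_id[of \<sigma> "pt \<Delta> k" "pt \<Delta> (Suc k)" h] by auto
  qed
  ultimately show ?case unfolding eq
    by (intro S_int_bound[OF \<nu> _ t Z_part_interval[OF part Z k]] restr_in_C_on) (use s in auto)
qed

text \<open>The radius \<delta> precedes the quantifier over \<mu>, so the estimate is uniform over
  all selectors in S while the time t is fixed. N will count the intervals passed.\<close>

abbreviation newton_within :: "real \<Rightarrow> real \<Rightarrow> real \<Rightarrow> real \<Rightarrow> cfun \<Rightarrow> real \<Rightarrow> functional_map set \<Rightarrow>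
    (cfun \<Rightarrow> real \<Rightarrow> real) \<Rightarrow> real \<Rightarrow> real \<Rightarrow> bool" where
  "newton_within a b \<delta> e u z S w t N \<equiv> \<forall>u' z' B \<mu>. u' \<in> C_on a b \<longrightarrow> norm (u' - u) < \<delta> \<longrightarrow> \<bar>z' - z\<bar> < \<delta> \<longrightarrow> \<mu> \<in> S \<longrightarrow>
     modulus_le a b e (u' - u) B \<longrightarrow> \<bar>w u' z' - w u z - \<mu> (u', z', t) (u' - u, z' - z)\<bar> \<le> N * B"

text \<open>The chain rule: the number \<eta> left open in \<open>P_int_newton\<close> is set to the
  functional at the left node. Its error, at most k * B by hypothesis, is added to the B of the new
  interval.\<close>

lemma Sk_part_newton_step:
  assumes part: "is_partition a b \<Delta>" "a < b" and r: "0 < r" and Z: "(u, z0) \<in> Z_part r a b \<Delta>"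
    and e: "0 < e" and k: "k < npt \<Delta>" and t: "t \<in> {pt \<Delta> k..pt \<Delta> (Suc k)}"
    and IH: "\<exists>\<delta>>0. newton_within a b \<delta> e u z0 (Sk_part r a b \<Delta> k) (w_part r \<Delta> k) (pt \<Delta> k) (real k)"
  shows "\<exists>\<delta>>0. newton_within a b \<delta> e u z0 (Sk_part r a b \<Delta> (Suc k)) (\<lambda>u z. play r a b (u, z) t) t (real (Suc k))"
proof -
  let ?c = "pt \<Delta> k" and ?d = "pt \<Delta> (Suc k)"
  let ?R = "restr ?c ?d"
  note s = pt_Suc_less[OF part k]
  then have cd: "?c \<le> ?d" by simp
  have u: "u \<in> C_on a b" using Z unfolding Z_part_iff by simp
  obtain \<delta>1 where \<delta>1: "\<delta>1 > 0" "newton_within a b \<delta>1 e u z0 (Sk_part r a b \<Delta> k) (w_part r \<Delta> k) (pt \<Delta> k) (real k)"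
    using IH by blast
  obtain \<delta>2 where \<delta>2: "\<delta>2 > 0" "\<forall>u' p' \<eta> B \<nu>. u' \<in> C_on ?c ?d \<longrightarrow> norm (u' - ?R u) < \<delta>2 \<longrightarrow> \<bar>p' - w_part r \<Delta> k u z0\<bar> < \<delta>2 \<longrightarrow> \<nu> \<in> S_int r ?c ?d \<longrightarrow>
     modulus_le ?c ?d e (u' - ?R u) B \<longrightarrow>
     \<bar>P_int r ?c ?d u' p' t - P_int r ?c ?d (?R u) (w_part r \<Delta> k u z0) t - \<nu> (u', p', t) (u' - ?R u, \<eta>)\<bar>
       \<le> \<bar>p' - w_part r \<Delta> k u z0 - \<eta>\<bar> + B"
    using P_int_newton[OF cd Z_part_interval[OF part Z k] t e] by blast
  obtain \<delta>3 where \<delta>3: "\<delta>3 > 0" "\<forall>u' z'. u' \<in> C_on a b \<longrightarrow> norm (u' - u) < \<delta>3 \<longrightarrow> (u', z') \<in> Z_part r a b \<Delta>"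
    using Z_part_perturb[OF part Z] by blast
  show ?thesis
  \<comment> \<open>The node value is Lipschitz with constant one in norm u + |z|, so half of
    \<delta>2 for each argument keeps its change below \<delta>2.\<close>
  proof (intro exI[of _ "min \<delta>1 (min (\<delta>2 / 2) \<delta>3)"] conjI allI impI)
    show "0 < min \<delta>1 (min (\<delta>2 / 2) \<delta>3)" using \<delta>1(1) \<delta>2(1) \<delta>3(1) by simp
    fix u' z' B \<mu>
    assume u': "u' \<in> C_on a b" and n: "norm (u' - u) < min \<delta>1 (min (\<delta>2 / 2) \<delta>3)"
      and z': "\<bar>z' - z0\<bar> < min \<delta>1 (min (\<delta>2 / 2) \<delta>3)" and \<mu>: "\<mu> \<in> Sk_part r a b \<Delta> (Suc k)"
      and B: "modulus_le a b e (u' - u) B"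
    have Z': "(u', z') \<in> Z_part r a b \<Delta>" using \<delta>3(2) u' n by simp
    have C: "u' - u \<in> C_on a b" by (rule C_on_diff[OF u' u])
    obtain \<nu> \<mu>' where \<nu>: "\<nu> \<in> S_int r ?c ?d" and \<mu>': "\<mu>' \<in> Sk_part r a b \<Delta> k"
      and eq: "\<mu> (u', z', t) (u' - u, z' - z0) = \<nu> (?R u', w_part r \<Delta> k u' z', t)
            (?R (u' - u), \<mu>' (u', z', ?c) (u' - u, z' - z0))"
      using Sk_part_SucD[OF \<mu>] Z' t C by fast
    have 1: "\<bar>w_part r \<Delta> k u' z' - w_part r \<Delta> k u z0 - \<mu>' (u', z', ?c) (u' - u, z' - z0)\<bar> \<le> real k * B"
      by (rule \<delta>1(2)[rule_format, OF u' _ _ \<mu>']) (use n z' B in auto)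
    have w: "\<bar>w_part r \<Delta> k u' z' - w_part r \<Delta> k u z0\<bar> < \<delta>2"
      using w_part_Lipschitz[OF part r Z' Z less_imp_le[OF k]] n z' by simp
    have "norm (?R u' - ?R u) < \<delta>2"
      using norm_restr_le[of ?c ?d "u' - u"] n \<delta>2(1) by (simp add: restr_diff)
    moreover have "\<bar>(?R u' - ?R u) s - (?R u' - ?R u) s'\<bar> \<le> B"
      if "s \<in> {?c..?d}" "s' \<in> {?c..?d}" "\<bar>s - s'\<bar> < e" for s s'
    proof -
      have "s \<in> {a..b}" "s' \<in> {a..b}" using that s by auto
      then have "\<bar>(u' - u) s - (u' - u) s'\<bar> \<le> B" using B that(3) by blast
      then show ?thesis unfolding restr_diff[symmetric] restr_apply_id[OF that(1)] restr_apply_id[OF that(2)] .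
    qed
    ultimately have "\<bar>P_int r ?c ?d (?R u') (w_part r \<Delta> k u' z') t - P_int r ?c ?d (?R u) (w_part r \<Delta> k u z0) t
        - \<nu> (?R u', w_part r \<Delta> k u' z', t) (?R u' - ?R u, \<mu>' (u', z', ?c) (u' - u, z' - z0))\<bar>
       \<le> \<bar>w_part r \<Delta> k u' z' - w_part r \<Delta> k u z0 - \<mu>' (u', z', ?c) (u' - u, z' - z0)\<bar> + B"
      by (intro \<delta>2(2)[rule_format] restr_in_C_on cd w \<nu>) auto
    also have "\<dots> \<le> real (Suc k) * B" using 1 by (simp add: algebra_simps)
    finally show "\<bar>play r a b (u', z') t - play r a b (u, z0) t - \<mu> (u', z', t) (u' - u, z' - z0)\<bar> \<le> real (Suc k) * B"
      unfolding play_P_int[OF part r Z k t] play_P_int[OF part r Z' k t] eq restr_diff .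
  qed
qed

text \<open>At the first node the clipping is linearised exactly, so the count starts with remainder
  0. The induction step is the chain rule at the right node, where \<open>w_part\<close> and the
  play coincide.\<close>

lemma Sk_part_newton:
  assumes part: "is_partition a b \<Delta>" "a < b" and r: "0 < r" and Z: "(u, z0) \<in> Z_part r a b \<Delta>"
    and e: "0 < e" and k: "k \<le> npt \<Delta>"
  shows "\<exists>\<delta>>0. newton_within a b \<delta> e u z0 (Sk_part r a b \<Delta> k) (w_part r \<Delta> k) (pt \<Delta> k) (real k)"
  using k
proof (induction k)
  case 0
  have u: "u \<in> C_on a b" using Z unfolding Z_part_iff by simp
  obtain \<delta>1 where \<delta>1: "\<delta>1 > 0" "\<forall>z'. \<bar>z' - z0\<bar> < \<delta>1 \<longrightarrow> (\<forall>l\<in>S_R r. clip r z' - clip r z0 = l z' * (z' - z0))"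
    using clip_newton[OF r] by blast
  obtain \<delta>3 where \<delta>3: "\<delta>3 > 0" "\<forall>u' z'. u' \<in> C_on a b \<longrightarrow> norm (u' - u) < \<delta>3 \<longrightarrow> (u', z') \<in> Z_part r a b \<Delta>"
    using Z_part_perturb[OF part Z] by blast
  show ?case
  proof (intro exI[of _ "min \<delta>1 \<delta>3"] conjI allI impI)
    show "0 < min \<delta>1 \<delta>3" using \<delta>1(1) \<delta>3(1) by simp
    fix u' z' B \<mu>
    assume u': "u' \<in> C_on a b" and n: "norm (u' - u) < min \<delta>1 \<delta>3"
      and z': "\<bar>z' - z0\<bar> < min \<delta>1 \<delta>3" and \<mu>: "\<mu> \<in> Sk_part r a b \<Delta> 0"
    have Z': "(u', z') \<in> Z_part r a b \<Delta>" using \<delta>3(2) u' n by simp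
    have C: "u' - u \<in> C_on a b" by (rule C_on_diff[OF u' u])
    obtain l where l: "l \<in> S_R r" "\<mu> (u', z', pt \<Delta> 0) (u' - u, z' - z0) = (u' - u) a - l z' * (z' - z0)"
      using \<mu> Z' C by auto
    have "clip r z' - clip r z0 = l z' * (z' - z0)" using \<delta>1(2) z' l(1) by simp
    then show "\<bar>w_part r \<Delta> 0 u' z' - w_part r \<Delta> 0 u z0 - \<mu> (u', z', pt \<Delta> 0) (u' - u, z' - z0)\<bar> \<le> real 0 * B"
      unfolding l(2) using partition_basic(4)[OF part] by simp
  qed
next
  case (Suc k)
  then have k: "k < npt \<Delta>" by simp
  have t: "pt \<Delta> (Suc k) \<in> {pt \<Delta> k..pt \<Delta> (Suc k)}" using pt_Suc_less[OF part k] by simp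
  obtain \<delta>1 where \<delta>1: "\<delta>1 > 0" "newton_within a b \<delta>1 e u z0 (Sk_part r a b \<Delta> (Suc k)) (\<lambda>u z. play r a b (u, z) (pt \<Delta> (Suc k))) (pt \<Delta> (Suc k)) (real (Suc k))"
    using Sk_part_newton_step[OF part r Z e k t] Suc by auto
  obtain \<delta>3 where \<delta>3: "\<delta>3 > 0" "\<forall>u' z'. u' \<in> C_on a b \<longrightarrow> norm (u' - u) < \<delta>3 \<longrightarrow> (u', z') \<in> Z_part r a b \<Delta>"
    using Z_part_perturb[OF part Z] by blast
  show ?case
  proof (intro exI[of _ "min \<delta>1 \<delta>3"] conjI allI impI)
    show "0 < min \<delta>1 \<delta>3" using \<delta>1(1) \<delta>3(1) by simp
    fix u' z' B \<mu>
    assume u': "u' \<in> C_on a b" and n: "norm (u' - u) < min \<delta>1 \<delta>3"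
      and z': "\<bar>z' - z0\<bar> < min \<delta>1 \<delta>3" and \<mu>: "\<mu> \<in> Sk_part r a b \<Delta> (Suc k)"
      and B: "modulus_le a b e (u' - u) B"
    have Z': "(u', z') \<in> Z_part r a b \<Delta>" using \<delta>3(2) u' n by simp
    show "\<bar>w_part r \<Delta> (Suc k) u' z' - w_part r \<Delta> (Suc k) u z0 - \<mu> (u', z', pt \<Delta> (Suc k)) (u' - u, z' - z0)\<bar> \<le> real (Suc k) * B"
      unfolding w_part_eq_play[OF part r Z Suc.prems] w_part_eq_play[OF part r Z' Suc.prems]
      by (rule \<delta>1(2)[rule_format, OF u' _ _ \<mu>]) (use n z' B in auto)
  qed
qed

text \<open>The index depends on \<open>t\<close> only, so the constants below are uniform over \<open>S_part\<close>.\<close>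

lemma S_part_piece:
  assumes part: "is_partition a b \<Delta>" "a < b" and t: "t \<in> {a..b}"
  shows "\<exists>k<npt \<Delta>. t \<in> {pt \<Delta> k..pt \<Delta> (Suc k)} \<and> (\<forall>\<mu>\<in>S_part r a b \<Delta>. \<exists>\<mu>'\<in>Sk_part r a b \<Delta> (Suc k).
     \<forall>u z0. (u, z0) \<in> Z_part r a b \<Delta> \<longrightarrow> \<mu> (u, z0, t) = \<mu>' (u, z0, t))"
proof -
  have *: "\<exists>\<mu>k. (\<forall>k \<in> {1..npt \<Delta>}. \<mu>k k \<in> Sk_part r a b \<Delta> k) \<and>
     (\<forall>u z0. (u, z0) \<in> Z_part r a b \<Delta> \<longrightarrow>
        (\<forall>t \<in> {pt \<Delta> 0..pt \<Delta> 1}. \<mu> (u, z0, t) = \<mu>k 1 (u, z0, t)) \<and>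
        (\<forall>k \<in> {2..npt \<Delta>}. \<forall>t \<in> {pt \<Delta> (k - 1)<..pt \<Delta> k}. \<mu> (u, z0, t) = \<mu>k k (u, z0, t)))"
    if \<mu>: "\<mu> \<in> S_part r a b \<Delta>" for \<mu>
  proof -
    obtain \<mu>k where \<mu>k: "\<forall>k \<in> {1..npt \<Delta>}. \<mu>k k \<in> Sk_part r a b \<Delta> k"
      "\<forall>(u :: cfun, z0) \<in> Z_part r a b \<Delta>.
        (\<forall>t \<in> {pt \<Delta> 0..pt \<Delta> 1}. \<mu> (u, z0, t) = \<mu>k 1 (u, z0, t)) \<and>
        (\<forall>k \<in> {2..npt \<Delta>}. \<forall>t \<in> {pt \<Delta> (k - 1)<..pt \<Delta> k}. \<mu> (u, z0, t) = \<mu>k k (u, z0, t))"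
      using \<mu> unfolding S_part_def by blast
    show ?thesis
    proof (intro exI[of _ \<mu>k] conjI[OF \<mu>k(1)] allI impI)
      fix u z0 assume "(u, z0) \<in> Z_part r a b \<Delta>"
      from bspec[OF \<mu>k(2) this] show "(\<forall>t \<in> {pt \<Delta> 0..pt \<Delta> 1}. \<mu> (u, z0, t) = \<mu>k 1 (u, z0, t)) \<and>
        (\<forall>k \<in> {2..npt \<Delta>}. \<forall>t \<in> {pt \<Delta> (k - 1)<..pt \<Delta> k}. \<mu> (u, z0, t) = \<mu>k k (u, z0, t))"
        by (simp only: prod.case)
    qed
  qed
  have n: "1 \<le> npt \<Delta>" by (rule partition_basic(1)[OF part])
  show ?thesis
  proof (cases "t \<le> pt \<Delta> 1")
    case True
    then have t': "t \<in> {pt \<Delta> 0..pt \<Delta> 1}" using t partition_basic(4)[OF part] by simp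
    show ?thesis
    proof (intro exI[of _ 0] conjI ballI)
      fix \<mu> assume "\<mu> \<in> S_part r a b \<Delta>"
      from *[OF this] obtain \<mu>k where 1: "\<forall>k \<in> {1..npt \<Delta>}. \<mu>k k \<in> Sk_part r a b \<Delta> k"
        and 2: "\<And>u z0. (u, z0) \<in> Z_part r a b \<Delta> \<Longrightarrow> \<mu> (u, z0, t) = \<mu>k 1 (u, z0, t)" using t' by blast
      have "\<mu>k 1 \<in> Sk_part r a b \<Delta> (Suc 0)" using bspec[OF 1, of 1] n by (simp del: Sk_part.simps)
      then show "\<exists>\<mu>'\<in>Sk_part r a b \<Delta> (Suc 0). \<forall>u z0. (u, z0) \<in> Z_part r a b \<Delta> \<longrightarrow> \<mu> (u, z0, t) = \<mu>' (u, z0, t)"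
        using 2 by blast
    qed (use n t' in auto)
  next
    case False
    then have "t \<in> {a<..b}" using t pt_mem(2)[OF part n] by auto
    from partition_cover[OF part this] obtain k where k: "k < npt \<Delta>" "t \<in> {pt \<Delta> k<..pt \<Delta> (Suc k)}" by blast
    have "k \<noteq> 0" using False k by (cases k) auto
    then have k2: "Suc k \<in> {2..npt \<Delta>}" using k by auto
    show ?thesis
    proof (intro exI[of _ k] conjI ballI k(1))
      fix \<mu> assume "\<mu> \<in> S_part r a b \<Delta>"
      from *[OF this] obtain \<mu>k where 1: "\<forall>k \<in> {1..npt \<Delta>}. \<mu>k k \<in> Sk_part r a b \<Delta> k"
        and 2: "\<forall>u z0. (u, z0) \<in> Z_part r a b \<Delta> \<longrightarrow>
        (\<forall>t \<in> {pt \<Delta> 0..pt \<Delta> 1}. \<mu> (u, z0, t) = \<mu>k 1 (u, z0, t)) \<and>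
        (\<forall>k \<in> {2..npt \<Delta>}. \<forall>t \<in> {pt \<Delta> (k - 1)<..pt \<Delta> k}. \<mu> (u, z0, t) = \<mu>k k (u, z0, t))" by blast
      have "\<mu> (u, z0, t) = \<mu>k (Suc k) (u, z0, t)" if "(u, z0) \<in> Z_part r a b \<Delta>" for u z0
      proof -
        have "\<forall>k \<in> {2..npt \<Delta>}. \<forall>t \<in> {pt \<Delta> (k - 1)<..pt \<Delta> k}. \<mu> (u, z0, t) = \<mu>k k (u, z0, t)" using 2 that by blast
        from bspec[OF this k2] show ?thesis using k(2) by simp
      qed
      moreover have "\<mu>k (Suc k) \<in> Sk_part r a b \<Delta> (Suc k)" by (rule bspec[OF 1]) (use k2 in auto)
      ultimately show "\<exists>\<mu>'\<in>Sk_part r a b \<Delta> (Suc k). \<forall>u z0. (u, z0) \<in> Z_part r a b \<Delta> \<longrightarrow> \<mu> (u, z0, t) = \<mu>' (u, z0, t)"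
        by blast
    qed (use k in auto)
  qed
qed

lemma S_part_bound:
  fixes u h :: cfun
  assumes "is_partition a b \<Delta>" "a < b" "(u, z0) \<in> Z_part r a b \<Delta>" "h \<in> C_on a b"
    and "\<mu> \<in> S_part r a b \<Delta>" "t \<in> {a..b}" "\<And>s. s \<in> {a..t} \<Longrightarrow> \<bar>h s\<bar> \<le> B"
  shows "\<bar>\<mu> (u, z0, t) (h, y)\<bar> \<le> B + \<bar>y\<bar>"
proof -
  obtain k \<mu>' where k: "k < npt \<Delta>" "t \<in> {pt \<Delta> k..pt \<Delta> (Suc k)}" "\<mu>' \<in> Sk_part r a b \<Delta> (Suc k)"
    "\<mu> (u, z0, t) = \<mu>' (u, z0, t)"
    using S_part_piece[OF assms(1,2,6), of r] assms(3,5) by blast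
  show ?thesis unfolding k(4)
    by (rule Sk_part_bound[OF assms(1-4) _ k(3)]) (use k assms(7) in auto)
qed

lemma S_part_dual:
  assumes "is_partition a b \<Delta>" "a < b" "(u, z0) \<in> Z_part r a b \<Delta>" "\<mu> \<in> S_part r a b \<Delta>" "t \<in> {a..b}"
  shows "\<mu> (u, z0, t) \<in> dual_CR a b"
proof -
  obtain k \<mu>' where k: "k < npt \<Delta>" "t \<in> {pt \<Delta> k..pt \<Delta> (Suc k)}" "\<mu>' \<in> Sk_part r a b \<Delta> (Suc k)"
    "\<mu> (u, z0, t) = \<mu>' (u, z0, t)"
    using S_part_piece[OF assms(1,2,5), of r] assms(3,4) by blast
  show ?thesis unfolding k(4) using k(2,3) assms(3) by auto
qed

theorem S_part_newton:
  assumes part: "is_partition a b \<Delta>" "a < b" and r: "0 < r" and Z: "(u, z0) \<in> Z_part r a b \<Delta>"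
    and e: "0 < e" and t: "t \<in> {a..b}"
  shows "\<exists>\<delta>>0. newton_within a b \<delta> e u z0 (S_part r a b \<Delta>) (\<lambda>u z. play r a b (u, z) t) t (real (npt \<Delta>))"
proof -
  obtain k where k: "k < npt \<Delta>" "t \<in> {pt \<Delta> k..pt \<Delta> (Suc k)}" and piece:
    "\<forall>\<mu>\<in>S_part r a b \<Delta>. \<exists>\<mu>'\<in>Sk_part r a b \<Delta> (Suc k). \<forall>u z0. (u, z0) \<in> Z_part r a b \<Delta> \<longrightarrow> \<mu> (u, z0, t) = \<mu>' (u, z0, t)"
    using S_part_piece[OF part t, of r] by blast
  obtain \<delta>1 where \<delta>1: "\<delta>1 > 0" "newton_within a b \<delta>1 e u z0 (Sk_part r a b \<Delta> (Suc k)) (\<lambda>u z. play r a b (u, z) t) t (real (Suc k))"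
    using Sk_part_newton_step[OF part r Z e k Sk_part_newton[OF part r Z e less_imp_le[OF k(1)]]] by blast
  obtain \<delta>3 where \<delta>3: "\<delta>3 > 0" "\<forall>u' z'. u' \<in> C_on a b \<longrightarrow> norm (u' - u) < \<delta>3 \<longrightarrow> (u', z') \<in> Z_part r a b \<Delta>"
    using Z_part_perturb[OF part Z] by blast
  show ?thesis
  proof (intro exI[of _ "min \<delta>1 \<delta>3"] conjI allI impI)
    show "0 < min \<delta>1 \<delta>3" using \<delta>1(1) \<delta>3(1) by simp
    fix u' z' B \<mu>
    assume u': "u' \<in> C_on a b" and n: "norm (u' - u) < min \<delta>1 \<delta>3"
      and z': "\<bar>z' - z0\<bar> < min \<delta>1 \<delta>3" and \<mu>: "\<mu> \<in> S_part r a b \<Delta>"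
      and B: "modulus_le a b e (u' - u) B"
    have Z': "(u', z') \<in> Z_part r a b \<Delta>" using \<delta>3(2) u' n by simp
    obtain \<mu>' where \<mu>': "\<mu>' \<in> Sk_part r a b \<Delta> (Suc k)" "\<mu> (u', z', t) = \<mu>' (u', z', t)"
      using piece \<mu> Z' by blast
    \<comment> \<open>The trivial case s = s' of the modulus condition shows that B is nonnegative,
      so the number of intervals up to t may be replaced by the total number.\<close>
    have "\<bar>(u' - u) t - (u' - u) t\<bar> \<le> B" using B[rule_format, OF t t] e by simp
    then have "0 \<le> B" by simp
    have "\<bar>play r a b (u', z') t - play r a b (u, z0) t - \<mu>' (u', z', t) (u' - u, z' - z0)\<bar> \<le> real (Suc k) * B"
      by (rule \<delta>1(2)[rule_format, OF u' _ _ \<mu>'(1)]) (use n z' B in auto)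
    also have "\<dots> \<le> real (npt \<Delta>) * B" using k(1) \<open>0 \<le> B\<close> by (intro mult_right_mono) auto
    finally show "\<bar>play r a b (u', z') t - play r a b (u, z0) t - \<mu> (u', z', t) (u' - u, z' - z0)\<bar> \<le> real (npt \<Delta>) * B"
      unfolding \<mu>'(2) .
  qed
qed

section \<open>Measurability with respect to the weak-star topology\<close>

lemma openin_weak_star_eval:
  "open U \<Longrightarrow> openin (subtopology strong_operator_topology D) {\<phi> \<in> D. blinfun_apply \<phi> h \<in> U}"
proof -
  assume "open U"
  then have "openin strong_operator_topology {\<phi> \<in> topspace strong_operator_topology. blinfun_apply \<phi> h \<in> U}"
    using openin_continuous_map_preimage[OF strong_operator_topology_continuous_evaluation] by fastforce
  then show ?thesis unfolding openin_subtopology strong_operator_topology_topspace by blast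
qed

lemma weak_star_borel_alt: "weak_star_borel D = sigma D {U. openin (subtopology strong_operator_topology D) U}"
  unfolding weak_star_borel_def borel_of_def by (simp add: strong_operator_topology_topspace)

lemma space_weak_star_borel: "space (weak_star_borel D) = D"
  unfolding weak_star_borel_alt by (rule space_measure_of) (auto dest: openin_imp_subset)

lemma weak_star_eval_measurable:
  assumes "\<psi> \<in> M \<rightarrow>\<^sub>M weak_star_borel D"
  shows "(\<lambda>x. blinfun_apply (\<psi> x) h) \<in> borel_measurable M"
proof (rule measurable_compose[OF assms])
  show "(\<lambda>\<phi>. blinfun_apply \<phi> h) \<in> borel_measurable (weak_star_borel D)"
  proof (rule borel_measurableI)
    fix U :: "real set" assume "open U"
    have "(\<lambda>\<phi>. blinfun_apply \<phi> h) -` U \<inter> space (weak_star_borel D) = {\<phi> \<in> D. blinfun_apply \<phi> h \<in> U}"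
      unfolding space_weak_star_borel by auto
    also have "\<dots> \<in> sets (weak_star_borel D)"
    proof -
      have "{U. openin (subtopology strong_operator_topology D) U} \<subseteq> Pow D"
        by (auto dest: openin_imp_subset)
      then have "sets (weak_star_borel D) = sigma_sets D {U. openin (subtopology strong_operator_topology D) U}"
        unfolding weak_star_borel_alt by (rule sets_measure_of)
      then show ?thesis
        by (simp only:) (intro sigma_sets.Basic CollectI openin_weak_star_eval[OF \<open>open U\<close>])
    qed
    finally show "(\<lambda>\<phi>. blinfun_apply \<phi> h) -` U \<inter> space (weak_star_borel D) \<in> sets (weak_star_borel D)" .
  qed
qed

text \<open>A weak-star neighbourhood tests finitely many points i. On a norm-bounded set each may
  be replaced by a nearby point of the sequence A at small cost. P is a map through which all
  functionals in D factor, so only its range has to be approximated.\<close>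

lemma weak_star_nhd_countable:
  fixes D :: "('a::real_normed_vector \<Rightarrow>\<^sub>L real) set" and A :: "nat \<Rightarrow> 'a"
  assumes fac: "\<And>\<phi> h. \<phi> \<in> D \<Longrightarrow> blinfun_apply \<phi> h = \<phi> (P h)"
    and dense: "\<And>h e. 0 < e \<Longrightarrow> \<exists>n. norm (P h - A n) < e"
    and V: "openin strong_operator_topology V" "\<phi> \<in> V" "\<phi> \<in> D" "norm \<phi> \<le> B"
  shows "\<exists>W. open W \<and> (\<lambda>n. blinfun_apply \<phi> (A n)) \<in> W \<and> (\<forall>\<phi>'\<in>D. norm \<phi>' \<le> B \<longrightarrow> (\<lambda>n. blinfun_apply \<phi>' (A n)) \<in> W \<longrightarrow> \<phi>' \<in> V)"
proof -
  obtain W' where W': "open W'" "V = blinfun_apply -` W'"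
    using V(1) unfolding strong_operator_topology_def openin_pullback_topology by auto
  then have "openin (product_topology (\<lambda>i. euclidean) UNIV) W'" "blinfun_apply \<phi> \<in> W'"
    using V(2) by (auto simp: open_fun_def)
  from product_topology_open_contains_basis[OF this] obtain X where X:
    "\<And>i. \<phi> i \<in> X i" "\<And>i. open (X i)" "finite {i. X i \<noteq> UNIV}" "(\<Pi>\<^sub>E i\<in>UNIV. X i) \<subseteq> W'" by auto
  let ?I = "{i. X i \<noteq> UNIV}"
  have "\<exists>e>0. ball (\<phi> i) e \<subseteq> X i" for i by (rule openE[OF X(2,1)]) blast
  then have "\<forall>i. \<exists>e>0. ball (\<phi> i) e \<subseteq> X i" by blast
  from choice[OF this] obtain e where "\<forall>i. e i > 0 \<and> ball (\<phi> i) (e i) \<subseteq> X i" ..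
  then have e: "\<And>i. 0 < e i" "\<And>i. ball (\<phi> i) (e i) \<subseteq> X i" by auto
  \<comment> \<open>The tolerance e i is split in three: moving \<phi> and \<phi>' from P i to A (n
    i), and comparing them at A (n i). Adding 1 to |B| keeps C positive.\<close>
  define C where "C = 3 * (\<bar>B\<bar> + 1)"
  have C: "0 < C" unfolding C_def by simp
  have "\<forall>i. \<exists>n. norm (P i - A n) < e i / C" using dense e(1) C by simp
  from choice[OF this] obtain n where n: "\<forall>i. norm (P i - A (n i)) < e i / C" ..
  define W where "W = {x :: nat \<Rightarrow> real. \<forall>i\<in>?I. x (n i) \<in> ball (\<phi> (A (n i))) (e i / 3)}"
  have "open W" unfolding W_def by (rule product_topology_basis'[OF X(3)]) simp
  moreover have "(\<lambda>n. \<phi> (A n)) \<in> W" unfolding W_def using e(1) by auto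
  moreover have "\<phi>' \<in> V" if \<phi>': "\<phi>' \<in> D" "norm \<phi>' \<le> B" "(\<lambda>n. blinfun_apply \<phi>' (A n)) \<in> W" for \<phi>'
  proof -
    have "\<phi>' i \<in> X i" for i
    proof (cases "i \<in> ?I")
      case True
      have small: "\<bar>\<xi> (P i) - \<xi> (A (n i))\<bar> < e i / 3" if "norm \<xi> \<le> B" for \<xi> :: "'a \<Rightarrow>\<^sub>L real"
      proof -
        have "\<bar>\<xi> (P i) - \<xi> (A (n i))\<bar> \<le> norm \<xi> * norm (P i - A (n i))"
          using norm_blinfun[of \<xi> "P i - A (n i)"] by (simp add: blinfun.diff_right)
        also have "\<dots> \<le> (\<bar>B\<bar> + 1) * norm (P i - A (n i))" using that by (intro mult_right_mono) auto
        also have "\<dots> < (\<bar>B\<bar> + 1) * (e i / C)" using n by (intro mult_strict_left_mono) auto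
        also have "\<bar>B\<bar> + 1 = C / 3" unfolding C_def by simp
        also have "C / 3 * (e i / C) = e i / 3" using C by simp
        finally show ?thesis .
      qed
      have "\<bar>\<phi>' (A (n i)) - \<phi> (A (n i))\<bar> < e i / 3"
        using \<phi>'(3) True unfolding W_def by (auto simp: dist_real_def abs_minus_commute)
      then have "\<bar>\<phi>' (P i) - \<phi> (P i)\<bar> < e i"
        using small[OF \<phi>'(2)] small[OF V(4)] by linarith
      then have "\<phi>' i \<in> ball (\<phi> i) (e i)"
        unfolding fac[OF \<phi>'(1), of i] fac[OF V(3), of i] by (simp add: dist_real_def abs_minus_commute)
      then show ?thesis using e(2) by blast
    qed auto
    then have "blinfun_apply \<phi>' \<in> W'" using X(4) by auto
    then show ?thesis unfolding W'(2) by simp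
  qed
  ultimately show ?thesis by blast
qed

text \<open>Under the map to the sequence of evaluations at A, the preimage of a weak-star open set
  is the preimage of an open set of sequences. A map into sequences is Borel as soon as its
  coordinates are.\<close>

theorem measurable_weak_star_borelI:
  fixes D :: "('a::real_normed_vector \<Rightarrow>\<^sub>L real) set" and A :: "nat \<Rightarrow> 'a"
  assumes fac: "\<And>\<phi> h. \<phi> \<in> D \<Longrightarrow> blinfun_apply \<phi> h = \<phi> (P h)"
    and dense: "\<And>h e. 0 < e \<Longrightarrow> \<exists>n. norm (P h - A n) < e"
    and \<psi>: "\<And>x. x \<in> space M \<Longrightarrow> \<psi> x \<in> D" "\<And>x. x \<in> space M \<Longrightarrow> norm (\<psi> x) \<le> B"
    and eval: "\<And>h. (\<lambda>x. blinfun_apply (\<psi> x) h) \<in> borel_measurable M"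
  shows "\<psi> \<in> M \<rightarrow>\<^sub>M weak_star_borel D"
  unfolding weak_star_borel_alt
proof (rule measurable_measure_of)
  show "{U. openin (subtopology strong_operator_topology D) U} \<subseteq> Pow D"
    by (auto dest: openin_imp_subset)
  show "\<psi> \<in> space M \<rightarrow> D" using \<psi>(1) by auto
  fix U assume "U \<in> {U. openin (subtopology strong_operator_topology D) U}"
  then obtain V where V: "openin strong_operator_topology V" "U = V \<inter> D"
    unfolding openin_subtopology by auto
  define W where "W = \<Union>{W. open W \<and> (\<forall>\<phi>\<in>D. norm \<phi> \<le> B \<longrightarrow> (\<lambda>n. blinfun_apply \<phi> (A n)) \<in> W \<longrightarrow> \<phi> \<in> V)}"
  have "open W" unfolding W_def by (rule open_Union) auto
  have "\<psi> x \<in> V \<longleftrightarrow> (\<lambda>n. \<psi> x (A n)) \<in> W" if "x \<in> space M" for x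
  proof
    assume "\<psi> x \<in> V"
    from weak_star_nhd_countable[OF fac dense V(1) this \<psi>(1)[OF that] \<psi>(2)[OF that]]
    show "(\<lambda>n. \<psi> x (A n)) \<in> W" unfolding W_def by blast
  qed (use \<psi> that in \<open>auto simp: W_def\<close>)
  then have "\<psi> -` U \<inter> space M = (\<lambda>x n. \<psi> x (A n)) -` W \<inter> space M"
    unfolding V(2) using \<psi>(1) by auto
  also have "\<dots> \<in> sets M"
  proof (rule measurable_sets)
    show "(\<lambda>x n. \<psi> x (A n)) \<in> borel_measurable M"
      by (rule measurable_coordinatewise_then_product) (rule eval)
  qed (use \<open>open W\<close> in simp)
  finally show "\<psi> -` U \<inter> space M \<in> sets M" .
qed

lemma C_on_separable:
  assumes "c \<le> d"
  shows "\<exists>A :: nat \<Rightarrow> cfun. \<forall>h e. 0 < e \<longrightarrow> (\<exists>n. norm (restr c d h - A n) < e)"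
proof -
  have "\<forall>i :: nat \<times> rat list. \<exists>v. v \<in> C_on c d \<and> (\<forall>t\<in>{c..d}. v t = poly (\<Sum>j\<le>fst i. monom (of_rat (snd i ! j)) j) t)"
  proof
    fix i :: "nat \<times> rat list"
    show "\<exists>v. v \<in> C_on c d \<and> (\<forall>t\<in>{c..d}. v t = poly (\<Sum>j\<le>fst i. monom (of_rat (snd i ! j)) j) t)"
      by (rule C_on_extend[OF assms]) (intro continuous_intros)
  qed
  from choice[OF this] obtain v where
    "\<forall>i. v i \<in> C_on c d \<and> (\<forall>t\<in>{c..d}. v i t = poly (\<Sum>j\<le>fst i. monom (of_rat (snd i ! j)) j) t)" ..
  then have v: "\<And>i. v i \<in> C_on c d"
    "\<And>i t. t \<in> {c..d} \<Longrightarrow> v i t = poly (\<Sum>j\<le>fst i. monom (of_rat (snd i ! j)) j) t" by blast+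
  show ?thesis
  proof (intro exI[of _ "\<lambda>n. v (from_nat n)"] allI impI)
    fix h :: cfun and e :: real assume "0 < e"
    then obtain m l where p: "\<forall>t\<in>{c..d}. \<bar>h t - poly (\<Sum>i\<le>m. monom (of_rat (l ! i)) i) t\<bar> < e / 2"
      using rational_polynomial_dense[of c d h "e / 2"] by auto
    have "norm (restr c d h - v (m, l)) \<le> e / 2"
    proof (rule norm_C_on_le[OF C_on_diff[OF restr_in_C_on[OF assms] v(1)] assms])
      fix t assume t: "t \<in> {c..d}"
      show "\<bar>(restr c d h - v (m, l)) t\<bar> \<le> e / 2"
        using bspec[OF p t] v(2)[OF t, of "(m, l)"] clamp_id[OF t] by simp
    qed
    then have "norm (restr c d h - v (from_nat (to_nat (m, l)))) < e" using \<open>0 < e\<close> by simp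
    then show "\<exists>n. norm (restr c d h - v (from_nat n)) < e" by blast
  qed
qed

lemma measurable_weak_star_C:
  assumes "c \<le> d" "\<And>x. x \<in> space M \<Longrightarrow> \<psi> x \<in> dual_C c d" "\<And>x. x \<in> space M \<Longrightarrow> norm (\<psi> x) \<le> B"
    and "\<And>h. (\<lambda>x. blinfun_apply (\<psi> x) h) \<in> borel_measurable M"
  shows "\<psi> \<in> M \<rightarrow>\<^sub>M weak_star_borel (dual_C c d)"
proof -
  obtain A :: "nat \<Rightarrow> cfun" where A: "\<forall>h e. 0 < e \<longrightarrow> (\<exists>n. norm (restr c d h - A n) < e)"
    using C_on_separable[OF assms(1)] by blast
  show ?thesis
  proof (rule measurable_weak_star_borelI[where P="restr c d" and A=A and B=B])
    show "blinfun_apply \<phi> h = \<phi> (restr c d h)" if "\<phi> \<in> dual_C c d" for \<phi> h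
      using that unfolding dual_C_def by simp
    show "\<exists>n. norm (restr c d h - A n) < e" if "0 < e" for h e
      using A that by simp
  qed (fact assms)+
qed

lemma measurable_weak_star_CR:
  assumes "c \<le> d" "\<And>x. x \<in> space M \<Longrightarrow> \<psi> x \<in> dual_CR c d" "\<And>x. x \<in> space M \<Longrightarrow> norm (\<psi> x) \<le> B"
    and "\<And>h y. h \<in> C_on c d \<Longrightarrow> (\<lambda>x. blinfun_apply (\<psi> x) (h, y)) \<in> borel_measurable M"
  shows "\<psi> \<in> M \<rightarrow>\<^sub>M weak_star_borel (dual_CR c d)"
proof -
  obtain A :: "nat \<Rightarrow> cfun" where A: "\<forall>h e. 0 < e \<longrightarrow> (\<exists>n. norm (restr c d h - A n) < e)"
    using C_on_separable[OF assms(1)] by blast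
  \<comment> \<open>Rational second components keep the dense set countable; \<open>from_nat\<close>
    enumerates all pairs.\<close>
  define A' :: "nat \<Rightarrow> cfun \<times> real" where
    "A' = (\<lambda>n. (A (fst (from_nat n :: nat \<times> rat)), of_rat (snd (from_nat n :: nat \<times> rat))))"
  show ?thesis
  proof (rule measurable_weak_star_borelI[where P="\<lambda>(h, y). (restr c d h, y)" and A=A' and B=B])
    fix h :: "cfun \<times> real" and e :: real assume "0 < e"
    obtain k y where h: "h = (k, y)" by (cases h)
    obtain n where n: "norm (restr c d k - A n) < e / 2" using A \<open>0 < e\<close> by (metis half_gt_zero)
    obtain q where "y < of_rat q" "of_rat q < y + e / 2"
      using of_rat_dense[of y "y + e / 2"] \<open>0 < e\<close> by auto
    then have "norm (y - of_rat q) < e / 2" by auto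
    then have "norm ((restr c d k, y) - A' (to_nat (n, q))) < e"
      using n norm_Pair_le[of "restr c d k - A n" "y - of_rat q"] by (simp add: A'_def)
    then show "\<exists>n. norm ((case h of (h, y) \<Rightarrow> (restr c d h, y)) - A' n) < e" unfolding h by auto
  next
    fix \<phi> :: "(cfun \<times> real) \<Rightarrow>\<^sub>L real" and h :: "cfun \<times> real"
    assume "\<phi> \<in> dual_CR c d"
    then show "\<phi> h = \<phi> (case h of (h, y) \<Rightarrow> (restr c d h, y))"
      unfolding dual_CR_def by (cases h) simp
  next
    fix h :: "cfun \<times> real"
    obtain k y where h: "h = (k, y)" by (cases h)
    have "(\<lambda>x. blinfun_apply (\<psi> x) (restr c d k, y)) \<in> borel_measurable M"
      by (rule assms(4)[OF restr_in_C_on[OF assms(1)]])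
    moreover have "blinfun_apply (\<psi> x) (restr c d k, y) = blinfun_apply (\<psi> x) h" if "x \<in> space M" for x
      using assms(2)[OF that] unfolding dual_CR_def h by simp
    ultimately show "(\<lambda>x. blinfun_apply (\<psi> x) h) \<in> borel_measurable M"
      by (simp cong: measurable_cong)
  qed (fact assms)+
qed

section \<open>Existence of measurable selectors\<close>

lemma continuous_on_F_int_time:
  fixes u :: cfun
  shows "continuous_on {c..d} (F_int c d u)"
  unfolding continuous_on_iff
proof (intro ballI allI impI)
  fix t and e :: real assume t: "t \<in> {c..d}" and e: "0 < e"
  have "uniformly_continuous_on {c..d} u" by (rule compact_uniformly_continuous) auto
  then obtain \<delta> where \<delta>: "\<delta> > 0" "\<And>s t. s \<in> {c..d} \<Longrightarrow> t \<in> {c..d} \<Longrightarrow> dist t s < \<delta> \<Longrightarrow> dist (u t) (u s) < e"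
    unfolding uniformly_continuous_on_def using e by metis
  have *: "\<bar>F_int c d u t - F_int c d u s\<bar> < e" if st: "s \<in> {c..d}" "t \<in> {c..d}" "s \<le> t" "t - s < \<delta>" for s t
  proof -
    obtain \<sigma> where \<sigma>: "\<sigma> \<in> {c..t}" "u \<sigma> = F_int c d u t" using F_int_attained_cfun[OF st(2)] by blast
    obtain \<tau> where \<tau>: "\<tau> \<in> {c..s}" "u \<tau> = F_int c d u s" using F_int_attained_cfun[OF st(1)] by blast
    have 1: "F_int c d u s \<le> F_int c d u t"
      unfolding \<tau>(2)[symmetric] by (rule F_int_ge) (use \<tau>(1) st in auto)
    have 2: "F_int c d u t < F_int c d u s + e"
    proof (cases "\<sigma> \<le> s")
      case True
      then have "u \<sigma> \<le> F_int c d u s" by (intro F_int_ge) (use \<sigma>(1) st in auto)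
      then show ?thesis using \<sigma>(2) e by simp
    next
      case False
      then have "dist (u \<sigma>) (u s) < e" using \<sigma>(1) st by (intro \<delta>(2)) (auto simp: dist_real_def)
      moreover have "u s \<le> F_int c d u s" by (rule F_int_ge) (use st in auto)
      ultimately show ?thesis using \<sigma>(2) by (simp add: dist_real_def)
    qed
    show ?thesis using 1 2 by simp
  qed
  show "\<exists>d'>0. \<forall>x'\<in>{c..d}. dist x' t < d' \<longrightarrow> dist (F_int c d u x') (F_int c d u t) < e"
  proof (intro exI[of _ \<delta>] conjI ballI impI \<delta>(1))
    fix s assume s: "s \<in> {c..d}" "dist s t < \<delta>"
    show "dist (F_int c d u s) (F_int c d u t) < e"
      using *[of s t] *[of t s] s t by (cases "s \<le> t") (auto simp: dist_real_def abs_minus_commute)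
  qed
qed

text \<open>Joint continuity follows from continuity in t for fixed u together with a Lipschitz
  bound in u that is uniform in t.\<close>

lemma continuous_on_F_int: "continuous_on (UNIV \<times> {c..d}) (\<lambda>(u :: cfun, t). F_int c d u t)"
  unfolding continuous_on_iff
proof (intro ballI allI impI)
  fix x :: "cfun \<times> real" and e :: real assume x: "x \<in> UNIV \<times> {c..d}" and e: "0 < e"
  obtain u t where [simp]: "x = (u, t)" by (cases x)
  have t: "t \<in> {c..d}" using x by simp
  obtain \<delta> where \<delta>: "\<delta> > 0" "\<And>s. s \<in> {c..d} \<Longrightarrow> dist s t < \<delta> \<Longrightarrow> dist (F_int c d u s) (F_int c d u t) < e / 2"
    using continuous_on_F_int_time[of c d u] t e unfolding continuous_on_iff by (metis half_gt_zero)
  show "\<exists>d'>0. \<forall>x'\<in>UNIV \<times> {c..d}. dist x' x < d' \<longrightarrow>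
      dist (case x' of (u, t) \<Rightarrow> F_int c d (apply_bcontfun u) t) (case x of (u, t) \<Rightarrow> F_int c d (apply_bcontfun u) t) < e"
  proof (intro exI[of _ "min \<delta> (e / 2)"] conjI ballI impI)
    fix x' :: "cfun \<times> real" assume x': "x' \<in> UNIV \<times> {c..d}" "dist x' x < min \<delta> (e / 2)"
    obtain v s where [simp]: "x' = (v, s)" by (cases x')
    have s: "s \<in> {c..d}" using x' by simp
    have d: "dist v u < e / 2" "dist s t < \<delta>"
      using dist_fst_le[of x' x] dist_snd_le[of x' x] x'(2) by auto
    have "\<bar>F_int c d v s - F_int c d u s\<bar> \<le> dist v u"
      by (rule F_int_Lipschitz) (use s dist_apply_le[of v _ u] in \<open>auto simp: dist_real_def\<close>)
    moreover have "\<bar>F_int c d u s - F_int c d u t\<bar> < e / 2" using \<delta>(2)[OF s d(2)] by (simp add: dist_real_def)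
    ultimately have "\<bar>F_int c d v s - F_int c d u t\<bar> < e" using d(1) by linarith
    then show "dist (case x' of (u, t) \<Rightarrow> F_int c d (apply_bcontfun u) t) (case x of (u, t) \<Rightarrow> F_int c d (apply_bcontfun u) t) < e"
      by (simp add: dist_real_def)
  qed (use \<delta> e in simp)
qed

definition argmax_last :: "real \<Rightarrow> real \<Rightarrow> cfun \<times> real \<Rightarrow> real" where
  "argmax_last c d = (\<lambda>(u, t). Sup (M_int c d (apply_bcontfun u) t))"

lemma argmax_last_props:
  fixes u :: cfun
  assumes t: "t \<in> {c..d}"
  shows "argmax_last c d (u, t) \<in> M_int c d u t" "s \<in> M_int c d u t \<Longrightarrow> s \<le> argmax_last c d (u, t)"
proof -
  have eq: "M_int c d u t = {c..t} \<inter> {s. u s = F_int c d u t}" using t unfolding M_int_def by auto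
  have cl: "closed (M_int c d u t)" unfolding eq by (intro closed_Int closed_Collect_eq) auto
  have ne: "M_int c d u t \<noteq> {}" unfolding eq using F_int_attained_cfun[OF t, of u] by blast
  have bdd: "bdd_above (M_int c d u t)" unfolding eq by (rule bdd_aboveI[of _ t]) auto
  show "argmax_last c d (u, t) \<in> M_int c d u t"
    unfolding argmax_last_def using closed_contains_Sup[OF ne bdd cl] by simp
  show "s \<in> M_int c d u t \<Longrightarrow> s \<le> argmax_last c d (u, t)"
    unfolding argmax_last_def using cSup_upper[OF _ bdd] by simp
qed

text \<open>The last maximiser is at or after x exactly when the maximum is already reached on
  [x, t]. This compares two functions that are jointly continuous in (u, t), which makes the
  superlevel sets of \<open>argmax_last\<close> measurable.\<close>

lemma argmax_last_ge_iff:
  fixes u :: cfun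
  assumes t: "t \<in> {c..d}" and x: "c \<le> x"
  shows "x \<le> argmax_last c d (u, t) \<longleftrightarrow> x \<le> t \<and> F_int c d u t \<le> F_int x d u t"
proof
  assume le: "x \<le> argmax_last c d (u, t)"
  have m: "argmax_last c d (u, t) \<le> t" "u (argmax_last c d (u, t)) = F_int c d u t"
    using argmax_last_props(1)[OF t, of u] unfolding M_int_def by auto
  have "u (argmax_last c d (u, t)) \<le> F_int x d u t"
    by (rule F_int_ge) (use le m t in auto)
  then show "x \<le> t \<and> F_int c d u t \<le> F_int x d u t" using le m by simp
next
  assume *: "x \<le> t \<and> F_int c d u t \<le> F_int x d u t"
  then have t': "t \<in> {x..d}" using t by auto
  obtain s where s: "s \<in> {x..t}" "u s = F_int x d u t" using F_int_attained_cfun[OF t'] by blast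
  have "u s \<le> F_int c d u t" by (rule F_int_ge) (use s t x in auto)
  then have "s \<in> M_int c d u t" unfolding M_int_def using s * t x by auto
  from argmax_last_props(2)[OF t this] show "x \<le> argmax_last c d (u, t)" using s(1) by simp
qed

lemma argmax_last_measurable:
  "argmax_last c d \<in> borel_measurable (restrict_space borel (C_on c d \<times> {c..d}))"
  unfolding borel_measurable_iff_ge
proof
  fix x
  let ?\<Omega> = "C_on c d \<times> {c..d}"
  have sp: "space (restrict_space borel ?\<Omega>) = ?\<Omega>" by (simp add: space_restrict_space)
  show "{w \<in> space (restrict_space borel ?\<Omega>). x \<le> argmax_last c d w} \<in> sets (restrict_space borel ?\<Omega>)"
  proof (cases "c \<le> x")
    case True
    let ?S = "{w \<in> (UNIV :: cfun set) \<times> {x..d}. (case w of (u :: cfun, t) \<Rightarrow> F_int c d u t) \<le> (case w of (u :: cfun, t) \<Rightarrow> F_int x d u t)}"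
    have "closed ?S"
    proof (rule continuous_on_closed_Collect_le)
      show "continuous_on ((UNIV :: cfun set) \<times> {x..d}) (\<lambda>(u :: cfun, t). F_int c d u t)"
        by (rule continuous_on_subset[OF continuous_on_F_int]) (use True in auto)
    qed (rule continuous_on_F_int, intro closed_Times closed_UNIV closed_atLeastAtMost)
    moreover have "{w \<in> ?\<Omega>. x \<le> argmax_last c d w} = ?\<Omega> \<inter> ?S"
      by (auto simp: argmax_last_ge_iff[OF _ True])
    ultimately show ?thesis unfolding sp sets_restrict_space by (auto intro!: imageI)
  next
    case False
    have "x \<le> argmax_last c d w" if "w \<in> ?\<Omega>" for w
    proof -
      obtain u t where w: "w = (u, t)" by (cases w)
      have "argmax_last c d (u, t) \<in> M_int c d u t" by (rule argmax_last_props) (use that w in auto)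
      then show ?thesis unfolding w M_int_def using False by auto
    qed
    then have "{w \<in> space (restrict_space borel ?\<Omega>). x \<le> argmax_last c d w} = space (restrict_space borel ?\<Omega>)"
      unfolding sp by auto
    then show ?thesis by (simp only: sets.top)
  qed
qed

lemma bounded_linear_eval: "bounded_linear (\<lambda>h :: cfun. apply_bcontfun h s)"
  by (rule bounded_linear_intro[where K=1]) (auto simp: abs_apply_le_norm)

lemma blinfun_apply_eval: "blinfun_apply (Blinfun (\<lambda>h :: cfun. apply_bcontfun h s)) = (\<lambda>h. h s)"
  by (rule bounded_linear_Blinfun_apply[OF bounded_linear_eval])

lemma eval_in_\<Phi>_int:
  fixes u :: cfun
  assumes t: "t \<in> {c..d}" and s: "s \<in> M_int c d u t"
  shows "Blinfun (\<lambda>h :: cfun. apply_bcontfun h s) \<in> \<Phi>_int c d u t"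
proof -
  let ?E = "Blinfun (\<lambda>h :: cfun. apply_bcontfun h s)"
  have s': "s \<in> {c..d}" using s unfolding M_int_def by auto
  have "norm ?E \<le> 1"
    by (rule norm_blinfun_bound) (auto simp: blinfun_apply_eval abs_apply_le_norm)
  moreover have "1 \<le> norm ?E * norm (const_bcontfun 1 :: cfun)"
    using norm_blinfun[of ?E "const_bcontfun 1"] by (simp add: blinfun_apply_eval)
  then have "1 \<le> norm ?E"
    using norm_const_bcontfun_one mult_left_mono[OF norm_const_bcontfun_one norm_ge_zero[of ?E]] by linarith
  moreover have "supp c d ?E \<subseteq> {s}"
  proof
    fix x assume x: "x \<in> supp c d ?E"
    show "x \<in> {s}"
    proof (rule ccontr)
      assume "x \<notin> {s}"
      then have "open (- {s})" "x \<in> - {s}" by auto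
      then obtain h :: cfun where "\<forall>t\<in>{c..d} - - {s}. h t = 0" "?E h \<noteq> 0"
        using x unfolding supp_def by blast
      then show False using s' by (auto simp: blinfun_apply_eval)
    qed
  qed
  ultimately show ?thesis
    unfolding \<Phi>_int_def dual_C_def using s s' by (auto simp: blinfun_apply_eval clamp_id)
qed

text \<open>The Dirac measure at the last maximiser is a measurable selector. Such selectors have to
  be exhibited because a Newton derivative must have nonempty values.\<close>

lemma S\<Phi>_int_nonempty:
  assumes "c \<le> d"
  shows "(\<lambda>x. Blinfun (\<lambda>h :: cfun. apply_bcontfun h (argmax_last c d x))) \<in> S\<Phi>_int c d"
proof -
  let ?\<Omega> = "C_on c d \<times> {c..d}"
  have \<Phi>: "Blinfun (\<lambda>h :: cfun. apply_bcontfun h (argmax_last c d (u, t))) \<in> \<Phi>_int c d u t" if "t \<in> {c..d}" for u t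
    by (rule eval_in_\<Phi>_int[OF that argmax_last_props(1)[OF that]])
  have "(\<lambda>x. Blinfun (\<lambda>h :: cfun. apply_bcontfun h (argmax_last c d x)))
      \<in> restrict_space borel ?\<Omega> \<rightarrow>\<^sub>M weak_star_borel (dual_C c d)"
  proof (rule measurable_weak_star_C[where B=1, OF assms])
    fix x assume "x \<in> space (restrict_space borel ?\<Omega>)"
    then have "x \<in> ?\<Omega>" by (simp add: space_restrict_space)
    then obtain u t where "x = (u, t)" "t \<in> {c..d}" by auto
    then show "Blinfun (\<lambda>h :: cfun. apply_bcontfun h (argmax_last c d x)) \<in> dual_C c d"
      "norm (Blinfun (\<lambda>h :: cfun. apply_bcontfun h (argmax_last c d x))) \<le> 1"
      using \<Phi>[of t u] unfolding \<Phi>_int_def by auto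
  next
    fix h :: cfun
    have "apply_bcontfun h \<in> borel_measurable borel" by (rule borel_measurable_continuous_onI) auto
    from measurable_compose[OF argmax_last_measurable this]
    show "(\<lambda>x. Blinfun (\<lambda>h :: cfun. apply_bcontfun h (argmax_last c d x)) h) \<in> borel_measurable (restrict_space borel ?\<Omega>)"
      unfolding blinfun_apply_eval .
  qed
  then show ?thesis unfolding S\<Phi>_int_def using \<Phi> by auto
qed

text \<open>The delicate point is the overlap of the two branches, where one value has to satisfy
  both formulas. There both arguments of l are negative, so l vanishes and both formulas give
  \<eta>.\<close>

lemma S_int_nonempty:
  assumes "c \<le> d"
  shows "S_int r c d \<noteq> {}"
proof -
  define l :: "real \<Rightarrow> real" where "l = (\<lambda>x. if 0 < x then 1 else 0)"
  have l: "l \<in> S_H" unfolding S_H_def l_def by auto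
  obtain \<mu> where \<mu>: "\<mu> \<in> S\<Phi>_int c d" using S\<Phi>_int_nonempty[OF assms] by blast
  define br :: "real \<Rightarrow> (cfun \<Rightarrow>\<^sub>L real) \<Rightarrow> ((cfun \<times> real) \<Rightarrow>\<^sub>L real)" where
    "br = (\<lambda>k \<phi>. Blinfun (\<lambda>x. snd x + k * (\<phi> (fst x) - \<phi> (const_bcontfun 1) * snd x)))"
  have br: "br k \<phi> (h, \<eta>) = \<eta> + k * \<phi> (h - const_bcontfun \<eta>)" for k \<phi> h \<eta>
  proof -
    have "bounded_linear (\<lambda>x :: cfun \<times> real. snd x + k * (\<phi> (fst x) - \<phi> (const_bcontfun 1) * snd x))"
      by (intro bounded_linear_add bounded_linear_sub bounded_linear_const_mult bounded_linear_snd
        bounded_linear_compose[OF blinfun.bounded_linear_right bounded_linear_fst])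
    then show ?thesis
      unfolding br_def const_bcontfun_eq_scaleR[of \<eta>]
      by (simp add: bounded_linear_Blinfun_apply blinfun.bilinear_simps)
  qed
  have br_dual: "br k \<phi> \<in> dual_CR c d" if "\<phi> \<in> dual_C c d" for k \<phi>
  proof -
    have "\<phi> (h - const_bcontfun \<eta>) = \<phi> (restr c d h - const_bcontfun \<eta>)" for h \<eta>
    proof -
      have "\<phi> h = \<phi> (restr c d h)" using that unfolding dual_C_def by blast
      then show ?thesis by (simp add: blinfun.diff_right)
    qed
    then show ?thesis unfolding dual_CR_def by (auto simp: br)
  qed
  define \<nu> where "\<nu> = (\<lambda>(u :: cfun, p, t). if (u, p) \<in> Z_plus r c d then br (l (F_int c d (\<lambda>s. u s - p - r) t)) (\<mu> (u, t))
      else br (l (F_int c d (\<lambda>s. - u s + p - r) t)) (\<mu> (- u, t)))"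
  have "\<nu> \<in> S_int r c d"
    unfolding S_int_def
  proof (intro CollectI bexI[OF _ l] bexI[OF _ \<mu>], clarify, intro conjI ballI allI impI)
    fix u :: cfun and p t assume Z: "(u, p) \<in> Z_int r c d" and t: "t \<in> {c..d}"
    have u: "u \<in> C_on c d" using Z unfolding Z_int_def by auto
    have d: "\<mu> (v, t) \<in> dual_C c d" if "v \<in> C_on c d" for v
      using \<mu> t that unfolding S\<Phi>_int_def \<Phi>_int_def by auto
    show "\<nu> (u, p, t) \<in> dual_CR c d"
      unfolding \<nu>_def using br_dual d[OF u] d[OF C_on_uminus[OF u]] by simp
    fix h :: cfun and \<eta>
    show "\<nu> (u, p, t) (h, \<eta>) = \<eta> + l (F_int c d (\<lambda>s. u s - p - r) t) * \<mu> (u, t) (h - const_bcontfun \<eta>)"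
      if "(u, p) \<in> Z_plus r c d"
      using that unfolding \<nu>_def by (simp add: br)
    show "\<nu> (u, p, t) (h, \<eta>) = \<eta> + l (F_int c d (\<lambda>s. - u s + p - r) t) * \<mu> (- u, t) (h - const_bcontfun \<eta>)"
      if m: "(u, p) \<in> Z_minus r c d"
    proof (cases "(u, p) \<in> Z_plus r c d")
      case True
      have "l (F_int c d (\<lambda>s. u s - p - r) t) = 0" "l (F_int c d (\<lambda>s. - u s + p - r) t) = 0"
        unfolding F_int_shift[OF t] l_def using w_plus_minus_agree(3,4)[OF assms True m t] by simp_all
      then show ?thesis using True unfolding \<nu>_def by (simp add: br)
    next
      case False then show ?thesis unfolding \<nu>_def by (simp add: br)
    qed
  qed
  then show ?thesis by blast
qed

lemma bounded_linear_restr: "bounded_linear (restr c d)"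
  by (rule bounded_linear_intro[where K=1]) (auto simp: restr_add restr_scaleR norm_restr_le)

lemma restr_restr:
  assumes "a \<le> c" "c \<le> d" "d \<le> b"
  shows "restr c d (restr a b h) = restr c d h"
  by (rule bcontfun_eqI) (use assms in \<open>simp add: max_def min_def\<close>)

lemma Sk_part_nonempty:
  assumes part: "is_partition a b \<Delta>" "a < b" and "k \<le> npt \<Delta>"
  shows "Sk_part r a b \<Delta> k \<noteq> {}"
  using assms(3)
proof (induction k)
  case 0
  define l :: "real \<Rightarrow> real" where "l = (\<lambda>x. if \<bar>x\<bar> < r then 1 else 0)"
  have l: "l \<in> S_R r" unfolding S_R_def l_def by auto
  define \<mu> :: functional_map where
    "\<mu> = (\<lambda>(u, z0, t). Blinfun (\<lambda>x. apply_bcontfun (fst x) a - l z0 * snd x))"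
  have \<mu>: "\<mu> (u, z0, t) (h, y) = h a - l z0 * y" for u z0 t and h :: cfun and y
  proof -
    have "bounded_linear (\<lambda>x :: cfun \<times> real. apply_bcontfun (fst x) a - l z0 * snd x)"
      by (intro bounded_linear_sub bounded_linear_const_mult bounded_linear_snd
        bounded_linear_compose[OF bounded_linear_eval bounded_linear_fst])
    then show ?thesis unfolding \<mu>_def by (simp add: bounded_linear_Blinfun_apply)
  qed
  have "\<mu> \<in> Sk_part r a b \<Delta> 0"
    unfolding Sk_part.simps
    by (intro CollectI bexI[OF _ l]) (use assms(2) in \<open>auto simp: \<mu> dual_CR_def\<close>)
  then show ?case by blast
next
  case (Suc k)
  then have k: "k < npt \<Delta>" by simp
  let ?c = "pt \<Delta> k" and ?d = "pt \<Delta> (Suc k)"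
  note s = pt_Suc_less[OF part k]
  obtain \<mu>' where \<mu>': "\<mu>' \<in> Sk_part r a b \<Delta> k" using Suc by auto
  obtain \<nu> where \<nu>: "\<nu> \<in> S_int r ?c ?d" using S_int_nonempty[of ?c ?d r] s by auto
  define \<mu> :: functional_map where
    "\<mu> = (\<lambda>(u, z0, t). Blinfun (\<lambda>x. \<nu> (restr ?c ?d u, w_part r \<Delta> k u z0, t) (restr ?c ?d (fst x), \<mu>' (u, z0, ?c) x)))"
  have \<mu>: "\<mu> (u, z0, t) x = \<nu> (restr ?c ?d u, w_part r \<Delta> k u z0, t) (restr ?c ?d (fst x), \<mu>' (u, z0, ?c) x)" for u z0 t x
  proof -
    have "bounded_linear (\<lambda>x :: cfun \<times> real. \<nu> (restr ?c ?d u, w_part r \<Delta> k u z0, t) (restr ?c ?d (fst x), \<mu>' (u, z0, ?c) x))"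
      by (intro bounded_linear_compose[OF blinfun.bounded_linear_right] bounded_linear_Pair
        bounded_linear_compose[OF bounded_linear_restr bounded_linear_fst] blinfun.bounded_linear_right)
    then show ?thesis unfolding \<mu>_def by (simp add: bounded_linear_Blinfun_apply)
  qed
  \<comment> \<open>The new functional depends on h through a restriction and through the previous
    functional, so the latter must factor through the restriction to [a, b] as well.\<close>
  have dual': "\<mu>' (u, z0, ?c) (h, y) = \<mu>' (u, z0, ?c) (restr a b h, y)" if "(u, z0) \<in> Z_part r a b \<Delta>" for u z0 h y
  proof -
    have "\<mu>' (u, z0, ?c) \<in> dual_CR a b"
    proof (cases k)
      case 0 then show ?thesis using \<mu>' that by auto
    next
      case (Suc j)
      then have "?c \<in> {pt \<Delta> j..pt \<Delta> (Suc j)}" using pt_Suc_less[OF part, of j] k by auto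
      then show ?thesis using \<mu>' that unfolding Suc by auto
    qed
    then show ?thesis unfolding dual_CR_def by blast
  qed
  have "\<mu> \<in> Sk_part r a b \<Delta> (Suc k)"
    unfolding Sk_part.simps
  proof (intro CollectI bexI[OF _ \<nu>] bexI[OF _ \<mu>'], clarify, intro conjI ballI allI)
    fix u z0 t assume Z: "(u, z0) \<in> Z_part r a b \<Delta>"
    show "\<mu> (u, z0, t) \<in> dual_CR a b"
      unfolding dual_CR_def using dual'[OF Z] restr_restr[of a ?c ?d b] s by (auto simp: \<mu>)
  qed (simp add: \<mu>)
  then show ?case by blast
qed

lemma S_part_nonempty:
  assumes part: "is_partition a b \<Delta>" "a < b"
  shows "S_part r a b \<Delta> \<noteq> {}"
proof -
  have "\<forall>k\<in>{1..npt \<Delta>}. \<exists>\<mu>. \<mu> \<in> Sk_part r a b \<Delta> k" using Sk_part_nonempty[OF part] by (simp add: ex_in_conv)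
  from bchoice[OF this] obtain \<mu>k where \<mu>k: "\<forall>k\<in>{1..npt \<Delta>}. \<mu>k k \<in> Sk_part r a b \<Delta> k" ..
  \<comment> \<open>The index of the interval containing t. The first interval is closed; afterwards
    a node belongs to the interval on its left, hence the least index.\<close>
  define K where "K t = (if t \<le> pt \<Delta> 1 then 1 else (LEAST k. t \<le> pt \<Delta> k))" for t
  have K: "K t = k" if "k \<in> {2..npt \<Delta>}" "t \<in> {pt \<Delta> (k - 1)<..pt \<Delta> k}" for k t
  proof -
    have "\<not> t \<le> pt \<Delta> j" if "j < k" for j
    proof -
      have "j < k - 1 \<or> j = k - 1" "k - 1 \<le> npt \<Delta>" using that \<open>k \<in> {2..npt \<Delta>}\<close> by auto
      then have "pt \<Delta> j \<le> pt \<Delta> (k - 1)"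
        using pt_less[OF part, of j "k - 1"] by (metis less_eq_real_def)
      then show ?thesis using \<open>t \<in> {pt \<Delta> (k - 1)<..pt \<Delta> k}\<close> by auto
    qed
    then have "\<not> t \<le> pt \<Delta> 1" "(LEAST k. t \<le> pt \<Delta> k) = k"
      using that by (auto intro!: Least_equality leI)
    then show ?thesis unfolding K_def by simp
  qed
  define \<mu> :: functional_map where "\<mu> = (\<lambda>x. \<mu>k (K (snd (snd x))) x)"
  have 1: "\<forall>t\<in>{pt \<Delta> 0..pt \<Delta> 1}. \<mu> (u, z0, t) = \<mu>k 1 (u, z0, t)" for u z0
    unfolding \<mu>_def K_def by simp
  have 2: "\<forall>k\<in>{2..npt \<Delta>}. \<forall>t\<in>{pt \<Delta> (k - 1)<..pt \<Delta> k}. \<mu> (u, z0, t) = \<mu>k k (u, z0, t)" for u z0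
    unfolding \<mu>_def using K by simp
  have "\<mu> \<in> S_part r a b \<Delta>"
    unfolding S_part_def
  proof (intro CollectI exI[of _ \<mu>k] conjI \<mu>k ballI)
    fix x assume "x \<in> Z_part r a b \<Delta>"
    show "case x of (u, z0) \<Rightarrow> (\<forall>t\<in>{pt \<Delta> 0..pt \<Delta> 1}. \<mu> (u, z0, t) = \<mu>k 1 (u, z0, t)) \<and>
        (\<forall>k\<in>{2..npt \<Delta>}. \<forall>t\<in>{pt \<Delta> (k - 1)<..pt \<Delta> k}. \<mu> (u, z0, t) = \<mu>k k (u, z0, t))"
      unfolding case_prod_beta using 1 2 by blast
  qed
  then show ?thesis by blast
qed

section \<open>Measurability of the functionals\<close>

lemma S_H_measurable: "l \<in> S_H \<Longrightarrow> l \<in> borel_measurable borel"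
proof -
  assume l: "l \<in> S_H"
  have "l = (\<lambda>x. if x < 0 then 0 else if x = 0 then l 0 else 1)"
  proof
    fix x show "l x = (if x < 0 then 0 else if x = 0 then l 0 else 1)"
      using l unfolding S_H_def by (cases x "0 :: real" rule: linorder_cases) auto
  qed
  then show ?thesis by (subst \<open>l = _\<close>) measurable
qed

lemma S_R_measurable: "l \<in> S_R r \<Longrightarrow> l \<in> borel_measurable borel"
proof -
  assume l: "l \<in> S_R r"
  have "l = (\<lambda>x. if \<bar>x\<bar> < r then 1 else if x = r then l r else if x = - r then l (- r) else 0)"
  proof
    fix x show "l x = (if \<bar>x\<bar> < r then 1 else if x = r then l r else if x = - r then l (- r) else 0)"
      using l unfolding S_R_def by (cases "\<bar>x\<bar> < r"; cases "x = r"; cases "x = - r"; cases "\<bar>x\<bar> > r") (auto simp: abs_if split: if_splits)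
  qed
  then show ?thesis by (subst \<open>l = _\<close>) measurable
qed

lemma F_int_measurable:
  fixes U :: "'x \<Rightarrow> cfun"
  assumes "(\<lambda>x. (U x, t x)) \<in> borel_measurable M" "\<And>x. x \<in> space M \<Longrightarrow> t x \<in> {c..d}"
  shows "(\<lambda>x. F_int c d (U x) (t x)) \<in> borel_measurable M"
proof -
  have 1: "(\<lambda>x. (U x, t x)) \<in> M \<rightarrow>\<^sub>M restrict_space borel (UNIV \<times> {c..d})"
    by (rule measurable_restrict_space2[OF _ assms(1)]) (use assms(2) in auto)
  have 2: "(\<lambda>(u :: cfun, t). F_int c d u t) \<in> borel_measurable (restrict_space borel (UNIV \<times> {c..d}))"
    by (rule borel_measurable_continuous_on_restrict[OF continuous_on_F_int])
  from measurable_compose[OF 1 2] show ?thesis by simp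
qed

text \<open>Replaces a condition on all t by one inequality in p and the maximum of -u over the
  interval, so that the choice of the branch is measurable.\<close>

lemma Z_plus_F_int_iff:
  fixes u :: cfun
  assumes "c \<le> d" "(u, p) \<in> Z_int r c d"
  shows "(u, p) \<in> Z_plus r c d \<longleftrightarrow> p + F_int c d (- u) d < r"
proof -
  have d: "d \<in> {c..d}" using assms(1) by simp
  obtain s where s: "s \<in> {c..d}" "(- u) s = F_int c d (- u) d" using F_int_attained_cfun[OF d] by blast
  have "(- u) t \<le> F_int c d (- u) d" if "t \<in> {c..d}" for t
    by (rule F_int_ge[OF continuous_on_apply_bcontfun d that])
  then have le: "- u t \<le> F_int c d (- u) d" if "t \<in> {c..d}" for t using that by simp
  show ?thesis
  proof
    assume "(u, p) \<in> Z_plus r c d"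
    then have "p < u s + r" using s(1) unfolding Z_plus_iff[OF assms(1)] by blast
    then show "p + F_int c d (- u) d < r" using s(2) by simp
  next
    assume *: "p + F_int c d (- u) d < r"
    have "p < u t + r" if "t \<in> {c..d}" for t using * le[OF that] by linarith
    then show "(u, p) \<in> Z_plus r c d" unfolding Z_plus_iff[OF assms(1)] using assms(2) by blast
  qed
qed

lemma S\<Phi>_int_eval_measurable:
  fixes U :: "'x \<Rightarrow> cfun"
  assumes "\<mu> \<in> S\<Phi>_int c d" "(\<lambda>x. (U x, t x)) \<in> borel_measurable M"
    and "\<And>x. x \<in> space M \<Longrightarrow> U x \<in> C_on c d \<and> t x \<in> {c..d}"
  shows "(\<lambda>x. blinfun_apply (\<mu> (U x, t x)) h) \<in> borel_measurable M"
proof -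
  have 1: "(\<lambda>x. (U x, t x)) \<in> M \<rightarrow>\<^sub>M restrict_space borel (C_on c d \<times> {c..d})"
    by (rule measurable_restrict_space2[OF _ assms(2)]) (use assms(3) in auto)
  have 2: "\<mu> \<in> restrict_space borel (C_on c d \<times> {c..d}) \<rightarrow>\<^sub>M weak_star_borel (dual_C c d)"
    using assms(1) unfolding S\<Phi>_int_def by simp
  show ?thesis by (rule weak_star_eval_measurable[OF measurable_compose[OF 1 2]])
qed

text \<open>All arguments are arbitrary measurable functions on an abstract space, so that the
  recursion along the partition can insert node values and node functionals for p and
  \<eta>.\<close>

lemma S_int_measurable:
  fixes U :: "'x \<Rightarrow> cfun"
  assumes \<nu>: "\<nu> \<in> S_int r c d" and cd: "c \<le> d" and h: "h \<in> C_on c d"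
    and Ut: "(\<lambda>x. (U x, t x)) \<in> borel_measurable M"
    and p [measurable]: "p \<in> borel_measurable M" and \<eta> [measurable]: "\<eta> \<in> borel_measurable M"
    and Z: "\<And>x. x \<in> space M \<Longrightarrow> (U x, p x) \<in> Z_int r c d" and t: "\<And>x. x \<in> space M \<Longrightarrow> t x \<in> {c..d}"
  shows "(\<lambda>x. \<nu> (U x, p x, t x) (h, \<eta> x)) \<in> borel_measurable M"
proof -
  obtain lp lm \<mu>p \<mu>m where l: "lp \<in> S_H" "lm \<in> S_H" and \<mu>: "\<mu>p \<in> S\<Phi>_int c d" "\<mu>m \<in> S\<Phi>_int c d"
    and eq: "\<forall>(u :: cfun, p) \<in> Z_int r c d. \<forall>t \<in> {c..d}.
       \<nu> (u, p, t) \<in> dual_CR c d \<and>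
       (\<forall>h \<in> C_on c d. \<forall>\<eta>.
         ((u, p) \<in> Z_plus r c d \<longrightarrow>
            \<nu> (u, p, t) (h, \<eta>) =
              \<eta> + lp (F_int c d (\<lambda>s. u s - p - r) t) * \<mu>p (u, t) (h - const_bcontfun \<eta>)) \<and>
         ((u, p) \<in> Z_minus r c d \<longrightarrow>
            \<nu> (u, p, t) (h, \<eta>) =
              \<eta> + lm (F_int c d (\<lambda>s. - u s + p - r) t) * \<mu>m (- u, t) (h - const_bcontfun \<eta>)))"
    using \<nu> unfolding S_int_def by blast
  have C: "U x \<in> C_on c d" if "x \<in> space M" for x using Z[OF that] unfolding Z_int_def by simp
  have nUt: "(\<lambda>x. (- U x, t x)) \<in> borel_measurable M"
  proof -
    have "(\<lambda>x :: cfun \<times> real. (- fst x, snd x)) \<in> borel_measurable borel"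
      by (intro borel_measurable_continuous_onI continuous_intros)
    from measurable_compose[OF Ut this] show ?thesis by simp
  qed
  have nUd: "(\<lambda>x. (- U x, d)) \<in> borel_measurable M"
  proof -
    have "(\<lambda>x :: cfun \<times> real. (- fst x, d)) \<in> borel_measurable borel"
      by (intro borel_measurable_continuous_onI continuous_intros)
    from measurable_compose[OF Ut this] show ?thesis by simp
  qed
  \<comment> \<open>Since \<eta> varies with x, the tested function varies too; linearity leaves
    only the two fixed test functions h and 1.\<close>
  have const: "\<mu> (h - const_bcontfun k) = \<mu> h - k * \<mu> (const_bcontfun 1)" for \<mu> :: "cfun \<Rightarrow>\<^sub>L real" and k
    by (subst const_bcontfun_eq_scaleR) (simp add: blinfun.bilinear_simps)
  note [measurable] = F_int_measurable[OF Ut t] F_int_measurable[OF nUt t] S_H_measurable[OF l(1)] S_H_measurable[OF l(2)]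
  have [measurable]: "(\<lambda>x. F_int c d (- U x) d) \<in> borel_measurable M"
    by (rule F_int_measurable[OF nUd]) (use cd in simp)
  have [measurable]: "(\<lambda>x. blinfun_apply (\<mu>p (U x, t x)) k) \<in> borel_measurable M" for k
    by (rule S\<Phi>_int_eval_measurable[OF \<mu>(1) Ut]) (use C t in simp)
  have [measurable]: "(\<lambda>x. blinfun_apply (\<mu>m (- U x, t x)) k) \<in> borel_measurable M" for k
    by (rule S\<Phi>_int_eval_measurable[OF \<mu>(2) nUt]) (use C C_on_uminus t in blast)
  let ?f = "\<lambda>x. if p x + F_int c d (- U x) d < r
     then \<eta> x + lp (F_int c d (U x) (t x) - p x - r) * (\<mu>p (U x, t x) h - \<eta> x * \<mu>p (U x, t x) (const_bcontfun 1))
     else \<eta> x + lm (F_int c d (- U x) (t x) + p x - r) * (\<mu>m (- U x, t x) h - \<eta> x * \<mu>m (- U x, t x) (const_bcontfun 1))"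
  have eqf: "\<nu> (U x, p x, t x) (h, \<eta> x) = ?f x" if x: "x \<in> space M" for x
  proof -
    have eqx: "((U x, p x) \<in> Z_plus r c d \<longrightarrow>
            \<nu> (U x, p x, t x) (h, \<eta> x) =
              \<eta> x + lp (F_int c d (\<lambda>s. U x s - p x - r) (t x)) * \<mu>p (U x, t x) (h - const_bcontfun (\<eta> x))) \<and>
         ((U x, p x) \<in> Z_minus r c d \<longrightarrow>
            \<nu> (U x, p x, t x) (h, \<eta> x) =
              \<eta> x + lm (F_int c d (\<lambda>s. - U x s + p x - r) (t x)) * \<mu>m (- U x, t x) (h - const_bcontfun (\<eta> x)))"
      using bspec[OF eq Z[OF x]] t[OF x] h by simp
    show ?thesis
      using eqx Z_int_cases[OF cd Z[OF x]] Z_plus_F_int_iff[OF cd Z[OF x]]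
      unfolding F_int_shift[OF t[OF x]] const by auto
  qed
  have meas: "?f \<in> borel_measurable M" by measurable
  show ?thesis by (rule iffD2[OF measurable_cong[OF eqf] meas])
qed

lemma continuous_on_w_part:
  assumes part: "is_partition a b \<Delta>" "a < b" and r: "0 < r" and k: "k \<le> npt \<Delta>"
  shows "continuous_on (Z_part r a b \<Delta>) (\<lambda>x. w_part r \<Delta> k (fst x) (snd x))"
  unfolding continuous_on_iff
proof (intro ballI allI impI)
  fix x and e :: real assume x: "x \<in> Z_part r a b \<Delta>" and e: "0 < e"
  show "\<exists>d>0. \<forall>x'\<in>Z_part r a b \<Delta>. dist x' x < d \<longrightarrow> dist (w_part r \<Delta> k (fst x') (snd x')) (w_part r \<Delta> k (fst x) (snd x)) < e"
  proof (intro exI[of _ "e / 2"] conjI ballI impI)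
    fix x' assume x': "x' \<in> Z_part r a b \<Delta>" "dist x' x < e / 2"
    have "\<bar>w_part r \<Delta> k (fst x') (snd x') - w_part r \<Delta> k (fst x) (snd x)\<bar> \<le> norm (fst x' - fst x) + \<bar>snd x' - snd x\<bar>"
      by (rule w_part_Lipschitz[OF part r _ _ k]) (use x x' in simp_all)
    also have "\<dots> = dist (fst x') (fst x) + dist (snd x') (snd x)" by (simp add: dist_norm)
    also have "\<dots> < e" using dist_fst_le[of x' x] dist_snd_le[of x' x] x'(2) by linarith
    finally show "dist (w_part r \<Delta> k (fst x') (snd x')) (w_part r \<Delta> k (fst x) (snd x)) < e"
      by (simp add: dist_real_def)
  qed (use e in simp)
qed

definition strip :: "(cfun \<times> real) set \<Rightarrow> real set \<Rightarrow> (cfun \<times> real \<times> real) set" where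
  "strip Z I = {x. (fst x, fst (snd x)) \<in> Z \<and> snd (snd x) \<in> I}"

lemma Sk_part_Suc_measurable:
  assumes part: "is_partition a b \<Delta>" "a < b" and r: "0 < r" and k: "k < npt \<Delta>" and h: "h \<in> C_on a b"
    and IH: "\<And>\<mu>. \<mu> \<in> Sk_part r a b \<Delta> k \<Longrightarrow>
      (\<lambda>x. \<mu> (fst x, snd x, pt \<Delta> k) (h, y)) \<in> borel_measurable (restrict_space borel (Z_part r a b \<Delta>))"
    and \<mu>: "\<mu> \<in> Sk_part r a b \<Delta> (Suc k)"
  shows "(\<lambda>x. \<mu> x (h, y)) \<in> borel_measurable (restrict_space borel (strip (Z_part r a b \<Delta>) {pt \<Delta> k..pt \<Delta> (Suc k)}))"
proof -
  let ?c = "pt \<Delta> k" and ?d = "pt \<Delta> (Suc k)"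
  let ?M = "restrict_space borel (strip (Z_part r a b \<Delta>) {?c..?d}) :: (cfun \<times> real \<times> real) measure"
  have cd: "?c \<le> ?d" using pt_Suc_less[OF part k] by simp
  have sp: "x \<in> space ?M \<longleftrightarrow> (fst x, fst (snd x)) \<in> Z_part r a b \<Delta> \<and> snd (snd x) \<in> {?c..?d}" for x
    by (simp add: space_restrict_space strip_def)
  obtain \<nu> \<mu>' where \<nu>: "\<nu> \<in> S_int r ?c ?d" and \<mu>': "\<mu>' \<in> Sk_part r a b \<Delta> k"
    and eq: "\<forall>u z0 t h y. (u, z0) \<in> Z_part r a b \<Delta> \<longrightarrow> t \<in> {?c..?d} \<longrightarrow> h \<in> C_on a b \<longrightarrow>
       \<mu> (u, z0, t) (h, y) = \<nu> (restr ?c ?d u, w_part r \<Delta> k u z0, t) (restr ?c ?d h, \<mu>' (u, z0, ?c) (h, y))"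
    using Sk_part_SucD[OF \<mu>] by blast
  have base: "(\<lambda>x. (fst x, fst (snd x))) \<in> ?M \<rightarrow>\<^sub>M restrict_space borel (Z_part r a b \<Delta>)"
    by (rule measurable_restrict_space2)
      (use sp in \<open>auto intro!: borel_measurable_continuous_on_restrict continuous_intros\<close>)
  have meas: "(\<lambda>x. \<nu> (restr ?c ?d (fst x), w_part r \<Delta> k (fst x) (fst (snd x)), snd (snd x))
      (restr ?c ?d h, \<mu>' (fst x, fst (snd x), ?c) (h, y))) \<in> borel_measurable ?M"
  proof (rule S_int_measurable[OF \<nu> cd restr_in_C_on[OF cd]])
    show "(\<lambda>x. (restr ?c ?d (fst x), snd (snd x))) \<in> borel_measurable ?M"
      by (intro borel_measurable_continuous_on_restrict continuous_intros
        bounded_linear.continuous_on[OF bounded_linear_restr])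
    have "(\<lambda>x. w_part r \<Delta> k (fst x) (snd x)) \<in> borel_measurable (restrict_space borel (Z_part r a b \<Delta>))"
      by (rule borel_measurable_continuous_on_restrict[OF continuous_on_w_part[OF part r less_imp_le[OF k]]])
    from measurable_compose[OF base this]
    show "(\<lambda>x. w_part r \<Delta> k (fst x) (fst (snd x))) \<in> borel_measurable ?M" by simp
    from measurable_compose[OF base IH[OF \<mu>']]
    show "(\<lambda>x. \<mu>' (fst x, fst (snd x), ?c) (h, y)) \<in> borel_measurable ?M" by simp
    show "(restr ?c ?d (fst x), w_part r \<Delta> k (fst x) (fst (snd x))) \<in> Z_int r ?c ?d" if "x \<in> space ?M" for x
      using Z_part_interval[OF part _ k] that sp by blast
    show "snd (snd x) \<in> {?c..?d}" if "x \<in> space ?M" for x using that sp by blast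
  qed
  have eqf: "\<mu> x (h, y) = \<nu> (restr ?c ?d (fst x), w_part r \<Delta> k (fst x) (fst (snd x)), snd (snd x))
      (restr ?c ?d h, \<mu>' (fst x, fst (snd x), ?c) (h, y))" if "x \<in> space ?M" for x
    using eq[rule_format, of "fst x" "fst (snd x)" "snd (snd x)" h y] that h unfolding sp by simp
  show ?thesis by (rule iffD2[OF measurable_cong[OF eqf] meas])
qed

text \<open>The recursion consults the previous functional at its node only, so the induction runs
  over node values as functions of (u, z) alone; the time variable enters on the last
  interval.\<close>

lemma Sk_part_node_measurable:
  assumes part: "is_partition a b \<Delta>" "a < b" and r: "0 < r" and h: "h \<in> C_on a b"
    and "k \<le> npt \<Delta>" "\<mu> \<in> Sk_part r a b \<Delta> k"
  shows "(\<lambda>x. \<mu> (fst x, snd x, pt \<Delta> k) (h, y)) \<in> borel_measurable (restrict_space borel (Z_part r a b \<Delta>))"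
  using assms(5,6)
proof (induction k arbitrary: \<mu>)
  case 0
  let ?M = "restrict_space borel (Z_part r a b \<Delta>) :: (cfun \<times> real) measure"
  obtain l where l: "l \<in> S_R r" and eq: "\<forall>(u :: cfun, z0) \<in> Z_part r a b \<Delta>.
     \<mu> (u, z0, pt \<Delta> 0) \<in> dual_CR a b \<and> (\<forall>h \<in> C_on a b. \<forall>y. \<mu> (u, z0, pt \<Delta> 0) (h, y) = h a - l z0 * y)"
    using 0(2) unfolding Sk_part.simps by blast
  have "snd \<in> borel_measurable ?M" by (intro borel_measurable_continuous_on_restrict continuous_intros)
  from measurable_compose[OF this S_R_measurable[OF l]]
  have [measurable]: "(\<lambda>x. l (snd x)) \<in> borel_measurable ?M" .
  have meas: "(\<lambda>x. h a - l (snd x) * y) \<in> borel_measurable ?M" by measurable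
  have eqf: "\<mu> (fst x, snd x, pt \<Delta> 0) (h, y) = h a - l (snd x) * y" if "x \<in> space ?M" for x
  proof -
    have "(fst x, snd x) \<in> Z_part r a b \<Delta>" using that by (simp add: space_restrict_space)
    from bspec[OF eq this, unfolded prod.case] show ?thesis using h by blast
  qed
  show ?case by (rule iffD2[OF measurable_cong[OF eqf] meas])
next
  case (Suc k)
  then have k: "k < npt \<Delta>" by simp
  let ?M = "restrict_space borel (Z_part r a b \<Delta>) :: (cfun \<times> real) measure"
  let ?I = "{pt \<Delta> k..pt \<Delta> (Suc k)}"
  have "(\<lambda>x. \<mu> x (h, y)) \<in> borel_measurable (restrict_space borel (strip (Z_part r a b \<Delta>) ?I))"
    by (rule Sk_part_Suc_measurable[OF part r k h Suc.IH Suc.prems(2)]) (use k in auto)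
  moreover have "(\<lambda>x. (fst x, snd x, pt \<Delta> (Suc k))) \<in> ?M \<rightarrow>\<^sub>M restrict_space borel (strip (Z_part r a b \<Delta>) ?I)"
  proof (rule measurable_restrict_space2)
    show "(\<lambda>x. (fst x, snd x, pt \<Delta> (Suc k))) \<in> space ?M \<rightarrow> strip (Z_part r a b \<Delta>) ?I"
      using pt_Suc_less[OF part k] by (auto simp: strip_def space_restrict_space)
    show "(\<lambda>x. (fst x, snd x, pt \<Delta> (Suc k))) \<in> borel_measurable ?M"
      by (intro borel_measurable_continuous_on_restrict continuous_intros)
  qed
  ultimately show ?case by (rule measurable_compose[rotated])
qed

lemma Sk_part_measurable:
  assumes "is_partition a b \<Delta>" "a < b" "0 < r" "h \<in> C_on a b" "k < npt \<Delta>" "\<mu> \<in> Sk_part r a b \<Delta> (Suc k)"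
  shows "(\<lambda>x. \<mu> x (h, y)) \<in> borel_measurable (restrict_space borel (strip (Z_part r a b \<Delta>) {pt \<Delta> k..pt \<Delta> (Suc k)}))"
  by (rule Sk_part_Suc_measurable[OF assms(1-3,5,4) _ assms(6)])
    (rule Sk_part_node_measurable[OF assms(1-4)], use assms(5) in auto)

section \<open>Gluing along refining partitions\<close>

locale refining_partitions =
  fixes a b r :: real and D :: "nat \<Rightarrow> real set" and \<rho> :: "nat \<Rightarrow> real"
  assumes ab: "a < b" and r: "0 < r"
    and D1: "D 1 = {a, b}"
    and D_Suc: "\<And>n. n \<ge> 1 \<Longrightarrow> \<exists>x. a < x \<and> x < b \<and> x \<notin> D n \<and> D (Suc n) = insert x (D n)"
    and D_mesh: "(\<lambda>n. mesh (D n)) \<longlonglongrightarrow> 0"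
    and \<rho>: "0 < \<rho> 1" "\<And>n. n \<ge> 1 \<Longrightarrow> \<rho> n < \<rho> (Suc n)" "\<And>n. n \<ge> 1 \<Longrightarrow> \<rho> n < r"
begin

lemma part_D: "1 \<le> n \<Longrightarrow> is_partition a b (D n)"
proof (induction n rule: dec_induct)
  case base
  show ?case using ab unfolding D1 is_partition_def by auto
next
  case (step n)
  from D_Suc[OF step(1)] obtain x where "a < x" "x < b" "D (Suc n) = insert x (D n)" by blast
  then show ?case using partition_insert[OF step(3), of x] by simp
qed

lemma V_set_eq: "V_set a b D \<rho> n = Z_part (\<rho> n) a b (D n)"
  unfolding V_set_def Z_part_def ..

lemma V_set_Suc: 
  assumes n: "1 \<le> n"
  shows "V_set a b D \<rho> n \<subseteq> V_set a b D \<rho> (Suc n)"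
proof
  fix x assume "x \<in> V_set a b D \<rho> n"
  then obtain u z where x: "x = (u, z)" and Z: "(u, z) \<in> Z_part (\<rho> n) a b (D n)"
    unfolding V_set_eq by (cases x) auto
  have p: "is_partition a b (D n)" "is_partition a b (D (Suc n))" using part_D n by auto
  have sub: "D n \<subseteq> D (Suc n)" using D_Suc[OF n] by auto
  have "osc (pt (D (Suc n)) k) (pt (D (Suc n)) (Suc k)) u < \<rho> (Suc n)" if k: "k < npt (D (Suc n))" for k
  proof -
    have "\<exists>j<npt (D n). {pt (D (Suc n)) k..pt (D (Suc n)) (Suc k)} \<subseteq> {pt (D n) j..pt (D n) (Suc j)}"
      by (rule partition_refine[OF p ab sub k]) (intro exI conjI)
    then obtain j where j: "j < npt (D n)" "{pt (D (Suc n)) k..pt (D (Suc n)) (Suc k)} \<subseteq> {pt (D n) j..pt (D n) (Suc j)}"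
      by blast
    have le: "pt (D (Suc n)) k \<le> pt (D (Suc n)) (Suc k)" "pt (D n) j \<le> pt (D n) (Suc j)"
      using pt_Suc_less[OF p(2) ab k] pt_Suc_less[OF p(1) ab j(1)] by auto
    have "osc (pt (D n) j) (pt (D n) (Suc j)) u < \<rho> (Suc n)"
      using Z j(1) \<rho>(2)[OF n] unfolding Z_part_iff by force
    then show ?thesis using j(2) unfolding osc_less_iff[OF le(1)] osc_less_iff[OF le(2)] by blast
  qed
  then show "x \<in> V_set a b D \<rho> (Suc n)"
    using Z unfolding V_set_eq x Z_part_iff by auto
qed

lemma V_set_mono:
  assumes "1 \<le> m" "m \<le> n"
  shows "V_set a b D \<rho> m \<subseteq> V_set a b D \<rho> n"
  using assms(2)
proof (induction n rule: dec_induct)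
  case (step k)
  then show ?case using V_set_Suc[of k] assms(1) by auto
qed auto

lemma \<rho>_mono:
  assumes "1 \<le> m" "m \<le> n"
  shows "\<rho> m \<le> \<rho> n"
  using assms(2)
proof (induction n rule: dec_induct)
  case (step k)
  then show ?case using \<rho>(2)[of k] assms(1) by auto
qed auto

lemma V_bar_mono: "m \<le> n \<Longrightarrow> V_bar a b D \<rho> m \<subseteq> V_bar a b D \<rho> n"
  unfolding V_bar_def using closure_mono[OF V_set_mono[of m n]] by auto

lemma V_set_subset_V_bar: "1 \<le> n \<Longrightarrow> V_set a b D \<rho> n \<subseteq> V_bar a b D \<rho> n"
  unfolding V_bar_def using closure_subset by auto

text \<open>In the limit the strict bound becomes a weak one. As \<open>\<rho> n\<close> < r, the
  closure still lies in the set on which the objects of the partition are defined.\<close>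

lemma V_bar_osc:
  assumes x: "(u, z) \<in> V_bar a b D \<rho> n"
  shows "u \<in> C_on a b" "k < npt (D n) \<Longrightarrow> osc (pt (D n) k) (pt (D n) (Suc k)) u \<le> \<rho> n"
proof -
  have n: "1 \<le> n" and cl: "(u, z) \<in> closure (V_set a b D \<rho> n)"
    using x unfolding V_bar_def by (auto split: if_splits)
  from cl obtain X where X: "\<And>j. X j \<in> V_set a b D \<rho> n" "X \<longlonglongrightarrow> (u, z)" unfolding closure_sequential by blast
  have lim: "(\<lambda>j. fst (X j)) \<longlonglongrightarrow> u" using tendsto_fst[OF X(2)] by simp
  have Xj: "(fst (X j), snd (X j)) \<in> Z_part (\<rho> n) a b (D n)" for j using X(1)[of j] unfolding V_set_eq by simp
  show "u \<in> C_on a b"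
    by (rule closed_sequentially[OF closed_C_on _ lim]) (use Xj Z_part_iff in blast)
  show "osc (pt (D n) k) (pt (D n) (Suc k)) u \<le> \<rho> n" if k: "k < npt (D n)"
  proof -
    have le: "pt (D n) k \<le> pt (D n) (Suc k)" using pt_Suc_less[OF part_D[OF n] ab k] by simp
    show ?thesis unfolding osc_le_iff[OF le]
    proof (intro ballI)
      fix s t assume st: "s \<in> {pt (D n) k..pt (D n) (Suc k)}" "t \<in> {pt (D n) k..pt (D n) (Suc k)}"
      have "(\<lambda>j. \<bar>fst (X j) t - fst (X j) s\<bar>) \<longlonglongrightarrow> \<bar>u t - u s\<bar>"
        by (intro tendsto_intros bounded_linear.tendsto[OF bounded_linear_eval lim])
      moreover have "\<bar>fst (X j) t - fst (X j) s\<bar> \<le> \<rho> n" for j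
      proof -
        have "osc (pt (D n) k) (pt (D n) (Suc k)) (fst (X j)) < \<rho> n" using Xj[of j] k unfolding Z_part_iff by blast
        then show ?thesis using st unfolding osc_less_iff[OF le] by force
      qed
      ultimately show "\<bar>u t - u s\<bar> \<le> \<rho> n" by (intro LIMSEQ_le_const2) auto
    qed
  qed
qed

lemma V_bar_Z_part:
  assumes "(u, z) \<in> V_bar a b D \<rho> n"
  shows "1 \<le> n" "(u, z) \<in> Z_part r a b (D n)"
proof -
  show n: "1 \<le> n" using assms unfolding V_bar_def by (auto split: if_splits)
  show "(u, z) \<in> Z_part r a b (D n)"
    unfolding Z_part_iff using V_bar_osc[OF assms] \<rho>(3)[OF n] by force
qed

text \<open>Uniform continuity of u is applied with the smallest threshold \<open>\<rho> 1\<close>,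
  which then serves at whatever level the mesh is fine enough.\<close>

lemma V_set_exhaust:
  assumes u: "u \<in> C_on a b"
  shows "\<exists>n\<ge>1. (u, z) \<in> V_set a b D \<rho> n"
proof -
  have "uniformly_continuous_on {a..b} u" by (rule compact_uniformly_continuous) auto
  then obtain \<delta> where \<delta>: "\<delta> > 0" "\<And>s t. s \<in> {a..b} \<Longrightarrow> t \<in> {a..b} \<Longrightarrow> dist t s < \<delta> \<Longrightarrow> dist (u t) (u s) < \<rho> 1"
    unfolding uniformly_continuous_on_def using \<rho>(1) by metis
  have "\<forall>\<^sub>F n in sequentially. mesh (D n) < \<delta>" by (rule order_tendstoD(2)[OF D_mesh \<delta>(1)])
  then obtain N where N: "\<And>n. N \<le> n \<Longrightarrow> mesh (D n) < \<delta>" unfolding eventually_sequentially by blast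
  define n where "n = max 1 N"
  have n: "1 \<le> n" "mesh (D n) < \<delta>" using N unfolding n_def by auto
  have "osc (pt (D n) k) (pt (D n) (Suc k)) u < \<rho> n" if k: "k < npt (D n)" for k
  proof -
    note s = pt_Suc_less[OF part_D[OF n(1)] ab k]
    have "pt (D n) (Suc k) - pt (D n) (Suc k - 1) \<le> mesh (D n)"
      unfolding mesh_def using k by (intro Max_ge finite_imageI imageI) auto
    then have len: "pt (D n) (Suc k) - pt (D n) k < \<delta>" using n(2) by simp
    have "osc (pt (D n) k) (pt (D n) (Suc k)) u < \<rho> 1"
      unfolding osc_less_iff[OF less_imp_le[OF s(1)]]
    proof (intro ballI)
      fix x y assume xy: "x \<in> {pt (D n) k..pt (D n) (Suc k)}" "y \<in> {pt (D n) k..pt (D n) (Suc k)}"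
      have "dist (u y) (u x) < \<rho> 1"
        by (rule \<delta>(2)) (use xy s len in \<open>auto simp: dist_real_def abs_less_iff\<close>)
      then show "\<bar>u y - u x\<bar> < \<rho> 1" by (simp add: dist_real_def)
    qed
    then show ?thesis using \<rho>_mono[of 1 n] n(1) by simp
  qed
  then show ?thesis using n(1) u unfolding V_set_eq Z_part_iff by blast
qed

lemma level_exists:
  assumes "u \<in> C_on a b"
  shows "\<exists>n\<ge>1. (u, z) \<in> V_bar a b D \<rho> n - V_bar a b D \<rho> (n - 1)"
proof -
  obtain m where m: "1 \<le> m" "(u, z) \<in> V_set a b D \<rho> m" using V_set_exhaust[OF assms] by blast
  then have "(u, z) \<in> V_bar a b D \<rho> m" using V_set_subset_V_bar by blast
  then obtain n where n: "(u, z) \<in> V_bar a b D \<rho> n" "\<And>j. j < n \<Longrightarrow> (u, z) \<notin> V_bar a b D \<rho> j"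
    using exists_least_iff[of "\<lambda>n. (u, z) \<in> V_bar a b D \<rho> n"] by blast
  have "1 \<le> n" by (rule V_bar_Z_part(1)[OF n(1)])
  then show ?thesis using n by (intro exI[of _ n]) auto
qed

lemma level_unique:
  assumes "x \<in> V_bar a b D \<rho> n - V_bar a b D \<rho> (n - 1)" "x \<in> V_bar a b D \<rho> m - V_bar a b D \<rho> (m - 1)"
  shows "n = m"
proof (rule linorder_cases[of n m])
  assume "n < m"
  then have "V_bar a b D \<rho> n \<subseteq> V_bar a b D \<rho> (m - 1)" by (intro V_bar_mono) simp
  then show ?thesis using assms by blast
next
  assume "m < n"
  then have "V_bar a b D \<rho> m \<subseteq> V_bar a b D \<rho> (n - 1)" by (intro V_bar_mono) simp
  then show ?thesis using assms by blast
qed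

lemma S_play_level:
  assumes "\<mu> \<in> S_play r a b D \<rho>" "1 \<le> n"
  shows "\<exists>\<mu>n\<in>S_part r a b (D n). \<forall>u z t. (u, z) \<in> V_bar a b D \<rho> n - V_bar a b D \<rho> (n - 1) \<longrightarrow> t \<in> {a..b} \<longrightarrow>
    \<mu> (u, z, t) = \<mu>n (u, z, t)"
proof -
  obtain \<mu>n where \<mu>n: "\<forall>n\<ge>1. \<mu>n n \<in> S_part r a b (D n)"
     "\<forall>n\<ge>1. \<forall>(u :: cfun, z0) \<in> V_bar a b D \<rho> n - V_bar a b D \<rho> (n - 1). \<forall>t \<in> {a..b}. \<mu> (u, z0, t) = \<mu>n n (u, z0, t)"
    using assms(1) unfolding S_play_def by blast
  show ?thesis
  proof (intro bexI[of _ "\<mu>n n"] allI impI)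
    fix u z t assume "(u, z) \<in> V_bar a b D \<rho> n - V_bar a b D \<rho> (n - 1)" "t \<in> {a..b}"
    then show "\<mu> (u, z, t) = \<mu>n n (u, z, t)" using \<mu>n(2)[rule_format, OF assms(2)] by blast
  qed (use \<mu>n(1) assms(2) in simp)
qed

lemma S_play_bound:
  assumes \<mu>: "\<mu> \<in> S_play r a b D \<rho>" and u: "u \<in> C_on a b" and t: "t \<in> {a..b}"
  shows "\<mu> (u, z, t) \<in> dual_CR a b"
    and "h \<in> C_on a b \<Longrightarrow> (\<And>s. s \<in> {a..t} \<Longrightarrow> \<bar>h s\<bar> \<le> B) \<Longrightarrow> \<bar>\<mu> (u, z, t) (h, y)\<bar> \<le> B + \<bar>y\<bar>"
proof -
  obtain n where n: "1 \<le> n" "(u, z) \<in> V_bar a b D \<rho> n - V_bar a b D \<rho> (n - 1)" using level_exists[OF u] by blast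
  obtain \<mu>n where \<mu>n: "\<mu>n \<in> S_part r a b (D n)" "\<mu> (u, z, t) = \<mu>n (u, z, t)"
    using S_play_level[OF \<mu> n(1)] n(2) t by blast
  have Z: "(u, z) \<in> Z_part r a b (D n)" using V_bar_Z_part(2) n(2) by blast
  show "\<mu> (u, z, t) \<in> dual_CR a b"
    unfolding \<mu>n(2) by (rule S_part_dual[OF part_D[OF n(1)] ab Z \<mu>n(1) t])
  show "\<bar>\<mu> (u, z, t) (h, y)\<bar> \<le> B + \<bar>y\<bar>" if "h \<in> C_on a b" "\<And>s. s \<in> {a..t} \<Longrightarrow> \<bar>h s\<bar> \<le> B"
    unfolding \<mu>n(2) by (rule S_part_bound[OF part_D[OF n(1)] ab Z that(1) \<mu>n(1) t that(2)])
qed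

text \<open>These are the time sets on which \<open>S_part\<close> uses one functional. They are
  empty beyond the last interval, so that all natural k may index one countable family for every
  level.\<close>

definition piece :: "nat \<Rightarrow> nat \<Rightarrow> real set" where
  "piece n k = (if npt (D n) \<le> k then {} else if k = 0 then {pt (D n) 0..pt (D n) 1} else {pt (D n) k<..pt (D n) (Suc k)})"

text \<open>The domain is covered by countably many Borel sets, one for each level and each time
  piece. On each of them \<mu> coincides with a single element of \<open>Sk_part\<close>, whose
  evaluations are measurable.\<close>

theorem S_play_measurable:
  assumes \<mu>: "\<mu> \<in> S_play r a b D \<rho>"
  shows "\<mu> \<in> restrict_space borel (C_on a b \<times> UNIV \<times> {a..b}) \<rightarrow>\<^sub>M weak_star_borel (dual_CR a b)"
proof -
  let ?\<Omega> = "C_on a b \<times> (UNIV :: real set) \<times> {a..b}"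
  let ?M = "restrict_space borel ?\<Omega>"
  have sp: "space ?M = ?\<Omega>" by (simp add: space_restrict_space)
  define level where "level n = V_bar a b D \<rho> n - V_bar a b D \<rho> (n - 1)" for n
  have level_sets: "level n \<in> sets borel" for n
    unfolding level_def V_bar_def by auto
  have strip_sets: "strip V I \<in> sets borel" if "V \<in> sets borel" "I \<in> sets borel" for V I
  proof -
    have "(\<lambda>x :: cfun \<times> real \<times> real. (fst x, fst (snd x))) \<in> borel_measurable borel"
      "(\<lambda>x :: cfun \<times> real \<times> real. snd (snd x)) \<in> borel_measurable borel"
      by (intro borel_measurable_continuous_onI continuous_intros)+
    from measurable_sets[OF this(1) that(1)] measurable_sets[OF this(2) that(2)]
    have "(\<lambda>x. (fst x, fst (snd x))) -` V \<inter> (\<lambda>x. snd (snd x)) -` I \<in> sets (borel :: (cfun \<times> real \<times> real) measure)"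
      by auto
    moreover have "strip V I = (\<lambda>x. (fst x, fst (snd x))) -` V \<inter> (\<lambda>x. snd (snd x)) -` I"
      unfolding strip_def by auto
    ultimately show ?thesis by simp
  qed
  show ?thesis
  \<comment> \<open>The functional is bounded by norm h + |y|, and each summand is at most the norm
    of the pair, hence B = 2.\<close>
  proof (rule measurable_weak_star_CR[where B=2, OF less_imp_le[OF ab]])
    fix x assume "x \<in> space ?M"
    then obtain u z t where x: "x = (u, z, t)" "u \<in> C_on a b" "t \<in> {a..b}" unfolding sp by auto
    show dual: "\<mu> x \<in> dual_CR a b" unfolding x(1) by (rule S_play_bound(1)[OF \<mu> x(2,3)])
    show "norm (\<mu> x) \<le> 2"
    proof (rule norm_blinfun_bound)
      fix v :: "cfun \<times> real"
      obtain h y where v: "v = (h, y)" by (cases v)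
      have "\<mu> x v = \<mu> x (restr a b h, y)" using dual unfolding dual_CR_def v by blast
      also have "\<bar>\<dots>\<bar> \<le> norm h + \<bar>y\<bar>"
        unfolding x(1)
        by (rule S_play_bound(2)[OF \<mu> x(2,3) restr_in_C_on[OF less_imp_le[OF ab]]]) (simp add: abs_apply_le_norm)
      also have "\<dots> \<le> 2 * norm v" using norm_fst_le[of h y] norm_snd_le[of y h] unfolding v by simp
      finally show "norm (\<mu> x v) \<le> 2 * norm v" by simp
    qed simp
  next
    fix h y assume h: "h \<in> C_on a b"
    show "(\<lambda>x. blinfun_apply (\<mu> x) (h, y)) \<in> borel_measurable ?M"
    proof (rule measurable_piecewise_restrict)
      \<comment> \<open>Levels start at 1, hence the successor in the indexing.\<close>
      let ?C = "(\<lambda>(n, k). strip (level (Suc n)) (piece (Suc n) k)) ` (UNIV :: (nat \<times> nat) set)"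
      show "countable ?C" by simp
      show "\<Omega> \<inter> space ?M \<in> sets ?M" if "\<Omega> \<in> ?C" for \<Omega>
      proof -
        have "\<Omega> \<in> sets borel" using that strip_sets[OF level_sets] by (auto simp: piece_def)
        then have "?\<Omega> \<inter> \<Omega> \<in> sets ?M" unfolding sets_restrict_space by (rule imageI)
        then show ?thesis unfolding sp by (simp add: Int_commute)
      qed
      show "space ?M \<subseteq> \<Union> ?C"
      proof
        fix x assume "x \<in> space ?M"
        then obtain u z t where x: "x = (u, z, t)" "u \<in> C_on a b" "t \<in> {a..b}" unfolding sp by auto
        obtain n where n: "1 \<le> n" "(u, z) \<in> level n" using level_exists[OF x(2)] unfolding level_def by blast
        note p = part_D[OF n(1)]
        have "\<exists>k. t \<in> piece n k"
        proof (cases "t \<le> pt (D n) 1")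
          case True
          then have "t \<in> piece n 0"
            using x(3) partition_basic(1,4)[OF p ab] unfolding piece_def by auto
          then show ?thesis ..
        next
          case False
          then have "t \<in> {a<..b}" using x(3) pt_mem(2)[OF p ab partition_basic(1)[OF p ab]] by auto
          from partition_cover[OF p ab this] obtain k where k: "k < npt (D n)" "t \<in> {pt (D n) k<..pt (D n) (Suc k)}" by blast
          then have "k \<noteq> 0" using False by (cases k) auto
          then have "t \<in> piece n k" using k unfolding piece_def by auto
          then show ?thesis ..
        qed
        then obtain k where "t \<in> piece n k" ..
        then have "x \<in> strip (level (Suc (n - 1))) (piece (Suc (n - 1)) k)" using n x(1) by (simp add: strip_def)
        then show "x \<in> \<Union> ?C" by auto
      qed
      show "(\<lambda>x. blinfun_apply (\<mu> x) (h, y)) \<in> borel_measurable (restrict_space ?M \<Omega>)" if \<Omega>: "\<Omega> \<in> ?C" for \<Omega>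
      proof -
        obtain n k where n: "1 \<le> n" and \<Omega>_eq: "\<Omega> = strip (level n) (piece n k)" using \<Omega> by force
        note p = part_D[OF n]
        show ?thesis
        proof (cases "k < npt (D n)")
          case False
          then have "\<Omega> = {}" unfolding \<Omega>_eq piece_def strip_def by simp
          then have "space (restrict_space ?M \<Omega>) = {}" by (simp add: space_restrict_space)
          then show ?thesis by (simp add: measurable_def)
        next
          case k: True
          let ?Z = "Z_part r a b (D n)" and ?I = "{pt (D n) k..pt (D n) (Suc k)}"
          have lev: "level n \<subseteq> ?Z" unfolding level_def using V_bar_Z_part(2) by auto
          have sub: "\<Omega> \<subseteq> strip ?Z ?I" unfolding \<Omega>_eq strip_def piece_def using lev k by auto
          obtain \<mu>n where \<mu>n: "\<mu>n \<in> S_part r a b (D n)"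
            "\<forall>u z t. (u, z) \<in> level n \<longrightarrow> t \<in> {a..b} \<longrightarrow> \<mu> (u, z, t) = \<mu>n (u, z, t)"
            using S_play_level[OF \<mu> n] unfolding level_def by blast
          \<comment> \<open>\<open>S_part_piece\<close> chooses the functional after t; here one
            functional must serve the whole piece, so the definition is opened again.\<close>
          obtain \<mu>k where \<mu>k: "\<mu>k \<in> Sk_part r a b (D n) (Suc k)"
            "\<forall>u z t. (u, z) \<in> ?Z \<longrightarrow> t \<in> piece n k \<longrightarrow> \<mu>n (u, z, t) = \<mu>k (u, z, t)"
          proof -
            obtain \<mu>k where *: "\<forall>k \<in> {1..npt (D n)}. \<mu>k k \<in> Sk_part r a b (D n) k"
              "\<forall>(u :: cfun, z0) \<in> ?Z. (\<forall>t \<in> {pt (D n) 0..pt (D n) 1}. \<mu>n (u, z0, t) = \<mu>k 1 (u, z0, t)) \<and>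
                (\<forall>k \<in> {2..npt (D n)}. \<forall>t \<in> {pt (D n) (k - 1)<..pt (D n) k}. \<mu>n (u, z0, t) = \<mu>k k (u, z0, t))"
              using \<mu>n(1) unfolding S_part_def by blast
            have "\<mu>k (Suc k) \<in> Sk_part r a b (D n) (Suc k)" by (rule bspec[OF *(1)]) (use k in simp)
            moreover have "\<mu>n (u, z, t) = \<mu>k (Suc k) (u, z, t)" if uz: "(u, z) \<in> ?Z" and t: "t \<in> piece n k" for u z t
            proof -
              have **: "(\<forall>t \<in> {pt (D n) 0..pt (D n) 1}. \<mu>n (u, z, t) = \<mu>k 1 (u, z, t)) \<and>
                (\<forall>k \<in> {2..npt (D n)}. \<forall>t \<in> {pt (D n) (k - 1)<..pt (D n) k}. \<mu>n (u, z, t) = \<mu>k k (u, z, t))"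
                using bspec[OF *(2) uz] by (simp only: prod.case)
              show ?thesis
              proof (cases "k = 0")
                case True
                then have "t \<in> {pt (D n) 0..pt (D n) 1}" using t k unfolding piece_def by simp
                from bspec[OF conjunct1[OF **] this] show ?thesis using True by simp
              next
                case False
                then have k': "Suc k \<in> {2..npt (D n)}" and t': "t \<in> {pt (D n) (Suc k - 1)<..pt (D n) (Suc k)}"
                  using t k unfolding piece_def by auto
                show ?thesis by (rule bspec[OF bspec[OF conjunct2[OF **] k'] t'])
              qed
            qed
            ultimately show thesis by (intro that[of "\<mu>k (Suc k)"]) auto
          qed
          have "(\<lambda>x. \<mu>k x (h, y)) \<in> borel_measurable (restrict_space borel (strip ?Z ?I))"
            by (rule Sk_part_measurable[OF p ab r h k \<mu>k(1)])
          then have meas: "(\<lambda>x. \<mu>k x (h, y)) \<in> borel_measurable (restrict_space borel (?\<Omega> \<inter> \<Omega>))"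
            by (rule measurable_restrict_mono) (use sub in blast)
          have MM: "restrict_space ?M \<Omega> = restrict_space borel (?\<Omega> \<inter> \<Omega>)"
          proof (rule restrict_restrict_space)
            have "closed ?\<Omega>" by (intro closed_Times closed_C_on closed_UNIV closed_atLeastAtMost)
            then show "?\<Omega> \<inter> space borel \<in> sets borel" by simp
            have "piece n k \<in> sets borel" unfolding piece_def by simp
            then show "\<Omega> \<inter> space borel \<in> sets borel" unfolding \<Omega>_eq using strip_sets[OF level_sets] by simp
          qed
          have eqf: "\<mu> x (h, y) = \<mu>k x (h, y)" if "x \<in> space (restrict_space borel (?\<Omega> \<inter> \<Omega>))" for x
          proof -
            have "x \<in> ?\<Omega>" "x \<in> \<Omega>" using that by (auto simp: space_restrict_space)
            then obtain u z t where x: "x = (u, z, t)" "t \<in> {a..b}" "(u, z) \<in> level n" "t \<in> piece n k"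
              unfolding \<Omega>_eq strip_def by auto
            have "\<mu> (u, z, t) = \<mu>n (u, z, t)" using \<mu>n(2) x by blast
            moreover have "\<mu>n (u, z, t) = \<mu>k (u, z, t)" using \<mu>k(2) x lev by blast
            ultimately show ?thesis unfolding x(1) by simp
          qed
          show ?thesis unfolding MM by (rule iffD2[OF measurable_cong[OF eqf] meas])
        qed
      qed
    qed
  qed
qed

end

section \<open>A smooth step function\<close>

text \<open>The polynomial factor makes the family closed under differentiation, so smoothness at 0
  needs a single argument for all orders.\<close>

definition flat_fun :: "real poly \<Rightarrow> real \<Rightarrow> real" where
  "flat_fun p x = (if 0 < x then poly p (inverse x) * exp (- inverse x) else 0)"

lemma poly_times_exp_tendsto_0: "((\<lambda>y. poly p y * exp (- y)) \<longlongrightarrow> (0 :: real)) at_top"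
proof -
  have "((\<lambda>y. \<Sum>i\<le>degree p. coeff p i * (y ^ i / exp y)) \<longlongrightarrow> (\<Sum>i\<le>degree p. coeff p i * 0)) at_top"
    by (intro tendsto_sum tendsto_mult tendsto_const tendsto_power_div_exp_0)
  moreover have "(\<Sum>i\<le>degree p. coeff p i * (y ^ i / exp y)) = poly p y * exp (- y)" for y
    by (simp add: poly_altdef sum_distrib_right exp_minus divide_inverse mult.assoc)
  ultimately show ?thesis by simp
qed

lemma flat_fun_tendsto_0: "(flat_fun p \<longlongrightarrow> 0) (at 0)"
proof (rule filterlim_split_at)
  have "\<forall>\<^sub>F x in at_left 0. flat_fun p x = 0"
    by (rule eventually_at_leftI[of "-1"]) (auto simp: flat_fun_def)
  then show "(flat_fun p \<longlongrightarrow> 0) (at_left 0)" by (rule tendsto_eventually)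
  have "((\<lambda>x. poly p (inverse x) * exp (- inverse x)) \<longlongrightarrow> 0) (at_right 0)"
    by (rule filterlim_compose[OF poly_times_exp_tendsto_0 filterlim_inverse_at_top_right])
  moreover have "\<forall>\<^sub>F x in at_right 0. poly p (inverse x) * exp (- inverse x) = flat_fun p x"
    by (rule eventually_at_rightI[of 0 1]) (auto simp: flat_fun_def)
  ultimately show "(flat_fun p \<longlongrightarrow> 0) (at_right 0)" by (rule Lim_transform_eventually)
qed

lemma DERIV_eventually_eq:
  assumes "(f has_real_derivative d) (at x)" "\<forall>\<^sub>F y in nhds x. f y = g y"
  shows "(g has_real_derivative d) (at x)"
  using DERIV_cong_ev[OF refl assms(2) refl] assms(1) by blast

lemma DERIV_scaled:
  assumes "\<And>x. (B has_real_derivative B' x) (at x)"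
  shows "((\<lambda>x. B ((x - s) / \<epsilon>)) has_real_derivative B' ((x - s) / \<epsilon>) / \<epsilon>) (at x)"
proof -
  have "((\<lambda>x. (x - s) / \<epsilon>) has_real_derivative 1 / \<epsilon>) (at x)"
    by (auto intro!: derivative_eq_intros simp: divide_inverse)
  from DERIV_chain2[OF assms this] show ?thesis by simp
qed

text \<open>With y = 1/x one has dy/dx = -y^2, which gives the polynomial y^2 * (p - p'). At 0 the
  difference quotient is again a flat function, with p multiplied by y, and tends to 0.\<close>

lemma DERIV_flat_fun: "(flat_fun p has_real_derivative flat_fun ([:0, 0, 1:] * (p - pderiv p)) x) (at x)"
proof (cases x "0 :: real" rule: linorder_cases)
  case less
  have "((\<lambda>_. 0) has_real_derivative 0) (at x)" by simp
  moreover have "\<forall>\<^sub>F y in nhds x. 0 = flat_fun p y"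
    by (rule eventually_mono[OF eventually_nhds_in_open[of "{..<0}" x]]) (use less in \<open>auto simp: flat_fun_def\<close>)
  ultimately have "(flat_fun p has_real_derivative 0) (at x)" by (rule DERIV_eventually_eq)
  then show ?thesis using less by (simp add: flat_fun_def)
next
  case greater
  let ?q = "[:0, 0, 1:] * (p - pderiv p)"
  have "((\<lambda>x. poly p (inverse x) * exp (- inverse x)) has_real_derivative
      poly (pderiv p) (inverse x) * (- ((inverse x)^2)) * exp (- inverse x)
      + poly p (inverse x) * (exp (- inverse x) * (inverse x)^2)) (at x)"
    using greater by (auto intro!: derivative_eq_intros DERIV_chain2[OF poly_DERIV] simp: power2_eq_square)
  moreover have "poly (pderiv p) (inverse x) * (- ((inverse x)^2)) * exp (- inverse x)
      + poly p (inverse x) * (exp (- inverse x) * (inverse x)^2) = flat_fun ?q x"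
    using greater by (simp add: flat_fun_def algebra_simps power2_eq_square)
  moreover have "\<forall>\<^sub>F y in nhds x. poly p (inverse y) * exp (- inverse y) = flat_fun p y"
    by (rule eventually_mono[OF eventually_nhds_in_open[of "{0<..}" x]]) (use greater in \<open>auto simp: flat_fun_def\<close>)
  ultimately show ?thesis using DERIV_eventually_eq by metis
next
  case equal
  have z: "flat_fun q 0 = 0" for q by (simp add: flat_fun_def)
  have eq: "(\<lambda>h. flat_fun p h / h) = flat_fun (pCons 0 p)"
    by (rule ext) (simp add: flat_fun_def field_simps)
  show ?thesis unfolding equal DERIV_def z by (simp add: eq flat_fun_tendsto_0)
qed

text \<open>Closed under differentiation, hence consisting of functions with derivatives of all orders.\<close>

inductive smooth :: "(real \<Rightarrow> real) \<Rightarrow> bool" where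
  smooth_flat: "smooth (flat_fun p)"
| smooth_affine: "smooth f \<Longrightarrow> smooth (\<lambda>x. k * f (\<alpha> * x + \<beta>))"
| smooth_add: "smooth f \<Longrightarrow> smooth g \<Longrightarrow> smooth (\<lambda>x. f x + g x)"
| smooth_mult: "smooth f \<Longrightarrow> smooth g \<Longrightarrow> smooth (\<lambda>x. f x * g x)"
| smooth_antideriv: "(\<And>x. (f has_real_derivative g x) (at x)) \<Longrightarrow> smooth g \<Longrightarrow> smooth f"

lemma smooth_has_deriv:
  assumes "smooth f"
  shows "\<exists>g. smooth g \<and> (\<forall>x. (f has_real_derivative g x) (at x))"
  using assms
proof induction
  case (smooth_flat p)
  show ?case by (intro exI[of _ "flat_fun ([:0, 0, 1:] * (p - pderiv p))"] conjI allI smooth.smooth_flat DERIV_flat_fun)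
next
  case (smooth_affine f k \<alpha> \<beta>)
  then obtain g where g: "smooth g" "\<And>x. (f has_real_derivative g x) (at x)" by blast
  have "((\<lambda>x. k * f (\<alpha> * x + \<beta>)) has_real_derivative (k * \<alpha>) * g (\<alpha> * x + \<beta>)) (at x)" for x
    by (auto intro!: derivative_eq_intros DERIV_chain2[OF g(2)])
  then show ?case using smooth.smooth_affine[OF g(1), of "k * \<alpha>" \<alpha> \<beta>] by blast
next
  case (smooth_add f g)
  then obtain f' g' where *: "smooth f'" "\<And>x. (f has_real_derivative f' x) (at x)"
     "smooth g'" "\<And>x. (g has_real_derivative g' x) (at x)" by blast
  have "((\<lambda>x. f x + g x) has_real_derivative f' x + g' x) (at x)" for x
    by (intro DERIV_add *)
  then show ?case using smooth.smooth_add[OF *(1,3)] by blast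
next
  case (smooth_mult f g)
  then obtain f' g' where *: "smooth f'" "\<And>x. (f has_real_derivative f' x) (at x)"
     "smooth g'" "\<And>x. (g has_real_derivative g' x) (at x)" by blast
  have "((\<lambda>x. f x * g x) has_real_derivative f' x * g x + g' x * f x) (at x)" for x
    by (intro DERIV_mult *)
  then show ?case
    using smooth.smooth_add[OF smooth.smooth_mult[OF *(1) smooth_mult.hyps(2)] smooth.smooth_mult[OF *(3) smooth_mult.hyps(1)]] by blast
next
  case (smooth_antideriv f g)
  then show ?case by blast
qed

lemma smooth_iterated_deriv: "smooth f \<Longrightarrow> smooth ((deriv ^^ k) f)"
proof (induction k)
  case (Suc k)
  then obtain g where g: "smooth g" "\<forall>x. ((deriv ^^ k) f has_real_derivative g x) (at x)"
    using smooth_has_deriv by blast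
  then have "deriv ((deriv ^^ k) f) = g" by (auto intro: DERIV_imp_deriv)
  then show ?case using g(1) by simp
qed simp

lemma smooth_differentiable: "smooth f \<Longrightarrow> (deriv ^^ k) f field_differentiable (at t)"
  using smooth_has_deriv[OF smooth_iterated_deriv] unfolding field_differentiable_def by blast

text \<open>B is the normalised antiderivative of a bump. It is later rescaled: differences of two
  steps are test functions that approximate indicators of intervals.\<close>

lemma smooth_step_exists:
  "\<exists>B B' :: real \<Rightarrow> real. smooth B \<and> smooth B' \<and> (\<forall>x. (B has_real_derivative B' x) (at x)) \<and> (\<forall>x. 0 \<le> B' x) \<and>
     (\<forall>x\<le>0. B x = 0) \<and> (\<forall>x\<ge>1. B x = 1)"
proof -
  \<comment> \<open>On (0, 1) this is exp (- 1/x) * exp (- 1/(1 - x)); the second factor is written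
    so that it matches the rule \<open>smooth_affine\<close>.\<close>
  define b where "b = (\<lambda>x. flat_fun 1 x * (1 * flat_fun 1 ((-1) * x + 1)))"
  have sb: "smooth b" unfolding b_def by (intro smooth.intros)
  have b_nonneg: "0 \<le> b x" for x unfolding b_def flat_fun_def by simp
  have b_pos: "0 < b x" if "0 < x" "x < 1" for x unfolding b_def flat_fun_def using that by simp
  have b0: "b x = 0" if "x \<le> 0 \<or> 1 \<le> x" for x unfolding b_def flat_fun_def using that by auto
  have cont: "continuous_on S b" for S
    using smooth_has_deriv[OF sb] by (meson DERIV_continuous continuous_at_imp_continuous_on)
  \<comment> \<open>Starting the integral at -1 makes every x \<ge> 0 an interior point, so the
    one-sided derivative rule gives a derivative there; for x < 0 the function is constant.\<close>
  define F where "F = (\<lambda>x. integral {-1..x} b)"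
  have F0: "F x = 0" if "x \<le> 0" for x
  proof -
    have "integral {-1..x} b = integral {-1..x} (\<lambda>_. 0)" by (rule integral_cong) (use that b0 in auto)
    then show ?thesis unfolding F_def by simp
  qed
  have dF: "(F has_real_derivative b x) (at x)" for x
  proof (cases "x < 0")
    case True
    have "((\<lambda>_. 0) has_real_derivative 0) (at x)" by simp
    moreover have "\<forall>\<^sub>F y in nhds x. 0 = F y"
      by (rule eventually_mono[OF eventually_nhds_in_open[of "{..<0}" x]]) (use True in \<open>auto simp: F0\<close>)
    ultimately have "(F has_real_derivative 0) (at x)" by (rule DERIV_eventually_eq)
    then show ?thesis using b0[of x] True by simp
  next
    case False
    have "(F has_real_derivative b x) (at x within {-1..x+1})"
      unfolding F_def by (rule integral_has_real_derivative[OF cont]) (use False in auto)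
    then show ?thesis using at_within_Icc_at[of "-1" x "x + 1"] False by simp
  qed
  have "F 0 < F 1"
    by (rule DERIV_pos_imp_increasing_open)
      (use dF b_pos in \<open>auto intro: DERIV_continuous_on has_field_derivative_at_within\<close>)
  then have F1: "0 < F 1" using F0[of 0] by simp
  have Fc: "F x = F 1" if "1 \<le> x" for x
  proof (cases "x = 1")
    case False
    then have "1 < x" using that by simp
    moreover have "continuous_on {1..x} F"
      by (rule DERIV_continuous_on[OF has_field_derivative_at_within[OF dF]])
    moreover have "(F has_real_derivative 0) (at y)" if "1 < y" for y
      using dF[of y] b0[of y] that by simp
    ultimately show ?thesis by (intro DERIV_isconst_end) auto
  qed simp
  have sF: "smooth F" by (rule smooth_antideriv[OF dF sb])
  define K where "K = inverse (F 1)"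
  have "smooth (\<lambda>x. K * F x)" "smooth (\<lambda>x. K * b x)"
    using smooth_affine[OF sF, of K 1 0] smooth_affine[OF sb, of K 1 0] by simp_all
  moreover have "((\<lambda>x. K * F x) has_real_derivative K * b x) (at x)" for x
    by (rule DERIV_cmult[OF dF])
  moreover have "0 \<le> K * b x" for x using b_nonneg F1 unfolding K_def by simp
  moreover have "K * F x = 0" if "x \<le> 0" for x using F0[OF that] by simp
  moreover have "K * F x = 1" if "1 \<le> x" for x using Fc[OF that] F1 unfolding K_def by simp
  ultimately show ?thesis by (intro exI[of _ "\<lambda>x. K * F x"] exI[of _ "\<lambda>x. K * b x"]) simp
qed

section \<open>Weak derivatives\<close>

lemma integrable_lebesgue_on_open:
  fixes f :: "real \<Rightarrow> real"
  assumes "continuous_on {a..b} f"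
  shows "integrable (lebesgue_on {a<..<b}) f"
proof -
  have "f absolutely_integrable_on {a<..<b}"
    by (rule set_integrable_subset[OF absolutely_integrable_continuous_real[OF assms]]) auto
  then show ?thesis by (rule absolutely_integrable_imp_integrable) simp
qed

lemma lebesgue_on_open_has_integral:
  fixes f :: "real \<Rightarrow> real"
  assumes "continuous_on {a..b} f" "(f has_integral I) {a..b}"
  shows "(LINT x|lebesgue_on {a<..<b}. f x) = I"
proof -
  have "(LINT x|lebesgue_on {a<..<b}. f x) = integral {a<..<b} f"
    by (rule lebesgue_integral_eq_integral[OF integrable_lebesgue_on_open[OF assms(1)]]) simp
  also have "\<dots> = I" using integral_unique[OF assms(2)] integral_open_interval_real[of a b f] by simp
  finally show ?thesis .
qed

text \<open>The kernel is nonnegative, has integral one and lives on [s, s + \<epsilon>], so the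
  integral is an average of values of u that differ from u s by at most e.\<close>

lemma approximate_identity_bound:
  fixes u :: cfun
  assumes B: "\<And>x. (B has_real_derivative B' x) (at x)" "\<And>x. 0 \<le> B' x" "\<And>x. x \<le> 0 \<Longrightarrow> B x = 0" "\<And>x. 1 \<le> x \<Longrightarrow> B x = 1"
    and B'_supp: "\<And>x. x < 0 \<or> 1 < x \<Longrightarrow> B' x = 0" and cont: "continuous_on UNIV B'"
    and s: "a < s" "s + \<epsilon> < b" "0 < \<epsilon>"
    and near: "\<And>x. x \<in> {s..s + \<epsilon>} \<Longrightarrow> \<bar>u x - u s\<bar> \<le> e"
  shows "\<bar>(LINT x|lebesgue_on {a<..<b}. u x * (B' ((x - s) / \<epsilon>) / \<epsilon>)) - u s\<bar> \<le> e"
proof -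
  let ?M = "lebesgue_on {a<..<b}"
  let ?k = "\<lambda>x. B' ((x - s) / \<epsilon>) / \<epsilon>"
  have ck: "continuous_on {a..b} ?k"
    by (intro continuous_intros continuous_on_compose2[OF cont]) (use s in auto)
  have "(?k has_integral (B ((b - s) / \<epsilon>) - B ((a - s) / \<epsilon>))) {a..b}"
  proof (rule fundamental_theorem_of_calculus)
    fix x
    have "((\<lambda>x. B ((x - s) / \<epsilon>)) has_real_derivative ?k x) (at x)" by (rule DERIV_scaled[OF B(1)])
    then show "((\<lambda>x. B ((x - s) / \<epsilon>)) has_vector_derivative ?k x) (at x within {a..b})"
      unfolding has_real_derivative_iff_has_vector_derivative[symmetric] by (rule has_field_derivative_at_within)
  qed (use s in simp)
  moreover have "B ((b - s) / \<epsilon>) = 1" "B ((a - s) / \<epsilon>) = 0"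
    using s by (auto intro!: B(3,4) simp: field_simps)
  ultimately have one: "(LINT x|?M. ?k x) = 1" using lebesgue_on_open_has_integral[OF ck] by simp
  have int: "integrable ?M ?k" "integrable ?M (\<lambda>x. u x * ?k x)" "integrable ?M (\<lambda>x. u s * ?k x)"
    by (intro integrable_lebesgue_on_open ck continuous_on_mult continuous_on_const continuous_on_apply_bcontfun)+
  have "(LINT x|?M. u x * ?k x) - u s = (LINT x|?M. u x * ?k x) - (LINT x|?M. u s * ?k x)" using one by simp
  also have "\<dots> = (LINT x|?M. u x * ?k x - u s * ?k x)"
    by (rule Bochner_Integration.integral_diff[symmetric, OF int(2,3)])
  finally have eq: "(LINT x|?M. u x * ?k x) - u s = (LINT x|?M. u x * ?k x - u s * ?k x)" .
  have "\<bar>LINT x|?M. u x * ?k x - u s * ?k x\<bar> \<le> (LINT x|?M. e * ?k x)"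
  proof (rule integral_abs_bound_integral)
    show "\<bar>u x * ?k x - u s * ?k x\<bar> \<le> e * ?k x" for x
    proof (cases "x \<in> {s..s + \<epsilon>}")
      case True
      have "\<bar>p * k - q * k\<bar> = \<bar>p - q\<bar> * k" if "0 \<le> k" for p q k :: real
        using that by (metis abs_mult abs_of_nonneg left_diff_distrib)
      moreover have "0 \<le> ?k x" using B(2) s(3) by simp
      ultimately have "\<bar>u x * ?k x - u s * ?k x\<bar> = \<bar>u x - u s\<bar> * ?k x" by blast
      also have "\<dots> \<le> e * ?k x" using near[OF True] B(2) s(3) by (intro mult_right_mono) auto
      finally show ?thesis .
    next
      case False
      then have "(x - s) / \<epsilon> < 0 \<or> 1 < (x - s) / \<epsilon>" using s(3) by (auto simp: field_simps)
      then show ?thesis using B'_supp by simp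
    qed
  qed (use Bochner_Integration.integrable_diff[OF int(2,3)] integrable_mult_right[OF int(1)] in auto)
  then show ?thesis unfolding eq using one by simp
qed

text \<open>Test with a smooth plateau that rises just after s and falls just after t. Its
  derivative is the difference of two approximate identities, so one side is nearly the increment of
  u, and the other is bounded by the mass of v. The mass bound is taken in the affine form c *
  length + A that Young's inequality produces.\<close>

lemma weak_deriv_increment:
  fixes u :: cfun
  assumes st: "a < s" "s < t" "t < b" and v: "integrable (lebesgue_on {a<..<b}) v" and w: "weak_deriv a b u v"
    and c: "0 \<le> c"
    and bound: "\<And>s' t'. a < s' \<Longrightarrow> s' < t' \<Longrightarrow> t' < b \<Longrightarrow>
      (LINT x|lebesgue_on {a<..<b}. indicator {s'..t'} x * \<bar>v x\<bar>) \<le> c * (t' - s') + A"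
  shows "\<bar>u t - u s\<bar> \<le> c * (t - s) + A"
proof (rule field_le_epsilon)
  fix e :: real assume e: "0 < e"
  let ?M = "lebesgue_on {a<..<b}"
  obtain B B' where SB: "smooth B" and SB': "smooth B'" and "\<forall>x. (B has_real_derivative B' x) (at x)"
    and "\<forall>x. 0 \<le> B' x" and "\<forall>x\<le>0. B x = 0" and "\<forall>x\<ge>1. B x = 1"
    using smooth_step_exists by blast
  then have B: "\<And>x. (B has_real_derivative B' x) (at x)" "\<And>x. 0 \<le> B' x" "\<And>x. x \<le> 0 \<Longrightarrow> B x = 0" "\<And>x. 1 \<le> x \<Longrightarrow> B x = 1"
    by auto
  have cB': "continuous_on UNIV B'"
    using smooth_has_deriv[OF SB'] by (meson DERIV_continuous continuous_at_imp_continuous_on)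
  have B'_supp: "B' x = 0" if "x < 0 \<or> 1 < x" for x
    using that
  proof
    assume "x < 0"
    then have "\<forall>\<^sub>F y in nhds x. 0 = B y"
      by (intro eventually_mono[OF eventually_nhds_in_open[of "{..<0}" x]]) (auto simp: B(3))
    then have "(B has_real_derivative 0) (at x)" by (rule DERIV_eventually_eq[OF DERIV_const])
    then show ?thesis using DERIV_unique B(1) by blast
  next
    assume "1 < x"
    then have "\<forall>\<^sub>F y in nhds x. 1 = B y"
      by (intro eventually_mono[OF eventually_nhds_in_open[of "{1<..}" x]]) (auto simp: B(4))
    then have "(B has_real_derivative 0) (at x)" by (rule DERIV_eventually_eq[OF DERIV_const])
    then show ?thesis using DERIV_unique B(1) by blast
  qed
  have Bmono: "B x \<le> B y" if "x \<le> y" for x y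
    by (rule DERIV_nonneg_imp_nondecreasing[OF that]) (use B in blast)
  have B01: "0 \<le> B x" "B x \<le> 1" for x
    using Bmono[of "min x 0" x] Bmono[of x "max x 1"] B(3)[of "min x 0"] B(4)[of "max x 1"] by auto
  have "isCont u s" "isCont u t" by (simp_all add: continuous_on_interior[of UNIV])
  then obtain d1 d2 where d: "0 < d1" "\<And>x. dist x s < d1 \<Longrightarrow> dist (u x) (u s) < e / 3"
    "0 < d2" "\<And>x. dist x t < d2 \<Longrightarrow> dist (u x) (u t) < e / 3"
    using e unfolding continuous_at_eps_delta by (metis dist_real_def divide_pos_pos zero_less_numeral)
  \<comment> \<open>The error e is shared equally by continuity of u at s, by continuity at t, and
    by the extension of the interval from t to t + \<epsilon>, which costs c * \<epsilon>. Using c +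
    1 covers the case c = 0.\<close>
  define \<epsilon> where "\<epsilon> = min (min (d1 / 2) (d2 / 2)) (min ((b - t) / 2) (e / (3 * (c + 1))))"
  have \<epsilon>: "0 < \<epsilon>" "\<epsilon> < d1" "\<epsilon> < d2" "t + \<epsilon> < b" "c * \<epsilon> \<le> e / 3"
  proof -
    have "0 < e / (3 * (c + 1))" using e c by simp
    then show pos: "0 < \<epsilon>" unfolding \<epsilon>_def using d(1,3) st by simp
    have "\<epsilon> \<le> d1 / 2" "\<epsilon> \<le> d2 / 2" "\<epsilon> \<le> (b - t) / 2" unfolding \<epsilon>_def by linarith+
    then show "\<epsilon> < d1" "\<epsilon> < d2" "t + \<epsilon> < b" using d(1,3) st by (simp_all add: field_simps)
    have "c * \<epsilon> \<le> (c + 1) * (e / (3 * (c + 1)))"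
      by (rule mult_mono) (use c \<open>0 < \<epsilon>\<close> in \<open>auto simp: \<epsilon>_def\<close>)
    also have "\<dots> = e / 3"
    proof -
      have "k * (e / (3 * k)) = e / 3" if "k \<noteq> 0" for k using that by simp
      from this[of "c + 1"] show ?thesis using c by simp
    qed
    finally show "c * \<epsilon> \<le> e / 3" .
  qed
  define \<phi> where "\<phi> = (\<lambda>x. B ((x - s) / \<epsilon>) - B ((x - t) / \<epsilon>))"
  define \<phi>' where "\<phi>' = (\<lambda>x. B' ((x - s) / \<epsilon>) / \<epsilon> - B' ((x - t) / \<epsilon>) / \<epsilon>)"
  have d\<phi>: "(\<phi> has_real_derivative \<phi>' x) (at x)" for x
    unfolding \<phi>_def \<phi>'_def by (intro DERIV_diff DERIV_scaled B(1))
  have "smooth \<phi>"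
  proof -
    have "smooth (\<lambda>x. 1 * B (inverse \<epsilon> * x + (- s / \<epsilon>)) + (-1) * B (inverse \<epsilon> * x + (- t / \<epsilon>)))"
      by (intro smooth_add smooth_affine SB)
    also have "(\<lambda>x. 1 * B (inverse \<epsilon> * x + (- s / \<epsilon>)) + (-1) * B (inverse \<epsilon> * x + (- t / \<epsilon>))) = \<phi>"
      unfolding \<phi>_def by (simp add: fun_eq_iff divide_inverse algebra_simps)
    finally show ?thesis .
  qed
  have \<phi>_bounds: "0 \<le> \<phi> x" "\<phi> x \<le> 1" for x
    unfolding \<phi>_def using Bmono[of "(x - t) / \<epsilon>" "(x - s) / \<epsilon>"] B01[of "(x - s) / \<epsilon>"] B01[of "(x - t) / \<epsilon>"] st \<epsilon>(1)
    by (auto simp: divide_right_mono)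
  have \<phi>_supp: "\<phi> x = 0" if out: "x \<notin> {s..t + \<epsilon>}" for x
  proof -
    consider "x < s" | "t + \<epsilon> < x" using out by force
    then show ?thesis
    proof cases
      case 1
      then show ?thesis unfolding \<phi>_def using st \<epsilon>(1) by (simp add: B(3) field_simps)
    next
      case 2
      then have "1 \<le> (x - s) / \<epsilon>" "1 \<le> (x - t) / \<epsilon>" using st \<epsilon>(1) by (auto simp: field_simps)
      then show ?thesis unfolding \<phi>_def by (simp add: B(4))
    qed
  qed
  have "\<phi> \<in> test_functions a b"
    unfolding test_functions_def
    by (intro CollectI conjI allI smooth_differentiable \<open>smooth \<phi>\<close> exI[of _ s] exI[of _ "t + \<epsilon>"])
      (use st \<epsilon>(4) \<phi>_supp in auto)
  then have "(LINT x|?M. u x * deriv \<phi> x) = - (LINT x|?M. v x * \<phi> x)"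
    using w unfolding weak_deriv_def by blast
  moreover have "deriv \<phi> = \<phi>'" using d\<phi> by (auto intro: DERIV_imp_deriv)
  ultimately have weak: "(LINT x|?M. u x * \<phi>' x) = - (LINT x|?M. v x * \<phi> x)" by simp
  let ?ks = "\<lambda>x. B' ((x - s) / \<epsilon>) / \<epsilon>" and ?kt = "\<lambda>x. B' ((x - t) / \<epsilon>) / \<epsilon>"
  have int: "integrable ?M (\<lambda>x. u x * ?ks x)" "integrable ?M (\<lambda>x. u x * ?kt x)"
    using \<epsilon>(1) by (intro integrable_lebesgue_on_open continuous_intros continuous_on_compose2[OF cB'] continuous_on_apply_bcontfun; simp)+
  have "(LINT x|?M. u x * \<phi>' x) = (LINT x|?M. u x * ?ks x - u x * ?kt x)"
    unfolding \<phi>'_def by (simp add: right_diff_distrib)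
  also have "\<dots> = (LINT x|?M. u x * ?ks x) - (LINT x|?M. u x * ?kt x)"
    by (rule Bochner_Integration.integral_diff[OF int])
  finally have split: "(LINT x|?M. u x * \<phi>' x) = (LINT x|?M. u x * ?ks x) - (LINT x|?M. u x * ?kt x)" .
  have near_s: "\<bar>(LINT x|?M. u x * ?ks x) - u s\<bar> \<le> e / 3"
  proof (rule approximate_identity_bound[OF B B'_supp cB'])
    show "\<bar>u x - u s\<bar> \<le> e / 3" if "x \<in> {s..s + \<epsilon>}" for x
      using d(2)[of x] that \<epsilon>(1,2) by (auto simp: dist_real_def)
  qed (use st \<epsilon> in auto)
  have near_t: "\<bar>(LINT x|?M. u x * ?kt x) - u t\<bar> \<le> e / 3"
  proof (rule approximate_identity_bound[OF B B'_supp cB'])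
    show "\<bar>u x - u t\<bar> \<le> e / 3" if "x \<in> {t..t + \<epsilon>}" for x
      using d(4)[of x] that \<epsilon>(1,3) by (auto simp: dist_real_def)
  qed (use st \<epsilon> in auto)
  have "\<bar>LINT x|?M. v x * \<phi> x\<bar> \<le> (LINT x|?M. indicator {s..t + \<epsilon>} x * \<bar>v x\<bar>)"
  proof (rule integral_abs_bound_integral)
    have m: "\<phi> \<in> borel_measurable ?M"
    proof -
      have "continuous_on UNIV \<phi>" using d\<phi> by (meson DERIV_continuous continuous_at_imp_continuous_on)
      then have "\<phi> \<in> borel_measurable borel" by (rule borel_measurable_continuous_onI)
      then show ?thesis by (intro measurable_restrict_space1 measurable_completion) simp
    qed
    have mv: "v \<in> borel_measurable ?M" using v by (rule borel_measurable_integrable)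
    show "integrable ?M (\<lambda>x. v x * \<phi> x)"
    proof (rule Bochner_Integration.integrable_bound[OF v])
      show "AE x in ?M. norm (v x * \<phi> x) \<le> norm (v x)"
      proof (rule AE_I2)
        fix x
        show "norm (v x * \<phi> x) \<le> norm (v x)"
          using \<phi>_bounds[of x] mult_left_le[of "\<bar>\<phi> x\<bar>" "\<bar>v x\<bar>"] by (simp add: abs_mult)
      qed
    qed (use m mv in measurable)
    have mi: "indicat_real {s..t + \<epsilon>} \<in> borel_measurable ?M"
      by (intro measurable_restrict_space1 borel_measurable_indicator) simp
    show "integrable ?M (\<lambda>x. indicator {s..t + \<epsilon>} x * \<bar>v x\<bar>)"
    proof (rule Bochner_Integration.integrable_bound[OF v])
      show "(\<lambda>x. indicator {s..t + \<epsilon>} x * \<bar>v x\<bar>) \<in> borel_measurable ?M" using mi mv by measurable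
      show "AE x in ?M. norm (indicator {s..t + \<epsilon>} x * \<bar>v x\<bar>) \<le> norm (v x)"
        by (rule AE_I2) (simp add: indicator_def)
    qed
    show "\<bar>v x * \<phi> x\<bar> \<le> indicator {s..t + \<epsilon>} x * \<bar>v x\<bar>" for x
      using \<phi>_bounds[of x] \<phi>_supp[of x] mult_left_le[of "\<bar>\<phi> x\<bar>" "\<bar>v x\<bar>"] by (auto simp: indicator_def abs_mult)
  qed
  also have "\<dots> \<le> c * (t + \<epsilon> - s) + A" by (rule bound) (use st \<epsilon> in auto)
  finally have "\<bar>LINT x|?M. u x * \<phi>' x\<bar> \<le> c * (t - s) + c * \<epsilon> + A" unfolding weak by (simp add: algebra_simps)
  then show "\<bar>u t - u s\<bar> \<le> c * (t - s) + A + e"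
    using near_s near_t \<epsilon>(5) unfolding split by linarith
qed

section \<open>Hoelder and Sobolev spaces\<close>

text \<open>All that is used about the two scales of spaces: the unit ball is bounded and uniformly equicontinuous.\<close>

definition equicontinuous_space :: "real \<Rightarrow> real \<Rightarrow> cfun set \<Rightarrow> (cfun \<Rightarrow> real) \<Rightarrow> bool" where
  "equicontinuous_space a b X nX \<longleftrightarrow> X \<subseteq> C_on a b \<and> (\<forall>u\<in>X. \<forall>v\<in>X. u + v \<in> X) \<and> (\<forall>h\<in>X. 0 \<le> nX h) \<and>
     (\<exists>C\<ge>0. \<forall>h\<in>X. norm h \<le> C * nX h) \<and>
     (\<forall>e>0. \<exists>\<delta>>0. \<forall>h\<in>X. \<forall>s\<in>{a..b}. \<forall>t\<in>{a..b}. \<bar>s - t\<bar> < \<delta> \<longrightarrow> \<bar>apply_bcontfun h s - apply_bcontfun h t\<bar> \<le> e * nX h)"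

section \<open>Hoelder spaces\<close>

lemma holder_quotients_bound:
  fixes h :: cfun
  assumes "a < b" and h: "h \<in> holder_space a b \<alpha>"
  shows "0 \<le> Sup (holder_quotients a b \<alpha> h)"
    and "s \<in> {a..b} \<Longrightarrow> t \<in> {a..b} \<Longrightarrow> \<bar>h s - h t\<bar> \<le> Sup (holder_quotients a b \<alpha> h) * \<bar>s - t\<bar> powr \<alpha>"
proof -
  have bdd: "bdd_above (holder_quotients a b \<alpha> h)" using h unfolding holder_space_def by simp
  have up: "\<bar>h s - h t\<bar> / \<bar>s - t\<bar> powr \<alpha> \<le> Sup (holder_quotients a b \<alpha> h)"
    if "s \<in> {a..b}" "t \<in> {a..b}" "s \<noteq> t" for s t
    by (rule cSup_upper[OF _ bdd]) (use that in \<open>auto simp: holder_quotients_def\<close>)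
  have "0 \<le> \<bar>h a - h b\<bar> / \<bar>a - b\<bar> powr \<alpha>" by simp
  also have "\<dots> \<le> Sup (holder_quotients a b \<alpha> h)" by (rule up) (use assms(1) in auto)
  finally show nn: "0 \<le> Sup (holder_quotients a b \<alpha> h)" .
  show "\<bar>h s - h t\<bar> \<le> Sup (holder_quotients a b \<alpha> h) * \<bar>s - t\<bar> powr \<alpha>" if "s \<in> {a..b}" "t \<in> {a..b}"
  proof (cases "s = t")
    case False
    have "0 < \<bar>s - t\<bar> powr \<alpha>" using False by simp
    then show ?thesis using up[OF that False] by (simp add: pos_divide_le_eq)
  qed (use nn in simp)
qed

lemma holder_space_add:
  assumes "u \<in> holder_space a b \<alpha>" "v \<in> holder_space a b \<alpha>"
  shows "u + v \<in> holder_space a b \<alpha>"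
proof -
  obtain A where A: "\<And>q. q \<in> holder_quotients a b \<alpha> u \<Longrightarrow> q \<le> A"
    using assms(1) unfolding holder_space_def bdd_above_def by blast
  obtain B where B: "\<And>q. q \<in> holder_quotients a b \<alpha> v \<Longrightarrow> q \<le> B"
    using assms(2) unfolding holder_space_def bdd_above_def by blast
  have "q \<le> A + B" if "q \<in> holder_quotients a b \<alpha> (u + v)" for q
  proof -
    obtain s t where q: "q = \<bar>(u + v) t - (u + v) s\<bar> / \<bar>t - s\<bar> powr \<alpha>" "s \<in> {a..b}" "t \<in> {a..b}" "s \<noteq> t"
      using \<open>q \<in> _\<close> unfolding holder_quotients_def by blast
    have "\<bar>(u + v) t - (u + v) s\<bar> \<le> \<bar>u t - u s\<bar> + \<bar>v t - v s\<bar>" by simp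
    then have "q \<le> (\<bar>u t - u s\<bar> + \<bar>v t - v s\<bar>) / \<bar>t - s\<bar> powr \<alpha>" unfolding q(1) by (rule divide_right_mono) simp
    also have "\<dots> = \<bar>u t - u s\<bar> / \<bar>t - s\<bar> powr \<alpha> + \<bar>v t - v s\<bar> / \<bar>t - s\<bar> powr \<alpha>" by (rule add_divide_distrib)
    also have "\<dots> \<le> A + B"
      by (intro add_mono A B) (use q(2-4) in \<open>auto simp: holder_quotients_def\<close>)
    finally show ?thesis .
  qed
  then have "bdd_above (holder_quotients a b \<alpha> (u + v))" by (rule bdd_aboveI)
  then show ?thesis using assms C_on_add unfolding holder_space_def by blast
qed

theorem equicontinuous_holder:
  assumes "a < b" "0 < \<alpha>"
  shows "equicontinuous_space a b (holder_space a b \<alpha>) (holder_norm a b \<alpha>)"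
  unfolding equicontinuous_space_def
proof (intro conjI ballI allI impI)
  show "holder_space a b \<alpha> \<subseteq> C_on a b" unfolding holder_space_def by auto
  show "u + v \<in> holder_space a b \<alpha>" if "u \<in> holder_space a b \<alpha>" "v \<in> holder_space a b \<alpha>" for u v
    by (rule holder_space_add[OF that])
  show "0 \<le> holder_norm a b \<alpha> h" if "h \<in> holder_space a b \<alpha>" for h
    unfolding holder_norm_def using holder_quotients_bound(1)[OF assms(1) that] by simp
  let ?C = "1 + (b - a) powr \<alpha>"
  show "\<exists>C\<ge>0. \<forall>h\<in>holder_space a b \<alpha>. norm h \<le> C * holder_norm a b \<alpha> h"
  proof (intro exI[of _ ?C] conjI ballI)
    fix h assume h: "h \<in> holder_space a b \<alpha>"
    let ?S = "Sup (holder_quotients a b \<alpha> h)"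
    note q = holder_quotients_bound[OF assms(1) h]
    show "norm h \<le> ?C * holder_norm a b \<alpha> h"
    proof (rule norm_C_on_le[of _ a b])
      show "h \<in> C_on a b" using h unfolding holder_space_def by simp
      fix t assume t: "t \<in> {a..b}"
      have "\<bar>h t - h a\<bar> \<le> ?S * \<bar>t - a\<bar> powr \<alpha>" by (rule q(2)) (use t in auto)
      also have "\<dots> \<le> ?S * (b - a) powr \<alpha>"
        by (rule mult_left_mono[OF powr_mono2]) (use t assms q(1) in auto)
      finally have "\<bar>h t\<bar> \<le> \<bar>h a\<bar> + ?S * (b - a) powr \<alpha>" by linarith
      also have "\<dots> \<le> ?C * (\<bar>h a\<bar> + ?S)"
      proof -
        have "0 \<le> \<bar>h a\<bar> * (b - a) powr \<alpha>" by simp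
        then show ?thesis using q(1) by (simp add: algebra_simps)
      qed
      finally show "\<bar>h t\<bar> \<le> ?C * holder_norm a b \<alpha> h" unfolding holder_norm_def .
    qed (use assms in simp)
  qed simp
  fix e :: real assume e: "0 < e"
  show "\<exists>\<delta>>0. \<forall>h\<in>holder_space a b \<alpha>. \<forall>s\<in>{a..b}. \<forall>t\<in>{a..b}. \<bar>s - t\<bar> < \<delta> \<longrightarrow> \<bar>apply_bcontfun h s - apply_bcontfun h t\<bar> \<le> e * holder_norm a b \<alpha> h"
  \<comment> \<open>The radius solves \<delta>^\<alpha> = e.\<close>
  proof (intro exI[of _ "e powr (1 / \<alpha>)"] conjI ballI impI)
    show "0 < e powr (1 / \<alpha>)" using e by simp
    fix h s t assume h: "h \<in> holder_space a b \<alpha>" and s: "s \<in> {a..b}" and t: "t \<in> {a..b}" and st: "\<bar>s - t\<bar> < e powr (1 / \<alpha>)"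
    let ?S = "Sup (holder_quotients a b \<alpha> h)"
    note q = holder_quotients_bound[OF assms(1) h]
    have "\<bar>s - t\<bar> powr \<alpha> \<le> (e powr (1 / \<alpha>)) powr \<alpha>"
      by (rule powr_mono2) (use st assms in auto)
    also have "\<dots> = e" using e assms(2) by (simp add: powr_powr)
    finally have *: "\<bar>s - t\<bar> powr \<alpha> \<le> e" .
    have "\<bar>h s - h t\<bar> \<le> ?S * \<bar>s - t\<bar> powr \<alpha>" by (rule q(2)[OF s t])
    also have "\<dots> \<le> ?S * e" by (rule mult_left_mono[OF * q(1)])
    also have "\<dots> \<le> e * holder_norm a b \<alpha> h" unfolding holder_norm_def using e by (simp add: algebra_simps)
    finally show "\<bar>h s - h t\<bar> \<le> e * holder_norm a b \<alpha> h" .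
  qed
qed

section \<open>Lebesgue and Sobolev spaces\<close>

lemma Lp_norm_finite_iff:
  assumes "p \<noteq> \<infinity>"
  shows "Lp_norm M p f < \<infinity> \<longleftrightarrow> (\<integral>\<^sup>+ x. ennreal (\<bar>f x\<bar> powr enn2real p) \<partial>M) \<noteq> \<infinity>"
  using assms unfolding Lp_norm_def Let_def by simp

text \<open>Only finiteness is at stake; bounding the sum by twice the maximum of the two moduli
  gives it for every finite exponent.\<close>

lemma Lp_space_add:
  assumes "v \<in> Lp_space M p" "w \<in> Lp_space M p"
  shows "(\<lambda>x. v x + w x) \<in> Lp_space M p"
proof -
  have [measurable]: "v \<in> borel_measurable M" "w \<in> borel_measurable M"
    using assms unfolding Lp_space_def by auto
  have fin: "Lp_norm M p v < \<infinity>" "Lp_norm M p w < \<infinity>" using assms unfolding Lp_space_def by auto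
  have "Lp_norm M p (\<lambda>x. v x + w x) < \<infinity>"
  proof (cases "p = \<infinity>")
    case True
    have "AE x in M. ennreal \<bar>v x + w x\<bar> \<le> esssup M (\<lambda>x. ennreal \<bar>v x\<bar>) + esssup M (\<lambda>x. ennreal \<bar>w x\<bar>)"
      using esssup_AE[of "\<lambda>x. ennreal \<bar>v x\<bar>" M] esssup_AE[of "\<lambda>x. ennreal \<bar>w x\<bar>" M]
    proof eventually_elim
      case (elim x)
      have "ennreal \<bar>v x + w x\<bar> \<le> ennreal (\<bar>v x\<bar> + \<bar>w x\<bar>)" by (rule ennreal_leI) simp
      also have "\<dots> = ennreal \<bar>v x\<bar> + ennreal \<bar>w x\<bar>" by (simp add: ennreal_plus)
      also have "\<dots> \<le> esssup M (\<lambda>x. ennreal \<bar>v x\<bar>) + esssup M (\<lambda>x. ennreal \<bar>w x\<bar>)" by (rule add_mono[OF elim])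
      finally show ?case .
    qed
    then have "esssup M (\<lambda>x. ennreal \<bar>v x + w x\<bar>) \<le> esssup M (\<lambda>x. ennreal \<bar>v x\<bar>) + esssup M (\<lambda>x. ennreal \<bar>w x\<bar>)"
      by (intro esssup_I) auto
    also have "\<dots> < \<infinity>" using fin True unfolding Lp_norm_def by simp
    finally show ?thesis using True unfolding Lp_norm_def by simp
  next
    case False
    let ?q = "enn2real p"
    have "\<bar>v x + w x\<bar> powr ?q \<le> 2 powr ?q * (\<bar>v x\<bar> powr ?q + \<bar>w x\<bar> powr ?q)" for x
    proof -
      have "\<bar>v x + w x\<bar> powr ?q \<le> (2 * max \<bar>v x\<bar> \<bar>w x\<bar>) powr ?q" by (rule powr_mono2) auto
      also have "\<dots> = 2 powr ?q * max \<bar>v x\<bar> \<bar>w x\<bar> powr ?q" by (simp add: powr_mult)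
      also have "\<dots> \<le> 2 powr ?q * (\<bar>v x\<bar> powr ?q + \<bar>w x\<bar> powr ?q)"
        by (intro mult_left_mono) (auto simp: max_def)
      finally show ?thesis .
    qed
    then have "(\<integral>\<^sup>+ x. ennreal (\<bar>v x + w x\<bar> powr ?q) \<partial>M) \<le> (\<integral>\<^sup>+ x. ennreal (2 powr ?q) * (ennreal (\<bar>v x\<bar> powr ?q) + ennreal (\<bar>w x\<bar> powr ?q)) \<partial>M)"
      by (intro nn_integral_mono) (simp add: ennreal_plus[symmetric] ennreal_mult[symmetric] del: ennreal_plus)
    also have "\<dots> = ennreal (2 powr ?q) * ((\<integral>\<^sup>+ x. ennreal (\<bar>v x\<bar> powr ?q) \<partial>M) + (\<integral>\<^sup>+ x. ennreal (\<bar>w x\<bar> powr ?q) \<partial>M))"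
      by (simp add: nn_integral_cmult nn_integral_add)
    also have "\<dots> < \<infinity>"
      using fin unfolding Lp_norm_finite_iff[OF False] by (simp add: ennreal_mult_less_top less_top)
    finally show ?thesis unfolding Lp_norm_finite_iff[OF False] by simp
  qed
  then show ?thesis unfolding Lp_space_def by simp
qed

text \<open>Either y \<le> c, or y^(1 - p) \<le> c^(1 - p) because the exponent is negative. A large
  c makes the second term small, which is the source of the absolute continuity of the mass of
  v.\<close>

lemma young_linear:
  fixes c y p :: real
  assumes "0 < c" "1 < p" "0 \<le> y"
  shows "y \<le> c + c powr (1 - p) * y powr p"
proof (cases "y \<le> c")
  case False
  then have y: "0 < y" using assms by simp
  have "y = y powr (1 - p) * y powr p" using y by (simp add: powr_add[symmetric])
  also have "\<dots> \<le> c powr (1 - p) * y powr p"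
    by (rule mult_right_mono[OF powr_mono2']) (use assms False in auto)
  finally show ?thesis using assms(1) by simp
qed (use assms in \<open>simp add: add_increasing2\<close>)

text \<open>For the exponent infinity any number above 1 would serve; the value 2 only has to make
  the tail K powr (1 - 2) tend to 0.\<close>

definition young_exponent :: "ennreal \<Rightarrow> real" where
  "young_exponent \<gamma> = (if \<gamma> = \<infinity> then 2 else enn2real \<gamma>)"

lemma young_exponent_gt_one:
  assumes "1 < \<gamma>"
  shows "1 < young_exponent \<gamma>"
proof (cases "\<gamma> = \<infinity>")
  case False
  then have "ennreal (enn2real \<gamma>) = \<gamma>" by (simp add: less_top)
  then have "ennreal 1 < ennreal (enn2real \<gamma>)" using assms by simp
  then show ?thesis using False by (simp add: young_exponent_def ennreal_less_iff)
qed (simp add: young_exponent_def)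

text \<open>Replaces Hoelder's inequality on subintervals; \<open>K\<close> is a free parameter that is chosen large.\<close>

lemma Lp_space_local_mass:
  fixes v :: "real \<Rightarrow> real" and a b :: real and \<gamma> :: ennreal
  defines "M \<equiv> lebesgue_on {a<..<b}"
  assumes v: "v \<in> Lp_space M \<gamma>" and \<gamma>: "1 < \<gamma>"
  defines "N \<equiv> enn2real (Lp_norm M \<gamma> v)"
  shows "integrable M v \<and> (\<forall>K e s t. 1 \<le> K \<longrightarrow> 0 < e \<longrightarrow> a < s \<longrightarrow> s < t \<longrightarrow> t < b \<longrightarrow>
    (LINT x|M. indicator {s..t} x * \<bar>v x\<bar>) \<le> (N + e) * K * (t - s) + (N + e) * K powr (1 - young_exponent \<gamma>))"
proof -
  have [measurable]: "v \<in> borel_measurable M" using v unfolding Lp_space_def by simp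
  have Nfin: "Lp_norm M \<gamma> v < \<infinity>" using v unfolding Lp_space_def by simp
  have N0: "0 \<le> N" unfolding N_def by simp
  interpret finite_measure M
  proof
    have "emeasure M (space M) = emeasure lebesgue {a<..<b}" unfolding M_def by (simp add: emeasure_restrict_space)
    then show "emeasure M (space M) \<noteq> \<infinity>"
      using emeasure_bounded_finite[of "{a<..<b}"] by simp
  qed
  have ind_m [measurable]: "indicat_real {s..t} \<in> borel_measurable M" for s t
    unfolding M_def by (intro measurable_restrict_space1 borel_measurable_indicator) simp
  have int_ind: "integrable M (indicat_real {s..t})" for s t
    by (rule integrable_const_bound[where B=1]) (auto simp: indicator_def)
  have LINT_ind: "(LINT x|M. indicat_real {s..t} x) = t - s" if "a < s" "s < t" "t < b" for s t
  proof -
    have "(LINT x|M. indicat_real {s..t} x) = measure M ({s..t} \<inter> space M)"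
      by (rule Bochner_Integration.integral_indicator)
    also have "{s..t} \<inter> space M = {s..t}" unfolding M_def using that by (auto simp: space_restrict_space)
    also have "measure M {s..t} = measure lebesgue {s..t}"
      unfolding M_def by (rule measure_restrict_space) (use that in auto)
    also have "\<dots> = t - s" using that by simp
    finally show ?thesis .
  qed
  show ?thesis
  proof (cases "\<gamma> = \<infinity>")
    case True
    have "AE x in M. \<bar>v x\<bar> \<le> N"
      using esssup_AE[of "\<lambda>x. ennreal \<bar>v x\<bar>" M]
    proof eventually_elim
      case (elim x)
      then have "enn2real (ennreal \<bar>v x\<bar>) \<le> N"
        unfolding N_def using Nfin True by (intro enn2real_mono) (auto simp: Lp_norm_def)
      then show ?case by simp
    qed
    then have iv: "integrable M v" by (intro integrable_const_bound[of _ N]) auto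
    have "(LINT x|M. indicator {s..t} x * \<bar>v x\<bar>) \<le> (N + e) * K * (t - s) + (N + e) * K powr (1 - 2)"
      if K: "1 \<le> K" and e: "0 < e" and st: "a < s" "s < t" "t < b" for K e s t
    proof -
      have "(LINT x|M. indicator {s..t} x * \<bar>v x\<bar>) \<le> (LINT x|M. N * indicat_real {s..t} x)"
      proof (rule integral_mono_AE)
        show "integrable M (\<lambda>x. indicator {s..t} x * \<bar>v x\<bar>)"
        proof (rule Bochner_Integration.integrable_bound[OF iv])
          show "AE x in M. norm (indicator {s..t} x * \<bar>v x\<bar>) \<le> norm (v x)"
            by (rule AE_I2) (simp add: indicator_def)
        qed measurable
        show "AE x in M. indicator {s..t} x * \<bar>v x\<bar> \<le> N * indicat_real {s..t} x"
          using \<open>AE x in M. \<bar>v x\<bar> \<le> N\<close> by eventually_elim (simp add: indicator_def)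
      qed (use int_ind in simp)
      also have "\<dots> = N * (t - s)" using LINT_ind[OF st] by simp
      also have "\<dots> \<le> (N + e) * K * (t - s)"
      proof -
        have "N * 1 \<le> (N + e) * K" by (rule mult_mono) (use N0 e K in auto)
        then show ?thesis using st by (intro mult_right_mono) auto
      qed
      also have "\<dots> \<le> (N + e) * K * (t - s) + (N + e) * K powr (1 - 2)" using N0 e by simp
      finally show ?thesis .
    qed
    then show ?thesis using iv True by (simp add: young_exponent_def)
  next
    case False
    define p where "p = enn2real \<gamma>"
    have p: "1 < p" using young_exponent_gt_one[OF \<gamma>] False by (simp add: p_def young_exponent_def)
    define I where "I = (\<integral>\<^sup>+ x. ennreal (\<bar>v x\<bar> powr p) \<partial>M)"
    have I: "I \<noteq> \<infinity>" using Nfin unfolding Lp_norm_finite_iff[OF False] I_def p_def .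
    have N: "N = enn2real I powr (1 / p)"
      unfolding N_def Lp_norm_def Let_def using False I by (simp add: I_def p_def)
    have Np: "N powr p = enn2real I" unfolding N using p by (simp add: powr_powr)
    have ip: "integrable M (\<lambda>x. \<bar>v x\<bar> powr p)"
      by (rule integrableI_nonneg) (use I in \<open>auto simp: I_def less_top\<close>)
    have LINT_p: "(LINT x|M. \<bar>v x\<bar> powr p) = N powr p"
      unfolding Np I_def by (rule integral_eq_nn_integral) auto
    have iv: "integrable M v"
    proof (rule Bochner_Integration.integrable_bound)
      show "integrable M (\<lambda>x. 1 + \<bar>v x\<bar> powr p)" using ip by simp
      show "AE x in M. norm (v x) \<le> norm (1 + \<bar>v x\<bar> powr p)"
      proof (rule AE_I2)
        fix x
        have "\<bar>v x\<bar> \<le> 1 + \<bar>v x\<bar> powr p" using young_linear[of 1 p "\<bar>v x\<bar>"] p by simp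
        then show "norm (v x) \<le> norm (1 + \<bar>v x\<bar> powr p)" by simp
      qed
    qed measurable
    have "(LINT x|M. indicator {s..t} x * \<bar>v x\<bar>) \<le> (N + e) * K * (t - s) + (N + e) * K powr (1 - p)"
      if K: "1 \<le> K" and e: "0 < e" and st: "a < s" "s < t" "t < b" for K e s t
    proof -
      \<comment> \<open>With this threshold the tail c powr (1 - p) * N powr p is at most (N + e) *
        K powr (1 - p), so both terms carry the factor N + e. The summand e keeps c positive when N
        = 0.\<close>
      define c where "c = (N + e) * K"
      have c: "0 < c" unfolding c_def using N0 e K by simp
      have "(LINT x|M. indicator {s..t} x * \<bar>v x\<bar>) \<le> (LINT x|M. c * indicat_real {s..t} x + c powr (1 - p) * \<bar>v x\<bar> powr p)"
      proof (rule integral_mono)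
        show "integrable M (\<lambda>x. indicator {s..t} x * \<bar>v x\<bar>)"
        proof (rule Bochner_Integration.integrable_bound[OF iv])
          show "AE x in M. norm (indicator {s..t} x * \<bar>v x\<bar>) \<le> norm (v x)"
            by (rule AE_I2) (simp add: indicator_def)
        qed measurable
        show "integrable M (\<lambda>x. c * indicat_real {s..t} x + c powr (1 - p) * \<bar>v x\<bar> powr p)"
          by (intro Bochner_Integration.integrable_add integrable_mult_right int_ind ip)
        show "indicator {s..t} x * \<bar>v x\<bar> \<le> c * indicat_real {s..t} x + c powr (1 - p) * \<bar>v x\<bar> powr p" for x
          using young_linear[OF c p, of "\<bar>v x\<bar>"] by (simp add: indicator_def)
      qed
      also have "\<dots> = c * (t - s) + c powr (1 - p) * N powr p"
        using LINT_ind[OF st] LINT_p int_ind ip by simp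
      also have "c powr (1 - p) * N powr p \<le> c powr (1 - p) * (N + e) powr p"
        by (intro mult_left_mono powr_mono2) (use N0 e p in auto)
      also have "c powr (1 - p) * (N + e) powr p = K powr (1 - p) * ((N + e) powr (1 - p) * (N + e) powr p)"
        unfolding c_def using N0 e K by (simp add: powr_mult)
      also have "(N + e) powr (1 - p) * (N + e) powr p = N + e"
        using N0 e by (simp add: powr_add[symmetric])
      finally show ?thesis unfolding c_def by (simp add: mult.commute)
    qed
    then show ?thesis using iv False by (simp add: young_exponent_def p_def)
  qed
qed

text \<open>Test functions vanish near a and b, so the increment estimate covers interior points and
  reaches the end points by continuity of u. The auxiliary e of \<open>Lp_space_local_mass\<close>
  is removed by letting it tend to 0.\<close>

lemma sobolev_modulus:
  fixes u :: cfun
  assumes "a < b" "1 < \<gamma>" and v: "v \<in> Lp_space (lebesgue_on {a<..<b}) \<gamma>" and w: "weak_deriv a b u v"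
    and K: "1 \<le> K" and s: "s \<in> {a..b}" and t: "t \<in> {a..b}"
  shows "\<bar>u t - u s\<bar> \<le> enn2real (Lp_norm (lebesgue_on {a<..<b}) \<gamma> v) * (K * \<bar>t - s\<bar> + K powr (1 - young_exponent \<gamma>))"
proof -
  define N where "N = enn2real (Lp_norm (lebesgue_on {a<..<b}) \<gamma> v)"
  define p where "p = young_exponent \<gamma>"
  have N0: "0 \<le> N" unfolding N_def by simp
  have iv: "integrable (lebesgue_on {a<..<b}) v"
    and loc: "\<forall>K e s t. 1 \<le> K \<longrightarrow> 0 < e \<longrightarrow> a < s \<longrightarrow> s < t \<longrightarrow> t < b \<longrightarrow>
    (LINT x|lebesgue_on {a<..<b}. indicator {s..t} x * \<bar>v x\<bar>) \<le> (N + e) * K * (t - s) + (N + e) * K powr (1 - p)"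
    using Lp_space_local_mass[OF v assms(2)] unfolding N_def p_def by blast+
  have open_case: "\<bar>u t - u s\<bar> \<le> N * (K * (t - s) + K powr (1 - p))"
    if st: "a < s" "s < t" "t < b" for s t
  proof (rule field_le_epsilon)
    fix e :: real assume e: "0 < e"
    define L where "L = K * (t - s) + K powr (1 - p)"
    have "0 < K * (t - s)" using K st by simp
    then have L: "0 < L" unfolding L_def by (simp add: add_pos_nonneg)
    have eL: "0 < e / L" using e L by simp
    have "\<bar>u t - u s\<bar> \<le> (N + e / L) * K * (t - s) + (N + e / L) * K powr (1 - p)"
    proof (rule weak_deriv_increment[OF st iv w])
      show "0 \<le> (N + e / L) * K" using N0 eL K by simp
    qed (use loc K eL in blast)
    also have "\<dots> = (N + e / L) * L" unfolding L_def by (simp only: distrib_left mult.assoc)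
    also have "\<dots> = N * L + e" using L by (simp add: distrib_right)
    finally show "\<bar>u t - u s\<bar> \<le> N * (K * (t - s) + K powr (1 - p)) + e" unfolding L_def .
  qed
  have closed_case: "\<bar>u t - u s\<bar> \<le> N * (K * (t - s) + K powr (1 - p))"
    if st: "a \<le> s" "s < t" "t \<le> b" for s t
  proof -
    \<comment> \<open>The factor 1/3 keeps s + d n strictly below t - d n.\<close>
    define d where "d = (\<lambda>n. (t - s) / 3 * inverse (real (Suc n)))"
    have d: "0 < d n" "d n \<le> (t - s) / 3" for n
    proof -
      show "0 < d n" unfolding d_def using st by simp
      have "inverse (real (Suc n)) \<le> 1" by (simp add: field_simps)
      then show "d n \<le> (t - s) / 3" unfolding d_def using st by (intro mult_left_le) auto
    qed
    have d_lim: "d \<longlonglongrightarrow> 0" unfolding d_def by (rule tendsto_mult_right_zero[OF LIMSEQ_inverse_real_of_nat])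
    have cu: "isCont u x" for x by (simp add: continuous_on_interior[of UNIV])
    have "(\<lambda>n. t - d n) \<longlonglongrightarrow> t" "(\<lambda>n. s + d n) \<longlonglongrightarrow> s"
      using tendsto_diff[OF tendsto_const d_lim, of t] tendsto_add[OF tendsto_const d_lim, of s] by simp_all
    then have "(\<lambda>n. \<bar>u (t - d n) - u (s + d n)\<bar>) \<longlonglongrightarrow> \<bar>u t - u s\<bar>"
      by (intro tendsto_rabs tendsto_diff isCont_tendsto_compose[OF cu])
    moreover have "\<bar>u (t - d n) - u (s + d n)\<bar> \<le> N * (K * (t - s) + K powr (1 - p))" for n
    proof -
      have "\<bar>u (t - d n) - u (s + d n)\<bar> \<le> N * (K * ((t - d n) - (s + d n)) + K powr (1 - p))"
        by (rule open_case) (use st d[of n] in auto)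
      also have "\<dots> \<le> N * (K * (t - s) + K powr (1 - p))"
        by (intro mult_left_mono add_right_mono N0) (use K d[of n] in auto)
      finally show ?thesis .
    qed
    ultimately show ?thesis by (intro LIMSEQ_le_const2) auto
  qed
  consider "s < t" | "t < s" | "s = t" by linarith
  then have "\<bar>u t - u s\<bar> \<le> N * (K * \<bar>t - s\<bar> + K powr (1 - p))"
  proof cases
    case 1 then show ?thesis using closed_case[of s t] s t by simp
  next
    case 2 then show ?thesis using closed_case[of t s] s t by (simp add: abs_minus_commute)
  next
    case 3 then show ?thesis using N0 by simp
  qed
  then show ?thesis unfolding N_def p_def .
qed

text \<open>The integral of a non-integrable function is 0 by default, so adding two weak
  derivatives has to be preceded by the integrability of these products.\<close>

lemma test_function_products_integrable:
  assumes \<phi>: "\<phi> \<in> test_functions a b"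
  shows "integrable (lebesgue_on {a<..<b}) (\<lambda>x. apply_bcontfun u x * deriv \<phi> x)"
    and "integrable (lebesgue_on {a<..<b}) v \<Longrightarrow> integrable (lebesgue_on {a<..<b}) (\<lambda>x. v x * \<phi> x)"
proof -
  let ?M = "lebesgue_on {a<..<b}"
  have diff: "(deriv ^^ k) \<phi> field_differentiable (at t)" for k t using \<phi> unfolding test_functions_def by auto
  have c: "continuous_on S ((deriv ^^ k) \<phi>)" for k S
    by (rule continuous_at_imp_continuous_on) (use diff field_differentiable_imp_continuous_at in blast)
  have c0: "continuous_on S \<phi>" and c1: "continuous_on S (deriv \<phi>)" for S using c[of S 0] c[of S 1] by simp_all
  show "integrable ?M (\<lambda>x. apply_bcontfun u x * deriv \<phi> x)"
    by (intro integrable_lebesgue_on_open continuous_on_mult c1 continuous_on_apply_bcontfun)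
  assume v: "integrable ?M v"
  have "compact (\<phi> ` {a..b})" by (rule compact_continuous_image[OF c0]) simp
  from compact_imp_bounded[OF this] obtain B where "\<forall>y\<in>\<phi> ` {a..b}. norm y \<le> B"
    unfolding bounded_iff by blast
  then have B: "\<And>x. x \<in> {a..b} \<Longrightarrow> \<bar>\<phi> x\<bar> \<le> B" by simp
  have "\<phi> \<in> borel_measurable borel" by (rule borel_measurable_continuous_onI[OF c0])
  then have m: "\<phi> \<in> borel_measurable ?M" by (intro measurable_restrict_space1 measurable_completion) simp
  show "integrable ?M (\<lambda>x. v x * \<phi> x)"
  proof (rule Bochner_Integration.integrable_bound)
    show "integrable ?M (\<lambda>x. B * v x)" using v by simp
    show "(\<lambda>x. v x * \<phi> x) \<in> borel_measurable ?M" using m borel_measurable_integrable[OF v] by measurable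
    show "AE x in ?M. norm (v x * \<phi> x) \<le> norm (B * v x)"
    proof (rule AE_I2)
      fix x assume "x \<in> space ?M"
      then have "\<bar>\<phi> x\<bar> \<le> B" by (intro B) (simp add: space_restrict_space)
      then have "\<bar>\<phi> x\<bar> \<le> \<bar>B\<bar>" by simp
      then show "norm (v x * \<phi> x) \<le> norm (B * v x)"
        unfolding real_norm_def abs_mult by (subst mult.commute) (rule mult_right_mono, auto)
    qed
  qed
qed

lemma sobolev_space_add:
  assumes "1 < \<gamma>" "u \<in> sobolev_space a b \<gamma>" "w \<in> sobolev_space a b \<gamma>"
  shows "u + w \<in> sobolev_space a b \<gamma>"
proof -
  let ?M = "lebesgue_on {a<..<b}"
  obtain f where f: "f \<in> Lp_space ?M \<gamma>" "weak_deriv a b u f" using assms(2) unfolding sobolev_space_def by blast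
  obtain g where g: "g \<in> Lp_space ?M \<gamma>" "weak_deriv a b w g" using assms(3) unfolding sobolev_space_def by blast
  have int: "integrable ?M f" "integrable ?M g"
    using Lp_space_local_mass[OF f(1) assms(1)] Lp_space_local_mass[OF g(1) assms(1)] by auto
  have "weak_deriv a b (u + w) (\<lambda>x. f x + g x)"
    unfolding weak_deriv_def
  proof
    fix \<phi> assume \<phi>: "\<phi> \<in> test_functions a b"
    note i = test_function_products_integrable[OF \<phi>]
    have "(LINT t|?M. (u + w) t * deriv \<phi> t) = (LINT t|?M. u t * deriv \<phi> t + w t * deriv \<phi> t)"
      by (simp add: distrib_right)
    also have "\<dots> = (LINT t|?M. u t * deriv \<phi> t) + (LINT t|?M. w t * deriv \<phi> t)"
      by (rule Bochner_Integration.integral_add[OF i(1) i(1)])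
    also have "\<dots> = - ((LINT t|?M. f t * \<phi> t) + (LINT t|?M. g t * \<phi> t))"
      using f(2) g(2) \<phi> unfolding weak_deriv_def by simp
    also have "(LINT t|?M. f t * \<phi> t) + (LINT t|?M. g t * \<phi> t) = (LINT t|?M. f t * \<phi> t + g t * \<phi> t)"
      by (rule Bochner_Integration.integral_add[symmetric, OF i(2)[OF int(1)] i(2)[OF int(2)]])
    also have "\<dots> = (LINT t|?M. (f t + g t) * \<phi> t)" by (simp add: distrib_right)
    finally show "(LINT t|?M. (u + w) t * deriv \<phi> t) = - (LINT t|?M. (f t + g t) * \<phi> t)" .
  qed
  then show ?thesis
    using Lp_space_add[OF f(1) g(1)] C_on_add assms(2,3) unfolding sobolev_space_def by blast
qed

theorem equicontinuous_sobolev: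
  assumes "a < b" "1 < \<gamma>"
  shows "equicontinuous_space a b (sobolev_space a b \<gamma>) (sobolev_norm a b \<gamma>)"
proof -
  let ?M = "lebesgue_on {a<..<b}"
  define der where "der u = (SOME v. v \<in> Lp_space ?M \<gamma> \<and> weak_deriv a b u v)" for u :: "real \<Rightarrow> real"
  define N where "N u = enn2real (Lp_norm ?M \<gamma> (der u))" for u
  have der: "der h \<in> Lp_space ?M \<gamma>" "weak_deriv a b h (der h)" if "h \<in> sobolev_space a b \<gamma>" for h :: cfun
  proof -
    have "\<exists>v. v \<in> Lp_space ?M \<gamma> \<and> weak_deriv a b h v" using that unfolding sobolev_space_def by blast
    from someI_ex[OF this] show "der h \<in> Lp_space ?M \<gamma>" "weak_deriv a b h (der h)" unfolding der_def by auto
  qed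
  have norm_eq: "sobolev_norm a b \<gamma> h = \<bar>h a\<bar> + N h" for h :: cfun
    unfolding sobolev_norm_def N_def der_def ..
  have N0: "0 \<le> N h" for h unfolding N_def by simp
  have mod: "\<bar>h t - h s\<bar> \<le> N h * (K * \<bar>t - s\<bar> + K powr (1 - young_exponent \<gamma>))"
    if "h \<in> sobolev_space a b \<gamma>" "1 \<le> K" "s \<in> {a..b}" "t \<in> {a..b}" for h :: cfun and K s t
    unfolding N_def by (rule sobolev_modulus[OF assms der[OF that(1)] that(2-4)])
  show ?thesis
    unfolding equicontinuous_space_def norm_eq
  proof (intro conjI ballI allI impI)
    show "sobolev_space a b \<gamma> \<subseteq> C_on a b" unfolding sobolev_space_def by auto
    show "u + v \<in> sobolev_space a b \<gamma>" if "u \<in> sobolev_space a b \<gamma>" "v \<in> sobolev_space a b \<gamma>" for u v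
      by (rule sobolev_space_add[OF assms(2) that])
    show "0 \<le> \<bar>h a\<bar> + N h" for h :: cfun using N0 by simp
    show "\<exists>C\<ge>0. \<forall>h\<in>sobolev_space a b \<gamma>. norm h \<le> C * (\<bar>apply_bcontfun h a\<bar> + N h)"
    proof (intro exI[of _ "1 + (b - a)"] conjI ballI)
      show "0 \<le> 1 + (b - a)" using assms by simp
      fix h assume h: "h \<in> sobolev_space a b \<gamma>"
      show "norm h \<le> (1 + (b - a)) * (\<bar>h a\<bar> + N h)"
      proof (rule norm_C_on_le[of _ a b])
        show "h \<in> C_on a b" using h unfolding sobolev_space_def by simp
        fix t assume t: "t \<in> {a..b}"
        have "\<bar>h t - h a\<bar> \<le> N h * (1 * \<bar>t - a\<bar> + 1 powr (1 - young_exponent \<gamma>))"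
          by (rule mod[OF h]) (use t in auto)
        also have "\<dots> \<le> N h * (1 + (b - a))" by (rule mult_left_mono[OF _ N0]) (use t in auto)
        finally have "\<bar>h t\<bar> \<le> \<bar>h a\<bar> + N h * (1 + (b - a))" by linarith
        also have "\<dots> \<le> (1 + (b - a)) * (\<bar>h a\<bar> + N h)"
        proof -
          have "0 \<le> (b - a) * \<bar>h a\<bar>" using assms by simp
          then show ?thesis by (simp add: algebra_simps)
        qed
        finally show "\<bar>h t\<bar> \<le> (1 + (b - a)) * (\<bar>h a\<bar> + N h)" .
      qed (use assms in simp)
    qed
    fix e :: real assume e: "0 < e"
    \<comment> \<open>First K is fixed so large that the tail is below e / 2; then the radius e / (2
      * K) makes the linear term at most e / 2. For the bound on the maximum norm above, K = 1 was
      enough.\<close>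
    have "((\<lambda>K. K powr (1 - young_exponent \<gamma>)) \<longlongrightarrow> 0) at_top"
      by (rule tendsto_neg_powr) (use young_exponent_gt_one[OF assms(2)] filterlim_ident in auto)
    then have "\<forall>\<^sub>F K in at_top. K powr (1 - young_exponent \<gamma>) < e / 2 \<and> 1 \<le> K"
      by (intro eventually_conj order_tendstoD(2) eventually_ge_at_top) (use e in auto)
    then obtain K where K: "K powr (1 - young_exponent \<gamma>) < e / 2" "1 \<le> K"
      using eventually_happens'[OF trivial_limit_at_top_linorder] by blast
    show "\<exists>\<delta>>0. \<forall>h\<in>sobolev_space a b \<gamma>. \<forall>s\<in>{a..b}. \<forall>t\<in>{a..b}. \<bar>s - t\<bar> < \<delta> \<longrightarrow> \<bar>apply_bcontfun h s - apply_bcontfun h t\<bar> \<le> e * (\<bar>apply_bcontfun h a\<bar> + N h)"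
    proof (intro exI[of _ "e / (2 * K)"] conjI ballI impI)
      show "0 < e / (2 * K)" using e K by simp
      fix h s t assume h: "h \<in> sobolev_space a b \<gamma>" and s: "s \<in> {a..b}" and t: "t \<in> {a..b}" and st: "\<bar>s - t\<bar> < e / (2 * K)"
      have "K * \<bar>s - t\<bar> \<le> e / 2" using st K(2) by (simp add: field_simps)
      have "\<bar>h s - h t\<bar> \<le> N h * (K * \<bar>s - t\<bar> + K powr (1 - young_exponent \<gamma>))"
        by (rule mod[OF h K(2) t s])
      also have "\<dots> \<le> N h * e"
        by (rule mult_left_mono[OF _ N0]) (use \<open>K * \<bar>s - t\<bar> \<le> e / 2\<close> K(1) in linarith)
      also have "\<dots> \<le> e * (\<bar>h a\<bar> + N h)" using e by (simp add: algebra_simps)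
      finally show "\<bar>h s - h t\<bar> \<le> e * (\<bar>h a\<bar> + N h)" .
    qed
  qed
qed

section \<open>Remainder estimate in Lebesgue spaces\<close>

lemma Lp_norm_bounded:
  fixes f :: "'a \<Rightarrow> real"
  assumes "finite_measure M" "1 \<le> q" "f \<in> borel_measurable M" "\<And>x. x \<in> space M \<Longrightarrow> \<bar>f x\<bar> \<le> K"
  shows "integrable M (\<lambda>x. \<bar>f x\<bar> powr q)"
    and "Lp_norm M (ennreal q) f = ennreal ((LINT x|M. \<bar>f x\<bar> powr q) powr (1 / q))"
proof -
  interpret finite_measure M by fact
  have [measurable]: "f \<in> borel_measurable M" by fact
  show i: "integrable M (\<lambda>x. \<bar>f x\<bar> powr q)"
  proof (rule integrable_const_bound)
    show "AE x in M. norm (\<bar>f x\<bar> powr q) \<le> K powr q"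
      by (rule AE_I2) (use assms(2,4) in \<open>auto intro!: powr_mono2\<close>)
  qed measurable
  have "(\<integral>\<^sup>+ x. ennreal (\<bar>f x\<bar> powr q) \<partial>M) = ennreal (LINT x|M. \<bar>f x\<bar> powr q)"
    by (rule nn_integral_eq_integral[OF i]) simp
  moreover have "0 \<le> (LINT x|M. \<bar>f x\<bar> powr q)" by (rule Bochner_Integration.integral_nonneg) simp
  ultimately show "Lp_norm M (ennreal q) f = ennreal ((LINT x|M. \<bar>f x\<bar> powr q) powr (1 / q))"
    using assms(2) unfolding Lp_norm_def Let_def by simp
qed

lemma Lp_norm_le_sup:
  fixes f :: "'a \<Rightarrow> real"
  assumes "finite_measure M" "1 \<le> q" "f \<in> borel_measurable M" "\<And>x. x \<in> space M \<Longrightarrow> \<bar>f x\<bar> \<le> K" "0 \<le> K"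
  shows "Lp_norm M (ennreal q) f \<le> ennreal (K * measure M (space M) powr (1 / q))"
proof -
  interpret finite_measure M by fact
  note b = Lp_norm_bounded[OF assms(1-4)]
  have "(LINT x|M. \<bar>f x\<bar> powr q) \<le> (LINT x|M. K powr q)"
    by (rule integral_mono[OF b(1)]) (use assms in \<open>auto intro!: powr_mono2\<close>)
  also have "\<dots> = measure M (space M) * K powr q" by simp
  finally have "(LINT x|M. \<bar>f x\<bar> powr q) powr (1 / q) \<le> (measure M (space M) * K powr q) powr (1 / q)"
    by (intro powr_mono2) (use assms(2) in \<open>auto intro!: Bochner_Integration.integral_nonneg\<close>)
  also have "\<dots> = K * measure M (space M) powr (1 / q)"
    using assms(2,5) by (simp add: powr_mult powr_powr mult.commute)
  finally have le: "(LINT x|M. \<bar>f x\<bar> powr q) powr (1 / q) \<le> K * measure M (space M) powr (1 / q)" .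
  show ?thesis by (rule ord_eq_le_trans[OF b(2) ennreal_leI[OF le]])
qed

lemma finite_measure_lebesgue_on_open: "finite_measure (lebesgue_on {a<..<b::real})"
proof
  have "emeasure (lebesgue_on {a<..<b}) (space (lebesgue_on {a<..<b})) = emeasure lebesgue {a<..<b}"
    by (simp add: emeasure_restrict_space)
  then show "emeasure (lebesgue_on {a<..<b}) (space (lebesgue_on {a<..<b})) \<noteq> \<infinity>"
    using emeasure_bounded_finite[of "{a<..<b}"] by simp
qed

text \<open>R d is the supremum of Q over all points with N at most d, hence monotone. The inserted
  0 keeps the set nonempty and R nonnegative.\<close>

lemma modulus_exists:
  fixes N Q :: "'a \<Rightarrow> real"
  assumes Q: "\<And>x. x \<in> S \<Longrightarrow> Q x \<le> K"
    and small: "\<And>e. 0 < e \<Longrightarrow> \<exists>\<delta>>0. \<forall>x\<in>S. N x < \<delta> \<longrightarrow> Q x \<le> e"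
  shows "\<exists>R. mono_on {0<..} R \<and> (R \<longlongrightarrow> 0) (at_right 0) \<and> (\<forall>x\<in>S. Q x \<le> R (N x))"
proof -
  define A where "A d = insert 0 (Q ` {x \<in> S. N x \<le> d})" for d :: real
  have bdd: "bdd_above (A d)" for d
    unfolding A_def bdd_above_insert by (rule bdd_aboveI2[of _ _ K]) (use Q in simp)
  define R where "R d = Sup (A d)" for d
  have nn: "0 \<le> R d" for d unfolding R_def by (rule cSup_upper[OF _ bdd]) (simp add: A_def)
  have "mono_on {0<..} R"
    unfolding R_def by (intro mono_onI cSup_subset_mono bdd) (auto simp: A_def)
  moreover have "(R \<longlongrightarrow> 0) (at_right 0)"
    unfolding tendsto_iff
  proof (intro allI impI)
    fix e :: real assume e: "0 < e"
    then obtain \<delta> where \<delta>: "\<delta> > 0" "\<forall>x\<in>S. N x < \<delta> \<longrightarrow> Q x \<le> e / 2" using small[of "e / 2"] by auto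
    have "dist (R d) 0 < e" if "0 < d" "d < \<delta>" for d
    proof -
      have "R d \<le> e / 2"
        unfolding R_def by (rule cSup_least) (use \<delta>(2) that e in \<open>auto simp: A_def\<close>)
      then show ?thesis using nn[of d] e by (simp add: dist_real_def)
    qed
    then show "\<forall>\<^sub>F d in at_right 0. dist (R d) 0 < e"
      by (intro eventually_at_rightI[of 0 \<delta>]) (use \<delta>(1) in auto)
  qed
  moreover have "Q x \<le> R (N x)" if "x \<in> S" for x
    unfolding R_def by (rule cSup_upper[OF _ bdd]) (use that in \<open>auto simp: A_def\<close>)
  ultimately show ?thesis by blast
qed

lemma uniform_delta:
  fixes N :: "'a \<Rightarrow> real"
  assumes "finite J" "\<And>n. n \<in> J \<Longrightarrow> \<exists>\<delta>>0. \<forall>x. N x < \<delta> \<longrightarrow> Q n x"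
  shows "\<exists>\<delta>>0. \<forall>n\<in>J. \<forall>x. N x < \<delta> \<longrightarrow> Q n x"
  using assms
proof (induction J rule: finite_induct)
  case empty
  then show ?case by (intro exI[of _ 1]) simp
next
  case (insert n J)
  from insert(3,4) obtain \<delta>1 where \<delta>1: "\<delta>1 > 0" "\<forall>n\<in>J. \<forall>x. N x < \<delta>1 \<longrightarrow> Q n x" by auto
  from insert(4)[of n] obtain \<delta>2 where \<delta>2: "\<delta>2 > 0" "\<forall>x. N x < \<delta>2 \<longrightarrow> Q n x" by auto
  show ?case by (rule exI[of _ "min \<delta>1 \<delta>2"]) (use \<delta>1 \<delta>2 in auto)
qed

section \<open>The remainder of the play: single times, small increments, modulus\<close>

context refining_partitions
begin

text \<open>An element of G at (u, z) provides a functional map for the level of (u, z) only. The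
  other levels are filled by choice; levels are disjoint, so the glued map is well defined.\<close>

lemma G_play_S_play:
  assumes L: "L \<in> G_play r a b D \<rho> (u, z)"
  shows "\<exists>\<mu>\<in>S_play r a b D \<rho>. \<forall>h y t. L (h, y) t = \<mu> (u, z, t) (h, y)"
proof -
  obtain n where n: "1 \<le> n" "(u, z) \<in> V_bar a b D \<rho> n - V_bar a b D \<rho> (n - 1)" "L \<in> G_part r a b (D n) (u, z)"
    using L unfolding G_play_def by blast
  obtain \<mu>n where \<mu>n: "\<mu>n \<in> S_part r a b (D n)" "L = (\<lambda>(h, y) t. \<mu>n (u, z, t) (h, y))"
    using n(3) unfolding G_part_def by auto
  have "\<forall>m. \<exists>\<mu>. 1 \<le> m \<longrightarrow> \<mu> \<in> S_part r a b (D m)"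
    using S_part_nonempty[OF part_D ab] by (metis ex_in_conv)
  from choice[OF this] obtain \<mu>' where \<mu>': "\<forall>m. 1 \<le> m \<longrightarrow> \<mu>' m \<in> S_part r a b (D m)" ..
  define \<mu>s where "\<mu>s = \<mu>'(n := \<mu>n)"
  have \<mu>s: "\<forall>m\<ge>1. \<mu>s m \<in> S_part r a b (D m)" unfolding \<mu>s_def using \<mu>' \<mu>n(1) by simp
  define lev where "lev x = (SOME m. x \<in> V_bar a b D \<rho> m - V_bar a b D \<rho> (m - 1))" for x
  have lev: "lev x = m" if x: "x \<in> V_bar a b D \<rho> m - V_bar a b D \<rho> (m - 1)" for x m
    unfolding lev_def
  proof (rule some_equality[of "\<lambda>m. x \<in> V_bar a b D \<rho> m - V_bar a b D \<rho> (m - 1)" m, OF x])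
    show "k = m" if "x \<in> V_bar a b D \<rho> k - V_bar a b D \<rho> (k - 1)" for k
      by (rule level_unique[OF that x])
  qed
  define \<mu> :: functional_map where "\<mu> = (\<lambda>(u, z, t). \<mu>s (lev (u, z)) (u, z, t))"
  have "\<mu> \<in> S_play r a b D \<rho>"
    unfolding S_play_def
  proof (intro CollectI exI[of _ \<mu>s] conjI \<mu>s allI impI ballI)
    fix m x assume "x \<in> V_bar a b D \<rho> m - V_bar a b D \<rho> (m - 1)"
    from lev[OF this] show "case x of (u, z0) \<Rightarrow> \<forall>t\<in>{a..b}. \<mu> (u, z0, t) = \<mu>s m (u, z0, t)"
      by (cases x) (simp add: \<mu>_def)
  qed
  moreover have "L (h, y) t = \<mu> (u, z, t) (h, y)" for h y t
    unfolding \<mu>n(2) \<mu>_def using lev[OF n(2)] by (simp add: \<mu>s_def)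
  ultimately show ?thesis by blast
qed

lemma G_play_nonempty:
  assumes "u \<in> C_on a b"
  shows "G_play r a b D \<rho> (u, z) \<noteq> {}"
proof -
  obtain n where n: "1 \<le> n" "(u, z) \<in> V_bar a b D \<rho> n - V_bar a b D \<rho> (n - 1)" using level_exists[OF assms] by blast
  obtain \<mu> where "\<mu> \<in> S_part r a b (D n)" using S_part_nonempty[OF part_D[OF n(1)] ab, of r] by blast
  then have "(\<lambda>(h, y) t. \<mu> (u, z, t) (h, y)) \<in> G_part r a b (D n) (u, z)" unfolding G_part_def by auto
  then show ?thesis using n unfolding G_play_def by blast
qed

lemma G_play_bound:
  assumes "L \<in> G_play r a b D \<rho> (u, z)" "u \<in> C_on a b" "h \<in> C_on a b" "t \<in> {a..b}"
    and "\<And>s. s \<in> {a..t} \<Longrightarrow> \<bar>apply_bcontfun h s\<bar> \<le> B"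
  shows "\<bar>L (h, y) t\<bar> \<le> B + \<bar>y\<bar>"
proof -
  obtain \<mu> where \<mu>: "\<mu> \<in> S_play r a b D \<rho>" "\<forall>h y t. L (h, y) t = \<mu> (u, z, t) (h, y)"
    using G_play_S_play[OF assms(1)] by blast
  show ?thesis unfolding \<mu>(2)[rule_format] by (rule S_play_bound(2)[OF \<mu>(1) assms(2,4,3,5)])
qed

lemma G_play_sup_norm:
  assumes L: "L \<in> G_play r a b D \<rho> (u, z)" and u: "u \<in> C_on a b" and h: "h \<in> C_on a b" and t: "t \<in> {a..b}"
  shows "sup_norm_upto a t (L (h, y)) \<le> sup_norm_upto a t (apply_bcontfun h) + ennreal \<bar>y\<bar>"
proof -
  have "continuous_on {a..t} (\<lambda>s. \<bar>h s\<bar>)" by (intro continuous_intros continuous_on_apply_bcontfun)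
  then obtain \<sigma> where \<sigma>: "\<sigma> \<in> {a..t}" "\<And>s. s \<in> {a..t} \<Longrightarrow> \<bar>h s\<bar> \<le> \<bar>h \<sigma>\<bar>"
    using continuous_attains_sup[of "{a..t}" "\<lambda>s. \<bar>h s\<bar>"] t by auto
  show ?thesis unfolding sup_norm_upto_def
  proof (rule SUP_least)
    fix s assume s: "s \<in> {a..t}"
    have "\<bar>L (h, y) s\<bar> \<le> \<bar>h \<sigma>\<bar> + \<bar>y\<bar>"
      by (rule G_play_bound[OF L u h]) (use s t \<sigma>(2) in auto)
    then have "ennreal \<bar>L (h, y) s\<bar> \<le> ennreal \<bar>h \<sigma>\<bar> + ennreal \<bar>y\<bar>"
      by (simp add: ennreal_plus[symmetric] del: ennreal_plus)
    also have "\<dots> \<le> (SUP s\<in>{a..t}. ennreal \<bar>h s\<bar>) + ennreal \<bar>y\<bar>"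
      by (intro add_right_mono SUP_upper \<sigma>(1))
    finally show "ennreal \<bar>L (h, y) s\<bar> \<le> (SUP s\<in>{a..t}. ennreal \<bar>h s\<bar>) + ennreal \<bar>y\<bar>" .
  qed
qed

lemma G_play_measurable:
  assumes L: "L \<in> G_play r a b D \<rho> (u, z)" and u: "u \<in> C_on a b"
  shows "L (h, y) \<in> borel_measurable (lebesgue_on {a<..<b})"
proof -
  obtain \<mu> where \<mu>: "\<mu> \<in> S_play r a b D \<rho>" "\<forall>h y t. L (h, y) t = \<mu> (u, z, t) (h, y)"
    using G_play_S_play[OF L] by blast
  have "(\<lambda>t. (u, z, t)) \<in> borel_measurable borel" by (intro borel_measurable_continuous_onI continuous_intros)
  then have "(\<lambda>t. (u, z, t)) \<in> lebesgue_on {a<..<b} \<rightarrow>\<^sub>M borel"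
    by (intro measurable_restrict_space1 measurable_completion) simp
  then have "(\<lambda>t. (u, z, t)) \<in> lebesgue_on {a<..<b} \<rightarrow>\<^sub>M restrict_space borel (C_on a b \<times> UNIV \<times> {a..b})"
    by (intro measurable_restrict_space2) (use u in \<open>auto simp: space_restrict_space\<close>)
  from measurable_compose[OF this weak_star_eval_measurable[OF S_play_measurable[OF \<mu>(1)], of "(h, y)"]]
  have "(\<lambda>t. blinfun_apply (\<mu> (u, z, t)) (h, y)) \<in> borel_measurable (lebesgue_on {a<..<b})" .
  moreover have "L (h, y) = (\<lambda>t. blinfun_apply (\<mu> (u, z, t)) (h, y))" using \<mu>(2) by (simp add: fun_eq_iff)
  ultimately show ?thesis by simp
qed

lemma G_play_linear:
  assumes L: "L \<in> G_play r a b D \<rho> (u, z)"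
  shows "L (v + w) - (L v + L w) = 0" "L (c *\<^sub>R v) - c *\<^sub>R L v = 0"
proof -
  obtain \<mu> :: functional_map where \<mu>: "\<forall>h y t. L (h, y) t = \<mu> (u, z, t) (h, y)"
    using G_play_S_play[OF L] by blast
  then have "L v t = \<mu> (u, z, t) v" for v t by (cases v) simp
  then show "L (v + w) - (L v + L w) = 0" "L (c *\<^sub>R v) - c *\<^sub>R L v = 0"
    by (auto simp: fun_eq_iff blinfun.add_right blinfun.scaleR_right scaleR_fun_def)
qed

lemma play_measurable: "apply_bcontfun u \<in> borel_measurable (lebesgue_on {a<..<b})"
proof -
  have "apply_bcontfun u \<in> borel_measurable borel" by (rule borel_measurable_continuous_onI) auto
  then show ?thesis by (intro measurable_restrict_space1 measurable_completion) simp
qed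

text \<open>Points near (u, z) lie in the same set \<open>V_set\<close> of some level m, so their
  own levels are at most m. The expansion at (u, z) is available for each of these finitely many
  partitions, and a common radius exists.\<close>

lemma pointwise_remainder:
  assumes X: "equicontinuous_space a b X nX" and u: "u \<in> C_on a b" and t: "t \<in> {a..b}" and e: "0 < e"
  shows "\<exists>\<delta>>0. \<forall>h\<in>X. \<forall>y. norm h + \<bar>y\<bar> < \<delta> \<longrightarrow> (\<forall>L\<in>G_play r a b D \<rho> (u + h, z + y).
     \<bar>play r a b (u + h, z + y) t - play r a b (u, z) t - L (h, y) t\<bar> \<le> e * nX h)"
proof -
  obtain m where m: "1 \<le> m" "(u, z) \<in> V_set a b D \<rho> m" using V_set_exhaust[OF u] by blast
  obtain \<delta>0 where \<delta>0: "\<delta>0 > 0" "\<forall>u' z'. u' \<in> C_on a b \<longrightarrow> norm (u' - u) < \<delta>0 \<longrightarrow> (u', z') \<in> V_set a b D \<rho> m"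
    using Z_part_perturb[OF part_D[OF m(1)] ab m(2)[unfolded V_set_eq]] unfolding V_set_eq by blast
  have XC: "X \<subseteq> C_on a b" using X unfolding equicontinuous_space_def by blast
  have X_nonneg: "0 \<le> nX h" if "h \<in> X" for h using X that unfolding equicontinuous_space_def by blast
  define J where "J = {n \<in> {1..m}. (u, z) \<in> Z_part r a b (D n)}"
  have "\<exists>\<delta>>0. \<forall>n\<in>J. \<forall>x. norm (fst x) + \<bar>snd x\<bar> < \<delta> \<longrightarrow> (fst x \<in> X \<longrightarrow> (\<forall>\<mu>\<in>S_part r a b (D n).
     \<bar>play r a b (u + fst x, z + snd x) t - play r a b (u, z) t - \<mu> (u + fst x, z + snd x, t) x\<bar> \<le> e * nX (fst x)))"
  proof (rule uniform_delta)
    fix n assume n: "n \<in> J"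
    then have Z: "(u, z) \<in> Z_part r a b (D n)" and n1: "1 \<le> n" unfolding J_def by auto
    \<comment> \<open>Each of the \<open>npt (D n)\<close> intervals contributes at most e' times
      the norm of h, in total at most e times it.\<close>
    define e' where "e' = e / (real (npt (D n)) + 1)"
    have e': "0 < e'" unfolding e'_def using e by simp
    obtain \<eta> where \<eta>: "\<eta> > 0" "\<forall>h\<in>X. \<forall>s\<in>{a..b}. \<forall>t\<in>{a..b}. \<bar>s - t\<bar> < \<eta> \<longrightarrow> \<bar>apply_bcontfun h s - apply_bcontfun h t\<bar> \<le> e' * nX h"
      using X e' unfolding equicontinuous_space_def by blast
    obtain \<delta> where \<delta>: "\<delta> > 0" "newton_within a b \<delta> \<eta> u z (S_part r a b (D n)) (\<lambda>u z. play r a b (u, z) t) t (real (npt (D n)))"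
      using S_part_newton[OF part_D[OF n1] ab r Z \<eta>(1) t] by blast
    show "\<exists>\<delta>>0. \<forall>x. norm (fst x) + \<bar>snd x\<bar> < \<delta> \<longrightarrow> (fst x \<in> X \<longrightarrow> (\<forall>\<mu>\<in>S_part r a b (D n).
     \<bar>play r a b (u + fst x, z + snd x) t - play r a b (u, z) t - \<mu> (u + fst x, z + snd x, t) x\<bar> \<le> e * nX (fst x)))"
    proof (intro exI[of _ \<delta>] conjI \<delta>(1) allI impI ballI)
      fix x :: "cfun \<times> real" and \<mu>
      assume x: "norm (fst x) + \<bar>snd x\<bar> < \<delta>" and hX: "fst x \<in> X" and \<mu>: "\<mu> \<in> S_part r a b (D n)"
      have "\<bar>play r a b (u + fst x, z + snd x) t - play r a b (u, z) t
          - \<mu> (u + fst x, z + snd x, t) (u + fst x - u, z + snd x - z)\<bar> \<le> real (npt (D n)) * (e' * nX (fst x))"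
      proof (rule \<delta>(2)[rule_format, OF _ _ _ \<mu>])
        show "u + fst x \<in> C_on a b" using C_on_add u hX XC by blast
        have "norm (fst x) < \<delta>" "\<bar>snd x\<bar> < \<delta>"
          using x norm_ge_zero[of "fst x"] abs_ge_zero[of "snd x"] by linarith+
        then show "norm (u + fst x - u) < \<delta>" "\<bar>z + snd x - z\<bar> < \<delta>" by simp_all
        show "\<bar>(u + fst x - u) s - (u + fst x - u) s'\<bar> \<le> e' * nX (fst x)"
          if "s \<in> {a..b}" "s' \<in> {a..b}" "\<bar>s - s'\<bar> < \<eta>" for s s'
          using \<eta>(2) hX that by simp
      qed
      also have "\<dots> \<le> e * nX (fst x)"
      proof -
        have "real (npt (D n)) * e' \<le> e" unfolding e'_def using e by (simp add: field_simps)
        then show ?thesis using X_nonneg[OF hX] mult_right_mono by (metis mult.assoc)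
      qed
      finally show "\<bar>play r a b (u + fst x, z + snd x) t - play r a b (u, z) t - \<mu> (u + fst x, z + snd x, t) x\<bar> \<le> e * nX (fst x)"
        by simp
    qed
  qed (simp add: J_def)
  then obtain \<delta>1 where \<delta>1: "\<delta>1 > 0" "\<forall>n\<in>J. \<forall>x. norm (fst x) + \<bar>snd x\<bar> < \<delta>1 \<longrightarrow> (fst x \<in> X \<longrightarrow> (\<forall>\<mu>\<in>S_part r a b (D n).
     \<bar>play r a b (u + fst x, z + snd x) t - play r a b (u, z) t - \<mu> (u + fst x, z + snd x, t) x\<bar> \<le> e * nX (fst x)))"
    by blast
  \<comment> \<open>The last radius serves the base point: its oscillation exceeds that of u + h by
    at most 2 * norm h, which is less than r - \<open>\<rho> m\<close>.\<close>
  let ?\<delta> = "min (min \<delta>0 \<delta>1) ((r - \<rho> m) / 2)"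
  show ?thesis
  proof (intro exI[of _ ?\<delta>] conjI ballI allI impI)
    show "0 < ?\<delta>" using \<delta>0(1) \<delta>1(1) \<rho>(3)[OF m(1)] by simp
    fix h y L assume hX: "h \<in> X" and small: "norm h + \<bar>y\<bar> < ?\<delta>" and L: "L \<in> G_play r a b D \<rho> (u + h, z + y)"
    obtain n where n: "1 \<le> n" "(u + h, z + y) \<in> V_bar a b D \<rho> n - V_bar a b D \<rho> (n - 1)"
      "L \<in> G_part r a b (D n) (u + h, z + y)"
      using L unfolding G_play_def by blast
    obtain \<mu> where \<mu>: "\<mu> \<in> S_part r a b (D n)" "L = (\<lambda>(h', y') t. \<mu> (u + h, z + y, t) (h', y'))"
      using n(3) unfolding G_part_def by auto
    have "u + h \<in> C_on a b" using C_on_add u hX XC by blast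
    moreover have "norm h + \<bar>y\<bar> < \<delta>0" using small by simp
    then have "norm (u + h - u) < \<delta>0" using abs_ge_zero[of y] by simp
    ultimately have "(u + h, z + y) \<in> V_set a b D \<rho> m" using \<delta>0(2) by blast
    then have in_m: "(u + h, z + y) \<in> V_bar a b D \<rho> m" using V_set_subset_V_bar[OF m(1)] by blast
    have nm: "n \<le> m"
    proof (rule ccontr)
      assume "\<not> n \<le> m"
      then have "V_bar a b D \<rho> m \<subseteq> V_bar a b D \<rho> (n - 1)" by (intro V_bar_mono) simp
      then show False using in_m n(2) by blast
    qed
    have "(u, z) \<in> Z_part r a b (D n)"
      unfolding Z_part_iff
    proof (intro conjI u allI impI)
      fix k assume k: "k < npt (D n)"
      have le: "pt (D n) k \<le> pt (D n) (Suc k)" using pt_Suc_less[OF part_D[OF n(1)] ab k] by simp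
      have "osc (pt (D n) k) (pt (D n) (Suc k)) u \<le> osc (pt (D n) k) (pt (D n) (Suc k)) (u + h) + 2 * norm (u - (u + h))"
        by (rule osc_perturb[OF le])
      also have "\<dots> \<le> \<rho> m + 2 * norm h"
        using V_bar_osc(2)[of "u + h" "z + y" n k] n(2) k \<rho>_mono[OF n(1) nm] by (simp add: norm_minus_commute)
      also have "\<dots> < r" using small by auto
      finally show "osc (pt (D n) k) (pt (D n) (Suc k)) u < r" .
    qed
    then have "n \<in> J" unfolding J_def using n(1) nm by simp
    from \<delta>1(2)[rule_format, OF this, of "(h, y)"] hX small \<mu>(1)
    show "\<bar>play r a b (u + h, z + y) t - play r a b (u, z) t - L (h, y) t\<bar> \<le> e * nX h"
      unfolding \<mu>(2) by simp
  qed
qed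

text \<open>The radius in \<open>pointwise_remainder\<close> depends on t, so a limit theorem has to
  take over. Counterexamples for a fixed e give increments tending to 0. Divided by N j, the
  remainders are bounded by 2 * (C + 1) and tend to 0 at every time, while their norms in L^q stay
  above e.\<close>

lemma remainder_small:
  assumes X: "equicontinuous_space a b X nX" and q: "1 \<le> q" and u: "u \<in> C_on a b" and e: "0 < e"
  shows "\<exists>\<delta>>0. \<forall>h\<in>X. \<forall>y. norm h + \<bar>y\<bar> < \<delta> \<longrightarrow> (\<forall>L\<in>G_play r a b D \<rho> (u + h, z + y).
     Lp_norm (lebesgue_on {a<..<b}) (ennreal q) (apply_bcontfun (play r a b (u + h, z + y)) - apply_bcontfun (play r a b (u, z)) - L (h, y))
       \<le> ennreal (e * (nX h + \<bar>y\<bar>)))" (is "\<exists>\<delta>>0. ?good \<delta>")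
proof (rule ccontr)
  let ?M = "lebesgue_on {a<..<b}"
  define rem where "rem h y L = apply_bcontfun (play r a b (u + h, z + y)) - apply_bcontfun (play r a b (u, z)) - L (h, y)"
    for h y and L :: "cfun \<times> real \<Rightarrow> real \<Rightarrow> real"
  define n where "n h y = nX h + \<bar>y\<bar>" for h and y :: real
  have XC: "X \<subseteq> C_on a b" and X_nonneg: "\<And>h. h \<in> X \<Longrightarrow> 0 \<le> nX h"
    using X unfolding equicontinuous_space_def by blast+
  obtain C where C: "0 \<le> C" "\<And>h. h \<in> X \<Longrightarrow> norm h \<le> C * nX h"
    using X unfolding equicontinuous_space_def by blast
  have n_bound: "norm h + \<bar>y\<bar> \<le> (C + 1) * n h y" if "h \<in> X" for h y
  proof -
    have "0 \<le> C * \<bar>y\<bar>" using C(1) by simp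
    then show ?thesis using C(2)[OF that] X_nonneg[OF that] unfolding n_def by (simp add: algebra_simps)
  qed
  assume "\<not> ?thesis"
  then have "\<not> ?good \<delta>" if "0 < \<delta>" for \<delta> using that by blast
  then have "\<exists>h y L. h \<in> X \<and> norm h + \<bar>y\<bar> < inverse (real (Suc j)) \<and> L \<in> G_play r a b D \<rho> (u + h, z + y) \<and>
      \<not> Lp_norm ?M (ennreal q) (rem h y L) \<le> ennreal (e * n h y)" for j
    unfolding rem_def n_def by (metis inverse_positive_iff_positive of_nat_0_less_iff zero_less_Suc)
  then have "\<forall>j. \<exists>x. case x of (h, y, L) \<Rightarrow> h \<in> X \<and> norm h + \<bar>y\<bar> < inverse (real (Suc j)) \<and> L \<in> G_play r a b D \<rho> (u + h, z + y) \<and>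
      \<not> Lp_norm ?M (ennreal q) (rem h y L) \<le> ennreal (e * n h y)" by fastforce
  from choice[OF this] obtain x where x: "\<forall>j. case x j of (h, y, L) \<Rightarrow> h \<in> X \<and> norm h + \<bar>y\<bar> < inverse (real (Suc j)) \<and> L \<in> G_play r a b D \<rho> (u + h, z + y) \<and>
      \<not> Lp_norm ?M (ennreal q) (rem h y L) \<le> ennreal (e * n h y)" ..
  define h where "h j = fst (x j)" for j
  define y where "y j = fst (snd (x j))" for j
  define L where "L j = snd (snd (x j))" for j
  have hX: "h j \<in> X" and small: "norm (h j) + \<bar>y j\<bar> < inverse (real (Suc j))"
    and L: "L j \<in> G_play r a b D \<rho> (u + h j, z + y j)"
    and bad: "\<not> Lp_norm ?M (ennreal q) (rem (h j) (y j) (L j)) \<le> ennreal (e * n (h j) (y j))" for j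
    using x[rule_format, of j] unfolding h_def y_def L_def by (auto simp: case_prod_beta)
  define N where "N j = n (h j) (y j)" for j
  define f where "f j t = rem (h j) (y j) (L j) t" for j t
  have hC: "h j \<in> C_on a b" "u + h j \<in> C_on a b" for j using hX XC C_on_add[OF u] by blast+
  have f_bound: "\<bar>f j t\<bar> \<le> 2 * (C + 1) * N j" if t: "t \<in> {a..b}" for j t
  proof -
    have "\<bar>play r a b (u + h j, z + y j) t - play r a b (u, z) t\<bar> \<le> norm (u + h j - u) + \<bar>z + y j - z\<bar>"
      by (rule play_Lipschitz[OF ab r hC(2) u t])
    moreover have "\<bar>L j (h j, y j) t\<bar> \<le> norm (h j) + \<bar>y j\<bar>"
      by (rule G_play_bound[OF L hC(2) hC(1) t]) (simp add: abs_apply_le_norm)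
    ultimately have "\<bar>f j t\<bar> \<le> 2 * (norm (h j) + \<bar>y j\<bar>)" unfolding f_def rem_def by simp
    also have "\<dots> \<le> 2 * (C + 1) * N j" using mult_left_mono[OF n_bound[OF hX[of j], of "y j"], of 2] unfolding N_def by (simp only: mult.assoc)
    finally show ?thesis .
  qed
  have f_meas: "f j \<in> borel_measurable ?M" for j
  proof -
    have "(\<lambda>t. play r a b (u + h j, z + y j) t - play r a b (u, z) t - L j (h j, y j) t) \<in> borel_measurable ?M"
      by (intro borel_measurable_diff play_measurable G_play_measurable[OF L hC(2)])
    then show ?thesis unfolding f_def rem_def by (simp add: fun_diff_def)
  qed
  have sp: "t \<in> space ?M \<Longrightarrow> t \<in> {a..b}" for t by (simp add: space_restrict_space)
  have fin: "finite_measure ?M" by (rule finite_measure_lebesgue_on_open)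
  have Lp: "integrable ?M (\<lambda>t. \<bar>f j t\<bar> powr q)"
    "Lp_norm ?M (ennreal q) (f j) = ennreal ((LINT t|?M. \<bar>f j t\<bar> powr q) powr (1 / q))" for j
    using Lp_norm_bounded[OF fin q f_meas f_bound[OF sp]] by auto
  have N_nonneg: "0 \<le> N j" for j using X_nonneg[OF hX] unfolding N_def n_def by simp
  have big: "e * N j < (LINT t|?M. \<bar>f j t\<bar> powr q) powr (1 / q)" for j
  proof (rule ccontr)
    assume "\<not> ?thesis"
    then have "Lp_norm ?M (ennreal q) (f j) \<le> ennreal (e * N j)" unfolding Lp(2) by (simp add: ennreal_leI)
    moreover have "f j = rem (h j) (y j) (L j)" by (rule ext) (simp add: f_def)
    ultimately show False using bad[of j] unfolding N_def by simp
  qed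
  \<comment> \<open>If N j were 0, the remainder would vanish and could not violate the estimate; so
    division by N j is legitimate.\<close>
  have N_pos: "0 < N j" for j
  proof (rule ccontr)
    assume "\<not> ?thesis"
    then have "N j = 0" using N_nonneg[of j] by simp
    then have "f j t = 0" if "t \<in> {a..b}" for t using f_bound[OF that, of j] by simp
    then have "(LINT t|?M. \<bar>f j t\<bar> powr q) = (LINT t|?M. 0)"
      by (intro Bochner_Integration.integral_cong) (auto dest: sp)
    then show False using big[of j] \<open>N j = 0\<close> by simp
  qed
  have scaled: "\<bar>f j t / N j\<bar> powr q = \<bar>f j t\<bar> powr q / N j powr q" for j t
    using N_pos[of j] by (simp add: abs_divide powr_divide)
  have lower: "e powr q < (LINT t|?M. \<bar>f j t / N j\<bar> powr q)" for j
  proof -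
    have nn: "0 \<le> (LINT t|?M. \<bar>f j t\<bar> powr q)" by (rule Bochner_Integration.integral_nonneg) simp
    have "(e * N j) powr q < ((LINT t|?M. \<bar>f j t\<bar> powr q) powr (1 / q)) powr q"
      by (rule powr_less_mono2) (use big e N_pos[of j] q in auto)
    also have "\<dots> = (LINT t|?M. \<bar>f j t\<bar> powr q)" using q nn by (simp add: powr_powr)
    finally have "e powr q * N j powr q < (LINT t|?M. \<bar>f j t\<bar> powr q)"
      using e N_pos[of j] by (simp add: powr_mult)
    then show ?thesis unfolding scaled using N_pos[of j] by (simp add: pos_less_divide_eq)
  qed
  have "(\<lambda>j. LINT t|?M. \<bar>f j t / N j\<bar> powr q) \<longlonglongrightarrow> (LINT t|?M. 0)"
  proof (rule integral_dominated_convergence[where w="\<lambda>_. (2 * (C + 1)) powr q"])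
    show "(\<lambda>t. \<bar>f j t / N j\<bar> powr q) \<in> borel_measurable ?M" for j
      using f_meas[of j] by measurable
    show "integrable ?M (\<lambda>_. (2 * (C + 1)) powr q)"
      using fin by (simp add: finite_measure.integrable_const)
    show "AE t in ?M. norm (\<bar>f j t / N j\<bar> powr q) \<le> (2 * (C + 1)) powr q" for j
    proof (rule AE_I2)
      fix t assume "t \<in> space ?M"
      then have "\<bar>f j t / N j\<bar> \<le> 2 * (C + 1)"
        using f_bound[OF sp, of t j] N_pos[of j] by (simp add: abs_divide pos_divide_le_eq)
      then show "norm (\<bar>f j t / N j\<bar> powr q) \<le> (2 * (C + 1)) powr q"
        using q by (simp add: powr_mono2)
    qed
    show "AE t in ?M. (\<lambda>j. \<bar>f j t / N j\<bar> powr q) \<longlonglongrightarrow> 0"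
    proof (rule AE_I2)
      fix t assume "t \<in> space ?M"
      then have t: "t \<in> {a..b}" by (rule sp)
      have "(\<lambda>j. f j t / N j) \<longlonglongrightarrow> 0"
        unfolding tendsto_iff
      proof (intro allI impI)
        fix c :: real assume c: "0 < c"
        obtain \<delta> where \<delta>: "\<delta> > 0" "\<forall>h\<in>X. \<forall>y. norm h + \<bar>y\<bar> < \<delta> \<longrightarrow> (\<forall>L\<in>G_play r a b D \<rho> (u + h, z + y).
          \<bar>play r a b (u + h, z + y) t - play r a b (u, z) t - L (h, y) t\<bar> \<le> c / 2 * nX h)"
          using pointwise_remainder[OF X u t, of "c / 2" z] c by auto
        have "\<forall>\<^sub>F j in sequentially. inverse (real (Suc j)) < \<delta>"
          by (rule order_tendstoD(2)[OF LIMSEQ_inverse_real_of_nat \<delta>(1)])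
        then show "\<forall>\<^sub>F j in sequentially. dist (f j t / N j) 0 < c"
        proof eventually_elim
          case (elim j)
          have "\<bar>f j t\<bar> \<le> c / 2 * nX (h j)"
            unfolding f_def rem_def using \<delta>(2) hX[of j] L[of j] less_trans[OF small elim] by simp
          also have "\<dots> \<le> c / 2 * N j" using c unfolding N_def n_def by simp
          also have "\<dots> < c * N j" using c N_pos[of j] by simp
          finally show ?case using N_pos[of j] by (simp add: abs_divide pos_divide_less_eq)
        qed
      qed
      then have "(\<lambda>j. \<bar>f j t / N j\<bar>) \<longlonglongrightarrow> 0" by (rule tendsto_rabs_zero)
      then have "(\<lambda>j. \<bar>f j t / N j\<bar> powr q) \<longlonglongrightarrow> 0 powr q"
        by (intro tendsto_powr' tendsto_const) (use q in auto)
      then show "(\<lambda>j. \<bar>f j t / N j\<bar> powr q) \<longlonglongrightarrow> 0" by simp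
    qed
  qed simp
  moreover have "0 < e powr q" using e by simp
  ultimately have "\<forall>\<^sub>F j in sequentially. (LINT t|?M. \<bar>f j t / N j\<bar> powr q) < e powr q"
    by (intro order_tendstoD(2)) auto
  then obtain j where "(LINT t|?M. \<bar>f j t / N j\<bar> powr q) < e powr q"
    using eventually_happens'[OF sequentially_bot] by blast
  then show False using lower[of j] by simp
qed

text \<open>Covers increments that are not small: the quotient of remainder and norm is bounded
  everywhere, so the supremum that defines the modulus is finite.\<close>

lemma remainder_bounded:
  assumes X: "equicontinuous_space a b X nX" and q: "1 \<le> q"
  shows "\<exists>K. \<forall>u\<in>C_on a b. \<forall>z. \<forall>h\<in>X. \<forall>y. \<forall>L\<in>G_play r a b D \<rho> (u + h, z + y).
     Lp_norm (lebesgue_on {a<..<b}) (ennreal q) (apply_bcontfun (play r a b (u + h, z + y)) - apply_bcontfun (play r a b (u, z)) - L (h, y))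
       \<le> ennreal (K * (nX h + \<bar>y\<bar>))"
proof -
  let ?M = "lebesgue_on {a<..<b}"
  have XC: "X \<subseteq> C_on a b" and X_nonneg: "\<And>h. h \<in> X \<Longrightarrow> 0 \<le> nX h"
    using X unfolding equicontinuous_space_def by blast+
  obtain C where C: "0 \<le> C" "\<And>h. h \<in> X \<Longrightarrow> norm h \<le> C * nX h"
    using X unfolding equicontinuous_space_def by blast
  let ?m = "measure ?M (space ?M) powr (1 / q)"
  show ?thesis
  proof (intro exI[of _ "2 * (C + 1) * ?m"] ballI allI)
    fix u z h y L assume u: "u \<in> C_on a b" and h: "h \<in> X" and L: "L \<in> G_play r a b D \<rho> (u + h, z + y)"
    have hC: "h \<in> C_on a b" "u + h \<in> C_on a b" using h XC C_on_add[OF u] by blast+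
    let ?f = "apply_bcontfun (play r a b (u + h, z + y)) - apply_bcontfun (play r a b (u, z)) - L (h, y)"
    have "0 \<le> C * \<bar>y\<bar>" using C(1) by simp
    then have le: "norm h + \<bar>y\<bar> \<le> (C + 1) * (nX h + \<bar>y\<bar>)"
      using C(2)[OF h] X_nonneg[OF h] by (simp add: algebra_simps)
    have "(\<lambda>t. play r a b (u + h, z + y) t - play r a b (u, z) t - L (h, y) t) \<in> borel_measurable ?M"
      by (intro borel_measurable_diff play_measurable G_play_measurable[OF L hC(2)])
    then have meas: "?f \<in> borel_measurable ?M" by (simp add: fun_diff_def)
    have bound: "\<bar>?f t\<bar> \<le> 2 * (norm h + \<bar>y\<bar>)" if "t \<in> space ?M" for t
    proof -
      have t: "t \<in> {a..b}" using that by (simp add: space_restrict_space)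
      have "\<bar>play r a b (u + h, z + y) t - play r a b (u, z) t\<bar> \<le> norm (u + h - u) + \<bar>z + y - z\<bar>"
        by (rule play_Lipschitz[OF ab r hC(2) u t])
      moreover have "\<bar>L (h, y) t\<bar> \<le> norm h + \<bar>y\<bar>"
        by (rule G_play_bound[OF L hC(2) hC(1) t]) (simp add: abs_apply_le_norm)
      ultimately show ?thesis by simp
    qed
    have "Lp_norm ?M (ennreal q) ?f \<le> ennreal (2 * (norm h + \<bar>y\<bar>) * ?m)"
      by (rule Lp_norm_le_sup[OF finite_measure_lebesgue_on_open q meas bound]) simp_all
    also have "\<dots> \<le> ennreal (2 * ((C + 1) * (nX h + \<bar>y\<bar>)) * ?m)"
      by (intro ennreal_leI mult_right_mono mult_left_mono le) simp_all
    also have "2 * ((C + 1) * (nX h + \<bar>y\<bar>)) * ?m = 2 * (C + 1) * ?m * (nX h + \<bar>y\<bar>)"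
      by (simp only: mult.assoc mult.commute mult.left_commute)
    finally show "Lp_norm ?M (ennreal q) ?f \<le> ennreal (2 * (C + 1) * ?m * (nX h + \<bar>y\<bar>))" .
  qed
qed

text \<open>The modulus is taken in the maximum norm, the factor in the norm of X; this mixed form
  is what \<open>remainder_small\<close> provides, since its radius refers to the maximum
  norm.\<close>

lemma remainder_modulus:
  assumes X: "equicontinuous_space a b X nX" and q: "1 \<le> q" and u: "u \<in> C_on a b"
  shows "\<exists>R. mono_on {0<..} R \<and> (R \<longlongrightarrow> 0) (at_right 0) \<and>
     (\<forall>h\<in>X. \<forall>y. (SUP L\<in>G_play r a b D \<rho> (u + h, z + y). Lp_norm (lebesgue_on {a<..<b}) (ennreal q)
        (apply_bcontfun (play r a b (u + h, z + y)) - apply_bcontfun (play r a b (u, z)) - L (h, y)))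
       \<le> ennreal (R (norm h + \<bar>y\<bar>) * (nX h + \<bar>y\<bar>)))"
proof -
  define S where "S x = (SUP L\<in>G_play r a b D \<rho> (u + fst x, z + snd x). Lp_norm (lebesgue_on {a<..<b}) (ennreal q)
        (apply_bcontfun (play r a b (u + fst x, z + snd x)) - apply_bcontfun (play r a b (u, z)) - L x))" for x
  define n where "n x = nX (fst x) + \<bar>snd x\<bar>" for x :: "cfun \<times> real"
  define N where "N x = norm (fst x) + \<bar>snd x\<bar>" for x :: "cfun \<times> real"
  have n_nonneg: "0 \<le> n x" if "x \<in> X \<times> UNIV" for x
    using that X unfolding equicontinuous_space_def n_def by auto
  obtain K where K: "\<forall>u\<in>C_on a b. \<forall>z. \<forall>h\<in>X. \<forall>y. \<forall>L\<in>G_play r a b D \<rho> (u + h, z + y).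
     Lp_norm (lebesgue_on {a<..<b}) (ennreal q) (apply_bcontfun (play r a b (u + h, z + y)) - apply_bcontfun (play r a b (u, z)) - L (h, y))
       \<le> ennreal (K * (nX h + \<bar>y\<bar>))"
    using remainder_bounded[OF X q] by blast
  have SK: "S x \<le> ennreal (max K 0 * n x)" if x: "x \<in> X \<times> UNIV" for x
    unfolding S_def
  proof (rule SUP_least)
    fix L assume L: "L \<in> G_play r a b D \<rho> (u + fst x, z + snd x)"
    have "fst x \<in> X" using x by auto
    from K[rule_format, OF u this L]
    have "Lp_norm (lebesgue_on {a<..<b}) (ennreal q) (apply_bcontfun (play r a b (u + fst x, z + snd x)) - apply_bcontfun (play r a b (u, z)) - L x)
      \<le> ennreal (K * n x)" unfolding n_def by simp
    also have "\<dots> \<le> ennreal (max K 0 * n x)" by (intro ennreal_leI mult_right_mono n_nonneg x) simp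
    finally show "Lp_norm (lebesgue_on {a<..<b}) (ennreal q) (apply_bcontfun (play r a b (u + fst x, z + snd x)) - apply_bcontfun (play r a b (u, z)) - L x)
      \<le> ennreal (max K 0 * n x)" .
  qed
  \<comment> \<open>If n x = 0, division by zero gives Q x = 0, and S x = 0 by the a priori bound,
    so S x = Q x * n x holds in all cases.\<close>
  define Q where "Q x = enn2real (S x) / n x" for x
  have S_Q: "S x = ennreal (Q x * n x)" if x: "x \<in> X \<times> UNIV" for x
  proof (cases "n x = 0")
    case True
    then show ?thesis using SK[OF x] by simp
  next
    case False
    have "S x < \<infinity>" by (rule le_less_trans[OF SK[OF x]]) simp
    then show ?thesis using False unfolding Q_def by simp
  qed
  have Q_le: "Q x \<le> c" if x: "x \<in> X \<times> UNIV" and "0 \<le> c" "S x \<le> ennreal (c * n x)" for x c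
  proof (cases "n x = 0")
    case False
    then have n: "0 < n x" using n_nonneg[OF x] by simp
    have "enn2real (S x) \<le> c * n x" using that(2,3) n by (intro enn2real_leI) auto
    then show ?thesis unfolding Q_def using n by (simp add: pos_divide_le_eq)
  qed (use that in \<open>simp add: Q_def\<close>)
  have "\<exists>R. mono_on {0<..} R \<and> (R \<longlongrightarrow> 0) (at_right 0) \<and> (\<forall>x\<in>X \<times> UNIV. Q x \<le> R (N x))"
  proof (rule modulus_exists)
    show "Q x \<le> max K 0" if "x \<in> X \<times> UNIV" for x by (rule Q_le[OF that _ SK[OF that]]) simp
    fix e :: real assume e: "0 < e"
    obtain \<delta> where \<delta>: "\<delta> > 0" "\<forall>h\<in>X. \<forall>y. norm h + \<bar>y\<bar> < \<delta> \<longrightarrow> (\<forall>L\<in>G_play r a b D \<rho> (u + h, z + y).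
     Lp_norm (lebesgue_on {a<..<b}) (ennreal q) (apply_bcontfun (play r a b (u + h, z + y)) - apply_bcontfun (play r a b (u, z)) - L (h, y))
       \<le> ennreal (e * (nX h + \<bar>y\<bar>)))"
      using remainder_small[OF X q u e] by blast
    show "\<exists>\<delta>>0. \<forall>x\<in>X \<times> UNIV. N x < \<delta> \<longrightarrow> Q x \<le> e"
    proof (intro exI[of _ \<delta>] conjI \<delta>(1) ballI impI)
      fix x :: "cfun \<times> real" assume x: "x \<in> X \<times> UNIV" and "N x < \<delta>"
      have "S x \<le> ennreal (e * n x)"
        unfolding S_def
      proof (rule SUP_least)
        fix L assume "L \<in> G_play r a b D \<rho> (u + fst x, z + snd x)"
        with \<delta>(2)[rule_format, of "fst x" "snd x" L] x \<open>N x < \<delta>\<close>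
        show "Lp_norm (lebesgue_on {a<..<b}) (ennreal q) (apply_bcontfun (play r a b (u + fst x, z + snd x)) - apply_bcontfun (play r a b (u, z)) - L x)
          \<le> ennreal (e * n x)"
          unfolding N_def n_def by auto
      qed
      then show "Q x \<le> e" using Q_le[OF x] e by simp
    qed
  qed
  then obtain R where R: "mono_on {0<..} R" "(R \<longlongrightarrow> 0) (at_right 0)" "\<forall>x\<in>X \<times> UNIV. Q x \<le> R (N x)" by blast
  have "S (h, y) \<le> ennreal (R (norm h + \<bar>y\<bar>) * (nX h + \<bar>y\<bar>))" if "h \<in> X" for h y
  proof -
    have x: "(h, y) \<in> X \<times> UNIV" using that by simp
    have "Q (h, y) * n (h, y) \<le> R (N (h, y)) * n (h, y)"
      by (rule mult_right_mono[OF bspec[OF R(3) x] n_nonneg[OF x]])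
    then show ?thesis unfolding S_Q[OF x] by (simp add: N_def n_def ennreal_leI)
  qed
  then have "\<forall>h\<in>X. \<forall>y. S (h, y) \<le> ennreal (R (norm h + \<bar>y\<bar>) * (nX h + \<bar>y\<bar>))" by blast
  then show ?thesis unfolding S_def fst_conv snd_conv using R(1,2) by blast
qed

theorem play_newton_derivative:
  assumes X: "equicontinuous_space a b X nX" and q: "1 \<le> q"
  shows "newton_derivative (X \<times> UNIV) (\<lambda>(h, y). nX h + \<bar>y\<bar>)
    (Lp_space (lebesgue_on {a<..<b}) (ennreal q)) (Lp_norm (lebesgue_on {a<..<b}) (ennreal q))
    (X \<times> UNIV) (\<lambda>x. apply_bcontfun (play r a b x)) (G_play r a b D \<rho>)"
  unfolding newton_derivative_def
proof (intro conjI ballI)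
  let ?M = "lebesgue_on {a<..<b}"
  have XC: "X \<subseteq> C_on a b" and X_nonneg: "\<And>h. h \<in> X \<Longrightarrow> 0 \<le> nX h"
    and X_add: "\<And>u v. u \<in> X \<Longrightarrow> v \<in> X \<Longrightarrow> u + v \<in> X"
    using X unfolding equicontinuous_space_def by blast+
  obtain C where C: "0 \<le> C" "\<And>h. h \<in> X \<Longrightarrow> norm h \<le> C * nX h"
    using X unfolding equicontinuous_space_def by blast
  have le: "norm h + \<bar>y\<bar> \<le> (C + 1) * (nX h + \<bar>y\<bar>)" if "h \<in> X" for h y
  proof -
    have "0 \<le> C * \<bar>y\<bar>" using C(1) by simp
    then show ?thesis using C(2)[OF that] X_nonneg[OF that] by (simp add: algebra_simps)
  qed
  have Lp_bounded: "f \<in> Lp_space ?M (ennreal q)"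
    if "f \<in> borel_measurable ?M" "\<And>t. t \<in> space ?M \<Longrightarrow> \<bar>f t\<bar> \<le> B" "0 \<le> B" for f B
    using Lp_norm_le_sup[OF finite_measure_lebesgue_on_open q that] that(1)
    unfolding Lp_space_def by (auto simp: less_top[symmetric] top_unique)
  show "X \<times> UNIV \<subseteq> X \<times> (UNIV :: real set)" by simp
  fix x :: "cfun \<times> real" assume "x \<in> X \<times> UNIV"
  then obtain u z where x: "x = (u, z)" "u \<in> X" by auto
  then have u: "u \<in> C_on a b" using XC by blast
  show "\<exists>e>0. \<forall>h\<in>X \<times> UNIV. (case h of (h, y) \<Rightarrow> nX h + \<bar>y\<bar>) < e \<longrightarrow> x + h \<in> X \<times> UNIV"
    using X_add x by (intro exI[of _ 1]) auto
  show "apply_bcontfun (play r a b x) \<in> Lp_space ?M (ennreal q)"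
    by (rule Lp_bounded[OF play_measurable abs_apply_le_norm]) simp
  show "G_play r a b D \<rho> x \<noteq> {}" unfolding x by (rule G_play_nonempty[OF u])
  show "G_play r a b D \<rho> x \<subseteq> linear_ops (X \<times> UNIV) (\<lambda>(h, y). nX h + \<bar>y\<bar>) (Lp_space ?M (ennreal q)) (Lp_norm ?M (ennreal q))"
  proof
    fix L assume L: "L \<in> G_play r a b D \<rho> x"
    then have L': "L \<in> G_play r a b D \<rho> (u, z)" unfolding x .
    have bound: "\<bar>L (h, y) t\<bar> \<le> norm h + \<bar>y\<bar>" if "h \<in> X" "t \<in> space ?M" for h y t
      by (rule G_play_bound[OF L' u]) (use that XC in \<open>auto simp: abs_apply_le_norm space_restrict_space\<close>)
    have zero: "Lp_norm ?M (ennreal q) 0 = 0"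
      using Lp_norm_le_sup[OF finite_measure_lebesgue_on_open q, of 0 a b 0] by (simp add: zero_fun_def)
    show "L \<in> linear_ops (X \<times> UNIV) (\<lambda>(h, y). nX h + \<bar>y\<bar>) (Lp_space ?M (ennreal q)) (Lp_norm ?M (ennreal q))"
      unfolding linear_ops_def
    proof (intro CollectI conjI ballI allI)
      show "L v \<in> Lp_space ?M (ennreal q)" if "v \<in> X \<times> UNIV" for v
      proof -
        obtain h y where v: "v = (h, y)" "h \<in> X" using \<open>v \<in> X \<times> UNIV\<close> by auto
        show ?thesis unfolding v by (rule Lp_bounded[OF G_play_measurable[OF L' u] bound[OF v(2)]]) simp_all
      qed
      show "Lp_norm ?M (ennreal q) (L (v + w) - (L v + L w)) = 0" for v w
        unfolding G_play_linear(1)[OF L'] by (rule zero)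
      show "Lp_norm ?M (ennreal q) (L (c *\<^sub>R v) - c *\<^sub>R L v) = 0" for c v
        unfolding G_play_linear(2)[OF L'] by (rule zero)
      let ?m = "measure ?M (space ?M) powr (1 / q)"
      show "\<exists>K. \<forall>v\<in>X \<times> UNIV. Lp_norm ?M (ennreal q) (L v) \<le> ennreal (K * (case v of (h, y) \<Rightarrow> nX h + \<bar>y\<bar>))"
      proof (intro exI[of _ "?m * (C + 1)"] ballI)
        fix v :: "cfun \<times> real" assume "v \<in> X \<times> UNIV"
        then obtain h y where v: "v = (h, y)" "h \<in> X" by auto
        have "Lp_norm ?M (ennreal q) (L v) \<le> ennreal ((norm h + \<bar>y\<bar>) * ?m)"
          unfolding v(1)
          by (rule Lp_norm_le_sup[OF finite_measure_lebesgue_on_open q G_play_measurable[OF L' u] bound[OF v(2)]]) simp_all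
        also have "\<dots> \<le> ennreal ((C + 1) * (nX h + \<bar>y\<bar>) * ?m)"
          by (intro ennreal_leI mult_right_mono le v(2)) simp
        finally show "Lp_norm ?M (ennreal q) (L v) \<le> ennreal (?m * (C + 1) * (case v of (h, y) \<Rightarrow> nX h + \<bar>y\<bar>))"
          unfolding v(1) by (simp add: mult.commute mult.left_commute mult.assoc)
      qed
    qed
  qed
  show "((\<lambda>h. (SUP L\<in>G_play r a b D \<rho> (x + h). Lp_norm ?M (ennreal q) (apply_bcontfun (play r a b (x + h)) - apply_bcontfun (play r a b x) - L h))
      / ennreal (case h of (h, y) \<Rightarrow> nX h + \<bar>y\<bar>)) \<longlongrightarrow> 0)
     (inf (filtercomap (\<lambda>(h, y). nX h + \<bar>y\<bar>) (at_right 0)) (principal (X \<times> UNIV)))" (is "(?g \<longlongrightarrow> 0) ?F")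
  proof (rule order_tendstoI)
    fix c :: ennreal assume "0 < c"
    \<comment> \<open>c may be infinite; any smaller c' is finite and provides a real number
      e.\<close>
    then obtain c' where c': "0 < c'" "c' < c" using dense by blast
    define e where "e = enn2real c'"
    have "c' < \<infinity>" using c'(2) by (metis infinity_ennreal_def less_top order_less_le_trans top_greatest)
    then have ec: "ennreal e = c'" unfolding e_def by simp
    have e: "0 < e" using c'(1) ec by (metis ennreal_less_zero_iff)
    obtain \<delta> where \<delta>: "\<delta> > 0" "\<forall>h\<in>X. \<forall>y. norm h + \<bar>y\<bar> < \<delta> \<longrightarrow> (\<forall>L\<in>G_play r a b D \<rho> (u + h, z + y).
     Lp_norm ?M (ennreal q) (apply_bcontfun (play r a b (u + h, z + y)) - apply_bcontfun (play r a b (u, z)) - L (h, y))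
       \<le> ennreal (e * (nX h + \<bar>y\<bar>)))"
      using remainder_small[OF X q u e] by blast
    \<comment> \<open>The radius \<delta> refers to the maximum norm, which is at most C + 1 times
      the norm of the product; hence \<delta> / (C + 1).\<close>
    have "?g v < c" if v: "v \<in> X \<times> UNIV" and small: "0 < (case v of (h, y) \<Rightarrow> nX h + \<bar>y\<bar>)" "(case v of (h, y) \<Rightarrow> nX h + \<bar>y\<bar>) < \<delta> / (C + 1)" for v
    proof -
      obtain h y where vh: "v = (h, y)" "h \<in> X" using v by auto
      define n where "n = nX h + \<bar>y\<bar>"
      have n: "0 < n" "n < \<delta> / (C + 1)" using small unfolding vh(1) n_def by simp_all
      have "norm h + \<bar>y\<bar> \<le> (C + 1) * n" unfolding n_def by (rule le[OF vh(2)])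
      also have "\<dots> < \<delta>" using n(2) C(1) by (simp add: pos_less_divide_eq mult.commute)
      finally have "(SUP L\<in>G_play r a b D \<rho> (x + v). Lp_norm ?M (ennreal q) (apply_bcontfun (play r a b (x + v)) - apply_bcontfun (play r a b x) - L v))
        \<le> ennreal (e * n)"
        using \<delta>(2) vh(2) unfolding x(1) vh(1) n_def by (intro SUP_least) simp
      then have "?g v \<le> ennreal (e * n) / ennreal n"
        unfolding vh(1) n_def by (simp add: divide_right_mono_ennreal)
      also have "\<dots> = ennreal e" using n(1) e by (simp add: divide_ennreal)
      also have "\<dots> < c" using ec c'(2) by simp
      finally show ?thesis .
    qed
    moreover have "\<forall>\<^sub>F s in at_right 0. 0 < s \<and> s < \<delta> / (C + 1)"
      by (rule eventually_at_rightI[of 0 "\<delta> / (C + 1)"]) (use \<delta>(1) C(1) in auto)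
    then have "\<forall>\<^sub>F v in filtercomap (\<lambda>(h, y). nX h + \<bar>y\<bar>) (at_right 0).
        0 < (case v of (h, y) \<Rightarrow> nX h + \<bar>y\<bar>) \<and> (case v of (h, y) \<Rightarrow> nX h + \<bar>y\<bar>) < \<delta> / (C + 1)"
      by (rule eventually_filtercomapI)
    ultimately show "\<forall>\<^sub>F v in ?F. ?g v < c"
      unfolding eventually_inf_principal by (elim eventually_mono) blast
  qed simp
qed

end

theorem theorem7p20:
  fixes a b r q :: real
    and X :: "cfun set" and nX :: "cfun \<Rightarrow> real"
    and D :: "nat \<Rightarrow> real set" and \<rho> :: "nat \<Rightarrow> real"
  defines "XR \<equiv> X \<times> (UNIV :: real set)"
    and "nXR \<equiv> \<lambda>(h, y). nX h + \<bar>y\<bar>"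
    and "Lq \<equiv> Lp_space (lebesgue_on {a<..<b}) (ennreal q)"
    and "nLq \<equiv> Lp_norm (lebesgue_on {a<..<b}) (ennreal q)"
    and "\<P> \<equiv> \<lambda>x. apply_bcontfun (play r a b x)"
    and "G \<equiv> G_play r a b D \<rho>"
  assumes "a < b" and "r > 0" and "1 \<le> q"
    and X: "(\<exists>\<alpha>. 0 < \<alpha> \<and> \<alpha> \<le> 1 \<and> X = holder_space a b \<alpha> \<and> nX = holder_norm a b \<alpha>) \<or>
            (\<exists>\<gamma>. 1 < \<gamma> \<and> X = sobolev_space a b \<gamma> \<and> nX = sobolev_norm a b \<gamma>)"
    and D1: "D 1 = {a, b}"
    and D_Suc: "\<And>n. n \<ge> 1 \<Longrightarrow> \<exists>x. a < x \<and> x < b \<and> x \<notin> D n \<and> D (Suc n) = insert x (D n)"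
    and D_mesh: "(\<lambda>n. mesh (D n)) \<longlonglongrightarrow> 0"
    and \<rho>: "0 < \<rho> 1" "\<And>n. n \<ge> 1 \<Longrightarrow> \<rho> n < \<rho> (Suc n)" "\<And>n. n \<ge> 1 \<Longrightarrow> \<rho> n < r"
  shows "newton_derivative XR nXR Lq nLq XR \<P> G \<and>
    (\<forall>x \<in> XR. \<exists>R :: real \<Rightarrow> real.
           mono_on {0<..} R \<and> (R \<longlongrightarrow> 0) (at_right 0) \<and>
           (\<forall>h\<in>X. \<forall>y. (SUP L \<in> G (x + (h, y)). nLq (\<P> (x + (h, y)) - \<P> x - L (h, y)))
              \<le> ennreal (R (norm h + \<bar>y\<bar>) * nXR (h, y)))) \<and>
    (\<forall>x \<in> XR. \<forall>L \<in> G x. \<forall>h\<in>X. \<forall>y. \<forall>t \<in> {a..b}.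
           sup_norm_upto a t (L (h, y)) \<le> sup_norm_upto a t (apply_bcontfun h) + ennreal \<bar>y\<bar>) \<and>
    (\<forall>(u, z0) \<in> XR. \<forall>L \<in> G (u, z0). \<exists>\<mu> \<in> S_play r a b D \<rho>. \<forall>h\<in>X. \<forall>y. \<forall>t \<in> {a<..<b}.
           L (h, y) t = \<mu> (u, z0, t) (h, y)) \<and>
    (\<forall>\<mu> \<in> S_play r a b D \<rho>.
           \<mu> \<in> restrict_space borel (C_on a b \<times> UNIV \<times> {a..b}) \<rightarrow>\<^sub>M weak_star_borel (dual_CR a b))"
proof -
  interpret refining_partitions a b r D \<rho>
    by (unfold_locales) (fact assms)+
  have E: "equicontinuous_space a b X nX"
    using X equicontinuous_holder[OF \<open>a < b\<close>] equicontinuous_sobolev[OF \<open>a < b\<close>] by blast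
  then have XC: "X \<subseteq> C_on a b" unfolding equicontinuous_space_def by blast
  show ?thesis
  proof (intro conjI)
    show "newton_derivative XR nXR Lq nLq XR \<P> G"
      unfolding XR_def nXR_def Lq_def nLq_def \<P>_def G_def by (rule play_newton_derivative[OF E \<open>1 \<le> q\<close>])
    show "\<forall>x \<in> XR. \<exists>R :: real \<Rightarrow> real.
           mono_on {0<..} R \<and> (R \<longlongrightarrow> 0) (at_right 0) \<and>
           (\<forall>h\<in>X. \<forall>y. (SUP L \<in> G (x + (h, y)). nLq (\<P> (x + (h, y)) - \<P> x - L (h, y)))
              \<le> ennreal (R (norm h + \<bar>y\<bar>) * nXR (h, y)))"
    proof
      fix x assume "x \<in> XR"
      then obtain u z where x: "x = (u, z)" "u \<in> C_on a b" unfolding XR_def using XC by blast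
      show "\<exists>R. mono_on {0<..} R \<and> (R \<longlongrightarrow> 0) (at_right 0) \<and>
           (\<forall>h\<in>X. \<forall>y. (SUP L \<in> G (x + (h, y)). nLq (\<P> (x + (h, y)) - \<P> x - L (h, y)))
              \<le> ennreal (R (norm h + \<bar>y\<bar>) * nXR (h, y)))"
        using remainder_modulus[OF E \<open>1 \<le> q\<close> x(2), of z]
        unfolding x(1) add_Pair nXR_def nLq_def \<P>_def G_def prod.case .
    qed
    show "\<forall>x \<in> XR. \<forall>L \<in> G x. \<forall>h\<in>X. \<forall>y. \<forall>t \<in> {a..b}.
           sup_norm_upto a t (L (h, y)) \<le> sup_norm_upto a t (apply_bcontfun h) + ennreal \<bar>y\<bar>"
    proof (intro ballI allI)
      fix x L h y t assume "x \<in> XR" and L: "L \<in> G x" and h: "h \<in> X" and t: "t \<in> {a..b}"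
      then obtain u z where x: "x = (u, z)" "u \<in> C_on a b" unfolding XR_def using XC by blast
      show "sup_norm_upto a t (L (h, y)) \<le> sup_norm_upto a t (apply_bcontfun h) + ennreal \<bar>y\<bar>"
        by (rule G_play_sup_norm[OF _ x(2) _ t, of L z]) (use L h XC in \<open>auto simp: x(1) G_def\<close>)
    qed
    show "\<forall>(u, z0) \<in> XR. \<forall>L \<in> G (u, z0). \<exists>\<mu> \<in> S_play r a b D \<rho>. \<forall>h\<in>X. \<forall>y. \<forall>t \<in> {a<..<b}.
           L (h, y) t = \<mu> (u, z0, t) (h, y)"
      unfolding G_def using G_play_S_play by blast
    show "\<forall>\<mu> \<in> S_play r a b D \<rho>.
           \<mu> \<in> restrict_space borel (C_on a b \<times> UNIV \<times> {a..b}) \<rightarrow>\<^sub>M weak_star_borel (dual_CR a b)"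
      using S_play_measurable by blast
  qed
qed

end
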